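(* Let $K=K_\uparrow=\{\mu\in\mathbb{R}^n:\mu_1\le\cdots\le\mu_n\}$, $\mu_0\in K_\uparrow$, and $Y=X\mu_0+\xi$ as in the context, with $n\to\infty$, $m$ and $\mu_0$ depending on $n$, and $\sigma\in(0,\infty)$ fixed. For $1\le k\le n$ let $\mathcal{M}_k$ be the class of all piecewise constant $\mu\in K_\uparrow$ with at most $k$ pieces. Then for any sequence of near minimizers $\hat\mu(\sigma)$, as $n\to\infty$ the normalized estimation error $n^{-1}\|\hat\mu(\sigma)-\mu_0\|^2$ is bounded from above by $$(1+\mathfrak{o}_{\mathbf P}(1))\bigg[\inf_{1\le k\le n}\bigg(\inf_{\mu\in\mathcal{M}_k}\frac{\|\mu-\mu_0\|^2}{n}+\frac{\sigma^2k\log(en/k)}{m}\bigg)\bigg]+\mathcal{O}_{\mathbf P}\Big(\frac{\mathfrak{L}_n}{m}\Big)=\mathfrak{o}_{\mathbf P}(1),$$ provided $m\gg\log n$ and $\mu_{0,n}-\mu_{0,1}=\mathcal{O}(1)$. The term $\mathcal{O}_{\mathbf P}(\mathfrak{L}_n/m)$ can be eliminated when $\mu_0\in\mathcal{M}_k$.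
   Context: Model: $X\in\mathbb{R}^{m\times n}$ has i.i.d. $\mathcal{N}(0,1/n)$ entries; $\xi\in\mathbb{R}^m$ is an error vector independent of $X$ with i.i.d. coordinates of mean $0$ and variance $\sigma^2\in(0,\infty)$. $\|\cdot\|$ is Euclidean. $\Pi_C$ denotes the metric projection onto a closed convex set $C$, and $h\sim\mathcal{N}(0,I_n)$. $a_n\gg b_n$ means $a_n/b_n\to\infty$. $T_K(\mu_0)=\mathrm{cl}\{\alpha(\nu-\mu_0):\alpha\ge0,\nu\in K\}$; for a closed convex cone $T$, $\delta_T=\mathbb{E}\|\Pi_T(h)\|^2$. $\mathfrak{L}_n=\log(1+\delta_{T_K(\mu_0)})+\log\log(16n)$. Near minimizers: $\hat\mu(\sigma)\in K$ with $m^{-1}\|Y-X\hat\mu(\sigma)\|^2\le\min_{\mu\in K}m^{-1}\|Y-X\mu\|^2+\mathfrak{o}_{\mathbf P}(r_n^2)$, where $r_n\in(0,\infty)$ is the unique solution of $n^{-1}\mathbb{E}\|\Pi_K(\mu_0+\omega_{m/n}(r)h)-\mu_0\|^2=r^2$, with $\omega_{m/n}(r)=\sqrt{(r^2+\sigma^2)/(m/n)}$ (it exists whenever $m>\delta_K$, hence for all large $n$ here). *)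

theory Defs
  imports "HOL-Probability.Probability"
begin

text \<open>
  The dimension varies along the sequence, so a vector in \<open>\<real>\<^sup>n\<close> is an extensional function
  on \<open>{1..n}\<close>.  This is the carrier of the library's product space
  \<open>\<Pi>\<^sub>M i\<in>{1..n}. borel\<close>, and the product topology on \<open>nat \<Rightarrow> real\<close> induces the
  Euclidean topology on it.  The Euclidean norm is \<open>L2_set\<close>.
\<close>

definition Rvec :: "nat \<Rightarrow> (nat \<Rightarrow> real) set" where
  "Rvec n = {1..n} \<rightarrow>\<^sub>E UNIV"

definition vdist :: "nat \<Rightarrow> (nat \<Rightarrow> real) \<Rightarrow> (nat \<Rightarrow> real) \<Rightarrow> real" where
  "vdist n x y = L2_set (\<lambda>i. x i - y i) {1..n}"

definition metric_proj :: "nat \<Rightarrow> (nat \<Rightarrow> real) set \<Rightarrow> (nat \<Rightarrow> real) \<Rightarrow> nat \<Rightarrow> real" where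
  "metric_proj n C x = (THE y. y \<in> C \<and> (\<forall>z\<in>C. vdist n x y \<le> vdist n x z))"

definition std_gaussian :: "nat \<Rightarrow> (nat \<Rightarrow> real) measure" where
  "std_gaussian n = (\<Pi>\<^sub>M i\<in>{1..n}. density lborel std_normal_density)"

definition tangent_cone ::
    "nat \<Rightarrow> (nat \<Rightarrow> real) set \<Rightarrow> (nat \<Rightarrow> real) \<Rightarrow> (nat \<Rightarrow> real) set" where
  "tangent_cone n K \<mu>0 = closure {\<lambda>i\<in>{1..n}. \<alpha> * (\<nu> i - \<mu>0 i) | \<alpha> \<nu>. 0 \<le> \<alpha> \<and> \<nu> \<in> K}"

definition stat_dim :: "nat \<Rightarrow> (nat \<Rightarrow> real) set \<Rightarrow> real" where
  "stat_dim n T = (\<integral>h. (L2_set (metric_proj n T h) {1..n})\<^sup>2 \<partial>std_gaussian n)"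

definition log_term :: "nat \<Rightarrow> (nat \<Rightarrow> real) set \<Rightarrow> (nat \<Rightarrow> real) \<Rightarrow> real" where
  "log_term n K \<mu>0 = ln (1 + stat_dim n (tangent_cone n K \<mu>0)) + ln (ln (16 * real n))"

definition omega :: "real \<Rightarrow> real \<Rightarrow> real \<Rightarrow> real" where
  "omega \<sigma> \<tau> r = sqrt ((r\<^sup>2 + \<sigma>\<^sup>2) / \<tau>)"

definition risk_radius ::
    "nat \<Rightarrow> nat \<Rightarrow> real \<Rightarrow> (nat \<Rightarrow> real) set \<Rightarrow> (nat \<Rightarrow> real) \<Rightarrow> real" where
  "risk_radius m n \<sigma> K \<mu>0 = (THE r. 0 < r \<and>
     (\<integral>h. (vdist n
        (metric_proj n K (\<lambda>i\<in>{1..n}. \<mu>0 i + omega \<sigma> (real m / real n) r * h i)) \<mu>0)\<^sup>2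
        \<partial>std_gaussian n) / real n = r\<^sup>2)"

definition monotone_cone :: "nat \<Rightarrow> (nat \<Rightarrow> real) set" where
  "monotone_cone n = {\<mu> \<in> Rvec n. mono_on {1..n} \<mu>}"

definition pw_const :: "nat \<Rightarrow> nat \<Rightarrow> (nat \<Rightarrow> real) set" where
  "pw_const n k = {\<mu> \<in> monotone_cone n. \<exists>P. partition_on {1..n} P \<and> card P \<le> k \<and>
     (\<forall>I\<in>P. (\<exists>a b. I = {a..b}) \<and> \<mu> constant_on I)}"

definition oracle_bound :: "nat \<Rightarrow> nat \<Rightarrow> real \<Rightarrow> (nat \<Rightarrow> real) \<Rightarrow> real" where
  "oracle_bound m n \<sigma> \<mu>0 = (INF k\<in>{1..n}.
     (INF \<mu>\<in>pw_const n k. (vdist n \<mu> \<mu>0)\<^sup>2 / real n)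
     + \<sigma>\<^sup>2 * real k * ln (exp 1 * real n / real k) / real m)"

text \<open>
  The joint independence in \<open>indep\<close>, over the disjoint union of the two index sets, says that
  the entries of \<open>X\<close> are independent, the coordinates of \<open>\<xi>\<close> are independent, and \<open>X\<close> is
  independent of \<open>\<xi>\<close>.  Note that \<open>normal_density\<close> takes the standard deviation.
\<close>

locale gaussian_design = prob_space M
  for M :: "'a measure" +
  fixes m n :: nat
    and X :: "nat \<Rightarrow> nat \<Rightarrow> 'a \<Rightarrow> real"
    and \<xi> :: "nat \<Rightarrow> 'a \<Rightarrow> real"
    and noise :: "real measure"
  assumes dims: "1 \<le> m" "1 \<le> n"
    and indep: "indep_vars (\<lambda>_. borel) (case_sum (\<lambda>(i, j). X i j) \<xi>)
                  (({1..m} \<times> {1..n}) <+> {1..m})"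
    and X_law: "\<And>i j. i \<in> {1..m} \<Longrightarrow> j \<in> {1..n} \<Longrightarrow>
                  distributed M lborel (X i j) (normal_density 0 (sqrt (1 / real n)))"
    and \<xi>_law: "\<And>i. i \<in> {1..m} \<Longrightarrow> distr M borel (\<xi> i) = noise"

text \<open>The response \<open>Y = X \<mu>\<^sub>0 + \<xi>\<close> and the loss \<open>\<parallel>Y - X \<mu>\<parallel>\<^sup>2 / m\<close>.\<close>

definition response ::
    "nat \<Rightarrow> (nat \<Rightarrow> nat \<Rightarrow> 'a \<Rightarrow> real) \<Rightarrow> (nat \<Rightarrow> 'a \<Rightarrow> real) \<Rightarrow> (nat \<Rightarrow> real) \<Rightarrow> 'a \<Rightarrow> nat \<Rightarrow> real"
  where "response n X \<xi> \<mu>0 \<omega> i = (\<Sum>j\<in>{1..n}. X i j \<omega> * \<mu>0 j) + \<xi> i \<omega>"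

definition sq_loss ::
    "nat \<Rightarrow> nat \<Rightarrow> (nat \<Rightarrow> nat \<Rightarrow> 'a \<Rightarrow> real) \<Rightarrow> ('a \<Rightarrow> nat \<Rightarrow> real) \<Rightarrow> (nat \<Rightarrow> real) \<Rightarrow> 'a \<Rightarrow> real"
  where "sq_loss m n X Y \<mu> \<omega> =
     (L2_set (\<lambda>i. Y \<omega> i - (\<Sum>j\<in>{1..n}. X i j \<omega> * \<mu> j)) {1..m})\<^sup>2 / real m"

text \<open>
  Stochastic orders along a sequence of probability spaces, for rates \<open>a n\<close> that are
  eventually positive.
\<close>

definition small_oP ::
    "(nat \<Rightarrow> 'a measure) \<Rightarrow> (nat \<Rightarrow> 'a \<Rightarrow> real) \<Rightarrow> (nat \<Rightarrow> real) \<Rightarrow> bool" where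
  "small_oP M Z a \<longleftrightarrow> (\<forall>n. Z n \<in> borel_measurable (M n)) \<and>
     (\<forall>\<epsilon>>0. (\<lambda>n. measure (M n) {\<omega> \<in> space (M n). \<bar>Z n \<omega>\<bar> > \<epsilon> * a n}) \<longlonglongrightarrow> 0)"

definition big_OP ::
    "(nat \<Rightarrow> 'a measure) \<Rightarrow> (nat \<Rightarrow> 'a \<Rightarrow> real) \<Rightarrow> (nat \<Rightarrow> real) \<Rightarrow> bool" where
  "big_OP M Z a \<longleftrightarrow> (\<forall>n. Z n \<in> borel_measurable (M n)) \<and>
     (\<forall>\<epsilon>>0. \<exists>C. \<forall>\<^sub>F n in sequentially.
        measure (M n) {\<omega> \<in> space (M n). \<bar>Z n \<omega>\<bar> > C * a n} \<le> \<epsilon>)"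

text \<open>
  \<open>\<mu>hat\<close> is a near minimizer of \<open>L\<close> over \<open>K\<close>: its excess loss is bounded by a random sequence
  of order \<open>o\<^sub>P(a n)\<close>.
\<close>

definition near_minimizers ::
    "(nat \<Rightarrow> 'a measure) \<Rightarrow> (nat \<Rightarrow> (nat \<Rightarrow> real) set) \<Rightarrow> (nat \<Rightarrow> (nat \<Rightarrow> real) \<Rightarrow> 'a \<Rightarrow> real) \<Rightarrow>
     (nat \<Rightarrow> real) \<Rightarrow> (nat \<Rightarrow> 'a \<Rightarrow> nat \<Rightarrow> real) \<Rightarrow> bool" where
  "near_minimizers M K L a \<mu>hat \<longleftrightarrow>
     (\<forall>n\<ge>1. \<mu>hat n \<in> measurable (M n) (\<Pi>\<^sub>M i\<in>{1..n}. borel)) \<and>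
     (\<exists>Z. small_oP M Z a \<and>
        (\<forall>n\<ge>1. AE \<omega> in M n. \<mu>hat n \<omega> \<in> K n \<and>
           L n (\<mu>hat n \<omega>) \<omega> \<le> (INF \<mu>\<in>K n. L n \<mu> \<omega>) + Z n \<omega>))"

end

theory Submission
  imports Defs
begin

text \<open>
  Fix a nearly optimal piecewise constant \<open>\<mu>\<close> with \<open>k\<close> blocks and put \<open>D = k log (e n / k)\<close>, which is
  at least \<open>log (e n)\<close> and, since the oracle bound tends to \<open>0\<close>, satisfies \<open>D / m \<rightarrow> 0\<close>.  Differences
  \<open>\<nu> - \<mu>\<close> with \<open>\<nu>\<close> monotone lie in the cone of blockwise monotone vectors.  The strong convexity of the
  loss gives
  \<open>\<parallel>X v\<parallel>\<^sup>2 + \<parallel>X w\<parallel>\<^sup>2 \<le> \<parallel>X u\<parallel>\<^sup>2 + 2 \<langle>\<xi>, X w\<rangle> + error\<close> for \<open>v\<close>, \<open>w\<close> the differences of the estimator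
  to \<open>\<mu>\<^sub>0\<close>, \<open>\<mu>\<close> and \<open>u = \<mu> - \<mu>\<^sub>0\<close>.  Three facts turn this into the sharp oracle inequality.

  First, the noise term is at most \<open>\<parallel>w\<parallel>\<close> times the norm of the projection of \<open>X\<^sup>T \<xi>\<close>, a multiple of a
  standard Gaussian vector \<open>h\<close>, onto the cone.  The squared norm \<open>F\<close> of the projection of \<open>h\<close> onto the
  monotone cone in dimension \<open>n\<close> is the sum of \<open>l x\<^sup>2\<close> over its level sets of length \<open>l\<close> and value \<open>x\<close>.  A block is a level
  set only if its bridge is nonnegative (probability \<open>1 / l\<close> by cyclic shifts) and its position is the
  argmin of the walk formed by the remaining coordinates (exactly one position).  Hence
  \<open>E (F f(F)) \<le> \<Sum>\<^sub>l E (\<chi>\<^sup>2 f(\<chi>\<^sup>2 + F\<^sub>n\<^sub>-\<^sub>l)) / l\<close>, which bounds the mean by the harmonic number and, with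
  \<open>f\<close> exponential, gives concentration.

  Second, only a lower isometry of \<open>X\<close> on the cone is needed.  Truncated squares are Lipschitz, so a
  symmetrization and contraction argument reduces it to the Gaussian width, which is at most \<open>\<surd>D + 1\<close>.

  Third, \<open>r\<^sub>n\<^sup>2\<close> is at most a multiple of the oracle bound, by the oracle inequality for the
  isotonic projection.  Since the oracle bound is at least of order \<open>log n / m\<close>, no additional
  term of order \<open>L\<^sub>n / m\<close> is required.
\<close>

section \<open>Isotonic projection\<close>

text \<open>The leading constant one shapes the proof. The cross term must be absorbed by
  \<open>\<parallel>X w\<parallel>\<^sup>2\<close> with only factors near one lost, so the projected
  noise has to concentrate at \<open>(1 + \<eta>) * D\<close>. The noise has only two moments;
  exponential tails must come from the design, which is why the noise is frozen while
  \<open>X\<close> stays random. The constant in \<open>D\<close> rests on concavity of the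
  logarithm: once harmonic numbers are replaced by \<open>1 + ln\<close>, equal block lengths are
  the worst case.

  The vector \<open>v = w + u\<close> leaves the cone, because \<open>\<mu>0\<close> need not be
  constant on the blocks. The single direction of \<open>u\<close> is therefore added to the cone.
  From above, \<open>X\<close> is controlled only at the one vector \<open>u\<close>, where a law of
  large numbers suffices.

  The curvature of the loss is reached through a point on the segment from the estimator to
  \<open>\<mu>\<close>. The slack of the near minimizer is divided by the relative length
  \<open>\<eta>\<close> of that step, so it must be below \<open>\<eta>\<^sup>2\<close> times the
  oracle bound; this is where the size of the risk radius matters.\<close>

lemma L2_set_squared: "(L2_set f A)\<^sup>2 = (\<Sum>i\<in>A. (f i)\<^sup>2)"
  by (simp add: L2_set_def sum_nonneg)

lemma vdist_squared: "(vdist n x y)\<^sup>2 = (\<Sum>i\<in>{1..n}. (x i - y i)\<^sup>2)"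
  by (simp add: vdist_def L2_set_squared)

lemma vdist_nonneg: "0 \<le> vdist n x y"
  by (simp add: vdist_def L2_set_nonneg)

lemma vdist_le_iff: "vdist n x y \<le> vdist n x z \<longleftrightarrow> (vdist n x y)\<^sup>2 \<le> (vdist n x z)\<^sup>2"
  by (metis abs_le_square_iff abs_of_nonneg vdist_nonneg)

lemma monotone_coneI:
  assumes "\<And>i. i \<notin> {1..n} \<Longrightarrow> z i = undefined"
    and "\<And>i j. 1 \<le> i \<Longrightarrow> i \<le> j \<Longrightarrow> j \<le> n \<Longrightarrow> z i \<le> z j"
  shows "z \<in> monotone_cone n"
  using assms unfolding monotone_cone_def Rvec_def mono_on_def
  by (auto simp: PiE_def extensional_def)

lemma monotone_cone_le: "z \<in> monotone_cone n \<Longrightarrow> 1 \<le> i \<Longrightarrow> i \<le> j \<Longrightarrow> j \<le> n \<Longrightarrow> z i \<le> z j"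
  unfolding monotone_cone_def mono_on_def by auto

lemma monotone_cone_undefined: "z \<in> monotone_cone n \<Longrightarrow> i \<notin> {1..n} \<Longrightarrow> z i = undefined"
  unfolding monotone_cone_def Rvec_def by (auto simp: PiE_def extensional_def)

lemma restrict_monotone_cone:
  assumes "mono_on {1..n} w" shows "restrict w {1..n} \<in> monotone_cone n"
  using assms by (intro monotone_coneI) (auto simp: mono_on_def)

lemma mono_on_monotone_cone: "z \<in> monotone_cone n \<Longrightarrow> mono_on {1..n} z"
  by (simp add: monotone_cone_def)

lemma closed_monotone_cone: "closed (monotone_cone n)"
proof -
  have eq: "monotone_cone n = (\<Inter>i\<in>-{1..n}. {z. z i = undefined}) \<inter>
      (\<Inter>p\<in>{(i,j). 1 \<le> i \<and> i \<le> j \<and> j \<le> n}. {z. z (fst p) \<le> z (snd p)})"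
    by (auto intro: monotone_coneI monotone_cone_undefined monotone_cone_le)
  show ?thesis
    unfolding eq
    by (intro closed_Int closed_INT ballI closed_Collect_eq closed_Collect_le
      continuous_on_const continuous_on_product_coordinates)
qed

text \<open>Compactness: a monotone vector with a coordinate beyond \<open>R\<close> in modulus is
  at least as far from \<open>x\<close> as the zero vector, so the search can be confined to a box.
  The box fixes the coordinates outside \<open>{1..n}\<close> to \<open>undefined\<close> and is
  compact as a product over all of \<open>nat\<close>.\<close>

lemma isotonic_minimizer_exists:
  "\<exists>p\<in>monotone_cone n. \<forall>z\<in>monotone_cone n. vdist n x p \<le> vdist n x z"
proof -
  define R where "R = (\<Sum>i\<in>{1..n}. \<bar>x i\<bar>) + vdist n x (\<lambda>_. 0)"
  define B where "B = (\<Pi>\<^sub>E i\<in>UNIV. if i \<in> {1..n} then {-R..R} else {undefined::real})"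
  define S where "S = B \<inter> monotone_cone n"
  have R0: "0 \<le> R" unfolding R_def by (intro add_nonneg_nonneg sum_nonneg vdist_nonneg) auto
  have "compact B"
    using compactin_PiE[of "\<lambda>_::nat. euclidean::real topology" UNIV
        "\<lambda>i. if i \<in> {1..n} then {-R..R} else {undefined::real}"]
    by (auto simp: B_def euclidean_product_topology)
  then have "compact S" unfolding S_def by (intro compact_Int_closed closed_monotone_cone)
  have z0: "restrict (\<lambda>_. 0) {1..n} \<in> monotone_cone n"
    by (rule restrict_monotone_cone) (auto simp: mono_on_def)
  then have z0S: "restrict (\<lambda>_. 0) {1..n} \<in> S"
    using R0 by (auto simp: S_def B_def PiE_def)
  have "continuous_on S (\<lambda>z. \<Sum>i\<in>{1..n}. (x i - z i)\<^sup>2)"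
    by (intro continuous_intros continuous_on_subset[OF continuous_on_product_coordinates]) auto
  then obtain p where p: "p \<in> S"
    and min: "\<And>z. z \<in> S \<Longrightarrow> (vdist n x p)\<^sup>2 \<le> (vdist n x z)\<^sup>2"
    using continuous_attains_inf[OF \<open>compact S\<close> _ \<open>continuous_on S _\<close>] z0S by (auto simp: vdist_squared)
  have "vdist n x p \<le> vdist n x z" if z: "z \<in> monotone_cone n" for z
  proof (cases "z \<in> S")
    case True then show ?thesis using min by (simp add: vdist_le_iff)
  next
    case False
    then obtain i where "z i \<notin> (if i \<in> {1..n} then {-R..R} else {undefined})"
      using z by (auto simp: S_def B_def PiE_def)
    then have i: "i \<in> {1..n}" "R < \<bar>z i\<bar>"
      using monotone_cone_undefined[OF z, of i] by (auto split: if_splits)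
    have "\<bar>x i\<bar> \<le> (\<Sum>i\<in>{1..n}. \<bar>x i\<bar>)" using i by (intro member_le_sum) auto
    then have "vdist n x (\<lambda>_. 0) \<le> \<bar>x i - z i\<bar>" using i unfolding R_def by linarith
    also have "\<dots> \<le> vdist n x z" unfolding vdist_def
      using i member_le_L2_set[of "{1..n}" i "\<lambda>i. \<bar>x i - z i\<bar>"] by (simp add: L2_set_def)
    finally have "vdist n x (\<lambda>_. 0) \<le> vdist n x z" .
    moreover have "vdist n x (\<lambda>_. 0) = vdist n x (restrict (\<lambda>_. 0) {1..n})"
      unfolding vdist_def by (intro L2_set_cong) auto
    ultimately show ?thesis using min[OF z0S] by (simp flip: vdist_le_iff)
  qed
  then show ?thesis using p by (auto simp: S_def)
qed

lemma isotonic_minimizer_variational: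
  assumes p: "p \<in> monotone_cone n" and min: "\<forall>z\<in>monotone_cone n. vdist n x p \<le> vdist n x z"
    and z: "z \<in> monotone_cone n"
  shows "(\<Sum>i\<in>{1..n}. (x i - p i) * (z i - p i)) \<le> 0"
proof (rule ccontr)
  define a where "a = (\<Sum>i\<in>{1..n}. (x i - p i) * (z i - p i))"
  define b where "b = (\<Sum>i\<in>{1..n}. (z i - p i)\<^sup>2)"
  assume "\<not> ?thesis" then have a: "0 < a" by (simp add: a_def)
  have b: "0 \<le> b" unfolding b_def by (intro sum_nonneg) auto
  \<comment> \<open>Moving from \<open>p\<close> towards \<open>z\<close> by \<open>t\<close>
    changes the squared distance by \<open>t\<^sup>2 * b - 2 * t * a\<close>; this choice makes it
    negative, and \<open>b + 1\<close> avoids a division by zero.\<close>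
  define t where "t = min 1 (a / (b + 1))"
  have t: "0 < t" "t \<le> 1" "t * b < 2 * a"
  proof -
    show "0 < t" "t \<le> 1" using a b by (auto simp: t_def)
    have "t * b \<le> a / (b+1) * b" using b by (intro mult_right_mono) (auto simp: t_def)
    also have "\<dots> \<le> a" using a b by (simp add: field_simps)
    finally show "t * b < 2 * a" using a by simp
  qed
  define y where "y = (\<lambda>i\<in>{1..n}. p i + t * (z i - p i))"
  have "y \<in> monotone_cone n"
  proof (rule monotone_coneI)
    fix i j :: nat assume ij: "1 \<le> i" "i \<le> j" "j \<le> n"
    have "(1-t) * p i + t * z i \<le> (1-t) * p j + t * z j"
      using t ij monotone_cone_le[OF p ij] monotone_cone_le[OF z ij]
      by (intro add_mono mult_left_mono) auto
    then show "y i \<le> y j" using ij by (simp add: y_def algebra_simps)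
  qed (auto simp: y_def)
  then have "(vdist n x p)\<^sup>2 \<le> (vdist n x y)\<^sup>2" using min by (simp flip: vdist_le_iff)
  also have "\<dots> = (\<Sum>i\<in>{1..n}. (x i - p i)\<^sup>2 - 2 * t * ((x i - p i) * (z i - p i)) + t\<^sup>2 * (z i - p i)\<^sup>2)"
    unfolding vdist_squared by (intro sum.cong) (auto simp: y_def power2_eq_square algebra_simps)
  also have "\<dots> = (vdist n x p)\<^sup>2 - 2 * t * a + t\<^sup>2 * b"
    by (simp add: vdist_squared sum.distrib sum_subtractf sum_distrib_left a_def b_def)
  finally have "2 * a * t \<le> t * b * t" by (simp add: power2_eq_square algebra_simps)
  then show False using t by (simp add: mult.commute)
qed

definition isoreg :: "nat \<Rightarrow> (nat \<Rightarrow> real) \<Rightarrow> nat \<Rightarrow> real" where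
  "isoreg n = metric_proj n (monotone_cone n)"

text \<open>Testing each of the two variational inequalities at the other point and adding gives
  \<open>|p - q|^2 \<le> 0\<close>. Outside \<open>{1..n}\<close> both vectors equal
  \<open>undefined\<close>, so they agree as functions.\<close>

lemma isotonic_variational_unique:
  assumes p: "p \<in> monotone_cone n" and q: "q \<in> monotone_cone n"
    and vp: "\<And>z. z \<in> monotone_cone n \<Longrightarrow> (\<Sum>i\<in>{1..n}. (x i - p i) * (z i - p i)) \<le> 0"
    and vq: "\<And>z. z \<in> monotone_cone n \<Longrightarrow> (\<Sum>i\<in>{1..n}. (x i - q i) * (z i - q i)) \<le> 0"
  shows "p = q"
proof -
  have "(\<Sum>i\<in>{1..n}. (p i - q i)\<^sup>2) =
     (\<Sum>i\<in>{1..n}. (x i - p i) * (q i - p i)) + (\<Sum>i\<in>{1..n}. (x i - q i) * (p i - q i))"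
    unfolding sum.distrib[symmetric] by (intro sum.cong) (auto simp: power2_eq_square algebra_simps)
  also have "\<dots> \<le> 0" using vp[OF q] vq[OF p] by simp
  finally have "(\<Sum>i\<in>{1..n}. (p i - q i)\<^sup>2) = 0"
    by (meson antisym sum_nonneg zero_le_power2)
  then have eq: "p i = q i" if "i \<in> {1..n}" for i
    using that by (subst (asm) sum_nonneg_eq_0_iff) auto
  show "p = q"
  proof
    fix i show "p i = q i"
      using eq monotone_cone_undefined[OF p] monotone_cone_undefined[OF q] by (cases "i \<in> {1..n}") auto
  qed
qed

lemma
  shows iso_in: "isoreg n x \<in> monotone_cone n"
    and iso_variational: "\<And>z. z \<in> monotone_cone n \<Longrightarrow>
      (\<Sum>i\<in>{1..n}. (x i - isoreg n x i) * (z i - isoreg n x i)) \<le> 0"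
proof -
  obtain p where p: "p \<in> monotone_cone n" "\<forall>z\<in>monotone_cone n. vdist n x p \<le> vdist n x z"
    using isotonic_minimizer_exists by blast
  have "isoreg n x = p" unfolding isoreg_def metric_proj_def
  proof (rule the_equality)
    show "p \<in> monotone_cone n \<and> (\<forall>z\<in>monotone_cone n. vdist n x p \<le> vdist n x z)"
      using p by simp
    show "q = p" if "q \<in> monotone_cone n \<and> (\<forall>z\<in>monotone_cone n. vdist n x q \<le> vdist n x z)" for q
      using that p isotonic_minimizer_variational[of _ n x]
      by (intro isotonic_variational_unique[of _ n _ x]) auto
  qed
  then show "isoreg n x \<in> monotone_cone n" "\<And>z. z \<in> monotone_cone n \<Longrightarrow>
      (\<Sum>i\<in>{1..n}. (x i - isoreg n x i) * (z i - isoreg n x i)) \<le> 0"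
    using p isotonic_minimizer_variational[of p n x] by auto
qed

lemma iso_eqI:
  assumes "p \<in> monotone_cone n"
    and "\<And>z. z \<in> monotone_cone n \<Longrightarrow> (\<Sum>i\<in>{1..n}. (x i - p i) * (z i - p i)) \<le> 0"
  shows "isoreg n x = p"
  using isotonic_variational_unique[OF iso_in assms(1) iso_variational[of _ n x] assms(2)] by auto

lemma iso_cong:
  assumes "\<And>i. i \<in> {1..n} \<Longrightarrow> x i = y i"
  shows "isoreg n x = isoreg n y"
proof (rule iso_eqI[OF iso_in])
  fix z assume "z \<in> monotone_cone n"
  then have "(\<Sum>i\<in>{1..n}. (y i - isoreg n y i) * (z i - isoreg n y i)) \<le> 0" by (rule iso_variational)
  also have "(\<Sum>i\<in>{1..n}. (y i - isoreg n y i) * (z i - isoreg n y i))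
      = (\<Sum>i\<in>{1..n}. (x i - isoreg n y i) * (z i - isoreg n y i))"
    using assms by (intro sum.cong) auto
  finally show "(\<Sum>i\<in>{1..n}. (x i - isoreg n y i) * (z i - isoreg n y i)) \<le> 0" .
qed

text \<open>Adding the variational inequalities of the two projections \<open>p\<close> and
  \<open>q\<close> gives \<open>|p - q|^2 \<le> <x - y, p - q>\<close>; the inequality between
  arithmetic and geometric means finishes.\<close>

lemma iso_nonexpansive: "vdist n (isoreg n x) (isoreg n y) \<le> vdist n x y"
proof -
  define p q where "p = isoreg n x" and "q = isoreg n y"
  have "(\<Sum>i\<in>{1..n}. (p i - q i)\<^sup>2) = (\<Sum>i\<in>{1..n}. (x i - y i) * (p i - q i)) +
      ((\<Sum>i\<in>{1..n}. (x i - p i) * (q i - p i)) + (\<Sum>i\<in>{1..n}. (y i - q i) * (p i - q i)))"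
    unfolding sum.distrib[symmetric] by (intro sum.cong) (auto simp: power2_eq_square algebra_simps)
  also have "\<dots> \<le> (\<Sum>i\<in>{1..n}. (x i - y i) * (p i - q i))"
    using iso_variational[OF iso_in[of n y], of x] iso_variational[OF iso_in[of n x], of y] by (simp add: p_def q_def)
  also have "\<dots> \<le> (\<Sum>i\<in>{1..n}. ((x i - y i)\<^sup>2 + (p i - q i)\<^sup>2) / 2)"
    by (intro sum_mono) (use sum_squares_bound[of "x _ - y _" "p _ - q _"] in \<open>auto simp: field_simps\<close>)
  also have "\<dots> = (\<Sum>i\<in>{1..n}. (x i - y i)\<^sup>2) / 2 + (\<Sum>i\<in>{1..n}. (p i - q i)\<^sup>2) / 2"
    by (simp add: sum.distrib add_divide_distrib sum_divide_distrib)
  finally have "(vdist n p q)\<^sup>2 \<le> (vdist n x y)\<^sup>2" by (simp add: vdist_squared)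
  then show ?thesis unfolding p_def q_def by (rule power2_le_imp_le) (rule vdist_nonneg)
qed

text \<open>Nonnegative multiples of the projection stay in the cone; doubling it
  (\<open>c = 1\<close>) and shrinking it to zero (\<open>c = -1\<close>) gives both signs.\<close>

lemma iso_orthogonal: "(\<Sum>i\<in>{1..n}. (x i - isoreg n x i) * isoreg n x i) = 0"
proof -
  let ?S = "\<Sum>i\<in>{1..n}. (x i - isoreg n x i) * isoreg n x i"
  have *: "c * ?S \<le> 0" if "c \<ge> -1" for c
  proof -
    have "mono_on {1..n} (\<lambda>i. (1 + c) * isoreg n x i)"
      using mono_on_monotone_cone[OF iso_in[of n x]] that unfolding mono_on_def
      by (auto intro: mult_left_mono)
    from iso_variational[OF restrict_monotone_cone[OF this], of x]
    have "(\<Sum>i\<in>{1..n}. c * ((x i - isoreg n x i) * isoreg n x i)) \<le> 0"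
      by (simp add: algebra_simps cong: sum.cong_simp)
    then show ?thesis by (simp add: sum_distrib_left)
  qed
  show ?thesis using *[of 1] *[of "-1"] by simp
qed

text \<open>Moreau's decomposition: by orthogonality the variational inequality says that the
  residual lies in the polar cone. The values of \<open>w\<close> outside \<open>{1..n}\<close> are
  free.\<close>

lemma iso_polar: "mono_on {1..n} w \<Longrightarrow> (\<Sum>i\<in>{1..n}. (x i - isoreg n x i) * w i) \<le> 0"
  using iso_variational[OF restrict_monotone_cone, of n w x] iso_orthogonal[of x n]
  by (simp add: right_diff_distrib sum_subtractf cong: sum.cong_simp)

lemma iso_scale:
  assumes "0 \<le> c" and "i \<in> {1..n}"
  shows "isoreg n (\<lambda>i. c * x i) i = c * isoreg n x i"
proof -
  have "isoreg n (\<lambda>i. c * x i) = (\<lambda>i\<in>{1..n}. c * isoreg n x i)"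
  proof (rule iso_eqI)
    show "(\<lambda>i\<in>{1..n}. c * isoreg n x i) \<in> monotone_cone n"
      using mono_on_monotone_cone[OF iso_in[of n x]] assms(1)
      by (intro restrict_monotone_cone) (auto simp: mono_on_def intro: mult_left_mono)
    fix z assume z: "z \<in> monotone_cone n"
    have "(\<Sum>i\<in>{1..n}. (c * x i - (\<lambda>i\<in>{1..n}. c * isoreg n x i) i) * (z i - (\<lambda>i\<in>{1..n}. c * isoreg n x i) i))
       = c * (\<Sum>i\<in>{1..n}. (x i - isoreg n x i) * z i) - c\<^sup>2 * (\<Sum>i\<in>{1..n}. (x i - isoreg n x i) * isoreg n x i)"
      unfolding sum_distrib_left sum_subtractf[symmetric]
      by (intro sum.cong) (auto simp: algebra_simps power2_eq_square)
    also have "\<dots> \<le> 0"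
      using iso_polar[OF mono_on_monotone_cone[OF z], of x] assms(1)
      by (simp only: iso_orthogonal) (simp add: mult_nonneg_nonpos)
    finally show "(\<Sum>i\<in>{1..n}. (c * x i - (\<lambda>i\<in>{1..n}. c * isoreg n x i) i) * (z i - (\<lambda>i\<in>{1..n}. c * isoreg n x i) i)) \<le> 0" .
  qed
  then show ?thesis using assms(2) by simp
qed

text \<open>Its Gaussian mean is the statistical dimension of the monotone cone. It is also the
  maximum of \<open>2 <x, w> - |w|^2\<close> over monotone \<open>w\<close>.\<close>

definition iso_energy :: "nat \<Rightarrow> (nat \<Rightarrow> real) \<Rightarrow> real" where
  "iso_energy n x = (\<Sum>i\<in>{1..n}. (isoreg n x i)\<^sup>2)"

lemma iso_energy_nonneg: "0 \<le> iso_energy n x"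
  unfolding iso_energy_def by (intro sum_nonneg) auto

lemma iso_energy_cong: "(\<And>i. i \<in> {1..n} \<Longrightarrow> x i = y i) \<Longrightarrow> iso_energy n x = iso_energy n y"
  unfolding iso_energy_def using iso_cong[of n x y] by simp

lemma iso_energy_scale: "0 \<le> c \<Longrightarrow> iso_energy n (\<lambda>i. c * x i) = c\<^sup>2 * iso_energy n x"
  unfolding iso_energy_def by (simp add: iso_scale power_mult_distrib sum_distrib_left cong: sum.cong_simp)

text \<open>Completing the square leaves \<open>|p - w|^2\<close> minus twice the pairing of the
  residual with \<open>w\<close>, which is nonpositive. It bounds an energy from below by any
  competitor, such as a projection from which a block has been cut out.\<close>

lemma iso_energy_ge:
  assumes "mono_on {1..n} w"
  shows "2 * (\<Sum>i\<in>{1..n}. x i * w i) - (\<Sum>i\<in>{1..n}. (w i)\<^sup>2) \<le> iso_energy n x"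
proof -
  have "iso_energy n x - (2 * (\<Sum>i\<in>{1..n}. x i * w i) - (\<Sum>i\<in>{1..n}. (w i)\<^sup>2))
     = (\<Sum>i\<in>{1..n}. (isoreg n x i - w i)\<^sup>2) - 2 * (\<Sum>i\<in>{1..n}. (x i - isoreg n x i) * w i)"
    unfolding iso_energy_def sum_distrib_left sum_subtractf[symmetric]
    by (intro sum.cong) (auto simp: algebra_simps power2_eq_square)
  moreover have "0 \<le> (\<Sum>i\<in>{1..n}. (isoreg n x i - w i)\<^sup>2)" by (intro sum_nonneg) auto
  ultimately show ?thesis using iso_polar[OF assms, of x] by linarith
qed

lemma inner_le_iso_energy:
  assumes "mono_on {1..n} w"
  shows "(\<Sum>i\<in>{1..n}. x i * w i) \<le> sqrt (iso_energy n x) * sqrt (\<Sum>i\<in>{1..n}. (w i)\<^sup>2)"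
proof -
  have "(\<Sum>i\<in>{1..n}. x i * w i) = (\<Sum>i\<in>{1..n}. (x i - isoreg n x i) * w i) + (\<Sum>i\<in>{1..n}. isoreg n x i * w i)"
    unfolding sum.distrib[symmetric] by (intro sum.cong) (auto simp: algebra_simps)
  also have "\<dots> \<le> (\<Sum>i\<in>{1..n}. \<bar>isoreg n x i\<bar> * \<bar>w i\<bar>)"
  proof -
    have "(\<Sum>i\<in>{1..n}. isoreg n x i * w i) \<le> (\<Sum>i\<in>{1..n}. \<bar>isoreg n x i\<bar> * \<bar>w i\<bar>)"
      by (intro sum_mono) (metis abs_ge_self abs_mult)
    then show ?thesis using iso_polar[OF assms, of x] by linarith
  qed
  also have "\<dots> \<le> L2_set (isoreg n x) {1..n} * L2_set w {1..n}"
    by (rule L2_set_mult_ineq)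
  finally show ?thesis by (simp add: L2_set_def iso_energy_def)
qed

section \<open>Measurability of the projection\<close>

lemma borel_measurable_vdist_lipschitz:
  assumes "\<And>x y. \<bar>f x - f y\<bar> \<le> vdist n x y"
  shows "f \<in> borel_measurable (\<Pi>\<^sub>M i\<in>{1..n}. borel)"
proof -
  have "continuous_on UNIV f"
  proof -
    have "(f \<longlongrightarrow> f x) (at x)" for x
    proof (rule tendstoI)
      fix e :: real assume "0 < e"
      have "continuous_on UNIV (\<lambda>y. vdist n y x)"
        unfolding vdist_def L2_set_def
        by (intro continuous_on_real_sqrt continuous_on_sum continuous_on_power continuous_on_diff
            continuous_on_const continuous_on_product_coordinates)
      then have "((\<lambda>y. vdist n y x) \<longlongrightarrow> vdist n x x) (at x)"
        by (auto simp: continuous_on_def)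
      moreover have "vdist n x x = 0" by (simp add: vdist_def L2_set_def)
      ultimately have "\<forall>\<^sub>F y in at x. vdist n y x < e"
        using \<open>0 < e\<close> by (auto dest: order_tendstoD)
      then show "\<forall>\<^sub>F y in at x. dist (f y) (f x) < e"
        by eventually_elim (use assms in \<open>fastforce simp: dist_real_def intro: le_less_trans\<close>)
    qed
    then show ?thesis by (simp add: continuous_on_def)
  qed
  then have "f \<in> borel_measurable borel" by (rule borel_measurable_continuous_onI)
  then have 1: "f \<in> borel_measurable (\<Pi>\<^sub>M i\<in>UNIV. borel)"
    by (simp cong: measurable_cong_sets add: sets_PiM_equal_borel)
  \<comment> \<open>Padding with zeros carries measurability from the countable product over all of
    \<open>nat\<close>, where the product sigma-algebra is the Borel one, to the coordinates
    \<open>{1..n}\<close>. The padded vector has distance zero from \<open>x\<close>, so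
    \<open>f\<close> takes the same value.\<close>
  have 2: "(\<lambda>x i. if i \<in> {1..n} then x i else 0) \<in> measurable (\<Pi>\<^sub>M i\<in>{1..n}. borel) (\<Pi>\<^sub>M i\<in>UNIV. (borel :: real measure))"
  proof (rule measurable_PiM_single')
    show "(\<lambda>x. if i \<in> {1..n} then x i else 0) \<in> borel_measurable (\<Pi>\<^sub>M i\<in>{1..n}. (borel :: real measure))" for i
      by (cases "i \<in> {1..n}") auto
  qed (auto simp: PiE_def)
  have "f = f \<circ> (\<lambda>x i. if i \<in> {1..n} then x i else 0)"
  proof
    fix x
    have "vdist n x (\<lambda>i. if i \<in> {1..n} then x i else 0) = 0"
      by (simp add: vdist_def L2_set_def)
    then show "f x = (f \<circ> (\<lambda>x i. if i \<in> {1..n} then x i else 0)) x"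
      using assms[of x "\<lambda>i. if i \<in> {1..n} then x i else 0"] by simp
  qed
  then show ?thesis using measurable_comp[OF 2 1] by simp
qed

lemma borel_measurable_iso:
  assumes "i \<in> {1..n}" shows "(\<lambda>x. isoreg n x i) \<in> borel_measurable (\<Pi>\<^sub>M i\<in>{1..n}. borel)"
proof (rule borel_measurable_vdist_lipschitz)
  fix x y
  have "\<bar>isoreg n x i - isoreg n y i\<bar> \<le> vdist n (isoreg n x) (isoreg n y)"
  proof -
    have "(isoreg n x i - isoreg n y i)\<^sup>2 \<le> (vdist n (isoreg n x) (isoreg n y))\<^sup>2"
      unfolding vdist_squared using assms by (intro member_le_sum) auto
    then show ?thesis by (metis abs_le_square_iff abs_of_nonneg vdist_nonneg)
  qed
  then show "\<bar>isoreg n x i - isoreg n y i\<bar> \<le> vdist n x y" using iso_nonexpansive order_trans by blast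
qed

lemma borel_measurable_iso_energy [measurable]:
  "iso_energy n \<in> borel_measurable (\<Pi>\<^sub>M i\<in>{1..n}. borel)"
  unfolding iso_energy_def[abs_def]
  by (intro borel_measurable_sum borel_measurable_power borel_measurable_iso)

section \<open>Level sets of the projection and its cumulative residual\<close>

lemma sum_split_shift:
  fixes g :: "nat \<Rightarrow> 'b::comm_monoid_add"
  shows "sum g {1..k + N} = sum g {1..k} + (\<Sum>j\<in>{1..N}. g (k + j))"
  by (induction N) (simp_all add: add.assoc)

text \<open>The permutation that lists the block \<open>{i+1..i+l}\<close> first and then the
  remaining indices in their order, so that \<open>h (rot i l j)\<close> has the block in the
  coordinates \<open>1..l\<close>.\<close>

definition rot :: "nat \<Rightarrow> nat \<Rightarrow> nat \<Rightarrow> nat" where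
  "rot i l j = (if j \<le> l then i + j else if j - l \<le> i then j - l else j)"

lemma bij_betw_rot:
  assumes "i + l \<le> n" shows "bij_betw (rot i l) {1..n} {1..n}"
proof (rule bij_betw_byWitness[where f' = "\<lambda>j. if j \<le> i then j + l else if j \<le> i + l then j - i else j"])
qed (use assms in \<open>auto simp: rot_def\<close>)

context
  fixes n :: nat and h :: "nat \<Rightarrow> real"
begin

text \<open>The vertical distance between the cumulative sum diagram of \<open>h\<close> and its
  greatest convex minorant, whose slopes are the projected values.\<close>

definition iso_gap :: "nat \<Rightarrow> real" where
  "iso_gap r = (\<Sum>j\<in>{1..r}. h j - isoreg n h j)"

lemma iso_gap_total: "iso_gap n = 0"
  using iso_polar[of n "\<lambda>_. 1" h] iso_polar[of n "\<lambda>_. -1" h]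
  by (simp add: iso_gap_def mono_on_def sum_subtractf)

lemma iso_gap_tail: "r \<le> n \<Longrightarrow> (\<Sum>j\<in>{1..n}. (h j - isoreg n h j) * (if j \<le> r then 0 else 1)) = - iso_gap r"
proof -
  assume "r \<le> n"
  then obtain N where N: "n = r + N" using le_Suc_ex by blast
  have "(\<Sum>j\<in>{1..n}. (h j - isoreg n h j) * (if j \<le> r then 0 else 1))
      = (\<Sum>j\<in>{1..r}. (h j - isoreg n h j) * (if j \<le> r then 0 else 1))
        + (\<Sum>j\<in>{1..N}. (h (r+j) - isoreg n h (r+j)) * (if r+j \<le> r then 0 else 1))"
    using sum_split_shift[of "\<lambda>j. (h j - isoreg n h j) * (if j \<le> r then 0 else 1)" r N] unfolding N[symmetric] by simp
  also have "\<dots> = (\<Sum>j\<in>{1..N}. h (r+j) - isoreg n h (r+j))" by simp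
  also have "\<dots> = iso_gap n - iso_gap r"
    using sum_split_shift[of "\<lambda>j. h j - isoreg n h j" r N] unfolding N[symmetric] iso_gap_def by simp
  finally show ?thesis by (simp add: iso_gap_total)
qed

text \<open>The step function that is 0 up to \<open>r\<close> and 1 afterwards is monotone, and its
  pairing with the residual is \<open>- iso_gap r\<close>.\<close>

lemma iso_gap_nonneg: "r \<le> n \<Longrightarrow> 0 \<le> iso_gap r"
  using iso_polar[of n "\<lambda>j. if j \<le> r then 0 else 1" h] iso_gap_tail[of r]
  by (simp add: mono_on_def)

text \<open>Where the projection jumps, a step of height \<open>e\<close> can be subtracted from it
  without losing monotonicity, which reverses the inequality of \<open>iso_gap_nonneg\<close>: the
  minorant touches the diagram at its kinks.\<close>

lemma iso_gap_jump:
  assumes r: "1 \<le> r" "r < n" and jump: "isoreg n h r < isoreg n h (Suc r)"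
  shows "iso_gap r = 0"
proof -
  define e where "e = isoreg n h (Suc r) - isoreg n h r"
  have e: "0 < e" using jump by (simp add: e_def)
  let ?w = "\<lambda>j. isoreg n h j - e * (if j \<le> r then 0 else 1)"
  have "mono_on {1..n} ?w"
  proof (rule mono_onI)
    fix a b assume ab: "a \<in> {1..n}" "b \<in> {1..n}" "a \<le> b"
    show "?w a \<le> ?w b"
    proof (cases "a \<le> r \<and> r < b")
      case True
      then have "isoreg n h a \<le> isoreg n h r" "isoreg n h (Suc r) \<le> isoreg n h b"
        using ab r by (auto intro!: monotone_cone_le[OF iso_in])
      then show ?thesis using True by (simp add: e_def)
    next
      case False
      then show ?thesis using ab monotone_cone_le[OF iso_in[of n h], of a b] by auto
    qed
  qed
  from iso_polar[OF this, of h]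
  have "(\<Sum>j\<in>{1..n}. (h j - isoreg n h j) * isoreg n h j)
      - e * (\<Sum>j\<in>{1..n}. (h j - isoreg n h j) * (if j \<le> r then 0 else 1)) \<le> 0"
    by (simp add: right_diff_distrib sum_subtractf sum_distrib_left mult.left_commute del: One_nat_def)
  then have "e * iso_gap r \<le> 0"
    using r by (simp add: iso_orthogonal iso_gap_tail del: One_nat_def)
  then show ?thesis using e iso_gap_nonneg[of r] r by (simp add: mult_le_0_iff)
qed

text \<open>A block is encoded by offset and length, which gives sums over blocks a deterministic
  index set. The equation asks for the whole level set, hence for a maximal block.\<close>

definition iso_level :: "nat \<Rightarrow> nat \<Rightarrow> bool" where
  "iso_level i l \<longleftrightarrow> 1 \<le> l \<and> i + l \<le> n \<and>
     {j\<in>{1..n}. isoreg n h j = isoreg n h (Suc i)} = {Suc i..i + l}"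

lemma iso_levelD:
  assumes "iso_level i l"
  shows "1 \<le> l" "i + l \<le> n"
    and "1 \<le> j \<Longrightarrow> j \<le> n \<Longrightarrow> isoreg n h j = isoreg n h (Suc i) \<longleftrightarrow> Suc i \<le> j \<and> j \<le> i + l"
  using assms unfolding iso_level_def set_eq_iff by auto

lemma iso_level_exists:
  assumes j: "j \<in> {1..n}"
  shows "\<exists>i l. iso_level i l \<and> j \<in> {Suc i..i + l}"
proof -
  define S where "S = {k\<in>{1..n}. isoreg n h k = isoreg n h j}"
  have S: "finite S" "j \<in> S" using j by (auto simp: S_def)
  define a b where "a = Min S" and "b = Max S"
  have ab: "a \<in> S" "b \<in> S" using S by (auto simp: a_def b_def intro: Min_in Max_in)
  have "S = {a..b}"
  proof
    show "S \<subseteq> {a..b}" using S by (auto simp: a_def b_def)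
    show "{a..b} \<subseteq> S"
    proof
      fix k assume k: "k \<in> {a..b}"
      have "isoreg n h a \<le> isoreg n h k" "isoreg n h k \<le> isoreg n h b" 
        using k ab monotone_cone_le[OF iso_in[of n h], of a k] monotone_cone_le[OF iso_in[of n h], of k b]
        by (auto simp: S_def)
      then show "k \<in> S" using ab k by (auto simp: S_def)
    qed
  qed
  moreover have "a \<le> j" "j \<le> b" using S by (auto simp: a_def b_def)
  moreover have "1 \<le> a" "b \<le> n" using ab by (auto simp: S_def)
  moreover have "isoreg n h a = isoreg n h j" using ab by (simp add: S_def)
  ultimately have "iso_level (a - 1) (b + 1 - a) \<and> j \<in> {Suc (a - 1)..a - 1 + (b + 1 - a)}"
    by (auto simp: iso_level_def S_def)
  then show ?thesis by blast
qed

text \<open>The level sets partition \<open>{1..n}\<close>. A sum over all pairs of length and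
  offset with an indicator removes the random partition from the index set, so that expectations can
  be taken term by term.\<close>

lemma iso_energy_levels:
  "iso_energy n h = (\<Sum>l\<in>{1..n}. \<Sum>i\<in>{0..n-l}. of_bool (iso_level i l) * (real l * (isoreg n h (Suc i))\<^sup>2))"
proof -
  define Lv where "Lv = {(l,i). l \<in> {1..n} \<and> i \<in> {0..n-l} \<and> iso_level i l}"
  have sub: "Lv \<subseteq> (SIGMA l:{1..n}. {0..n-l})" by (auto simp: Lv_def)
  then have fin: "finite Lv" by (rule finite_subset) auto
  let ?B = "\<lambda>(l,i). {Suc i..i + l}"
  have un: "{1..n} = (\<Union>p\<in>Lv. ?B p)"
  proof
    show "{1..n} \<subseteq> (\<Union>p\<in>Lv. ?B p)"
    proof
      fix j assume "j \<in> {1..n}"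
      from iso_level_exists[OF this] obtain i l where "iso_level i l" "j \<in> {Suc i..i+l}" by blast
      moreover from this iso_levelD(1,2)[of i l] have "(l,i) \<in> Lv" by (auto simp: Lv_def)
      ultimately show "j \<in> (\<Union>p\<in>Lv. ?B p)" by force
    qed
    show "(\<Union>p\<in>Lv. ?B p) \<subseteq> {1..n}" by (auto simp: Lv_def)
  qed
  have const: "isoreg n h j = isoreg n h (Suc i)" if "(l,i) \<in> Lv" "j \<in> {Suc i..i+l}" for l i j
  proof -
    have "iso_level i l" using that by (simp add: Lv_def)
    from iso_levelD(2)[OF this] iso_levelD(3)[OF this, of j] that(2) show ?thesis by auto
  qed
  have disj: "?B p \<inter> ?B q = {}" if "p \<in> Lv" "q \<in> Lv" "p \<noteq> q" for p q
  proof (rule ccontr)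
    obtain l i l' i' where pq: "p = (l,i)" "q = (l',i')" by (cases p, cases q)
    assume "?B p \<inter> ?B q \<noteq> {}"
    then obtain j where j: "j \<in> {Suc i..i+l}" "j \<in> {Suc i'..i'+l'}" unfolding pq by blast
    then have "isoreg n h (Suc i) = isoreg n h (Suc i')" using const that pq by metis
    moreover have "iso_level i l" "iso_level i' l'" using that pq by (simp_all add: Lv_def)
    ultimately have "{Suc i..i+l} = {Suc i'..i'+l'}" unfolding iso_level_def by metis
    then have "i = i' \<and> l = l'" using j by (auto simp: Icc_eq_Icc)
    then show False using that pq by simp
  qed
  have "iso_energy n h = (\<Sum>j\<in>(\<Union>p\<in>Lv. ?B p). (isoreg n h j)\<^sup>2)"
    unfolding iso_energy_def by (subst un[symmetric]) (rule refl)
  also have "\<dots> = (\<Sum>p\<in>Lv. \<Sum>j\<in>?B p. (isoreg n h j)\<^sup>2)"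
    using fin disj by (intro sum.UNION_disjoint) auto
  also have "\<dots> = (\<Sum>(l,i)\<in>Lv. real l * (isoreg n h (Suc i))\<^sup>2)"
  proof (intro sum.cong refl, clarify)
    fix l i assume "(l,i) \<in> Lv"
    then have "(\<Sum>j\<in>{Suc i..i+l}. (isoreg n h j)\<^sup>2) = (\<Sum>j\<in>{Suc i..i+l}. (isoreg n h (Suc i))\<^sup>2)"
      by (intro sum.cong refl arg_cong[where f = "\<lambda>x. x\<^sup>2"]) (rule const)
    then show "(\<Sum>j\<in>{Suc i..i+l}. (isoreg n h j)\<^sup>2) = real l * (isoreg n h (Suc i))\<^sup>2" by simp
  qed
  also have "\<dots> = (\<Sum>(l,i)\<in>(SIGMA l:{1..n}. {0..n-l}). of_bool (iso_level i l) * (real l * (isoreg n h (Suc i))\<^sup>2))"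
  proof (rule sum.mono_neutral_cong_left[OF _ sub])
    show "\<forall>p\<in>(SIGMA l:{1..n}. {0..n-l}) - Lv. (case p of (l,i) \<Rightarrow> of_bool (iso_level i l) * (real l * (isoreg n h (Suc i))\<^sup>2)) = 0"
      by (auto simp: Lv_def)
    show "(case p of (l,i) \<Rightarrow> real l * (isoreg n h (Suc i))\<^sup>2)
        = (case p of (l,i) \<Rightarrow> of_bool (iso_level i l) * (real l * (isoreg n h (Suc i))\<^sup>2))" if "p \<in> Lv" for p
      using that unfolding Lv_def by (cases p) simp
  qed simp
  also have "\<dots> = (\<Sum>l\<in>{1..n}. \<Sum>i\<in>{0..n-l}. of_bool (iso_level i l) * (real l * (isoreg n h (Suc i))\<^sup>2))"
    by (subst sum.Sigma) auto
  finally show ?thesis .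
qed

end

section \<open>Necessary conditions for a block to be a level set\<close>

definition block_mean :: "nat \<Rightarrow> (nat \<Rightarrow> real) \<Rightarrow> real" where
  "block_mean l g = (\<Sum>j\<in>{1..l}. g j) / real l"

definition bridge_nonneg :: "nat \<Rightarrow> (nat \<Rightarrow> real) \<Rightarrow> bool" where
  "bridge_nonneg l g \<longleftrightarrow> (\<forall>r\<in>{1..l}. 0 \<le> (\<Sum>j\<in>{1..r}. g j - block_mean l g))"

definition rest_walk :: "nat \<Rightarrow> (nat \<Rightarrow> real) \<Rightarrow> nat \<Rightarrow> real" where
  "rest_walk l g r = (\<Sum>j\<in>{1..r}. g (l + j) - block_mean l g)"

text \<open>The strict inequality makes the position unique, so the indicators sum to at most one
  over \<open>i\<close> whether or not the walk has ties.\<close>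

definition walk_argmin :: "nat \<Rightarrow> nat \<Rightarrow> (nat \<Rightarrow> real) \<Rightarrow> nat \<Rightarrow> bool" where
  "walk_argmin l N g i \<longleftrightarrow> (\<forall>r\<in>{0..N}. r \<noteq> i \<longrightarrow> rest_walk l g i < rest_walk l g r)"

text \<open>\<open>iso_gap\<close> vanishes at both ends of the block: hence the mean of the block
  is its projected value, and its bridge is a stretch of \<open>iso_gap\<close>. After the block is
  cut out, the walk is a nonnegative gap, zero at \<open>i\<close>, plus the partial sums of
  \<open>p' - x\<close>, which decrease strictly up to position \<open>i\<close> and increase
  strictly after it. The energy bound uses \<open>p'\<close> as competitor in dimension
  \<open>n - l\<close>.\<close>

lemma iso_level_conditions:
  assumes lev: "iso_level n h i l"
  defines "g \<equiv> \<lambda>j. h (rot i l j)"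
  shows "block_mean l g = isoreg n h (Suc i)"
    and "bridge_nonneg l g"
    and "walk_argmin l (n - l) g i"
    and "iso_energy n h \<le> real l * (block_mean l g)\<^sup>2 + iso_energy (n - l) (\<lambda>j. g (l + j))"
proof -
  let ?p = "isoreg n h" and ?D = "iso_gap n h"
  define x where "x = ?p (Suc i)"
  define N where "N = n - l"
  have l: "1 \<le> l" "i + l \<le> n" and B: "\<And>j. 1 \<le> j \<Longrightarrow> j \<le> n \<Longrightarrow> ?p j = x \<longleftrightarrow> Suc i \<le> j \<and> j \<le> i + l"
    using iso_levelD[OF lev] unfolding x_def by blast+
  have nN: "n = l + N" "i \<le> N" using l by (auto simp: N_def)
  have blk: "?p j = x" if "Suc i \<le> j" "j \<le> i + l" for j using that B[of j] l by auto
  have low: "?p j < x" if "1 \<le> j" "j \<le> i" for j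
  proof -
    have "?p j \<le> x" unfolding x_def using that l by (intro monotone_cone_le[OF iso_in]) auto
    moreover have "?p j \<noteq> x" using B[of j] that l by auto
    ultimately show ?thesis by simp
  qed
  have high: "x < ?p j" if "i + l < j" "j \<le> n" for j
  proof -
    have "x \<le> ?p j" unfolding x_def using that l by (intro monotone_cone_le[OF iso_in]) auto
    moreover have "?p j \<noteq> x" using B[of j] that l by auto
    ultimately show ?thesis by simp
  qed
  have Di: "?D i = 0"
  proof (cases "i = 0")
    case False
    then show ?thesis using l low[of i] blk[of "Suc i"] by (intro iso_gap_jump) auto
  qed (simp add: iso_gap_def)
  have Dil: "?D (i + l) = 0"
  proof (cases "i + l = n")
    case True then show ?thesis using iso_gap_total[of n h] by simp
  next
    case False
    then show ?thesis using l high[of "Suc (i+l)"] blk[of "i + l"] by (intro iso_gap_jump) auto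
  qed
  have shiftD: "?D (a + r) = ?D a + (\<Sum>j\<in>{1..r}. h (a + j) - ?p (a + j))" for a r
    unfolding iso_gap_def by (rule sum_split_shift)
  have gblk: "(\<Sum>j\<in>{1..r}. g j - x) = ?D (i + r)" if "r \<le> l" for r
  proof -
    have "(\<Sum>j\<in>{1..r}. g j - x) = (\<Sum>j\<in>{1..r}. h (i + j) - ?p (i + j))"
      using that by (intro sum.cong) (auto simp: g_def rot_def blk)
    then show ?thesis using shiftD[of i r] Di by simp
  qed
  have "(\<Sum>j\<in>{1..l}. g j) - real l * x = 0" using gblk[of l] Dil by (simp add: sum_subtractf)
  then show bm: "block_mean l g = isoreg n h (Suc i)" using l by (simp add: block_mean_def x_def field_simps)
  then have bmx: "block_mean l g = x" by (simp add: x_def)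
  show "bridge_nonneg l g" unfolding bridge_nonneg_def bmx
    using gblk iso_gap_nonneg[of _ n h] l by auto
  \<comment> \<open>The projected values and the gap with the block cut out: positions after
    \<open>i\<close> skip its \<open>l\<close> coordinates.\<close>
  define p' where "p' = (\<lambda>j. ?p (rot i l (l + j)))"
  define E where "E = (\<lambda>r. if r \<le> i then ?D r else ?D (r + l))"
  have E0: "0 \<le> E r" if "r \<le> N" for r
    using that nN by (auto simp: E_def intro!: iso_gap_nonneg)
  have gp: "(\<Sum>j\<in>{1..r}. g (l + j) - p' j) = E r" if "r \<le> N" for r
  proof (cases "r \<le> i")
    case True
    then have "(\<Sum>j\<in>{1..r}. g (l + j) - p' j) = (\<Sum>j\<in>{1..r}. h j - ?p j)"
      using l by (intro sum.cong) (auto simp: g_def p'_def rot_def)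
    then show ?thesis using True by (simp add: E_def iso_gap_def)
  next
    case False
    then obtain q where q: "r = i + q" using nat_le_linear le_Suc_ex by blast
    have "(\<Sum>j\<in>{1..r}. g (l + j) - p' j) = (\<Sum>j\<in>{1..i}. g (l + j) - p' j) + (\<Sum>j\<in>{1..q}. g (l + (i + j)) - p' (i + j))"
      unfolding q by (rule sum_split_shift)
    also have "(\<Sum>j\<in>{1..i}. g (l + j) - p' j) = (\<Sum>j\<in>{1..i}. h j - ?p j)"
      using l by (intro sum.cong) (auto simp: g_def p'_def rot_def)
    also have "\<dots> = 0" using Di by (simp add: iso_gap_def)
    also have "(\<Sum>j\<in>{1..q}. g (l + (i + j)) - p' (i + j)) = (\<Sum>j\<in>{1..q}. h (i + l + j) - ?p (i + l + j))"
      using l by (intro sum.cong) (auto simp: g_def p'_def rot_def add_ac)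
    also have "\<dots> = ?D (i + l + q)" using shiftD[of "i+l" q] Dil by simp
    finally show ?thesis using False q by (simp add: E_def add_ac)
  qed
  have walk: "rest_walk l g r = E r + (\<Sum>j\<in>{1..r}. p' j - x)" if "r \<le> N" for r
    unfolding rest_walk_def bmx gp[OF that, symmetric] sum.distrib[symmetric] by simp
  have Ei: "E i = 0" by (simp add: E_def Di)
  show "walk_argmin l (n - l) g i" unfolding walk_argmin_def N_def[symmetric]
  proof safe
    fix r assume r: "r \<in> {0..N}" "r \<noteq> i"
    show "rest_walk l g i < rest_walk l g r"
    proof (cases "r < i")
      case True
      then obtain q where q: "i = r + q" "0 < q" using less_imp_add_positive by blast
      have "(\<Sum>j\<in>{1..i}. p' j - x) = (\<Sum>j\<in>{1..r}. p' j - x) + (\<Sum>j\<in>{1..q}. p' (r + j) - x)"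
        unfolding q by (rule sum_split_shift)
      moreover have "(\<Sum>j\<in>{1..q}. p' (r + j) - x) < (\<Sum>j\<in>{1..q}. 0)"
        using q l by (intro sum_strict_mono) (auto simp: p'_def rot_def intro!: low)
      ultimately show ?thesis using walk[of i] walk[of r] Ei E0[of r] r nN by simp
    next
      case False
      then obtain q where q: "r = i + q" "0 < q" using r less_imp_add_positive by (metis linorder_neqE_nat)
      have "(\<Sum>j\<in>{1..r}. p' j - x) = (\<Sum>j\<in>{1..i}. p' j - x) + (\<Sum>j\<in>{1..q}. p' (i + j) - x)"
        unfolding q by (rule sum_split_shift)
      moreover have "(\<Sum>j\<in>{1..q}. 0) < (\<Sum>j\<in>{1..q}. p' (i + j) - x)"
      proof (intro sum_strict_mono)
        fix j assume "j \<in> {1..q}"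
        then show "0 < p' (i + j) - x"
          using q l r nN high[of "l + (i + j)"] by (auto simp: p'_def rot_def)
      qed (use q in auto)
      ultimately show ?thesis using walk[of i] walk[of r] Ei E0[of r] r nN by simp
    qed
  qed
  have perm: "(\<Sum>j\<in>{1..n}. f j) = (\<Sum>j\<in>{1..l}. f (i + j)) + (\<Sum>j\<in>{1..N}. f (rot i l (l + j)))" for f :: "nat \<Rightarrow> real"
  proof -
    have "(\<Sum>j\<in>{1..n}. f j) = (\<Sum>j\<in>{1..n}. f (rot i l j))"
      using sum.reindex_bij_betw[OF bij_betw_rot[OF l(2)], of f] by simp
    also have "\<dots> = (\<Sum>j\<in>{1..l}. f (rot i l j)) + (\<Sum>j\<in>{1..N}. f (rot i l (l + j)))"
      unfolding nN(1) by (rule sum_split_shift)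
    also have "(\<Sum>j\<in>{1..l}. f (rot i l j)) = (\<Sum>j\<in>{1..l}. f (i + j))"
      by (intro sum.cong) (auto simp: rot_def)
    finally show ?thesis .
  qed
  \<comment> \<open>The residual sums to zero over the block, on which the projection is constant,
    so orthogonality survives the removal of the block.\<close>
  have "(\<Sum>j\<in>{1..l}. (h (i+j) - ?p (i+j)) * ?p (i+j)) = (\<Sum>j\<in>{1..l}. h (i+j) - ?p (i+j)) * x"
    unfolding sum_distrib_right using blk by (intro sum.cong) auto
  also have "\<dots> = 0" using shiftD[of i l] Di Dil by simp
  finally have "(\<Sum>j\<in>{1..N}. (g (l + j) - p' j) * p' j) = 0"
    using perm[of "\<lambda>j. (h j - ?p j) * ?p j"] iso_orthogonal[of h n] by (simp add: g_def p'_def)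
  then have gpp: "(\<Sum>j\<in>{1..N}. g (l + j) * p' j) = (\<Sum>j\<in>{1..N}. (p' j)\<^sup>2)"
    by (simp add: left_diff_distrib sum_subtractf power2_eq_square)
  have "mono_on {1..N} p'"
  proof (rule mono_onI)
    fix a b assume "a \<in> {1..N}" "b \<in> {1..N}" "a \<le> b"
    then show "p' a \<le> p' b" using l nN
      by (auto simp: p'_def rot_def intro!: monotone_cone_le[OF iso_in])
  qed
  from iso_energy_ge[OF this, of "\<lambda>j. g (l + j)"]
  have "(\<Sum>j\<in>{1..N}. (p' j)\<^sup>2) \<le> iso_energy N (\<lambda>j. g (l + j))" by (simp only: gpp)
  moreover have "iso_energy n h = real l * x\<^sup>2 + (\<Sum>j\<in>{1..N}. (p' j)\<^sup>2)"
    using perm[of "\<lambda>j. (?p j)\<^sup>2"] blk by (simp add: iso_energy_def p'_def)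
  ultimately show "iso_energy n h \<le> real l * (block_mean l g)\<^sup>2 + iso_energy (n - l) (\<lambda>j. g (l + j))"
    by (simp add: bmx N_def)
qed

definition block_sq :: "nat \<Rightarrow> (nat \<Rightarrow> real) \<Rightarrow> real" where
  "block_sq l g = real l * (block_mean l g)\<^sup>2"

lemma block_sq_nonneg: "0 \<le> block_sq l g"
  by (simp add: block_sq_def)

text \<open>The summand attached to a block that has been moved to the front; its original position
  no longer occurs.\<close>

definition block_term :: "(real \<Rightarrow> real) \<Rightarrow> nat \<Rightarrow> nat \<Rightarrow> (nat \<Rightarrow> real) \<Rightarrow> real" where
  "block_term f n l g = of_bool (bridge_nonneg l g) *
     (block_sq l g * f (block_sq l g + iso_energy (n - l) (\<lambda>j. g (l + j))))"

text \<open>Each level set contributes its \<open>block_sq\<close>. Since \<open>f\<close> is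
  monotone, its argument may be replaced by the upper bound for the energy in terms of block and
  remainder, which are independent under the Gaussian law.\<close>

lemma iso_energy_block_bound:
  assumes f: "mono_on {0..} f" "\<And>y. 0 \<le> y \<Longrightarrow> 0 \<le> f y"
  shows "iso_energy n h * f (iso_energy n h) \<le>
    (\<Sum>l\<in>{1..n}. \<Sum>i\<in>{0..n-l}. of_bool (walk_argmin l (n - l) (\<lambda>j. h (rot i l j)) i) *
        block_term f n l (\<lambda>j. h (rot i l j)))"
proof -
  have "iso_energy n h * f (iso_energy n h) =
    (\<Sum>l\<in>{1..n}. \<Sum>i\<in>{0..n-l}. of_bool (iso_level n h i l) * (real l * (isoreg n h (Suc i))\<^sup>2) * f (iso_energy n h))"
    by (subst (1) iso_energy_levels) (simp only: sum_distrib_right)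
  also have "\<dots> \<le> (\<Sum>l\<in>{1..n}. \<Sum>i\<in>{0..n-l}. of_bool (walk_argmin l (n - l) (\<lambda>j. h (rot i l j)) i) *
        block_term f n l (\<lambda>j. h (rot i l j)))"
  proof (intro sum_mono)
    fix l i assume li: "l \<in> {1..n}" "i \<in> {0..n-l}"
    let ?g = "\<lambda>j. h (rot i l j)"
    have nn: "0 \<le> block_sq l ?g + iso_energy (n - l) (\<lambda>j. ?g (l + j))"
      by (intro add_nonneg_nonneg block_sq_nonneg iso_energy_nonneg)
    show "of_bool (iso_level n h i l) * (real l * (isoreg n h (Suc i))\<^sup>2) * f (iso_energy n h)
      \<le> of_bool (walk_argmin l (n - l) ?g i) * block_term f n l ?g"
    proof (cases "iso_level n h i l")
      case True
      note c = iso_level_conditions[OF True]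
      have "f (iso_energy n h) \<le> f (block_sq l ?g + iso_energy (n - l) (\<lambda>j. ?g (l + j)))"
        using c(4) nn iso_energy_nonneg by (intro mono_onD[OF f(1)]) (auto simp: block_sq_def)
      then have "block_sq l ?g * f (iso_energy n h) \<le> block_sq l ?g * f (block_sq l ?g + iso_energy (n - l) (\<lambda>j. ?g (l + j)))"
        by (rule mult_left_mono) (rule block_sq_nonneg)
      then show ?thesis using c(1,2,3) True by (simp add: block_term_def block_sq_def)
    next
      case False
      then show ?thesis using nn f(2) by (simp add: block_term_def block_sq_nonneg)
    qed
  qed
  finally show ?thesis .
qed

lemma walk_argmin_unique:
  assumes "walk_argmin l N g i" "walk_argmin l N g i'" "i \<le> N" "i' \<le> N"
  shows "i = i'"
  using assms unfolding walk_argmin_def by (metis atLeastAtMost_iff le0 less_asym)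

lemma sum_walk_argmin_le: "(\<Sum>i\<in>{0..N}. of_bool (walk_argmin l N g i)) \<le> (1::real)"
proof (cases "\<exists>i\<in>{0..N}. walk_argmin l N g i")
  case True
  then obtain i where i: "i \<le> N" "walk_argmin l N g i" by auto
  have "(\<Sum>k\<in>{0..N}. of_bool (walk_argmin l N g k)) = (\<Sum>k\<in>{0..N}. if k = i then 1 else (0::real))"
  proof (intro sum.cong refl)
    fix k assume "k \<in> {0..N}"
    then show "of_bool (walk_argmin l N g k) = (if k = i then 1 else (0::real))"
      using walk_argmin_unique[of l N g k i] i by (cases "k = i") auto
  qed
  then show ?thesis using i by simp
qed simp

section \<open>Gaussian product measures\<close>

abbreviation std_normal :: "real measure" where
  "std_normal \<equiv> density lborel std_normal_density"

text \<open>General index sets are allowed because single blocks and their complements occur as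
  index sets of marginals.\<close>

definition gauss_on :: "nat set \<Rightarrow> (nat \<Rightarrow> real) measure" where
  "gauss_on K = (\<Pi>\<^sub>M i\<in>K. std_normal)"

lemma std_gaussian_eq: "std_gaussian n = gauss_on {1..n}"
  by (simp add: std_gaussian_def gauss_on_def)

lemma prob_space_gauss_on: "prob_space (gauss_on K)"
  unfolding gauss_on_def by (intro prob_space_PiM prob_space_normal_density) simp

lemma sets_gauss_on [measurable_cong]: "sets (gauss_on K) = sets (\<Pi>\<^sub>M i\<in>K. (borel :: real measure))"
  unfolding gauss_on_def by (intro sets_PiM_cong) auto

lemma space_gauss_on: "space (gauss_on K) = (\<Pi>\<^sub>E i\<in>K. UNIV)"
  unfolding gauss_on_def by (simp add: space_PiM)

lemma measurable_gauss_on: "measurable (gauss_on K) N = measurable (\<Pi>\<^sub>M i\<in>K. (borel :: real measure)) N"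
  by (rule measurable_cong_sets[OF sets_gauss_on refl])

lemma distr_gauss_on_reindex:
  assumes "inj_on f I" "f \<in> I \<rightarrow> K"
  shows "distr (gauss_on K) (\<Pi>\<^sub>M i\<in>I. borel) (\<lambda>h. \<lambda>j\<in>I. h (f j)) = gauss_on I"
proof -
  have "distr (gauss_on K) (\<Pi>\<^sub>M i\<in>I. borel) (\<lambda>h. \<lambda>j\<in>I. h (f j))
      = distr (gauss_on K) (\<Pi>\<^sub>M i\<in>I. std_normal) (\<lambda>h. \<lambda>j\<in>I. h (f j))"
    by (intro distr_cong sets_PiM_cong) auto
  also have "\<dots> = gauss_on I"
    unfolding gauss_on_def
    using distr_PiM_reindex[of K "\<lambda>_. std_normal" f I] assms prob_space_normal_density by simp
  finally show ?thesis .
qed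

lemma measurable_reindex:
  assumes "f \<in> I \<rightarrow> K"
  shows "(\<lambda>h. \<lambda>j\<in>I. h (f j)) \<in> measurable (\<Pi>\<^sub>M i\<in>K. borel) (\<Pi>\<^sub>M i\<in>I. (borel :: real measure))"
  using assms by (intro measurable_restrict measurable_component_singleton) auto

lemma measurable_comp_reindex:
  fixes G :: "(nat \<Rightarrow> real) \<Rightarrow> 'b"
  assumes "f \<in> I \<rightarrow> K" and G: "G \<in> measurable (\<Pi>\<^sub>M i\<in>I. borel) N"
    and cong: "\<And>h h'. (\<And>j. j \<in> I \<Longrightarrow> h j = h' j) \<Longrightarrow> G h = G h'"
  shows "(\<lambda>h. G (\<lambda>j. h (f j))) \<in> measurable (\<Pi>\<^sub>M i\<in>K. borel) N"
proof -
  have "(\<lambda>h. G (\<lambda>j. h (f j))) = G \<circ> (\<lambda>h. \<lambda>j\<in>I. h (f j))"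
    by (rule ext) (unfold comp_def, rule cong, simp)
  then show ?thesis using measurable_comp[OF measurable_reindex[OF assms(1)] G] by simp
qed

text \<open>\<open>cong\<close> says that \<open>G\<close> depends only on the coordinates in
  \<open>I\<close>, so that \<open>G\<close> may be applied to \<open>\<lambda>j. h (f j)\<close>
  without restricting it to \<open>I\<close>.\<close>

lemma nn_integral_gauss_on_reindex:
  fixes G :: "(nat \<Rightarrow> real) \<Rightarrow> ennreal"
  assumes "inj_on f I" "f \<in> I \<rightarrow> K" and G: "G \<in> borel_measurable (\<Pi>\<^sub>M i\<in>I. borel)"
    and cong: "\<And>h h'. (\<And>j. j \<in> I \<Longrightarrow> h j = h' j) \<Longrightarrow> G h = G h'"
  shows "(\<integral>\<^sup>+h. G (\<lambda>j. h (f j)) \<partial>gauss_on K) = (\<integral>\<^sup>+h. G h \<partial>gauss_on I)"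
proof -
  have "(\<integral>\<^sup>+h. G h \<partial>gauss_on I) = (\<integral>\<^sup>+h. G (\<lambda>j\<in>I. h (f j)) \<partial>gauss_on K)"
    unfolding distr_gauss_on_reindex[OF assms(1,2), symmetric]
    by (rule nn_integral_distr) (use measurable_reindex[OF assms(2)] G in \<open>simp_all add: measurable_gauss_on\<close>)
  also have "\<dots> = (\<integral>\<^sup>+h. G (\<lambda>j. h (f j)) \<partial>gauss_on K)"
    by (intro nn_integral_cong cong) simp
  finally show ?thesis by (rule sym)
qed

lemma indep_vars_gauss_on:
  "prob_space.indep_vars (gauss_on K) (\<lambda>_. borel) (\<lambda>i h. h i) K"
proof (cases "K = {}")
  case True
  interpret prob_space "gauss_on K" by (rule prob_space_gauss_on)
  show ?thesis unfolding indep_vars_def indep_sets_def using True by auto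
next
  case False
  interpret prob_space "gauss_on K" by (rule prob_space_gauss_on)
  have comp: "distr (gauss_on K) borel (\<lambda>h. h i) = std_normal" if "i \<in> K" for i
  proof -
    have "distr (gauss_on K) borel (\<lambda>h. h i) = distr (gauss_on K) std_normal (\<lambda>h. h i)"
      by (intro distr_cong) auto
    then show ?thesis unfolding gauss_on_def
      using distr_PiM_component[of K "\<lambda>_. std_normal" i] that prob_space_normal_density by simp
  qed
  have "distr (gauss_on K) (\<Pi>\<^sub>M i\<in>K. borel) (\<lambda>h. \<lambda>i\<in>K. h i) = gauss_on K"
    using distr_gauss_on_reindex[of "\<lambda>j. j" K K] by auto
  also have "\<dots> = (\<Pi>\<^sub>M i\<in>K. distr (gauss_on K) borel (\<lambda>h. h i))"
    unfolding gauss_on_def[of K] using comp by (intro PiM_cong) (auto simp: gauss_on_def)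
  finally show ?thesis
    using False by (subst indep_vars_iff_distr_eq_PiM') (simp_all add: measurable_gauss_on)
qed

lemma distributed_gauss_on:
  assumes "i \<in> K" shows "distributed (gauss_on K) lborel (\<lambda>h. h i) std_normal_density"
proof -
  have "distr (gauss_on K) lborel (\<lambda>h. h i) = distr (gauss_on K) std_normal (\<lambda>h. h i)"
    by (intro distr_cong) auto
  also have "\<dots> = std_normal" unfolding gauss_on_def
    using distr_PiM_component[of K "\<lambda>_. std_normal" i] assms prob_space_normal_density by simp
  finally show ?thesis using assms
    by (simp add: distributed_def measurable_gauss_on)
qed

lemma (in prob_space) distributed_linear_normal:
  assumes "finite I" "indep_vars (\<lambda>_. borel) Z I"
    and Z: "\<And>i. i \<in> I \<Longrightarrow> distributed M lborel (Z i) (normal_density 0 s)" "0 < s"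
    and a: "\<exists>i\<in>I. a i \<noteq> 0"
  shows "distributed M lborel (\<lambda>\<omega>. \<Sum>i\<in>I. a i * Z i \<omega>) (normal_density 0 (s * L2_set a I))"
proof -
  \<comment> \<open>Vanishing coefficients are dropped: they would contribute normal laws of
    standard deviation zero, which have no density.\<close>
  define J where "J = {i\<in>I. a i \<noteq> 0}"
  have J: "finite J" "J \<noteq> {}" "J \<subseteq> I" using assms by (auto simp: J_def)
  have ind: "indep_vars (\<lambda>_. borel) (\<lambda>i \<omega>. a i * Z i \<omega>) J"
    using indep_vars_subset[OF assms(2) J(3)] by (rule indep_vars_compose2) auto
  have "distributed M lborel (\<lambda>\<omega>. a i * Z i \<omega>) (normal_density 0 (\<bar>a i\<bar> * s))" if "i \<in> J" for i
    using normal_density_affine[OF Z(1) Z(2), of i "a i" 0] that by (auto simp: J_def)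
  from sum_indep_normal[OF J(1,2) ind _ this]
  have "distributed M lborel (\<lambda>\<omega>. \<Sum>i\<in>J. a i * Z i \<omega>) (normal_density 0 (sqrt (\<Sum>i\<in>J. (\<bar>a i\<bar> * s)\<^sup>2)))"
    using Z(2) by (auto simp: J_def)
  moreover have "(\<Sum>i\<in>J. a i * Z i \<omega>) = (\<Sum>i\<in>I. a i * Z i \<omega>)" for \<omega>
    using assms(1) by (intro sum.mono_neutral_left) (auto simp: J_def)
  moreover have "sqrt (\<Sum>i\<in>J. (\<bar>a i\<bar> * s)\<^sup>2) = s * L2_set a I"
  proof -
    have "(\<Sum>i\<in>J. (\<bar>a i\<bar> * s)\<^sup>2) = s\<^sup>2 * (\<Sum>i\<in>J. (a i)\<^sup>2)"
      by (simp add: sum_distrib_left power_mult_distrib mult.commute)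
    also have "(\<Sum>i\<in>J. (a i)\<^sup>2) = (\<Sum>i\<in>I. (a i)\<^sup>2)"
      using assms(1) by (intro sum.mono_neutral_left) (auto simp: J_def)
    finally show ?thesis using Z(2) by (simp add: L2_set_def real_sqrt_mult)
  qed
  ultimately show ?thesis by simp
qed

lemma distributed_gauss_on_linear:
  assumes "finite K" "\<exists>i\<in>K. a i \<noteq> 0"
  shows "distributed (gauss_on K) lborel (\<lambda>h. \<Sum>i\<in>K. a i * h i) (normal_density 0 (L2_set a K))"
  using prob_space.distributed_linear_normal[OF prob_space_gauss_on assms(1) indep_vars_gauss_on distributed_gauss_on _ assms(2)]
  by simp

text \<open>The linear form has a normal density, hence no atoms. This excludes ties between shifted
  bridges and also shows that the risk is positive.\<close>

lemma gauss_on_linear_AE_nonzero: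
  assumes "finite K" "\<exists>i\<in>K. a i \<noteq> 0"
  shows "AE h in gauss_on K. (\<Sum>i\<in>K. a i * h i) \<noteq> 0"
proof -
  note d = distributed_gauss_on_linear[OF assms]
  have "AE y in lborel. y \<noteq> (0::real)" by (rule AE_lborel_singleton)
  then have "AE y in density lborel (normal_density 0 (L2_set a K)). y \<noteq> 0"
    by (subst AE_density) auto
  moreover have "distr (gauss_on K) lborel (\<lambda>h. \<Sum>i\<in>K. a i * h i) = density lborel (normal_density 0 (L2_set a K))"
    using d by (simp add: distributed_def)
  ultimately have "AE y in distr (gauss_on K) lborel (\<lambda>h. \<Sum>i\<in>K. a i * h i). y \<noteq> 0"
    by metis
  then show ?thesis
    using d by (subst (asm) AE_distr_iff) (auto simp: distributed_def)
qed

text \<open>Functions of disjoint blocks of coordinates are independent; each factor is then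
  integrated against the marginal of its own block.\<close>

lemma nn_integral_gauss_on_blocks:
  fixes A :: "'j \<Rightarrow> (nat \<Rightarrow> real) \<Rightarrow> ennreal"
  assumes J: "finite J" "disjoint_family_on B J" "\<And>j. j \<in> J \<Longrightarrow> B j \<subseteq> K"
    and A: "\<And>j. j \<in> J \<Longrightarrow> A j \<in> borel_measurable (\<Pi>\<^sub>M i\<in>B j. borel)"
    and cong: "\<And>j h h'. j \<in> J \<Longrightarrow> (\<And>i. i \<in> B j \<Longrightarrow> h i = h' i) \<Longrightarrow> A j h = A j h'"
  shows "(\<integral>\<^sup>+h. (\<Prod>j\<in>J. A j h) \<partial>gauss_on K) = (\<Prod>j\<in>J. \<integral>\<^sup>+h. A j h \<partial>gauss_on (B j))"
proof -
  interpret prob_space "gauss_on K" by (rule prob_space_gauss_on)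
  have "indep_vars (\<lambda>j. PiM (B j) (\<lambda>_. borel)) (\<lambda>j h. restrict (\<lambda>i. h i) (B j)) J"
    using J by (intro indep_vars_restrict[OF indep_vars_gauss_on]) auto
  from indep_vars_compose2[OF this, of A "\<lambda>_. borel"] A
  have ind: "indep_vars (\<lambda>_. borel) (\<lambda>j h. A j (restrict h (B j))) J" by simp
  have Ar: "A j (restrict h (B j)) = A j h" if "j \<in> J" for j h using that by (intro cong) auto
  have "(\<integral>\<^sup>+h. (\<Prod>j\<in>J. A j h) \<partial>gauss_on K) = (\<integral>\<^sup>+h. (\<Prod>j\<in>J. A j (restrict h (B j))) \<partial>gauss_on K)"
    by (intro nn_integral_cong prod.cong) (auto simp: Ar)
  also have "\<dots> = (\<Prod>j\<in>J. \<integral>\<^sup>+h. A j (restrict h (B j)) \<partial>gauss_on K)"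
    by (intro indep_vars_nn_integral[OF J(1) ind]) auto
  also have "\<dots> = (\<Prod>j\<in>J. \<integral>\<^sup>+h. A j h \<partial>gauss_on (B j))"
  proof (intro prod.cong refl)
    fix j assume j: "j \<in> J"
    have "(\<integral>\<^sup>+h. A j (restrict h (B j)) \<partial>gauss_on K) = (\<integral>\<^sup>+h. A j (\<lambda>i. h i) \<partial>gauss_on K)"
      using j by (simp add: Ar)
    also have "\<dots> = (\<integral>\<^sup>+h. A j h \<partial>gauss_on (B j))"
    proof (rule nn_integral_gauss_on_reindex[where f="\<lambda>i. i"])
      show "(\<lambda>i. i) \<in> B j \<rightarrow> K" using J(3)[OF j] by auto
      show "A j h = A j h'" if "\<And>i. i \<in> B j \<Longrightarrow> h i = h' i" for h h' using j that by (rule cong)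
    qed (auto simp: A[OF j])
    finally show "(\<integral>\<^sup>+h. A j (restrict h (B j)) \<partial>gauss_on K) = (\<integral>\<^sup>+h. A j h \<partial>gauss_on (B j))" .
  qed
  finally show ?thesis .
qed

section \<open>Moments of the isotonic energy\<close>

text \<open>The value of \<open>E (y^2 exp (s y^2))\<close> for a standard normal \<open>y\<close>,
  that is, \<open>1 - 2 * s\<close> to the power \<open>-3/2\<close>.\<close>

definition chisq_const :: "real \<Rightarrow> real" where
  "chisq_const s = (1 / sqrt (1 - 2 * s)) ^ 3"

lemma chisq_const_mono:
  assumes "s \<le> t" "t < 1/2" shows "chisq_const s \<le> chisq_const t"
  unfolding chisq_const_def using assms by (intro power_mono frac_le) auto

lemma chisq_const_pos: "s < 1/2 \<Longrightarrow> 0 < chisq_const s"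
  by (simp add: chisq_const_def)

text \<open>The factor \<open>exp (s * y\<^sup>2)\<close> tilts the standard normal density into
  \<open>r\<close> times the normal density of variance \<open>r\<^sup>2 = 1 / (1 - 2 * s)\<close>,
  whose second moment supplies the remaining \<open>r\<^sup>2\<close>.\<close>

lemma nn_integral_sq_exp:
  assumes "s < 1/2"
  shows "(\<integral>\<^sup>+y. y\<^sup>2 * exp (s * y\<^sup>2) \<partial>std_normal) = chisq_const s"
proof -
  define r where "r = 1 / sqrt (1 - 2 * s)"
  have r: "0 < r" "r\<^sup>2 = 1 / (1 - 2 * s)" using assms by (auto simp: r_def power_divide)
  have dens: "std_normal_density y * exp (s * y\<^sup>2) = r * normal_density 0 r y" for y
  proof -
    have "- y\<^sup>2 / 2 + s * y\<^sup>2 = - y\<^sup>2 / (2 * r\<^sup>2)" using assms unfolding r(2) by (simp add: field_simps)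
    then have "exp (- y\<^sup>2 / 2) * exp (s * y\<^sup>2) = exp (- y\<^sup>2 / (2 * r\<^sup>2))" by (simp flip: exp_add)
    moreover have "sqrt (2 * pi * r\<^sup>2) = sqrt (2 * pi) * r" using r(1) by (simp add: real_sqrt_mult)
    ultimately show ?thesis using r(1) by (simp add: normal_density_def)
  qed
  have hb: "has_bochner_integral lborel (\<lambda>y. r * (normal_density 0 r y * y\<^sup>2)) (r * r\<^sup>2)"
    using normal_moment_even[OF r(1), of 0 1] by (intro has_bochner_integral_mult_right) (simp add: mult.commute)
  have "(\<integral>\<^sup>+y. y\<^sup>2 * exp (s * y\<^sup>2) \<partial>std_normal) = (\<integral>\<^sup>+y. r * (normal_density 0 r y * y\<^sup>2) \<partial>lborel)"
  proof (subst nn_integral_density)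
    have eq: "std_normal_density y * (y\<^sup>2 * exp (s * y\<^sup>2)) = r * (normal_density 0 r y * y\<^sup>2)" for y
      using arg_cong[OF dens[of y], of "\<lambda>z. z * y\<^sup>2"] by (simp only: mult_ac)
    show "(\<integral>\<^sup>+y. ennreal (std_normal_density y) * ennreal (y\<^sup>2 * exp (s * y\<^sup>2)) \<partial>lborel)
        = (\<integral>\<^sup>+y. ennreal (r * (normal_density 0 r y * y\<^sup>2)) \<partial>lborel)"
      by (intro nn_integral_cong) (simp only: eq[symmetric] ennreal_mult' normal_density_nonneg)
  qed simp_all
  also have "\<dots> = r * r\<^sup>2"
    using hb r by (subst nn_integral_eq_integral) (auto simp: has_bochner_integral_iff)
  also have "r * r\<^sup>2 = chisq_const s" by (simp add: r_def chisq_const_def power_numeral_reduce)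
  finally show ?thesis .
qed

section \<open>Measurability of the block quantities\<close>

lemma block_mean_cong: "(\<And>j. j \<in> {1..l} \<Longrightarrow> h j = h' j) \<Longrightarrow> block_mean l h = block_mean l h'"
  by (simp add: block_mean_def cong: sum.cong_simp)

lemma block_sq_cong: "(\<And>j. j \<in> {1..l} \<Longrightarrow> h j = h' j) \<Longrightarrow> block_sq l h = block_sq l h'"
  using block_mean_cong[of l h h'] by (simp add: block_sq_def)

lemma borel_measurable_block_mean:
  "l \<le> n \<Longrightarrow> block_mean l \<in> borel_measurable (\<Pi>\<^sub>M i\<in>{1..n}. borel)"
  unfolding block_mean_def[abs_def]
  by (intro borel_measurable_divide borel_measurable_sum measurable_component_singleton borel_measurable_const) auto

lemma borel_measurable_block_sq:
  "l \<le> n \<Longrightarrow> block_sq l \<in> borel_measurable (\<Pi>\<^sub>M i\<in>{1..n}. borel)"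
  unfolding block_sq_def[abs_def]
  by (intro borel_measurable_times borel_measurable_power borel_measurable_block_mean borel_measurable_const)

lemma borel_measurable_iso_energy_rest:
  assumes "l \<le> n"
  shows "(\<lambda>h. iso_energy (n - l) (\<lambda>j. h (l + j))) \<in> borel_measurable (\<Pi>\<^sub>M i\<in>{1..n}. borel)"
proof (rule measurable_comp_reindex[where I="{1..n-l}" and f="\<lambda>j. l + j" and G="iso_energy (n - l)"])
  show "(\<lambda>j. l + j) \<in> {1..n - l} \<rightarrow> {1..n}" using assms by auto
qed (rule borel_measurable_iso_energy, rule iso_energy_cong)

lemma pred_bridge_nonneg:
  assumes "l \<le> n" shows "Measurable.pred (\<Pi>\<^sub>M i\<in>{1..n}. borel) (bridge_nonneg l)"
proof -
  have [measurable]: "(\<lambda>h. \<Sum>j\<in>{1..r}. h j - block_mean l h) \<in> borel_measurable (\<Pi>\<^sub>M i\<in>{1..n}. borel)" if "r \<in> {1..l}" for r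
    using assms that
    by (intro borel_measurable_sum borel_measurable_diff borel_measurable_block_mean measurable_component_singleton) auto
  show ?thesis unfolding bridge_nonneg_def[abs_def]
    by (intro pred_intros_finite) (auto simp: pred_def simp del: One_nat_def intro!: borel_measurable_le)
qed

lemma borel_measurable_block_weight:
  assumes l: "l \<le> n" and f: "f \<in> borel_measurable borel"
  shows "(\<lambda>h. block_sq l h * f (block_sq l h + iso_energy (n - l) (\<lambda>j. h (l + j)))) \<in> borel_measurable (\<Pi>\<^sub>M i\<in>{1..n}. borel)"
  by (intro borel_measurable_times borel_measurable_block_sq[OF l] measurable_compose[OF _ f]
      borel_measurable_add borel_measurable_iso_energy_rest[OF l])

lemma borel_measurable_block_term:
  assumes l: "l \<le> n" and f: "f \<in> borel_measurable borel"
  shows "block_term f n l \<in> borel_measurable (\<Pi>\<^sub>M i\<in>{1..n}. borel)"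
proof -
  note [measurable] = pred_bridge_nonneg[OF l] borel_measurable_block_weight[OF l f]
  show ?thesis unfolding block_term_def[abs_def] by measurable
qed

lemma borel_measurable_rest_walk:
  "l \<le> n \<Longrightarrow> r \<le> n - l \<Longrightarrow> (\<lambda>h. rest_walk l h r) \<in> borel_measurable (\<Pi>\<^sub>M i\<in>{1..n}. borel)"
  unfolding rest_walk_def
  by (intro borel_measurable_sum borel_measurable_diff borel_measurable_block_mean measurable_component_singleton) auto

lemma pred_walk_argmin:
  assumes "l \<le> n" "i \<le> n - l"
  shows "Measurable.pred (\<Pi>\<^sub>M i\<in>{1..n}. borel) (\<lambda>h. walk_argmin l (n - l) h i)"
  unfolding walk_argmin_def using assms
  by (intro pred_intros_finite pred_intros_imp' measurable_const)
     (auto simp: pred_def simp del: One_nat_def intro!: borel_measurable_less borel_measurable_rest_walk)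

lemma block_term_nonneg: "(\<And>y. 0 \<le> y \<Longrightarrow> 0 \<le> f y) \<Longrightarrow> 0 \<le> block_term f n l g"
  unfolding block_term_def
  using block_sq_nonneg[of l g] iso_energy_nonneg[of "n - l" "\<lambda>j. g (l + j)"]
  by (intro mult_nonneg_nonneg) simp_all

section \<open>Cyclic shifts of the block\<close>

definition cyc :: "nat \<Rightarrow> nat \<Rightarrow> nat \<Rightarrow> nat" where
  "cyc l c j = (if j \<le> l then (if j + c \<le> l then j + c else j + c - l) else j)"

lemma bij_betw_cyc:
  assumes "c < l" "l \<le> n" shows "bij_betw (cyc l c) {1..n} {1..n}"
proof (rule bij_betw_byWitness[where f' = "\<lambda>j. if j \<le> l then (if c < j then j - c else j + l - c) else j"])
qed (use assms in \<open>auto simp: cyc_def\<close>)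

lemma bij_betw_cyc_block:
  assumes "c < l" shows "bij_betw (cyc l c) {1..l} {1..l}"
  using bij_betw_cyc[OF assms order_refl] .

lemma block_mean_cyc: "c < l \<Longrightarrow> block_mean l (\<lambda>j. h (cyc l c j)) = block_mean l h"
  unfolding block_mean_def using sum.reindex_bij_betw[OF bij_betw_cyc_block, of c l h] by simp

lemma cyc_gt: "l < j \<Longrightarrow> cyc l c j = j"
  by (simp add: cyc_def)

text \<open>
  The linear form is the difference of the bridge values at \<open>c'\<close> and \<open>c\<close>; a shift has a nonnegative
  bridge only if it starts at a minimum of the bridge.
\<close>

lemma bridge_cyc_tie:
  assumes c: "c < c'" "c' < l"
    and b: "bridge_nonneg l (\<lambda>j. h (cyc l c j))" "bridge_nonneg l (\<lambda>j. h (cyc l c' j))"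
  shows "(\<Sum>j\<in>{1..l}. (of_bool (c < j \<and> j \<le> c') - real (c' - c) / real l) * h j) = 0"
proof -
  let ?x = "block_mean l h"
  have l: "0 < l" using c by simp
  have tot: "(\<Sum>j\<in>{1..l}. h j - ?x) = 0" using l by (simp add: block_mean_def sum_subtractf)
  have x: "block_mean l (\<lambda>j. h (cyc l c j)) = ?x" "block_mean l (\<lambda>j. h (cyc l c' j)) = ?x"
    using c by (auto intro!: block_mean_cyc)
  define d where "d = c' - c"
  have d: "c' = c + d" "0 < d" using c by (auto simp: d_def)
  have s1: "(\<Sum>j\<in>{1..d}. h (cyc l c j) - ?x) = (\<Sum>j\<in>{1..d}. h (c + j) - ?x)"
    using c d by (intro sum.cong) (auto simp: cyc_def add.commute)
  then have nonneg: "0 \<le> (\<Sum>j\<in>{1..d}. h (c + j) - ?x)"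
    using b(1) c d l unfolding bridge_nonneg_def x by (metis (no_types, lifting) atLeastAtMost_iff le_eq_less_or_eq less_imp_diff_less d_def Suc_leI One_nat_def order.strict_trans1)
  define q where "q = l - c'"
  have lq: "l = c' + q" "0 < q" using c by (auto simp: q_def)
  have "q + c \<in> {1..l}" using lq c by auto
  then have "0 \<le> (\<Sum>j\<in>{1..q + c}. h (cyc l c' j) - ?x)" using b(2) unfolding bridge_nonneg_def x by blast
  also have "\<dots> = (\<Sum>j\<in>{1..q}. h (cyc l c' j) - ?x) + (\<Sum>j\<in>{1..c}. h (cyc l c' (q + j)) - ?x)"
    by (rule sum_split_shift)
  also have "(\<Sum>j\<in>{1..q}. h (cyc l c' j) - ?x) = (\<Sum>j\<in>{1..q}. h (c' + j) - ?x)"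
    using lq by (intro sum.cong) (auto simp: cyc_def add.commute)
  also have "(\<Sum>j\<in>{1..c}. h (cyc l c' (q + j)) - ?x) = (\<Sum>j\<in>{1..c}. h j - ?x)"
    using lq c by (intro sum.cong) (auto simp: cyc_def)
  finally have 2: "0 \<le> (\<Sum>j\<in>{1..q}. h (c' + j) - ?x) + (\<Sum>j\<in>{1..c}. h j - ?x)" .
  have c'sum: "(\<Sum>j\<in>{1..c'}. h j - ?x) = (\<Sum>j\<in>{1..c}. h j - ?x) + (\<Sum>j\<in>{1..d}. h (c + j) - ?x)"
    unfolding d(1) by (rule sum_split_shift)
  have "(\<Sum>j\<in>{1..l}. h j - ?x) = (\<Sum>j\<in>{1..c'}. h j - ?x) + (\<Sum>j\<in>{1..q}. h (c' + j) - ?x)"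
    by (subst (1) lq(1)) (rule sum_split_shift)
  \<comment> \<open>The increments of the bridge over the two arcs between \<open>c\<close> and
    \<open>c'\<close> are both nonnegative and add up to its total, which is zero.\<close>
  then have zero: "(\<Sum>j\<in>{1..d}. h (c + j) - ?x) = 0" using nonneg 2 c'sum tot by linarith
  have "(\<Sum>j\<in>{1..l}. of_bool (c < j \<and> j \<le> c') * h j) = (\<Sum>j\<in>{1..d}. h (c + j))"
  proof -
    have "(\<Sum>j\<in>{1..l}. of_bool (c < j \<and> j \<le> c') * h j) = (\<Sum>j\<in>{c+1..c+d}. h j)"
      using c d by (intro sum.mono_neutral_cong_right) auto
    also have "\<dots> = (\<Sum>j\<in>{1..d}. h (c + j))"
      using sum.shift_bounds_cl_nat_ivl[of h 1 c d] by (simp add: add.commute)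
    finally show ?thesis .
  qed
  moreover have "(\<Sum>j\<in>{1..l}. real (c' - c) / real l * h j) = real d * ?x"
    by (simp add: sum_distrib_left sum_divide_distrib block_mean_def d_def)
  ultimately show ?thesis using zero by (simp add: left_diff_distrib sum_subtractf)
qed

text \<open>Two shifts with nonnegative bridges would force a nontrivial linear form to vanish, and
  there are only finitely many pairs of shifts.\<close>

lemma AE_sum_bridge_cyc_le:
  assumes l: "1 \<le> l" "l \<le> n"
  shows "AE h in gauss_on {1..n}. (\<Sum>c\<in>{..<l}. of_bool (bridge_nonneg l (\<lambda>j. h (cyc l c j)))) \<le> (1::real)"
proof -
  let ?a = "\<lambda>c c' j. of_bool (j \<le> l) * (of_bool (c < j \<and> j \<le> c') - real (c' - c) / real l)"
  have "AE h in gauss_on {1..n}. (\<Sum>j\<in>{1..n}. ?a c c' j * h j) \<noteq> 0" if "c < c'" "c' < l" for c c'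
  proof (rule gauss_on_linear_AE_nonzero)
    \<comment> \<open>The coefficient is \<open>1 - (c' - c) / l\<close>, positive because the
      shifts differ by less than \<open>l\<close>.\<close>
    have "Suc c \<in> {1..n}" "?a c c' (Suc c) \<noteq> 0" using that l by auto
    then show "\<exists>j\<in>{1..n}. ?a c c' j \<noteq> 0" by blast
  qed simp
  then have "AE h in gauss_on {1..n}. \<forall>p\<in>{(c,c'). c < c' \<and> c' < l}. (\<Sum>j\<in>{1..n}. ?a (fst p) (snd p) j * h j) \<noteq> 0"
  proof (intro AE_finite_allI)
    show "finite {(c,c'). c < c' \<and> c' < l}" by (rule finite_subset[of _ "{..<l} \<times> {..<l}"]) auto
  qed auto
  then show ?thesis
  proof eventually_elim
    case (elim h)
    have uniq: "c = c'" if "c < l" "c' < l" "bridge_nonneg l (\<lambda>j. h (cyc l c j))" "bridge_nonneg l (\<lambda>j. h (cyc l c' j))" for c c'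
    proof (rule ccontr)
      assume "c \<noteq> c'"
      have *: False if "c < c'" "c' < l" "bridge_nonneg l (\<lambda>j. h (cyc l c j))" "bridge_nonneg l (\<lambda>j. h (cyc l c' j))" for c c'
      proof -
        have "(\<Sum>j\<in>{1..n}. ?a c c' j * h j) = (\<Sum>j\<in>{1..l}. (of_bool (c < j \<and> j \<le> c') - real (c' - c) / real l) * h j)"
          using l by (intro sum.mono_neutral_cong_right) auto
        also have "\<dots> = 0" by (rule bridge_cyc_tie) fact+
        finally show False using elim that by force
      qed
      show False using that \<open>c \<noteq> c'\<close> *[of c c'] *[of c' c] by linarith
    qed
    show ?case
    proof (cases "\<exists>c<l. bridge_nonneg l (\<lambda>j. h (cyc l c j))")
      case True
      then obtain c where c: "c < l" "bridge_nonneg l (\<lambda>j. h (cyc l c j))" by blast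
      have "(\<Sum>k\<in>{..<l}. of_bool (bridge_nonneg l (\<lambda>j. h (cyc l k j)))) = (\<Sum>k\<in>{..<l}. if k = c then 1 else (0::real))"
      proof (intro sum.cong refl)
        fix k assume "k \<in> {..<l}"
        then show "of_bool (bridge_nonneg l (\<lambda>j. h (cyc l k j))) = (if k = c then 1 else (0::real))"
          using uniq[of k c] c by (cases "k = c") auto
      qed
      then show ?thesis using c by simp
    qed simp
  qed
qed

lemma nn_integral_gauss_on_permute:
  fixes G :: "(nat \<Rightarrow> real) \<Rightarrow> ennreal"
  assumes "bij_betw f {1..n} {1..n}" "G \<in> borel_measurable (\<Pi>\<^sub>M i\<in>{1..n}. borel)"
    and "\<And>h h'. (\<And>j. j \<in> {1..n} \<Longrightarrow> h j = h' j) \<Longrightarrow> G h = G h'"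
  shows "(\<integral>\<^sup>+h. G (\<lambda>j. h (f j)) \<partial>gauss_on {1..n}) = (\<integral>\<^sup>+h. G h \<partial>gauss_on {1..n})"
  using assms(1) by (intro nn_integral_gauss_on_reindex assms(2,3)) (auto simp: bij_betw_def)

lemma block_weight_cong:
  assumes "l \<le> n" "\<And>j. j \<in> {1..n} \<Longrightarrow> h j = h' j"
  shows "block_sq l h * f (block_sq l h + iso_energy (n - l) (\<lambda>j. h (l + j)))
       = block_sq l h' * f (block_sq l h' + iso_energy (n - l) (\<lambda>j. h' (l + j)))"
proof -
  have "block_sq l h = block_sq l h'" using assms by (intro block_sq_cong) auto
  moreover have "iso_energy (n - l) (\<lambda>j. h (l + j)) = iso_energy (n - l) (\<lambda>j. h' (l + j))"
    using assms by (intro iso_energy_cong) auto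
  ultimately show ?thesis by simp
qed

lemma bridge_nonneg_cong:
  assumes "\<And>j. j \<in> {1..l} \<Longrightarrow> h j = h' j"
  shows "bridge_nonneg l h = bridge_nonneg l h'"
proof -
  have "(\<Sum>j\<in>{1..r}. h j - block_mean l h) = (\<Sum>j\<in>{1..r}. h' j - block_mean l h')" if "r \<in> {1..l}" for r
    using that assms block_mean_cong[of l h h'] by (intro sum.cong) auto
  then show ?thesis unfolding bridge_nonneg_def by simp
qed

lemma block_term_cong:
  assumes "l \<le> n" "\<And>j. j \<in> {1..n} \<Longrightarrow> h j = h' j"
  shows "block_term f n l h = block_term f n l h'"
proof -
  have "bridge_nonneg l h = bridge_nonneg l h'" using assms by (intro bridge_nonneg_cong) auto
  then show ?thesis unfolding block_term_def using block_weight_cong[of l n h h' f, OF assms] by simp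
qed

lemma walk_argmin_cong:
  assumes "l \<le> n" "i \<le> n - l" "\<And>j. j \<in> {1..n} \<Longrightarrow> h j = h' j"
  shows "walk_argmin l (n - l) h i = walk_argmin l (n - l) h' i"
proof -
  have "block_mean l h = block_mean l h'" using assms by (intro block_mean_cong) auto
  then have "rest_walk l h r = rest_walk l h' r" if "r \<le> n - l" for r
    using that assms unfolding rest_walk_def by (intro sum.cong) auto
  then show ?thesis using assms(2) unfolding walk_argmin_def by auto
qed

text \<open>Averaging over the \<open>l\<close> cyclic shifts of the block: the Gaussian law, the
  block mean and the remainder are invariant, while the indicators of a nonnegative bridge sum to at
  most one. This is the source of the factor \<open>1 / l\<close> and hence of the harmonic
  numbers.\<close>

lemma nn_integral_block_term_le:
  assumes l: "1 \<le> l" "l \<le> n" and f: "f \<in> borel_measurable borel" "\<And>y. 0 \<le> y \<Longrightarrow> 0 \<le> f y"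
  shows "(\<integral>\<^sup>+h. block_term f n l h \<partial>gauss_on {1..n}) \<le>
    ennreal (1 / l) * (\<integral>\<^sup>+h. block_sq l h * f (block_sq l h + iso_energy (n - l) (\<lambda>j. h (l + j))) \<partial>gauss_on {1..n})"
proof -
  let ?W = "\<lambda>h. block_sq l h * f (block_sq l h + iso_energy (n - l) (\<lambda>j. h (l + j)))"
  let ?b = "\<lambda>c h. of_bool (bridge_nonneg l (\<lambda>j. h (cyc l c j))) :: real"
  have W0: "0 \<le> ?W h" for h
    using block_sq_nonneg[of l h] iso_energy_nonneg[of "n - l" "\<lambda>j. h (l + j)"] f(2)
    by (intro mult_nonneg_nonneg) simp_all
  have meas: "(\<lambda>h. ennreal (block_term f n l h)) \<in> borel_measurable (\<Pi>\<^sub>M i\<in>{1..n}. borel)"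
    by (intro measurable_compose[OF borel_measurable_block_term[OF l(2) f(1)] measurable_ennreal])
  have sh: "block_term f n l (\<lambda>j. h (cyc l c j)) = ?b c h * ?W h" if "c < l" for c h
  proof -
    have "iso_energy (n - l) (\<lambda>j. h (cyc l c (l + j))) = iso_energy (n - l) (\<lambda>j. h (l + j))"
      by (intro iso_energy_cong) (simp add: cyc_gt)
    then show ?thesis using block_mean_cyc[OF that, of h] by (simp add: block_term_def block_sq_def)
  qed
  have meas_sh: "(\<lambda>h. ennreal (block_term f n l (\<lambda>j. h (cyc l c j)))) \<in> borel_measurable (gauss_on {1..n})" if "c < l" for c
    unfolding measurable_gauss_on
    using bij_betw_cyc[OF that l(2)]
    by (intro measurable_comp_reindex[where f="cyc l c" and I="{1..n}"] meas) (auto simp: bij_betw_def intro!: arg_cong[where f=ennreal] block_term_cong l)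
  have eq: "(\<integral>\<^sup>+h. block_term f n l (\<lambda>j. h (cyc l c j)) \<partial>gauss_on {1..n}) = (\<integral>\<^sup>+h. block_term f n l h \<partial>gauss_on {1..n})" if "c < l" for c
    using bij_betw_cyc[OF that l(2)]
    by (intro nn_integral_gauss_on_permute meas) (auto intro!: arg_cong[where f=ennreal] block_term_cong l)
  have "of_nat l * (\<integral>\<^sup>+h. block_term f n l h \<partial>gauss_on {1..n})
      = (\<Sum>c\<in>{..<l}. \<integral>\<^sup>+h. block_term f n l (\<lambda>j. h (cyc l c j)) \<partial>gauss_on {1..n})"
    using eq by simp
  also have "\<dots> = (\<integral>\<^sup>+h. (\<Sum>c\<in>{..<l}. ennreal (block_term f n l (\<lambda>j. h (cyc l c j)))) \<partial>gauss_on {1..n})"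
    using meas_sh by (subst nn_integral_sum) auto
  also have "\<dots> \<le> (\<integral>\<^sup>+h. ?W h \<partial>gauss_on {1..n})"
  proof (rule nn_integral_mono_AE)
    show "AE h in gauss_on {1..n}. (\<Sum>c\<in>{..<l}. ennreal (block_term f n l (\<lambda>j. h (cyc l c j)))) \<le> ?W h"
      using AE_sum_bridge_cyc_le[OF l]
    proof eventually_elim
      case (elim h)
      have "(\<Sum>c\<in>{..<l}. ennreal (block_term f n l (\<lambda>j. h (cyc l c j)))) = (\<Sum>c\<in>{..<l}. ennreal (?b c h * ?W h))"
        by (intro sum.cong) (auto simp: sh)
      also have "\<dots> = ennreal ((\<Sum>c\<in>{..<l}. ?b c h) * ?W h)"
        unfolding sum_distrib_right using W0 by (intro sum_ennreal) auto
      also have "\<dots> \<le> ennreal (1 * ?W h)"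
        by (intro ennreal_leI mult_right_mono elim W0)
      finally show ?case by simp
    qed
  qed
  finally have *: "of_nat l * (\<integral>\<^sup>+h. block_term f n l h \<partial>gauss_on {1..n}) \<le> (\<integral>\<^sup>+h. ?W h \<partial>gauss_on {1..n})" .
  have "ennreal (1 / l) * of_nat l = 1"
    unfolding ennreal_of_nat_eq_real_of_nat using l(1) by (subst ennreal_mult[symmetric]) simp_all
  then have "(\<integral>\<^sup>+h. block_term f n l h \<partial>gauss_on {1..n}) = ennreal (1 / l) * (of_nat l * (\<integral>\<^sup>+h. block_term f n l h \<partial>gauss_on {1..n}))"
    by (simp add: mult.assoc[symmetric])
  also have "\<dots> \<le> ennreal (1 / l) * (\<integral>\<^sup>+h. ?W h \<partial>gauss_on {1..n})"
    by (intro mult_left_mono *) simp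
  finally show ?thesis .
qed

section \<open>Recursion for the exponential moments\<close>

lemma nn_integral_block_sq:
  assumes l: "1 \<le> l" and G: "G \<in> borel_measurable borel"
  shows "(\<integral>\<^sup>+h. G (block_sq l h) \<partial>gauss_on {1..l}) = (\<integral>\<^sup>+y. G (y\<^sup>2) \<partial>std_normal)"
proof -
  let ?S = "\<lambda>h. \<Sum>j\<in>{1..l}. (1 / sqrt l) * h j"
  \<comment> \<open>\<open>block_sq\<close> is the square of the block sum divided by
    \<open>sqrt l\<close>, which is again standard normal.\<close>
  have "L2_set (\<lambda>_. 1 / sqrt l) {1..l} = 1" using l by (simp add: L2_set_def power_divide)
  moreover have "\<exists>i\<in>{1..l}. 1 / sqrt (real l) \<noteq> 0" using l by (intro bexI[of _ 1]) auto
  ultimately have d: "distributed (gauss_on {1..l}) lborel ?S std_normal_density"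
    using distributed_gauss_on_linear[of "{1..l}" "\<lambda>_. 1 / sqrt l"] by simp
  have "block_sq l h = (?S h)\<^sup>2" for h
    using l unfolding block_sq_def block_mean_def sum_distrib_left[symmetric]
    by (simp add: power_mult_distrib power_divide) (simp add: power2_eq_square)
  then have "(\<integral>\<^sup>+h. G (block_sq l h) \<partial>gauss_on {1..l}) = (\<integral>\<^sup>+h. G ((?S h)\<^sup>2) \<partial>gauss_on {1..l})" by simp
  also have "\<dots> = (\<integral>\<^sup>+y. std_normal_density y * G (y\<^sup>2) \<partial>lborel)"
    using G by (intro distributed_nn_integral[OF d, symmetric]) simp
  also have "\<dots> = (\<integral>\<^sup>+y. G (y\<^sup>2) \<partial>std_normal)"
    using G by (subst nn_integral_density) auto
  finally show ?thesis .
qed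

text \<open>Block and remainder are independent, and the exponential of their sum factorises;
  exponential weights are chosen for this reason. The two factors are indexed by \<open>bool\<close>
  to match the general product rule for blocks.\<close>

lemma nn_integral_block_weight_exp:
  assumes l: "1 \<le> l" "l \<le> n" and t: "0 \<le> t" "t < 1/2"
  shows "(\<integral>\<^sup>+h. block_sq l h * exp (t * (block_sq l h + iso_energy (n - l) (\<lambda>j. h (l + j)))) \<partial>gauss_on {1..n})
    = chisq_const t * (\<integral>\<^sup>+h. exp (t * iso_energy (n - l) h) \<partial>gauss_on {1..n-l})"
proof -
  define A :: "bool \<Rightarrow> (nat \<Rightarrow> real) \<Rightarrow> ennreal" where
    "A = (\<lambda>b h. if b then ennreal (block_sq l h * exp (t * block_sq l h))
            else ennreal (exp (t * iso_energy (n - l) (\<lambda>j. h (l + j)))))"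
  define B where "B = (\<lambda>b. if b then {1..l} else {l+1..n})"
  have mA: "A True \<in> borel_measurable (\<Pi>\<^sub>M i\<in>{1..l}. borel)"
    unfolding A_def using borel_measurable_block_sq[of l l] by simp
  have mF: "(\<lambda>h. ennreal (exp (t * iso_energy (n - l) h))) \<in> borel_measurable (\<Pi>\<^sub>M i\<in>{1..n-l}. borel)"
    by measurable
  have re: "inj_on (\<lambda>j. l + j) {1..n-l}" "(\<lambda>j. l + j) \<in> {1..n-l} \<rightarrow> {l+1..n}" using l by auto
  have cF: "ennreal (exp (t * iso_energy (n - l) h)) = ennreal (exp (t * iso_energy (n - l) h'))"
    if "\<And>j. j \<in> {1..n-l} \<Longrightarrow> h j = h' j" for h h'
    using iso_energy_cong[OF that] by simp
  have mB: "A False \<in> borel_measurable (\<Pi>\<^sub>M i\<in>{l+1..n}. borel)"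
    using measurable_comp_reindex[OF re(2) mF cF] by (simp add: A_def)
  have "(\<integral>\<^sup>+h. block_sq l h * exp (t * (block_sq l h + iso_energy (n - l) (\<lambda>j. h (l + j)))) \<partial>gauss_on {1..n})
      = (\<integral>\<^sup>+h. (\<Prod>b\<in>UNIV. A b h) \<partial>gauss_on {1..n})"
  proof (intro nn_integral_cong)
    fix h
    have "block_sq l h * exp (t * (block_sq l h + iso_energy (n - l) (\<lambda>j. h (l + j))))
        = (block_sq l h * exp (t * block_sq l h)) * exp (t * iso_energy (n - l) (\<lambda>j. h (l + j)))"
      by (simp add: distrib_left exp_add)
    also have "ennreal \<dots> = A True h * A False h"
      unfolding A_def by (simp add: ennreal_mult block_sq_nonneg)
    also have "\<dots> = (\<Prod>b\<in>UNIV. A b h)" by (simp add: UNIV_bool mult.commute)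
    finally show "ennreal (block_sq l h * exp (t * (block_sq l h + iso_energy (n - l) (\<lambda>j. h (l + j)))))
       = (\<Prod>b\<in>UNIV. A b h)" .
  qed
  also have "\<dots> = (\<Prod>b\<in>UNIV. \<integral>\<^sup>+h. A b h \<partial>gauss_on (B b))"
  proof (rule nn_integral_gauss_on_blocks)
    show "disjoint_family_on B UNIV" by (auto simp: disjoint_family_on_def B_def)
    show "B j \<subseteq> {1..n}" for j using l by (auto simp: B_def)
    show "A j \<in> borel_measurable (\<Pi>\<^sub>M i\<in>B j. borel)" for j using mA mB by (cases j) (auto simp: B_def)
    show "A j h = A j h'" if "\<And>i. i \<in> B j \<Longrightarrow> h i = h' i" for j h h'
    proof (cases j)
      case True
      then have "block_sq l h = block_sq l h'" using that by (intro block_sq_cong) (auto simp: B_def)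
      then show ?thesis using True by (simp add: A_def)
    next
      case False
      then have "iso_energy (n - l) (\<lambda>j. h (l + j)) = iso_energy (n - l) (\<lambda>j. h' (l + j))"
        using that by (intro iso_energy_cong) (auto simp: B_def)
      then show ?thesis using False by (simp add: A_def)
    qed
  qed simp
  also have "\<dots> = (\<integral>\<^sup>+h. A True h \<partial>gauss_on {1..l}) * (\<integral>\<^sup>+h. A False h \<partial>gauss_on {l+1..n})"
    by (simp add: UNIV_bool B_def mult.commute)
  also have "(\<integral>\<^sup>+h. A True h \<partial>gauss_on {1..l}) = chisq_const t"
    using nn_integral_block_sq[OF l(1), of "\<lambda>x. ennreal (x * exp (t * x))"] nn_integral_sq_exp[OF t(2)]
    by (simp add: A_def)
  also have "(\<integral>\<^sup>+h. A False h \<partial>gauss_on {l+1..n}) = (\<integral>\<^sup>+h. exp (t * iso_energy (n - l) h) \<partial>gauss_on {1..n-l})"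
    using nn_integral_gauss_on_reindex[OF re mF cF] by (simp add: A_def)
  finally show ?thesis .
qed

text \<open>For fixed \<open>l\<close> and \<open>i\<close> the rotation preserves the Gaussian law,
  so every summand may be evaluated with its block at the front. There the block term is free of
  \<open>i\<close>, and the indicators of the argmin sum to at most one, which disposes of the sum
  over positions. Cyclic shifts then give \<open>1 / l\<close>, and independence gives the
  constant.\<close>

lemma nn_integral_iso_energy_exp_le:
  assumes t: "0 \<le> t" "t < 1/2"
  shows "(\<integral>\<^sup>+h. iso_energy n h * exp (t * iso_energy n h) \<partial>gauss_on {1..n}) \<le>
    (\<Sum>l\<in>{1..n}. ennreal (chisq_const t / l) * (\<integral>\<^sup>+h. exp (t * iso_energy (n - l) h) \<partial>gauss_on {1..n-l}))"
proof -
  let ?f = "\<lambda>y. exp (t * y)"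
  let ?T = "\<lambda>l i h. of_bool (walk_argmin l (n - l) h i) * block_term ?f n l h"
  have f: "mono_on {0..} ?f" "?f \<in> borel_measurable borel" "\<And>y. 0 \<le> y \<Longrightarrow> 0 \<le> ?f y"
    using t by (auto simp: mono_on_def mult_left_mono)
  have T0: "0 \<le> ?T l i h" for l i h using block_term_nonneg[OF f(3)] by simp
  have mT: "(\<lambda>h. ?T l i h) \<in> borel_measurable (\<Pi>\<^sub>M i\<in>{1..n}. borel)" if "l \<le> n" "i \<le> n - l" for l i
  proof -
    note [measurable] = pred_walk_argmin[OF that] borel_measurable_block_term[OF that(1) f(2)]
    show ?thesis by measurable
  qed
  have perm: "(\<integral>\<^sup>+h. ?T l i (\<lambda>j. h (rot i l j)) \<partial>gauss_on {1..n}) = (\<integral>\<^sup>+h. ?T l i h \<partial>gauss_on {1..n})"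
    and mperm: "(\<lambda>h. ennreal (?T l i (\<lambda>j. h (rot i l j)))) \<in> borel_measurable (\<Pi>\<^sub>M i\<in>{1..n}. borel)"
    if l: "l \<in> {1..n}" "i \<in> {0..n-l}" for l i
  proof -
    have b: "bij_betw (rot i l) {1..n} {1..n}" using l by (intro bij_betw_rot) auto
    have m: "(\<lambda>h. ennreal (?T l i h)) \<in> borel_measurable (\<Pi>\<^sub>M i\<in>{1..n}. borel)"
      using l by (intro measurable_compose[OF mT measurable_ennreal]) auto
    have c: "ennreal (?T l i h) = ennreal (?T l i h')" if "\<And>j. j \<in> {1..n} \<Longrightarrow> h j = h' j" for h h'
      using l walk_argmin_cong[of l n i h h', OF _ _ that] block_term_cong[of l n h h' ?f, OF _ that] by simp
    show "(\<integral>\<^sup>+h. ?T l i (\<lambda>j. h (rot i l j)) \<partial>gauss_on {1..n}) = (\<integral>\<^sup>+h. ?T l i h \<partial>gauss_on {1..n})"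
      by (rule nn_integral_gauss_on_permute[OF b m c])
    show "(\<lambda>h. ennreal (?T l i (\<lambda>j. h (rot i l j)))) \<in> borel_measurable (\<Pi>\<^sub>M i\<in>{1..n}. borel)"
      using b by (intro measurable_comp_reindex[OF _ m c]) (auto simp: bij_betw_def)
  qed
  have "(\<integral>\<^sup>+h. iso_energy n h * exp (t * iso_energy n h) \<partial>gauss_on {1..n})
     \<le> (\<integral>\<^sup>+h. (\<Sum>l\<in>{1..n}. \<Sum>i\<in>{0..n-l}. ennreal (?T l i (\<lambda>j. h (rot i l j)))) \<partial>gauss_on {1..n})"
  proof (rule nn_integral_mono)
    fix h
    have "iso_energy n h * ?f (iso_energy n h) \<le> (\<Sum>l\<in>{1..n}. \<Sum>i\<in>{0..n-l}. ?T l i (\<lambda>j. h (rot i l j)))"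
      by (rule iso_energy_block_bound[OF f(1,3)])
    then have "ennreal (iso_energy n h * ?f (iso_energy n h)) \<le> ennreal (\<Sum>l\<in>{1..n}. \<Sum>i\<in>{0..n-l}. ?T l i (\<lambda>j. h (rot i l j)))"
      by (rule ennreal_leI)
    also have "\<dots> = (\<Sum>l\<in>{1..n}. ennreal (\<Sum>i\<in>{0..n-l}. ?T l i (\<lambda>j. h (rot i l j))))"
      using T0 by (intro sum_ennreal[symmetric] sum_nonneg)
    also have "\<dots> = (\<Sum>l\<in>{1..n}. \<Sum>i\<in>{0..n-l}. ennreal (?T l i (\<lambda>j. h (rot i l j))))"
      using T0 by (intro sum.cong refl sum_ennreal[symmetric])
    finally show "ennreal (iso_energy n h * ?f (iso_energy n h)) \<le> (\<Sum>l\<in>{1..n}. \<Sum>i\<in>{0..n-l}. ennreal (?T l i (\<lambda>j. h (rot i l j))))" .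
  qed
  also have "\<dots> = (\<Sum>l\<in>{1..n}. \<integral>\<^sup>+h. (\<Sum>i\<in>{0..n-l}. ennreal (?T l i (\<lambda>j. h (rot i l j)))) \<partial>gauss_on {1..n})"
    by (intro nn_integral_sum borel_measurable_sum) (simp only: measurable_gauss_on mperm)
  also have "\<dots> = (\<Sum>l\<in>{1..n}. \<Sum>i\<in>{0..n-l}. \<integral>\<^sup>+h. ?T l i (\<lambda>j. h (rot i l j)) \<partial>gauss_on {1..n})"
    by (intro sum.cong refl nn_integral_sum) (simp only: measurable_gauss_on mperm)
  also have "\<dots> = (\<Sum>l\<in>{1..n}. \<Sum>i\<in>{0..n-l}. \<integral>\<^sup>+h. ?T l i h \<partial>gauss_on {1..n})"
    by (intro sum.cong refl perm)
  also have "\<dots> = (\<Sum>l\<in>{1..n}. \<integral>\<^sup>+h. (\<Sum>i\<in>{0..n-l}. ennreal (?T l i h)) \<partial>gauss_on {1..n})"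
    by (intro sum.cong refl nn_integral_sum[symmetric] measurable_compose[OF _ measurable_ennreal])
      (use mT in \<open>auto simp: measurable_gauss_on simp del: One_nat_def\<close>)
  also have "\<dots> \<le> (\<Sum>l\<in>{1..n}. \<integral>\<^sup>+h. block_term ?f n l h \<partial>gauss_on {1..n})"
  proof (intro sum_mono nn_integral_mono)
    fix l h
    have "(\<Sum>i\<in>{0..n-l}. ennreal (?T l i h)) = ennreal ((\<Sum>i\<in>{0..n-l}. of_bool (walk_argmin l (n - l) h i)) * block_term ?f n l h)"
      unfolding sum_distrib_right using T0 by (intro sum_ennreal)
    also have "\<dots> \<le> ennreal (1 * block_term ?f n l h)"
      by (intro ennreal_leI mult_right_mono sum_walk_argmin_le block_term_nonneg f(3))
    finally show "(\<Sum>i\<in>{0..n-l}. ennreal (?T l i h)) \<le> ennreal (block_term ?f n l h)" by simp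
  qed
  also have "\<dots> \<le> (\<Sum>l\<in>{1..n}. ennreal (1 / l) * (\<integral>\<^sup>+h. block_sq l h * ?f (block_sq l h + iso_energy (n - l) (\<lambda>j. h (l + j))) \<partial>gauss_on {1..n}))"
    by (intro sum_mono nn_integral_block_term_le f) auto
  also have "\<dots> = (\<Sum>l\<in>{1..n}. ennreal (1 / l) * (chisq_const t * (\<integral>\<^sup>+h. exp (t * iso_energy (n - l) h) \<partial>gauss_on {1..n-l})))"
    using t by (intro sum.cong refl arg_cong2[where f="(*)"] nn_integral_block_weight_exp) auto
  also have "\<dots> = (\<Sum>l\<in>{1..n}. ennreal (chisq_const t / l) * (\<integral>\<^sup>+h. exp (t * iso_energy (n - l) h) \<partial>gauss_on {1..n-l}))"
    using chisq_const_pos[OF t(2)]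
    by (intro sum.cong refl) (simp add: mult.assoc[symmetric] flip: ennreal_mult)
  finally show ?thesis .
qed

lemma harm_eq_sum: "harm n = (\<Sum>l\<in>{1..n}. 1 / real l)"
  by (simp add: harm_def field_simps)

text \<open>The recursion at \<open>t = 0\<close>, where all exponentials are one and
  \<open>chisq_const 0 = 1\<close>.\<close>

lemma nn_integral_iso_energy_le: "(\<integral>\<^sup>+h. iso_energy n h \<partial>gauss_on {1..n}) \<le> ennreal (harm n)"
proof -
  have "(\<integral>\<^sup>+h. iso_energy n h \<partial>gauss_on {1..n}) \<le> (\<Sum>l\<in>{1..n}. ennreal (1 / l) * 1)"
    using nn_integral_iso_energy_exp_le[of 0 n] prob_space.emeasure_space_1[OF prob_space_gauss_on]
    by (simp add: chisq_const_def)
  also have "\<dots> = ennreal (harm n)" by (simp add: harm_eq_sum sum_ennreal)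
  finally show ?thesis .
qed

text \<open>The recursion bounds the derivative of the moment generating function in dimension
  \<open>n\<close> by the functions of smaller dimensions. By the induction hypothesis the
  derivative is at most \<open>a * exp (a * t)\<close>, and integration from 0 to \<open>s\<close>
  gives the claim.\<close>

lemma nn_integral_exp_iso_energy_le:
  assumes lam: "0 \<le> lam" "lam < 1/2"
  shows "0 \<le> s \<Longrightarrow> s \<le> lam \<Longrightarrow>
    (\<integral>\<^sup>+h. exp (s * iso_energy n h) \<partial>gauss_on {1..n}) \<le> exp (chisq_const lam * harm n * s)"
proof (induction n arbitrary: s rule: less_induct)
  case (less n)
  define a where "a = chisq_const lam * harm n"
  have a: "0 \<le> a" using chisq_const_pos[OF lam(2)] harm_nonneg[of n, where 'a=real] by (simp add: a_def)
  interpret G: prob_space "gauss_on {1..n}" by (rule prob_space_gauss_on)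
  interpret P: pair_sigma_finite "gauss_on {1..n}" lborel
    by (rule pair_sigma_finite.intro) (rule G.sigma_finite_measure_axioms, rule sigma_finite_lborel)
  note m = borel_measurable_iso_energy[of n, folded measurable_gauss_on]
  let ?F = "iso_energy n"
  \<comment> \<open>Writing the exponential as an integral replaces differentiation under the
    expectation by Tonelli's theorem.\<close>
  have ftc: "ennreal (exp (s * ?F h)) = 1 + (\<integral>\<^sup>+t. ennreal (?F h * exp (t * ?F h)) * indicator {0..s} t \<partial>lborel)" for h
  proof -
    have "(\<integral>\<^sup>+t. ennreal (?F h * exp (t * ?F h)) * indicator {0..s} t \<partial>lborel) = ennreal (exp (s * ?F h) - exp (0 * ?F h))"
      using less.prems iso_energy_nonneg
      by (intro nn_integral_FTC_Icc) (auto intro!: derivative_eq_intros)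
    moreover have "1 \<le> exp (s * ?F h)" using less.prems iso_energy_nonneg[of n h] by simp
    then have "ennreal (exp (s * ?F h)) = 1 + ennreal (exp (s * ?F h) - exp (0 * ?F h))"
      by (simp flip: ennreal_1 ennreal_plus)
    ultimately show ?thesis by simp
  qed
  have inner: "(\<integral>\<^sup>+h. ?F h * exp (t * ?F h) \<partial>gauss_on {1..n}) \<le> ennreal (a * exp (a * t))" if t: "0 \<le> t" "t \<le> s" for t
  proof -
    have t': "t \<le> lam" "t < 1/2" using t less.prems lam by auto
    have "(\<integral>\<^sup>+h. ?F h * exp (t * ?F h) \<partial>gauss_on {1..n}) \<le>
      (\<Sum>l\<in>{1..n}. ennreal (chisq_const t / l) * (\<integral>\<^sup>+h. exp (t * iso_energy (n - l) h) \<partial>gauss_on {1..n-l}))"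
      by (rule nn_integral_iso_energy_exp_le[OF t(1) t'(2)])
    also have "\<dots> \<le> (\<Sum>l\<in>{1..n}. ennreal (chisq_const lam / l) * ennreal (exp (a * t)))"
    proof (intro sum_mono mult_mono)
      fix l assume l: "l \<in> {1..n}"
      show "ennreal (chisq_const t / l) \<le> ennreal (chisq_const lam / l)"
        using chisq_const_mono[OF t'(1) lam(2)] by (intro ennreal_leI divide_right_mono) auto
      have "(\<integral>\<^sup>+h. exp (t * iso_energy (n - l) h) \<partial>gauss_on {1..n-l}) \<le> exp (chisq_const lam * harm (n - l) * t)"
        using l t t' by (intro less.IH) auto
      also have "\<dots> \<le> exp (a * t)"
        unfolding a_def using t chisq_const_pos[OF lam(2)] harm_mono[of "n - l" n, where 'a=real]
        by (intro ennreal_leI) (auto intro!: mult_right_mono mult_left_mono)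
      finally show "(\<integral>\<^sup>+h. exp (t * iso_energy (n - l) h) \<partial>gauss_on {1..n-l}) \<le> ennreal (exp (a * t))" .
    qed auto
    also have "\<dots> = (\<Sum>l\<in>{1..n}. ennreal (chisq_const lam / l * exp (a * t)))"
      using chisq_const_pos[OF lam(2)] by (intro sum.cong refl ennreal_mult[symmetric]) auto
    also have "\<dots> = ennreal (\<Sum>l\<in>{1..n}. chisq_const lam / l * exp (a * t))"
      using chisq_const_pos[OF lam(2)] by (intro sum_ennreal) auto
    also have "(\<Sum>l\<in>{1..n}. chisq_const lam / l * exp (a * t)) = a * exp (a * t)"
      by (simp add: a_def harm_eq_sum sum_distrib_left sum_distrib_right)
    finally show ?thesis .
  qed
  have "(\<integral>\<^sup>+h. exp (s * ?F h) \<partial>gauss_on {1..n})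
      = (\<integral>\<^sup>+h. 1 + (\<integral>\<^sup>+t. ennreal (?F h * exp (t * ?F h)) * indicator {0..s} t \<partial>lborel) \<partial>gauss_on {1..n})"
    by (simp only: ftc)
  also have "\<dots> = 1 + (\<integral>\<^sup>+h. (\<integral>\<^sup>+t. ennreal (?F h * exp (t * ?F h)) * indicator {0..s} t \<partial>lborel) \<partial>gauss_on {1..n})"
    using m by (subst nn_integral_add) (auto simp: G.emeasure_space_1 simp del: One_nat_def)
  also have "(\<integral>\<^sup>+h. (\<integral>\<^sup>+t. ennreal (?F h * exp (t * ?F h)) * indicator {0..s} t \<partial>lborel) \<partial>gauss_on {1..n})
     = (\<integral>\<^sup>+t. (\<integral>\<^sup>+h. ennreal (?F h * exp (t * ?F h)) * indicator {0..s} t \<partial>gauss_on {1..n}) \<partial>lborel)"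
    using m by (intro P.Fubini'[symmetric]) measurable
  also have "\<dots> = (\<integral>\<^sup>+t. (\<integral>\<^sup>+h. ?F h * exp (t * ?F h) \<partial>gauss_on {1..n}) * indicator {0..s} t \<partial>lborel)"
    using m by (intro nn_integral_cong nn_integral_multc) measurable
  also have "\<dots> \<le> (\<integral>\<^sup>+t. ennreal (a * exp (a * t)) * indicator {0..s} t \<partial>lborel)"
    using inner by (intro nn_integral_mono) (auto split: split_indicator)
  also have "\<dots> = ennreal (exp (a * s) - exp (a * 0))"
    using less.prems a by (intro nn_integral_FTC_Icc) (auto intro!: derivative_eq_intros)
  also have "1 + \<dots> = ennreal (exp (a * s))"
    using a less.prems by (simp flip: ennreal_1 ennreal_plus)
  finally show ?case by (simp add: a_def add_left_mono)
qed

section \<open>Blockwise isotonic energy\<close>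

definition interval_partition :: "nat \<Rightarrow> nat set set \<Rightarrow> bool" where
  "interval_partition n P \<longleftrightarrow> partition_on {1..n} P \<and> (\<forall>I\<in>P. \<exists>a b. I = {a..b})"

text \<open>The interval is moved to \<open>{1..card I}\<close>; the offset is
  \<open>Min I - 1\<close> because coordinates start at one.\<close>

definition interval_energy :: "nat set \<Rightarrow> (nat \<Rightarrow> real) \<Rightarrow> real" where
  "interval_energy I h = iso_energy (card I) (\<lambda>j. h (Min I - 1 + j))"

definition block_energy :: "nat set set \<Rightarrow> (nat \<Rightarrow> real) \<Rightarrow> real" where
  "block_energy P h = (\<Sum>I\<in>P. interval_energy I h)"

text \<open>An upper bound for the statistical dimension of the product of the monotone cones of the
  blocks.\<close>

definition harm_dim :: "nat set set \<Rightarrow> real" where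
  "harm_dim P = (\<Sum>I\<in>P. harm (card I))"

lemma interval_partition_finite: "interval_partition n P \<Longrightarrow> finite P"
  unfolding interval_partition_def using finite_elements[of "{1..n}" P] by blast

lemma interval_partition_block:
  assumes "interval_partition n P" "I \<in> P"
  shows "I = {Min I - 1 + 1..Min I - 1 + card I}" "I \<subseteq> {1..n}" "1 \<le> card I"
proof -
  have part: "partition_on {1..n} P" using assms by (simp add: interval_partition_def)
  obtain a b where I: "I = {a..b}" using assms unfolding interval_partition_def by blast
  show sub: "I \<subseteq> {1..n}" using part assms(2) by (auto simp: partition_on_def)
  have "I \<noteq> {}" using part assms(2) by (auto simp: partition_on_def)
  then have ab: "a \<le> b" by (simp add: I)
  then have "1 \<le> a" using sub I by auto
  moreover have "Min I = a" unfolding I using ab by (intro Min_eqI) auto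
  ultimately show "I = {Min I - 1 + 1..Min I - 1 + card I}" "1 \<le> card I" using ab by (auto simp: I)
qed

lemma sum_interval_partition:
  fixes f :: "nat \<Rightarrow> real"
  assumes "interval_partition n P"
  shows "(\<Sum>i\<in>{1..n}. f i) = (\<Sum>I\<in>P. \<Sum>i\<in>I. f i)"
proof -
  have part: "partition_on {1..n} P" using assms by (simp add: interval_partition_def)
  have "(\<Sum>i\<in>\<Union>P. f i) = (\<Sum>I\<in>P. \<Sum>i\<in>I. f i)"
  proof (rule sum.Union_disjoint[unfolded comp_def])
    show "\<forall>A\<in>P. finite A" using interval_partition_block(2)[OF assms] finite_subset by blast
    show "\<forall>A\<in>P. \<forall>B\<in>P. A \<noteq> B \<longrightarrow> A \<inter> B = {}"
      using part by (auto simp: partition_on_def disjoint_def)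
  qed
  then show ?thesis using part by (simp add: partition_on_def)
qed

lemma sum_interval_shift:
  fixes f :: "nat \<Rightarrow> real"
  assumes "interval_partition n P" "I \<in> P"
  shows "(\<Sum>i\<in>I. f i) = (\<Sum>j\<in>{1..card I}. f (Min I - 1 + j))"
proof -
  have "(\<Sum>i\<in>I. f i) = (\<Sum>i\<in>{1 + (Min I - 1)..card I + (Min I - 1)}. f i)"
    using interval_partition_block(1)[OF assms] by (simp add: add.commute)
  also have "\<dots> = (\<Sum>j\<in>{1..card I}. f (j + (Min I - 1)))" by (rule sum.shift_bounds_cl_nat_ivl)
  finally show ?thesis by (simp add: add.commute)
qed

lemma interval_energy_nonneg: "0 \<le> interval_energy I h"
  by (simp add: interval_energy_def iso_energy_nonneg)

lemma block_energy_nonneg: "0 \<le> block_energy P h"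
  unfolding block_energy_def by (intro sum_nonneg interval_energy_nonneg)

lemma block_energy_scale: "0 \<le> c \<Longrightarrow> block_energy P (\<lambda>i. c * h i) = c\<^sup>2 * block_energy P h"
  by (simp add: block_energy_def interval_energy_def iso_energy_scale sum_distrib_left)

lemma interval_energy_cong:
  assumes "interval_partition n P" "I \<in> P" "\<And>i. i \<in> I \<Longrightarrow> h i = h' i"
  shows "interval_energy I h = interval_energy I h'"
  unfolding interval_energy_def
proof (rule iso_energy_cong)
  fix j assume "j \<in> {1..card I}"
  then have "Min I - 1 + j \<in> {Min I - 1 + 1..Min I - 1 + card I}" by auto
  then show "h (Min I - 1 + j) = h' (Min I - 1 + j)"
    using interval_partition_block(1)[OF assms(1,2)] assms(3) by blast
qed

lemma block_energy_cong:
  assumes "interval_partition n P" "\<And>i. i \<in> {1..n} \<Longrightarrow> h i = h' i"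
  shows "block_energy P h = block_energy P h'"
  unfolding block_energy_def
proof (intro sum.cong refl interval_energy_cong[OF assms(1)])
  fix I i assume "I \<in> P" "i \<in> I"
  then show "h i = h' i" using interval_partition_block(2)[OF assms(1)] assms(2) by blast
qed

text \<open>The bound for one monotone vector is applied on each block, followed by Cauchy-Schwarz
  over the blocks. Between blocks \<open>w\<close> may jump down.\<close>

lemma inner_le_block_energy:
  assumes P: "interval_partition n P" and w: "\<And>I. I \<in> P \<Longrightarrow> mono_on I w"
  shows "(\<Sum>i\<in>{1..n}. x i * w i) \<le> sqrt (block_energy P x) * sqrt (\<Sum>i\<in>{1..n}. (w i)\<^sup>2)"
proof -
  have "(\<Sum>i\<in>I. x i * w i) \<le> sqrt (interval_energy I x) * sqrt (\<Sum>i\<in>I. (w i)\<^sup>2)" if I: "I \<in> P" for I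
  proof -
    have "mono_on {1..card I} (\<lambda>j. w (Min I - 1 + j))"
    proof (rule mono_onI)
      fix r s assume rs: "r \<in> {1..card I}" "s \<in> {1..card I}" "r \<le> s"
      then have "Min I - 1 + r \<in> {Min I - 1 + 1..Min I - 1 + card I}" "Min I - 1 + s \<in> {Min I - 1 + 1..Min I - 1 + card I}" by auto
      then have "Min I - 1 + r \<in> I" "Min I - 1 + s \<in> I"
        by (auto intro: equalityD2[OF interval_partition_block(1)[OF P I], THEN subsetD] simp del: One_nat_def)
      then show "w (Min I - 1 + r) \<le> w (Min I - 1 + s)" using w[OF I] rs by (auto simp: mono_on_def)
    qed
    from inner_le_iso_energy[OF this, of "\<lambda>j. x (Min I - 1 + j)"]
    show ?thesis by (simp add: sum_interval_shift[OF P I] interval_energy_def)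
  qed
  then have "(\<Sum>i\<in>{1..n}. x i * w i) \<le> (\<Sum>I\<in>P. \<bar>sqrt (interval_energy I x)\<bar> * \<bar>sqrt (\<Sum>i\<in>I. (w i)\<^sup>2)\<bar>)"
    unfolding sum_interval_partition[OF P] by (intro sum_mono) (simp add: interval_energy_nonneg sum_nonneg)
  also have "\<dots> \<le> L2_set (\<lambda>I. sqrt (interval_energy I x)) P * L2_set (\<lambda>I. sqrt (\<Sum>i\<in>I. (w i)\<^sup>2)) P"
    by (rule L2_set_mult_ineq)
  also have "\<dots> = sqrt (block_energy P x) * sqrt (\<Sum>i\<in>{1..n}. (w i)\<^sup>2)"
    unfolding sum_interval_partition[OF P] L2_set_def block_energy_def
    by (simp add: interval_energy_nonneg sum_nonneg)
  finally show ?thesis .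
qed

lemma interval_reindex:
  assumes "interval_partition n P" "I \<in> P"
  shows "inj_on (\<lambda>j. Min I - 1 + j) {1..card I}" "(\<lambda>j. Min I - 1 + j) \<in> {1..card I} \<rightarrow> I"
proof -
  show "(\<lambda>j. Min I - 1 + j) \<in> {1..card I} \<rightarrow> I"
  proof
    fix j assume "j \<in> {1..card I}"
    then have "Min I - 1 + j \<in> {Min I - 1 + 1..Min I - 1 + card I}" by auto
    then show "Min I - 1 + j \<in> I" by (rule equalityD2[OF interval_partition_block(1)[OF assms], THEN subsetD])
  qed
qed simp

lemma borel_measurable_interval_energy:
  assumes "interval_partition n P" "I \<in> P" "I \<subseteq> K"
  shows "interval_energy I \<in> borel_measurable (\<Pi>\<^sub>M i\<in>K. borel)"
  unfolding interval_energy_def[abs_def] using interval_reindex(2)[OF assms(1,2)] assms(3)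
  by (intro measurable_comp_reindex[where I="{1..card I}" and f="\<lambda>j. Min I - 1 + j" and G="iso_energy (card I)"]
      borel_measurable_iso_energy iso_energy_cong) auto

lemma borel_measurable_block_energy:
  assumes "interval_partition n P"
  shows "block_energy P \<in> borel_measurable (\<Pi>\<^sub>M i\<in>{1..n}. borel)"
  unfolding block_energy_def[abs_def]
  by (intro borel_measurable_sum borel_measurable_interval_energy[OF assms] interval_partition_block(2)[OF assms])

lemma nn_integral_interval_energy:
  fixes G :: "real \<Rightarrow> ennreal"
  assumes "interval_partition n P" "I \<in> P" "I \<subseteq> K" "G \<in> borel_measurable borel"
  shows "(\<integral>\<^sup>+h. G (interval_energy I h) \<partial>gauss_on K) = (\<integral>\<^sup>+h. G (iso_energy (card I) h) \<partial>gauss_on {1..card I})"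
  unfolding interval_energy_def using interval_reindex[OF assms(1,2)] assms(3)
  by (intro nn_integral_gauss_on_reindex[where f="\<lambda>j. Min I - 1 + j" and G="\<lambda>h. G (iso_energy (card I) h)"]
       measurable_compose[OF borel_measurable_iso_energy assms(4)] arg_cong[where f=G] iso_energy_cong) auto

lemma harm_dim_nonneg: "0 \<le> harm_dim P"
  unfolding harm_dim_def by (intro sum_nonneg harm_nonneg)

lemma nn_integral_block_energy_le:
  assumes P: "interval_partition n P"
  shows "(\<integral>\<^sup>+h. block_energy P h \<partial>gauss_on {1..n}) \<le> ennreal (harm_dim P)"
proof -
  note sub = interval_partition_block(2)[OF P]
  have "(\<integral>\<^sup>+h. block_energy P h \<partial>gauss_on {1..n}) = (\<integral>\<^sup>+h. (\<Sum>I\<in>P. ennreal (interval_energy I h)) \<partial>gauss_on {1..n})"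
    unfolding block_energy_def by (intro nn_integral_cong sum_ennreal[symmetric] interval_energy_nonneg)
  also have "\<dots> = (\<Sum>I\<in>P. \<integral>\<^sup>+h. ennreal (interval_energy I h) \<partial>gauss_on {1..n})"
    using borel_measurable_interval_energy[OF P _ sub]
    by (intro nn_integral_sum measurable_compose[OF _ measurable_ennreal]) (simp add: measurable_gauss_on)
  also have "\<dots> = (\<Sum>I\<in>P. \<integral>\<^sup>+h. ennreal (iso_energy (card I) h) \<partial>gauss_on {1..card I})"
    by (intro sum.cong refl nn_integral_interval_energy[OF P _ sub]) auto
  also have "\<dots> \<le> (\<Sum>I\<in>P. ennreal (harm (card I)))"
    by (intro sum_mono nn_integral_iso_energy_le)
  also have "\<dots> = ennreal (harm_dim P)" unfolding harm_dim_def by (intro sum_ennreal harm_nonneg)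
  finally show ?thesis .
qed

text \<open>Distinct blocks are independent, so the expectations multiply and the exponents add up
  to \<open>harm_dim\<close>.\<close>

lemma nn_integral_exp_block_energy_le:
  assumes P: "interval_partition n P" and lam: "0 \<le> lam" "lam < 1/2"
  shows "(\<integral>\<^sup>+h. exp (lam * block_energy P h) \<partial>gauss_on {1..n}) \<le> exp (chisq_const lam * harm_dim P * lam)"
proof -
  note sub = interval_partition_block(2)[OF P]
  note fin = interval_partition_finite[OF P]
  have part: "partition_on {1..n} P" using P by (simp add: interval_partition_def)
  have "(\<integral>\<^sup>+h. exp (lam * block_energy P h) \<partial>gauss_on {1..n})
      = (\<integral>\<^sup>+h. (\<Prod>I\<in>P. ennreal (exp (lam * interval_energy I h))) \<partial>gauss_on {1..n})"
    unfolding block_energy_def sum_distrib_left exp_sum[OF fin]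
    by (intro nn_integral_cong prod_ennreal[symmetric]) auto
  also have "\<dots> = (\<Prod>I\<in>P. \<integral>\<^sup>+h. ennreal (exp (lam * interval_energy I h)) \<partial>gauss_on I)"
  proof (rule nn_integral_gauss_on_blocks[OF fin])
    show "disjoint_family_on (\<lambda>I. I) P" using part by (auto simp: partition_on_def disjoint_def disjoint_family_on_def)
    show "I \<subseteq> {1..n}" if "I \<in> P" for I using sub[OF that] .
    show "(\<lambda>h. ennreal (exp (lam * interval_energy I h))) \<in> borel_measurable (\<Pi>\<^sub>M i\<in>I. borel)" if "I \<in> P" for I
      using borel_measurable_interval_energy[OF P that order_refl] by measurable
    show "ennreal (exp (lam * interval_energy I h)) = ennreal (exp (lam * interval_energy I h'))"
      if "I \<in> P" "\<And>i. i \<in> I \<Longrightarrow> h i = h' i" for I h h'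
      using interval_energy_cong[OF P that] by simp
  qed
  also have "\<dots> = (\<Prod>I\<in>P. \<integral>\<^sup>+h. ennreal (exp (lam * iso_energy (card I) h)) \<partial>gauss_on {1..card I})"
    by (intro prod.cong refl nn_integral_interval_energy[OF P, where G="\<lambda>x. ennreal (exp (lam * x))"]) auto
  also have "\<dots> \<le> (\<Prod>I\<in>P. ennreal (exp (chisq_const lam * harm (card I) * lam)))"
    using lam by (intro prod_mono_ennreal nn_integral_exp_iso_energy_le) auto
  also have "\<dots> = ennreal (\<Prod>I\<in>P. exp (chisq_const lam * harm (card I) * lam))"
    by (intro prod_ennreal) auto
  also have "(\<Prod>I\<in>P. exp (chisq_const lam * harm (card I) * lam)) = exp (chisq_const lam * harm_dim P * lam)"
    unfolding exp_sum[OF fin, symmetric] harm_dim_def by (simp add: sum_distrib_left sum_distrib_right)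
  finally show ?thesis .
qed

text \<open>Chernoff's bound. For small \<open>lam\<close> the constant
  \<open>chisq_const lam\<close> is below \<open>1 + \<eta>\<close>, and the exponent is then
  negative and of order \<open>D\<close>.\<close>

lemma block_energy_tail:
  assumes P: "interval_partition n P" and lam: "0 < lam" "lam < 1/2" and D: "harm_dim P \<le> D"
  shows "measure (gauss_on {1..n}) {h \<in> space (gauss_on {1..n}). (1 + \<eta>) * D < block_energy P h}
    \<le> exp (- (lam * D * (1 + \<eta> - chisq_const lam)))"
proof -
  interpret prob_space "gauss_on {1..n}" by (rule prob_space_gauss_on)
  let ?A = "{h \<in> space (gauss_on {1..n}). (1 + \<eta>) * D < block_energy P h}"
  let ?c = "exp (- (lam * ((1 + \<eta>) * D)))"
  have m: "block_energy P \<in> borel_measurable (gauss_on {1..n})"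
    unfolding measurable_gauss_on by (rule borel_measurable_block_energy[OF P])
  have A: "?A \<in> sets (gauss_on {1..n})" by (rule borel_measurable_less[OF borel_measurable_const m])
  have "emeasure (gauss_on {1..n}) ?A = (\<integral>\<^sup>+h. indicator ?A h \<partial>gauss_on {1..n})" using A by simp
  also have "\<dots> \<le> (\<integral>\<^sup>+h. ennreal ?c * ennreal (exp (lam * block_energy P h)) \<partial>gauss_on {1..n})"
  proof (intro nn_integral_mono)
    fix h
    show "indicator ?A h \<le> ennreal ?c * ennreal (exp (lam * block_energy P h))"
    proof (cases "h \<in> ?A")
      case True
      then have "lam * ((1 + \<eta>) * D) \<le> lam * block_energy P h" using lam by (intro mult_left_mono) auto
      then have "ennreal 1 \<le> ennreal (?c * exp (lam * block_energy P h))"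
        by (intro ennreal_leI) (simp flip: exp_add)
      then show ?thesis using True by (simp add: ennreal_mult)
    qed simp
  qed
  also have "\<dots> = ennreal ?c * (\<integral>\<^sup>+h. exp (lam * block_energy P h) \<partial>gauss_on {1..n})"
    by (intro nn_integral_cmult measurable_compose[OF m]) measurable
  also have "\<dots> \<le> ennreal ?c * ennreal (exp (chisq_const lam * harm_dim P * lam))"
    using lam by (intro mult_left_mono nn_integral_exp_block_energy_le[OF P]) auto
  also have "\<dots> \<le> ennreal (exp (- (lam * D * (1 + \<eta> - chisq_const lam))))"
  proof -
    have "chisq_const lam * harm_dim P * lam \<le> chisq_const lam * D * lam"
      using D lam chisq_const_pos[of lam] by (intro mult_right_mono mult_left_mono) auto
    then show ?thesis
      by (simp add: exp_add[symmetric] algebra_simps flip: ennreal_mult)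
  qed
  finally show ?thesis by (simp add: emeasure_eq_measure del: One_nat_def)
qed

lemma integral_block_energy_le:
  assumes P: "interval_partition n P"
  shows "integrable (gauss_on {1..n}) (block_energy P)"
    and "(\<integral>h. block_energy P h \<partial>gauss_on {1..n}) \<le> harm_dim P"
proof -
  have m: "block_energy P \<in> borel_measurable (gauss_on {1..n})"
    unfolding measurable_gauss_on by (rule borel_measurable_block_energy[OF P])
  note le = nn_integral_block_energy_le[OF P]
  show int: "integrable (gauss_on {1..n}) (block_energy P)"
    using m le block_energy_nonneg
    by (intro integrableI_nonneg) (auto intro: le_less_trans)
  have "ennreal (\<integral>h. block_energy P h \<partial>gauss_on {1..n}) \<le> ennreal (harm_dim P)"
    using le int by (subst (asm) nn_integral_eq_integral) (auto simp: block_energy_nonneg)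
  then show "(\<integral>h. block_energy P h \<partial>gauss_on {1..n}) \<le> harm_dim P"
    by (simp add: harm_dim_nonneg)
qed

lemma harm_le_ln: "1 \<le> n \<Longrightarrow> harm n \<le> 1 + ln (real n)"
proof -
  assume "1 \<le> n"
  then obtain k where k: "n = Suc k" by (cases n) auto
  have "harm (Suc k) - ln (Suc k) \<le> harm (Suc 0) - ln (Suc 0)"
    using decseqD[OF decseq_harm_diff_ln, of 0 k] by simp
  then show ?thesis by (simp add: k harm_def)
qed

text \<open>Jensen's inequality for the logarithm bounds the sum by its value at equal lengths; the
  resulting \<open>p * (1 + ln (n / p))\<close> increases in the number of blocks \<open>p\<close>
  up to \<open>n\<close>.\<close>

lemma harm_dim_le:
  assumes P: "interval_partition n P" and k: "card P \<le> k" "1 \<le> k" "k \<le> n"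
  shows "harm_dim P \<le> real k * ln (exp 1 * real n / real k)"
proof -
  define p where "p = card P"
  have n: "1 \<le> n" using k by simp
  have cards: "(\<Sum>I\<in>P. real (card I)) = real n"
    using sum_interval_partition[OF P, of "\<lambda>_. 1"] by simp
  have p: "1 \<le> p" "p \<le> k"
  proof -
    have "P \<noteq> {}" using cards n by auto
    then show "1 \<le> p" using interval_partition_finite[OF P] by (simp add: p_def Suc_leI card_gt_0_iff)
  qed (use k p_def in simp)
  have lnle: "ln x \<le> ln y + (x - y) / y" if "0 < x" "0 < y" for x y :: real
  proof -
    have "ln (x / y) \<le> x / y - 1" using that by (intro ln_le_minus_one) auto
    then show ?thesis using that by (simp add: ln_div diff_divide_distrib)
  qed
  \<comment> \<open>The tangent of \<open>ln\<close> at the average length \<open>n / p\<close>; its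
    linear terms cancel in the sum because the lengths add up to \<open>n\<close>.\<close>
  have "harm_dim P \<le> (\<Sum>I\<in>P. 1 + (ln (n / p) + (real (card I) - n / p) / (n / p)))"
    unfolding harm_dim_def
  proof (intro sum_mono)
    fix I assume I: "I \<in> P"
    have "harm (card I) \<le> 1 + ln (real (card I))" using interval_partition_block(3)[OF P I] by (rule harm_le_ln)
    also have "ln (real (card I)) \<le> ln (n / p) + (real (card I) - n / p) / (n / p)"
      using interval_partition_block(3)[OF P I] n p by (intro lnle) auto
    finally show "harm (card I) \<le> 1 + (ln (n / p) + (real (card I) - n / p) / (n / p))" by simp
  qed
  also have "\<dots> = p * (1 + ln (n / p)) + ((\<Sum>I\<in>P. real (card I)) - p * (n / p)) / (n / p)"
    by (simp add: sum.distrib p_def algebra_simps sum_subtractf sum_divide_distrib sum_distrib_left diff_divide_distrib)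
  also have "\<dots> = p * (1 + ln (n / p))" using p by (simp add: cards)
  also have "\<dots> \<le> k * (1 + ln (n / k))"
  proof -
    \<comment> \<open>Monotonicity in the number of blocks, from \<open>ln y \<le> y - 1\<close> at
      \<open>y = k / p\<close>.\<close>
    have "real p * ln (k / p) \<le> p * (k / p - 1)" using p k by (intro mult_left_mono ln_le_minus_one) auto
    also have "\<dots> = real k - p" using p by (simp add: field_simps)
    finally have 1: "real p * (ln k - ln p) \<le> real k - p" using p k by (simp add: ln_div)
    have "0 \<le> (real k - p) * ln (n / k)" using p k by (intro mult_nonneg_nonneg) auto
    then show ?thesis using 1 p k n by (simp add: ln_div algebra_simps)
  qed
  also have "\<dots> = k * ln (exp 1 * n / k)" using k n by (simp add: ln_div ln_mult)
  finally show ?thesis .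
qed

section \<open>A comparison inequality for sums over independent rows\<close>

lemma Max_image_le_iff:
  assumes "finite A" "A \<noteq> {}"
  shows "Max (f ` A) \<le> (c::real) \<longleftrightarrow> (\<forall>t\<in>A. f t \<le> c)"
  using assms by simp

lemma Max_image_ge: "finite A \<Longrightarrow> t \<in> A \<Longrightarrow> f t \<le> (Max (f ` A) :: real)"
  by simp

lemma Max_image_attained:
  assumes "finite A" "A \<noteq> {}"
  obtains t where "t \<in> A" "Max (f ` A) = (f t :: real)"
proof -
  have "Max (f ` A) \<in> f ` A" using assms by (intro Max_in) auto
  then show ?thesis by (rule imageE) (rule that)
qed

text \<open>The pointwise content of symmetrization and contraction.\<close>

lemma Max_contraction:
  fixes c :: "'t \<Rightarrow> real"
  assumes A: "finite A" "A \<noteq> {}"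
    and lip: "\<And>x y. \<bar>\<phi> x - \<phi> y\<bar> \<le> \<Lambda> * \<bar>x - y\<bar>"
  shows "Max ((\<lambda>t. c t + \<phi> (u t) - \<phi> (v t)) ` A) + Max ((\<lambda>t. c t + \<phi> (v t) - \<phi> (u t)) ` A)
    \<le> (Max ((\<lambda>t. c t + 2 * \<Lambda> * u t) ` A) + Max ((\<lambda>t. c t - 2 * \<Lambda> * u t) ` A)
      + (Max ((\<lambda>t. c t + 2 * \<Lambda> * v t) ` A) + Max ((\<lambda>t. c t - 2 * \<Lambda> * v t) ` A))) / 2"
proof -
  obtain t where t: "t \<in> A" "Max ((\<lambda>t. c t + \<phi> (u t) - \<phi> (v t)) ` A) = c t + \<phi> (u t) - \<phi> (v t)"
    by (rule Max_image_attained[OF A])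
  obtain s where s: "s \<in> A" "Max ((\<lambda>t. c t + \<phi> (v t) - \<phi> (u t)) ` A) = c s + \<phi> (v s) - \<phi> (u s)"
    by (rule Max_image_attained[OF A])
  \<comment> \<open>The maxima are bounded from below by the values at \<open>t\<close> and
    \<open>s\<close>. Which of the two points takes the plus sign depends on the order of
    \<open>w t\<close> and \<open>w s\<close>; this produces the absolute value.\<close>
  have key: "c t + c s + 2 * \<Lambda> * \<bar>w t - w s\<bar> \<le> Max ((\<lambda>t. c t + 2 * \<Lambda> * w t) ` A) + Max ((\<lambda>t. c t - 2 * \<Lambda> * w t) ` A)" for w
  proof (cases "w s \<le> w t")
    case True
    then show ?thesis
      using Max_image_ge[OF A(1) t(1), of "\<lambda>t. c t + 2 * \<Lambda> * w t"] Max_image_ge[OF A(1) s(1), of "\<lambda>t. c t - 2 * \<Lambda> * w t"]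
      by (simp add: algebra_simps)
  next
    case False
    then show ?thesis
      using Max_image_ge[OF A(1) s(1), of "\<lambda>t. c t + 2 * \<Lambda> * w t"] Max_image_ge[OF A(1) t(1), of "\<lambda>t. c t - 2 * \<Lambda> * w t"]
      by (simp add: algebra_simps)
  qed
  have "\<phi> (u t) - \<phi> (u s) \<le> \<Lambda> * \<bar>u t - u s\<bar>" "\<phi> (v s) - \<phi> (v t) \<le> \<Lambda> * \<bar>v t - v s\<bar>"
    using lip[of "u t" "u s"] lip[of "v s" "v t"] by (auto simp: abs_minus_commute)
  then have "2 * ((c t + \<phi> (u t) - \<phi> (v t)) + (c s + \<phi> (v s) - \<phi> (u s)))
     \<le> (c t + c s + 2 * \<Lambda> * \<bar>u t - u s\<bar>) + (c t + c s + 2 * \<Lambda> * \<bar>v t - v s\<bar>)"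
    by (simp add: algebra_simps)
  also have "\<dots> \<le> (Max ((\<lambda>t. c t + 2 * \<Lambda> * u t) ` A) + Max ((\<lambda>t. c t - 2 * \<Lambda> * u t) ` A))
      + (Max ((\<lambda>t. c t + 2 * \<Lambda> * v t) ` A) + Max ((\<lambda>t. c t - 2 * \<Lambda> * v t) ` A))"
    by (intro add_mono key)
  finally show ?thesis unfolding t(2) s(2) by simp
qed

text \<open>One row of the empirical process, with law \<open>N\<close>. Finiteness of
  \<open>A\<close> makes the maxima measurable. At \<open>t0\<close> the process vanishes, so maxima
  with an offset that is zero there are nonnegative and can be handled by nonnegative integrals.
  \<open>sym\<close> is asked for all offsets \<open>c\<close>, because the other rows enter through
  such an offset.\<close>

locale symmetric_process = prob_space N for N :: "'b measure" +
  fixes A :: "'t set" and L :: "'t \<Rightarrow> 'b \<Rightarrow> real" and t0 :: 't and \<phi> :: "real \<Rightarrow> real" and \<Lambda> B :: real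
  assumes A: "finite A" "t0 \<in> A"
    and L: "\<And>t. t \<in> A \<Longrightarrow> L t \<in> borel_measurable N" "\<And>x. L t0 x = 0"
    and sym: "\<And>c k. (\<integral>\<^sup>+x. Max ((\<lambda>t. c t - k * L t x) ` A) \<partial>N) = (\<integral>\<^sup>+x. Max ((\<lambda>t. c t + k * L t x) ` A) \<partial>N)"
    and \<phi>: "\<phi> \<in> borel_measurable borel" "\<And>x. 0 \<le> \<phi> x" "\<And>x. \<phi> x \<le> B" "\<phi> 0 = 0"
    and lip: "\<And>x y. \<bar>\<phi> x - \<phi> y\<bar> \<le> \<Lambda> * \<bar>x - y\<bar>"
begin

lemma Ane: "A \<noteq> {}" using A by auto

definition mphi :: "'t \<Rightarrow> real" where "mphi t = (\<integral>x. \<phi> (L t x) \<partial>N)"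

lemma mphi_t0: "mphi t0 = 0" by (simp add: mphi_def L \<phi>)

lemma phi_L_measurable: "t \<in> A \<Longrightarrow> (\<lambda>x. \<phi> (L t x)) \<in> borel_measurable N"
  by (rule measurable_compose[OF L(1) \<phi>(1)])

lemma phi_L_integrable: "t \<in> A \<Longrightarrow> integrable N (\<lambda>x. \<phi> (L t x))"
  using \<phi>(2,3) by (intro integrable_const_bound[where B=B] phi_L_measurable) auto

text \<open>Symmetrization without random signs: an independent copy \<open>y\<close> replaces the
  mean, and the integral over \<open>y\<close> is moved outside the maximum. Averaging over the
  exchange of \<open>x\<close> and \<open>y\<close> gives the left side of
  \<open>Max_contraction\<close>, and the symmetry of the process merges the maxima of opposite
  sign.\<close>

lemma one_row:
  assumes c: "c t0 = 0"
  shows "(\<integral>\<^sup>+x. Max ((\<lambda>t. c t + (mphi t - \<phi> (L t x))) ` A) \<partial>N) \<le> (\<integral>\<^sup>+x. Max ((\<lambda>t. c t + 2 * \<Lambda> * L t x) ` A) \<partial>N)"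
proof -
  interpret P: pair_sigma_finite N N by unfold_locales
  let ?a = "\<lambda>x y. Max ((\<lambda>t. c t + \<phi> (L t y) - \<phi> (L t x)) ` A)"
  have a0: "0 \<le> ?a x y" for x y
    using Max_image_ge[OF A, of "\<lambda>t. c t + \<phi> (L t y) - \<phi> (L t x)"] by (simp add: c L)
  have am: "(\<lambda>(x, y). ennreal (?a x y)) \<in> borel_measurable (N \<Otimes>\<^sub>M N)"
    and am': "(\<lambda>(x, y). ennreal (?a y x)) \<in> borel_measurable (N \<Otimes>\<^sub>M N)"
    unfolding split_beta' using phi_L_measurable
    by (intro measurable_compose[OF _ measurable_ennreal] borel_measurable_Max[OF A(1)] borel_measurable_add
        borel_measurable_diff borel_measurable_const; simp)+
  have am1: "(\<lambda>y. ?a x y) \<in> borel_measurable N" and am2: "(\<lambda>x. ?a x y) \<in> borel_measurable N" for x y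
    using phi_L_measurable
    by (intro borel_measurable_Max[OF A(1)] borel_measurable_add borel_measurable_diff borel_measurable_const; simp)+
  have abound: "?a x y \<le> Max (c ` A) + B" for x y
  proof (subst Max_image_le_iff[OF A(1) Ane], intro ballI)
    fix t assume "t \<in> A"
    then show "c t + \<phi> (L t y) - \<phi> (L t x) \<le> Max (c ` A) + B"
      using Max_image_ge[OF A(1), of t c] \<phi>(2)[of "L t x"] \<phi>(3)[of "L t y"] by simp
  qed
  have ai: "integrable N (\<lambda>y. ?a x y)" for x
    using a0 abound by (intro integrable_const_bound[where B="Max (c ` A) + B"] am1) auto
  let ?X = "\<integral>\<^sup>+x. \<integral>\<^sup>+y. ?a x y \<partial>N \<partial>N"
  let ?Mp = "\<lambda>x. Max ((\<lambda>t. c t + 2 * \<Lambda> * L t x) ` A)" and ?Mm = "\<lambda>x. Max ((\<lambda>t. c t - 2 * \<Lambda> * L t x) ` A)"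
  have M0: "0 \<le> ?Mp x" "0 \<le> ?Mm x" for x
    using Max_image_ge[OF A, of "\<lambda>t. c t + 2 * \<Lambda> * L t x"] Max_image_ge[OF A, of "\<lambda>t. c t - 2 * \<Lambda> * L t x"] by (simp_all add: c L)
  have Mm: "?Mp \<in> borel_measurable N" "?Mm \<in> borel_measurable N"
    using L(1) by (intro borel_measurable_Max[OF A(1)] borel_measurable_add borel_measurable_diff borel_measurable_times borel_measurable_const; simp)+
  have 1: "(\<integral>\<^sup>+x. Max ((\<lambda>t. c t + (mphi t - \<phi> (L t x))) ` A) \<partial>N) \<le> ?X"
  proof (rule nn_integral_mono)
    fix x
    have "Max ((\<lambda>t. c t + (mphi t - \<phi> (L t x))) ` A) \<le> (\<integral>y. ?a x y \<partial>N)"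
    proof (subst Max_image_le_iff[OF A(1) Ane], intro ballI)
      fix t assume t: "t \<in> A"
      have "c t + (mphi t - \<phi> (L t x)) = (\<integral>y. c t + \<phi> (L t y) - \<phi> (L t x) \<partial>N)"
        using phi_L_integrable[OF t] by (simp add: mphi_def prob_space)
      also have "\<dots> \<le> (\<integral>y. ?a x y \<partial>N)"
        using phi_L_integrable[OF t] by (intro integral_mono ai Max_image_ge[OF A(1) t]) auto
      finally show "c t + (mphi t - \<phi> (L t x)) \<le> (\<integral>y. ?a x y \<partial>N)" .
    qed
    then have "ennreal (Max ((\<lambda>t. c t + (mphi t - \<phi> (L t x))) ` A)) \<le> ennreal (\<integral>y. ?a x y \<partial>N)"
      by (rule ennreal_leI)
    also have "\<dots> = (\<integral>\<^sup>+y. ?a x y \<partial>N)" using ai a0 by (intro nn_integral_eq_integral[symmetric]) auto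
    finally show "ennreal (Max ((\<lambda>t. c t + (mphi t - \<phi> (L t x))) ` A)) \<le> (\<integral>\<^sup>+y. ?a x y \<partial>N)" .
  qed
  have swap: "?X = (\<integral>\<^sup>+x. \<integral>\<^sup>+y. ?a y x \<partial>N \<partial>N)"
    by (rule P.Fubini'[OF am'])
  \<comment> \<open>The contraction needs both orders of the pair at once, whence the factor
    two.\<close>
  have "2 * ?X = (\<integral>\<^sup>+x. \<integral>\<^sup>+y. ?a x y \<partial>N \<partial>N) + (\<integral>\<^sup>+x. \<integral>\<^sup>+y. ?a y x \<partial>N \<partial>N)"
    by (simp only: swap[symmetric] mult_2)
  also have "\<dots> = (\<integral>\<^sup>+x. (\<integral>\<^sup>+y. ?a x y \<partial>N) + (\<integral>\<^sup>+y. ?a y x \<partial>N) \<partial>N)"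
  proof (intro nn_integral_add[symmetric])
    show "(\<lambda>x. \<integral>\<^sup>+y. ennreal (?a x y) \<partial>N) \<in> borel_measurable N"
      by (rule borel_measurable_nn_integral[OF am])
    show "(\<lambda>x. \<integral>\<^sup>+y. ennreal (?a y x) \<partial>N) \<in> borel_measurable N"
      by (rule borel_measurable_nn_integral[OF am'])
  qed
  also have "\<dots> = (\<integral>\<^sup>+x. (\<integral>\<^sup>+y. ennreal (?a x y) + ennreal (?a y x) \<partial>N) \<partial>N)"
    by (intro nn_integral_cong nn_integral_add[symmetric] measurable_compose[OF _ measurable_ennreal] am1 am2)
  also have "\<dots> \<le> (\<integral>\<^sup>+x. (\<integral>\<^sup>+y. (ennreal (1/2) * ennreal (?Mp y + ?Mm y)) + ennreal (1/2) * ennreal (?Mp x + ?Mm x) \<partial>N) \<partial>N)"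
  proof (intro nn_integral_mono)
    fix x y
    have "?a x y + ?a y x \<le> ((?Mp y + ?Mm y) + (?Mp x + ?Mm x)) / 2"
      by (rule Max_contraction[OF A(1) Ane lip])
    then have "ennreal (?a x y + ?a y x) \<le> ennreal (1/2 * (?Mp y + ?Mm y) + 1/2 * (?Mp x + ?Mm x))"
      by (intro ennreal_leI) (simp add: field_simps)
    also have "\<dots> = ennreal (1/2) * ennreal (?Mp y + ?Mm y) + ennreal (1/2) * ennreal (?Mp x + ?Mm x)"
    proof -
      have nn: "0 \<le> ?Mp y + ?Mm y" "0 \<le> ?Mp x + ?Mm x" using M0 by (simp_all add: add_nonneg_nonneg)
      have h: "(0::real) \<le> 1/2" by simp
      show ?thesis
        unfolding ennreal_mult[OF h nn(1), symmetric] ennreal_mult[OF h nn(2), symmetric]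
        using nn by (intro ennreal_plus) auto
    qed
    finally show "ennreal (?a x y) + ennreal (?a y x) \<le> ennreal (1/2) * ennreal (?Mp y + ?Mm y) + ennreal (1/2) * ennreal (?Mp x + ?Mm x)"
      using a0 by (simp add: ennreal_plus)
  qed
  also have "\<dots> = 2 * (ennreal (1/2) * (\<integral>\<^sup>+x. ?Mp x + ?Mm x \<partial>N))"
  proof -
    define S where "S = (\<lambda>y. ennreal (?Mp y + ?Mm y))"
    have S: "S \<in> borel_measurable N" unfolding S_def
      by (intro measurable_compose[OF _ measurable_ennreal] borel_measurable_add Mm)
    have hS: "(\<lambda>y. ennreal (1/2) * S y) \<in> borel_measurable N" using S by (intro borel_measurable_times_ennreal) auto
    have "(\<integral>\<^sup>+y. ennreal (1/2) * S y + ennreal (1/2) * S x \<partial>N) = ennreal (1/2) * (\<integral>\<^sup>+y. S y \<partial>N) + ennreal (1/2) * S x" for x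
      by (subst nn_integral_add[OF hS]) (simp_all add: nn_integral_cmult[OF S] emeasure_space_1)
    then have "(\<integral>\<^sup>+x. \<integral>\<^sup>+y. ennreal (1/2) * S y + ennreal (1/2) * S x \<partial>N \<partial>N)
        = (\<integral>\<^sup>+x. ennreal (1/2) * (\<integral>\<^sup>+y. S y \<partial>N) + ennreal (1/2) * S x \<partial>N)" by simp
    also have "\<dots> = ennreal (1/2) * (\<integral>\<^sup>+y. S y \<partial>N) + ennreal (1/2) * (\<integral>\<^sup>+y. S y \<partial>N)"
      by (subst nn_integral_add[OF _ hS]) (simp_all add: nn_integral_cmult[OF S] emeasure_space_1)
    finally show ?thesis unfolding S_def by (simp only: mult_2)
  qed
  also have "(\<integral>\<^sup>+x. ?Mp x + ?Mm x \<partial>N) = (\<integral>\<^sup>+x. ennreal (?Mp x) + ennreal (?Mm x) \<partial>N)"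
    using M0 by (intro nn_integral_cong ennreal_plus)
  also have "\<dots> = (\<integral>\<^sup>+x. ?Mp x \<partial>N) + (\<integral>\<^sup>+x. ?Mm x \<partial>N)"
    by (intro nn_integral_add measurable_compose[OF _ measurable_ennreal] Mm)
  also have "(\<integral>\<^sup>+x. ?Mm x \<partial>N) = (\<integral>\<^sup>+x. ?Mp x \<partial>N)" by (rule sym)
  also have "(\<integral>\<^sup>+x. ?Mp x \<partial>N) + (\<integral>\<^sup>+x. ?Mp x \<partial>N) = 2 * (\<integral>\<^sup>+x. ?Mp x \<partial>N)" by (rule mult_2[symmetric])
  also have "ennreal (1/2) * (2 * (\<integral>\<^sup>+x. ?Mp x \<partial>N)) = (\<integral>\<^sup>+x. ?Mp x \<partial>N)"
  proof -
    have "ennreal (1/2) * ennreal 2 = 1" by (subst ennreal_mult[symmetric]) auto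
    then show ?thesis by (simp add: mult.assoc[symmetric])
  qed
  finally have "?X \<le> (\<integral>\<^sup>+x. ?Mp x \<partial>N)"
    by (simp add: ennreal_mult_le_mult_iff)
  with 1 show ?thesis by (rule order_trans)
qed

text \<open>The rows are exchanged one at a time. With the other rows held fixed, their contribution
  is an offset that vanishes at \<open>t0\<close>, so \<open>one_row\<close> applies inside the
  integral.\<close>

lemma rows_comparison:
  fixes K :: "'i set"
  assumes "finite K" "I \<subseteq> K"
  shows "(\<integral>\<^sup>+G. Max ((\<lambda>t. \<Sum>i\<in>I. mphi t - \<phi> (L t (G i))) ` A) \<partial>(\<Pi>\<^sub>M i\<in>K. N))
    \<le> (\<integral>\<^sup>+G. Max ((\<lambda>t. \<Sum>i\<in>I. 2 * \<Lambda> * L t (G i)) ` A) \<partial>(\<Pi>\<^sub>M i\<in>K. N))"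
proof -
  interpret PS: product_sigma_finite "\<lambda>_::'i. N" by unfold_locales
  \<comment> \<open>Interpolation: the rows in \<open>J\<close> have already been replaced by the
    linear process.\<close>
  define H where "H = (\<lambda>J G. Max ((\<lambda>t. (\<Sum>i\<in>I-J. mphi t - \<phi> (L t (G i))) + (\<Sum>i\<in>J. 2 * \<Lambda> * L t (G i))) ` A))"
  have Hm: "H J \<in> borel_measurable (\<Pi>\<^sub>M i\<in>K. N)" if "J \<subseteq> I" for J
  proof -
    have m: "(\<lambda>G. \<phi> (L t (G i))) \<in> borel_measurable (\<Pi>\<^sub>M i\<in>K. N)" "(\<lambda>G. L t (G i)) \<in> borel_measurable (\<Pi>\<^sub>M i\<in>K. N)"
      if "t \<in> A" "i \<in> I" for t i
      using that assms(2) phi_L_measurable[OF that(1)] L(1)[OF that(1)]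
      by (auto intro!: measurable_compose[OF measurable_component_singleton])
    show ?thesis unfolding H_def
      using m that
      by (intro borel_measurable_Max[OF A(1)] borel_measurable_add borel_measurable_sum borel_measurable_diff
          borel_measurable_times borel_measurable_const) auto
  qed
  have step: "(\<integral>\<^sup>+G. H J G \<partial>(\<Pi>\<^sub>M i\<in>K. N)) \<le> (\<integral>\<^sup>+G. H (insert i J) G \<partial>(\<Pi>\<^sub>M i\<in>K. N))"
    if J: "insert i J \<subseteq> I" "i \<notin> J" for i J
  proof -
    define K' where "K' = K - {i}"
    have K: "K = insert i K'" "i \<notin> K'" "finite K'" using J assms by (auto simp: K'_def)
    have finI: "finite I" by (rule finite_subset[OF assms(2,1)])
    have finJ: "finite J" by (rule finite_subset[OF _ finI]) (use J in auto)
    have ins: "(\<integral>\<^sup>+G. H J' G \<partial>(\<Pi>\<^sub>M i\<in>K. N)) = (\<integral>\<^sup>+x. \<integral>\<^sup>+y. H J' (x(i := y)) \<partial>N \<partial>(\<Pi>\<^sub>M i\<in>K'. N))" if "J' \<subseteq> I" for J'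
      using PS.product_nn_integral_insert[OF K(3,2), of "\<lambda>G. ennreal (H J' G)"] Hm[OF that] by (simp add: K(1))
    have "(\<integral>\<^sup>+G. H J G \<partial>(\<Pi>\<^sub>M i\<in>K. N)) = (\<integral>\<^sup>+x. \<integral>\<^sup>+y. H J (x(i := y)) \<partial>N \<partial>(\<Pi>\<^sub>M i\<in>K'. N))"
      using J by (intro ins) auto
    also have "\<dots> \<le> (\<integral>\<^sup>+x. \<integral>\<^sup>+y. H (insert i J) (x(i := y)) \<partial>N \<partial>(\<Pi>\<^sub>M i\<in>K'. N))"
    proof (rule nn_integral_mono)
      fix x :: "'i \<Rightarrow> 'b"
      define c where "c = (\<lambda>t. (\<Sum>k\<in>I - insert i J. mphi t - \<phi> (L t (x k))) + (\<Sum>k\<in>J. 2 * \<Lambda> * L t (x k)))"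
      have c0: "c t0 = 0" by (simp add: c_def mphi_t0 L \<phi>)
      have e: "I - J = insert i (I - insert i J)" "i \<notin> I - insert i J" using J by auto
      have f1: "(\<Sum>k\<in>I-J. mphi t - \<phi> (L t ((x(i:=y)) k))) = (mphi t - \<phi> (L t y)) + (\<Sum>k\<in>I - insert i J. mphi t - \<phi> (L t (x k)))" for t y
        unfolding e(1) using finI by (subst sum.insert) (auto intro!: sum.cong)
      have f2: "(\<Sum>k\<in>J. 2 * \<Lambda> * L t ((x(i:=y)) k)) = (\<Sum>k\<in>J. 2 * \<Lambda> * L t (x k))" for t y
        using J(2) by (intro sum.cong) auto
      have f3: "(\<Sum>k\<in>I-insert i J. mphi t - \<phi> (L t ((x(i:=y)) k))) = (\<Sum>k\<in>I-insert i J. mphi t - \<phi> (L t (x k)))" for t y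
        by (intro sum.cong) auto
      have f4: "(\<Sum>k\<in>insert i J. 2 * \<Lambda> * L t ((x(i:=y)) k)) = 2 * \<Lambda> * L t y + (\<Sum>k\<in>J. 2 * \<Lambda> * L t (x k))" for t y
        using J(2) finJ f2[of t y] by simp
      have "H J (x(i := y)) = Max ((\<lambda>t. c t + (mphi t - \<phi> (L t y))) ` A)" for y
        unfolding H_def f1 f2 c_def by (intro arg_cong[where f=Max] image_cong) auto
      moreover have "H (insert i J) (x(i := y)) = Max ((\<lambda>t. c t + 2 * \<Lambda> * L t y) ` A)" for y
        unfolding H_def f3 f4 c_def by (intro arg_cong[where f=Max] image_cong) auto
      ultimately show "(\<integral>\<^sup>+y. H J (x(i := y)) \<partial>N) \<le> (\<integral>\<^sup>+y. H (insert i J) (x(i := y)) \<partial>N)"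
        using one_row[of c, OF c0] by simp
    qed
    also have "\<dots> = (\<integral>\<^sup>+G. H (insert i J) G \<partial>(\<Pi>\<^sub>M i\<in>K. N))"
      using J by (intro ins[symmetric]) auto
    finally show ?thesis .
  qed
  have "(\<integral>\<^sup>+G. H {} G \<partial>(\<Pi>\<^sub>M i\<in>K. N)) \<le> (\<integral>\<^sup>+G. H J G \<partial>(\<Pi>\<^sub>M i\<in>K. N))" if "J \<subseteq> I" for J
  proof -
    have "finite J" by (rule finite_subset[OF order_trans[OF that assms(2)] assms(1)])
    then show ?thesis using that
    proof (induction J rule: finite_induct)
      case (insert i J)
      then show ?case using step[of i J] order_trans by (metis insert_subset)
    qed simp
  qed
  from this[of I] show ?thesis by (simp add: H_def)
qed

end

text \<open>The clipped square is the square of \<open>min \<bar>z\<bar> b\<close>, which is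
  1-Lipschitz in \<open>z\<close> with values in \<open>{0..b}\<close>.\<close>

lemma clipped_square_lipschitz:
  assumes "0 \<le> (b::real)"
  shows "\<bar>min (x\<^sup>2) (b\<^sup>2) - min (y\<^sup>2) (b\<^sup>2)\<bar> \<le> 2 * b * \<bar>x - y\<bar>"
proof -
  have m: "min (z\<^sup>2) (b\<^sup>2) = (min \<bar>z\<bar> b)\<^sup>2" for z
    using assms by (cases "\<bar>z\<bar> \<le> b") (auto simp: min_def abs_le_square_iff[symmetric])
  define p q where "p = min \<bar>x\<bar> b" and "q = min \<bar>y\<bar> b"
  have pq: "0 \<le> p" "0 \<le> q" "p \<le> b" "q \<le> b" "\<bar>p - q\<bar> \<le> \<bar>x - y\<bar>"
    using assms by (auto simp: p_def q_def)
  have "\<bar>p\<^sup>2 - q\<^sup>2\<bar> = (p + q) * \<bar>p - q\<bar>"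
    using pq by (simp add: power2_eq_square square_diff_square_factored abs_mult)
  also have "\<dots> \<le> (2 * b) * \<bar>x - y\<bar>" using pq by (intro mult_mono) auto
  finally show ?thesis by (simp add: m p_def q_def)
qed

section \<open>The Gaussian design\<close>

context prob_space
begin

lemma indep_vars_inj:
  assumes Z: "indep_vars (\<lambda>_. N) Z J" and f: "inj_on f I" "f ` I \<subseteq> J"
  shows "indep_vars (\<lambda>_. N) (\<lambda>i. Z (f i)) I"
proof -
  have "indep_vars (\<lambda>i. PiM {f i} (\<lambda>_. N)) (\<lambda>i \<omega>. restrict (\<lambda>p. Z p \<omega>) {f i}) I"
    using f by (intro indep_vars_restrict[OF Z]) (auto simp: disjoint_family_on_def inj_on_def)
  then have "indep_vars (\<lambda>_. N) (\<lambda>i \<omega>. (\<lambda>g. g (f i)) (restrict (\<lambda>p. Z p \<omega>) {f i})) I"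
    by (rule indep_vars_compose2) auto
  then show ?thesis by simp
qed

lemma distr_indep_std_normal:
  assumes K: "K \<noteq> {}" and Z: "indep_vars (\<lambda>_. borel) Z K"
    and d: "\<And>i. i \<in> K \<Longrightarrow> distributed M lborel (Z i) std_normal_density"
  shows "distr M (\<Pi>\<^sub>M i\<in>K. borel) (\<lambda>\<omega>. \<lambda>i\<in>K. Z i \<omega>) = gauss_on K"
proof -
  have rv: "random_variable borel (Z i)" if "i \<in> K" for i using Z that by (auto simp: indep_vars_def)
  have "distr M borel (Z i) = std_normal" if "i \<in> K" for i
  proof -
    have "distr M borel (Z i) = distr M lborel (Z i)" by (intro distr_cong) auto
    then show ?thesis using d[OF that] by (simp add: distributed_def)
  qed
  then have "(\<Pi>\<^sub>M i\<in>K. distr M borel (Z i)) = gauss_on K"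
    unfolding gauss_on_def by (intro PiM_cong) auto
  then show ?thesis using indep_vars_iff_distr_eq_PiM'[OF K rv] Z by simp
qed

end

text \<open>The origin of the condition \<open>sym\<close> in \<open>symmetric_process\<close>: dot
  products with a fixed vector change sign under this map.\<close>

lemma distr_gauss_on_uminus:
  assumes "K \<noteq> {}"
  shows "distr (gauss_on K) (\<Pi>\<^sub>M i\<in>K. borel) (\<lambda>h. \<lambda>i\<in>K. - h i) = gauss_on K"
proof -
  interpret prob_space "gauss_on K" by (rule prob_space_gauss_on)
  show ?thesis
  proof (rule distr_indep_std_normal[OF assms])
    show "indep_vars (\<lambda>_. borel) (\<lambda>i h. - h i) K"
      by (rule indep_vars_compose2[OF indep_vars_gauss_on]) auto
    show "distributed (gauss_on K) lborel (\<lambda>h. - h i) std_normal_density" if "i \<in> K" for i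
      using normal_density_affine[OF distributed_gauss_on[OF that], of "-1" 0] by simp
  qed
qed

lemma (in gaussian_design) dims_pos: "0 < real m" "0 < real n"
  using dims by auto

context gaussian_design
begin

abbreviation "ZZ \<equiv> case_sum (\<lambda>(i, j). X i j) \<xi>"
abbreviation "IX \<equiv> ({1..m} \<times> {1..n}) <+> {1..m}"

lemma X_measurable: "i \<in> {1..m} \<Longrightarrow> j \<in> {1..n} \<Longrightarrow> X i j \<in> borel_measurable M"
  using X_law[of i j] by (auto simp: distributed_def)

lemma xi_measurable: "i \<in> {1..m} \<Longrightarrow> \<xi> i \<in> borel_measurable M"
  using indep unfolding indep_vars_def by (auto dest!: bspec[of _ _ "Inr i"])

lemma indep_xi: "indep_vars (\<lambda>_. borel) \<xi> {1..m}"
  using indep_vars_inj[OF indep, of Inr "{1..m}"] by auto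

lemma scaled_column_law:
  assumes z: "\<exists>i\<in>{1..m}. z i \<noteq> 0" and j: "j \<in> {1..n}"
  shows "distributed M lborel (\<lambda>\<omega>. (sqrt (real n) / L2_set z {1..m}) * (\<Sum>i\<in>{1..m}. z i * X i j \<omega>)) std_normal_density"
proof -
  define r where "r = L2_set z {1..m}"
  have r: "0 < r"
  proof -
    have "r \<noteq> 0" using z by (auto simp: r_def L2_set_eq_0_iff)
    then show ?thesis unfolding r_def using L2_set_nonneg[of z "{1..m}"] by linarith
  qed
  have ind: "indep_vars (\<lambda>_. borel) (\<lambda>i. X i j) {1..m}"
  proof -
    have "(\<lambda>i. Inl (i, j)) ` {1..m} \<subseteq> IX" using j by (auto simp: image_subset_iff)
    moreover have "inj_on (\<lambda>i. Inl (i, j)) {1..m}" by (auto simp: inj_on_def)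
    ultimately show ?thesis using indep_vars_inj[OF indep, of "\<lambda>i. Inl (i, j)" "{1..m}"] by simp
  qed
  have s: "0 < sqrt (1 / real n)" using dims_pos by simp
  have d: "distributed M lborel (\<lambda>\<omega>. \<Sum>i\<in>{1..m}. z i * X i j \<omega>) (normal_density 0 (sqrt (1 / real n) * r))"
    unfolding r_def using z j s by (intro distributed_linear_normal[OF _ ind]) (auto intro!: X_law)
  have "\<bar>sqrt (real n) / r\<bar> * (sqrt (1 / real n) * r) = 1"
    using r dims_pos by (simp add: real_sqrt_divide)
  then show ?thesis
    using normal_density_affine[OF d, of "sqrt (real n) / r" 0] r s dims_pos by (simp add: r_def[symmetric] del: One_nat_def)
qed

text \<open>Distinct columns use disjoint sets of entries and are therefore independent. The weights
  \<open>z\<close> will be a unit vector (one row), the constant vector (the sum of the rows) and a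
  fixed value of the noise.\<close>

lemma scaled_combination_law:
  assumes z: "\<exists>i\<in>{1..m}. z i \<noteq> 0"
  shows "distr M (\<Pi>\<^sub>M j\<in>{1..n}. borel)
     (\<lambda>\<omega>. \<lambda>j\<in>{1..n}. (sqrt (real n) / L2_set z {1..m}) * (\<Sum>i\<in>{1..m}. z i * X i j \<omega>)) = gauss_on {1..n}"
proof (rule distr_indep_std_normal)
  let ?c = "sqrt (real n) / L2_set z {1..m}"
  show "{1..n} \<noteq> {}" using dims by simp
  define K :: "nat \<Rightarrow> (nat \<times> nat + nat) set" where "K = (\<lambda>j. Inl ` ({1..m} \<times> {j}))"
  have "indep_vars (\<lambda>j. PiM (K j) (\<lambda>_. borel)) (\<lambda>j \<omega>. restrict (\<lambda>p. ZZ p \<omega>) (K j)) {1..n}"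
    by (intro indep_vars_restrict[OF indep]) (auto simp: K_def disjoint_family_on_def)
  then have "indep_vars (\<lambda>_. borel) (\<lambda>j \<omega>. (\<lambda>f. ?c * (\<Sum>i\<in>{1..m}. z i * f (Inl (i, j)))) (restrict (\<lambda>p. ZZ p \<omega>) (K j))) {1..n}"
    by (rule indep_vars_compose2)
      (intro borel_measurable_times borel_measurable_sum borel_measurable_const measurable_component_singleton; simp add: K_def)
  moreover have "(\<Sum>i\<in>{1..m}. z i * restrict (\<lambda>p. ZZ p \<omega>) (K j) (Inl (i, j))) = (\<Sum>i\<in>{1..m}. z i * X i j \<omega>)" for j \<omega>
    by (intro sum.cong) (auto simp: K_def)
  ultimately show "indep_vars (\<lambda>_. borel) (\<lambda>j \<omega>. ?c * (\<Sum>i\<in>{1..m}. z i * X i j \<omega>)) {1..n}" by simp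
qed (rule scaled_column_law[OF z])

lemma row_law:
  assumes i: "i \<in> {1..m}"
  shows "distr M (\<Pi>\<^sub>M j\<in>{1..n}. borel) (\<lambda>\<omega>. \<lambda>j\<in>{1..n}. sqrt (real n) * X i j \<omega>) = gauss_on {1..n}"
proof -
  define z where "z = (\<lambda>k. of_bool (k = i) :: real)"
  have "(\<Sum>k\<in>{1..m}. z k * X k j \<omega>) = X i j \<omega>" for j \<omega>
    using i by (simp add: z_def of_bool_def if_distrib[where f="\<lambda>x. x * _"] cong: if_cong)
  moreover have "L2_set z {1..m} = 1"
    using i by (simp add: L2_set_def z_def of_bool_def if_distrib[where f="\<lambda>x. x ^ 2"] cong: if_cong)
  moreover have "\<exists>k\<in>{1..m}. z k \<noteq> 0" using i by (auto simp: z_def intro!: bexI[of _ i])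
  ultimately show ?thesis using scaled_combination_law[of z] by simp
qed

lemma rows_law:
  "distr M (\<Pi>\<^sub>M i\<in>{1..m}. (\<Pi>\<^sub>M j\<in>{1..n}. borel)) (\<lambda>\<omega>. \<lambda>i\<in>{1..m}. \<lambda>j\<in>{1..n}. sqrt (real n) * X i j \<omega>)
    = (\<Pi>\<^sub>M i\<in>{1..m}. gauss_on {1..n})"
proof -
  define K :: "nat \<Rightarrow> (nat \<times> nat + nat) set" where "K = (\<lambda>i. Inl ` ({i} \<times> {1..n}))"
  let ?R = "\<lambda>i \<omega>. \<lambda>j\<in>{1..n}. sqrt (real n) * X i j \<omega>"
  have "indep_vars (\<lambda>i. PiM (K i) (\<lambda>_. borel)) (\<lambda>i \<omega>. restrict (\<lambda>p. ZZ p \<omega>) (K i)) {1..m}"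
    by (intro indep_vars_restrict[OF indep]) (auto simp: K_def disjoint_family_on_def)
  then have "indep_vars (\<lambda>_. \<Pi>\<^sub>M j\<in>{1..n}. borel)
      (\<lambda>i \<omega>. (\<lambda>f. \<lambda>j\<in>{1..n}. sqrt (real n) * f (Inl (i, j))) (restrict (\<lambda>p. ZZ p \<omega>) (K i))) {1..m}"
    by (rule indep_vars_compose2)
      (intro measurable_restrict borel_measurable_times borel_measurable_const measurable_component_singleton; simp add: K_def)
  moreover have "(\<lambda>j\<in>{1..n}. sqrt (real n) * restrict (\<lambda>p. ZZ p \<omega>) (K i) (Inl (i, j))) = ?R i \<omega>" for i \<omega>
    by (intro restrict_ext) (auto simp: K_def)
  ultimately have ind: "indep_vars (\<lambda>_. \<Pi>\<^sub>M j\<in>{1..n}. borel) ?R {1..m}" by simp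
  have rv: "random_variable (\<Pi>\<^sub>M j\<in>{1..n}. borel) (?R i)" if "i \<in> {1..m}" for i
    using ind that by (auto simp: indep_vars_def)
  have "(\<Pi>\<^sub>M i\<in>{1..m}. distr M (\<Pi>\<^sub>M j\<in>{1..n}. borel) (?R i)) = (\<Pi>\<^sub>M i\<in>{1..m}. gauss_on {1..n})"
    by (intro PiM_cong row_law refl) simp
  then show ?thesis
    using indep_vars_iff_distr_eq_PiM'[where I="{1..m}" and M'="\<lambda>_. \<Pi>\<^sub>M j\<in>{1..n}. borel" and X="?R"] rv ind dims by simp
qed

text \<open>Conditionally on the noise vector, \<open>X\<^sup>T \<xi>\<close> is a multiple of a standard Gaussian vector.\<close>

lemma noise_block_energy_tail:
  assumes P: "interval_partition n P" and lam: "0 < lam" "lam < 1/2" and D: "harm_dim P \<le> D"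
  shows "measure M {\<omega>\<in>space M. (1 + \<eta>) * D * ((\<Sum>i\<in>{1..m}. (\<xi> i \<omega>)\<^sup>2) / real n)
      < block_energy P (\<lambda>j. \<Sum>i\<in>{1..m}. \<xi> i \<omega> * X i j \<omega>)}
    \<le> exp (- (lam * D * (1 + \<eta> - chisq_const lam)))" (is "measure M ?Bad \<le> ?p")
proof -
  define IA where "IA = (Inr ` {1..m} :: (nat \<times> nat + nat) set)"
  define IB where "IB = (Inl ` ({1..m} \<times> {1..n}) :: (nat \<times> nat + nat) set)"
  let ?MA = "PiM IA (\<lambda>_. borel) :: (nat \<times> nat + nat \<Rightarrow> real) measure"
  let ?MB = "PiM IB (\<lambda>_. borel) :: (nat \<times> nat + nat \<Rightarrow> real) measure"
  let ?ZA = "\<lambda>\<omega>. restrict (\<lambda>p. ZZ p \<omega>) IA" and ?ZB = "\<lambda>\<omega>. restrict (\<lambda>p. ZZ p \<omega>) IB"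
  have iv: "indep_var ?MA ?ZA ?MB ?ZB"
    by (intro indep_var_restrict[OF indep]) (auto simp: IA_def IB_def)
  then have mA: "?ZA \<in> measurable M ?MA" and mB: "?ZB \<in> measurable M ?MB"
    and joint: "distr M ?MA ?ZA \<Otimes>\<^sub>M distr M ?MB ?ZB = distr M (?MA \<Otimes>\<^sub>M ?MB) (\<lambda>\<omega>. (?ZA \<omega>, ?ZB \<omega>))"
    by (auto simp: indep_var_distribution_eq)
  define v where "v = (\<lambda>(a :: nat \<times> nat + nat \<Rightarrow> real, b :: nat \<times> nat + nat \<Rightarrow> real) j. \<Sum>i\<in>{1..m}. a (Inr i) * b (Inl (i, j)))"
  define sq where "sq = (\<lambda>a :: nat \<times> nat + nat \<Rightarrow> real. (\<Sum>i\<in>{1..m}. (a (Inr i))\<^sup>2) / real n)"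
  define S where "S = {p \<in> space (?MA \<Otimes>\<^sub>M ?MB). (1 + \<eta>) * D * sq (fst p) < block_energy P (v p)}"
  have m1: "(\<lambda>p. fst p (Inr i)) \<in> borel_measurable (?MA \<Otimes>\<^sub>M ?MB)" if "i \<in> {1..m}" for i
    using that by (intro measurable_compose[OF measurable_fst measurable_component_singleton]) (simp add: IA_def)
  have m2: "(\<lambda>p. snd p (Inl (i, j))) \<in> borel_measurable (?MA \<Otimes>\<^sub>M ?MB)" if "i \<in> {1..m}" "j \<in> {1..n}" for i j
    using that by (intro measurable_compose[OF measurable_snd measurable_component_singleton]) (simp add: IB_def)
  have "(\<lambda>p. \<lambda>j\<in>{1..n}. v p j) \<in> measurable (?MA \<Otimes>\<^sub>M ?MB) (\<Pi>\<^sub>M j\<in>{1..n}. borel)"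
    unfolding v_def split_beta by (intro measurable_restrict borel_measurable_sum borel_measurable_times m1 m2)
  then have "(\<lambda>p. block_energy P (\<lambda>j\<in>{1..n}. v p j)) \<in> borel_measurable (?MA \<Otimes>\<^sub>M ?MB)"
    by (rule measurable_compose[OF _ borel_measurable_block_energy[OF P]])
  moreover have "block_energy P (\<lambda>j\<in>{1..n}. v p j) = block_energy P (v p)" for p
    by (rule block_energy_cong[OF P]) simp
  ultimately have mbe: "(\<lambda>p. block_energy P (v p)) \<in> borel_measurable (?MA \<Otimes>\<^sub>M ?MB)" by simp
  have msq: "(\<lambda>p. (1 + \<eta>) * D * sq (fst p)) \<in> borel_measurable (?MA \<Otimes>\<^sub>M ?MB)"
    unfolding sq_def by (intro borel_measurable_times borel_measurable_const borel_measurable_divide borel_measurable_sum borel_measurable_power m1)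
  have S: "S \<in> sets (?MA \<Otimes>\<^sub>M ?MB)" unfolding S_def by (rule borel_measurable_less[OF msq mbe])
  interpret A: prob_space "distr M ?MA ?ZA" by (rule prob_space_distr[OF mA])
  interpret B: prob_space "distr M ?MB ?ZB" by (rule prob_space_distr[OF mB])
  \<comment> \<open>With the noise frozen at \<open>a\<close>, the event concerns only the Gaussian
    design. The bound does not depend on \<open>a\<close> and hence survives integration over the
    noise.\<close>
  have slice: "emeasure (distr M ?MB ?ZB) (Pair a -` S) \<le> ennreal ?p" if a: "a \<in> space ?MA" for a
  proof -
    define z where "z = (\<lambda>i. a (Inr i))"
    have vz: "v (a, ?ZB \<omega>) j = (\<Sum>i\<in>{1..m}. z i * X i j \<omega>)" if "j \<in> {1..n}" for \<omega> j
      unfolding v_def z_def using that by (auto intro!: sum.cong simp: IB_def)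
    have be: "block_energy P (v (a, ?ZB \<omega>)) = block_energy P (\<lambda>j. \<Sum>i\<in>{1..m}. z i * X i j \<omega>)" for \<omega>
      by (intro block_energy_cong[OF P] vz)
    have ZBs: "?ZB \<omega> \<in> space ?MB" if "\<omega> \<in> space M" for \<omega> using mB that by (rule measurable_space)
    have "emeasure (distr M ?MB ?ZB) (Pair a -` S) = emeasure M (?ZB -` (Pair a -` S) \<inter> space M)"
      by (rule emeasure_distr[OF mB]) (rule sets_Pair1[OF S])
    also have "?ZB -` (Pair a -` S) \<inter> space M
        = {\<omega>\<in>space M. (1 + \<eta>) * D * ((\<Sum>i\<in>{1..m}. (z i)\<^sup>2) / real n) < block_energy P (\<lambda>j. \<Sum>i\<in>{1..m}. z i * X i j \<omega>)}"
      using a ZBs be by (auto simp: S_def space_pair_measure sq_def z_def)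
    also have "emeasure M \<dots> \<le> ennreal ?p"
    proof (cases "\<exists>i\<in>{1..m}. z i \<noteq> 0")
      \<comment> \<open>For vanishing frozen noise both sides of the strict inequality are zero, and
        the event is empty.\<close>
      case False
      then have "block_energy P (\<lambda>j. \<Sum>i\<in>{1..m}. z i * X i j \<omega>) = block_energy P (\<lambda>j. 0 * (0::real))" for \<omega>
        by (intro block_energy_cong[OF P]) simp
      also have "block_energy P (\<lambda>j. 0 * (0::real)) = 0"
        using block_energy_scale[of 0 P "\<lambda>_. 0"] by simp
      finally have "block_energy P (\<lambda>j. \<Sum>i\<in>{1..m}. z i * X i j \<omega>) = 0" for \<omega> .
      moreover have "(\<Sum>i\<in>{1..m}. (z i)\<^sup>2) = 0" using False by simp
      ultimately show ?thesis by simp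
    next
      case True
      define r where "r = L2_set z {1..m}"
      have r: "0 < r" "r\<^sup>2 = (\<Sum>i\<in>{1..m}. (z i)\<^sup>2)"
      proof -
        have "r \<noteq> 0" using True by (auto simp: r_def L2_set_eq_0_iff)
        then show "0 < r" unfolding r_def using L2_set_nonneg[of z "{1..m}"] by linarith
      qed (simp add: r_def L2_set_squared)
      define H where "H = (\<lambda>\<omega>. \<lambda>j\<in>{1..n}. (sqrt (real n) / r) * (\<Sum>i\<in>{1..m}. z i * X i j \<omega>))"
      have Hm: "H \<in> measurable M (\<Pi>\<^sub>M j\<in>{1..n}. borel)"
        unfolding H_def by (intro measurable_restrict borel_measurable_times borel_measurable_const borel_measurable_sum X_measurable)
      have Hlaw: "distr M (\<Pi>\<^sub>M j\<in>{1..n}. borel) H = gauss_on {1..n}"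
        unfolding H_def r_def by (rule scaled_combination_law[OF True])
      let ?T = "{h \<in> space (gauss_on {1..n}). (1 + \<eta>) * D < block_energy P h}"
      have T: "?T \<in> sets (gauss_on {1..n})"
        by (rule borel_measurable_less[OF borel_measurable_const])
           (simp add: measurable_gauss_on borel_measurable_block_energy[OF P] del: One_nat_def)
      have bH: "block_energy P (\<lambda>j. \<Sum>i\<in>{1..m}. z i * X i j \<omega>) = r\<^sup>2 / n * block_energy P (H \<omega>)" for \<omega>
      proof -
        have "block_energy P (\<lambda>j. \<Sum>i\<in>{1..m}. z i * X i j \<omega>) = block_energy P (\<lambda>j. (r / sqrt n) * H \<omega> j)"
          using r dims_pos by (intro block_energy_cong[OF P]) (auto simp: H_def)
        also have "\<dots> = (r / sqrt n)\<^sup>2 * block_energy P (H \<omega>)" using r by (intro block_energy_scale) simp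
        finally show ?thesis by (simp add: power_divide)
      qed
      have "(1 + \<eta>) * D * ((\<Sum>i\<in>{1..m}. (z i)\<^sup>2) / real n) < block_energy P (\<lambda>j. \<Sum>i\<in>{1..m}. z i * X i j \<omega>)
          \<longleftrightarrow> (1 + \<eta>) * D < block_energy P (H \<omega>)" for \<omega>
        unfolding bH r(2)[symmetric] using r(1) dims_pos
        by (subst mult.commute[of "r\<^sup>2 / n"], subst mult_less_cancel_right_pos) auto
      then have "{\<omega>\<in>space M. (1 + \<eta>) * D * ((\<Sum>i\<in>{1..m}. (z i)\<^sup>2) / real n) < block_energy P (\<lambda>j. \<Sum>i\<in>{1..m}. z i * X i j \<omega>)}
          = H -` ?T \<inter> space M"
        using measurable_space[OF Hm] by (auto simp: space_gauss_on space_PiM simp del: One_nat_def)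
      also have "emeasure M \<dots> = emeasure (gauss_on {1..n}) ?T"
        unfolding Hlaw[symmetric] by (rule emeasure_distr[OF Hm, symmetric]) (use T in \<open>simp add: Hlaw sets_gauss_on del: One_nat_def\<close>)
      also have "\<dots> = ennreal (measure (gauss_on {1..n}) ?T)"
      proof -
        interpret G: prob_space "gauss_on {1..n}" by (rule prob_space_gauss_on)
        show ?thesis by (rule G.emeasure_eq_measure)
      qed
      also have "\<dots> \<le> ennreal ?p" by (intro ennreal_leI block_energy_tail[OF P lam D])
      finally show ?thesis .
    qed
    finally show ?thesis .
  qed
  have "?Bad = (\<lambda>\<omega>. (?ZA \<omega>, ?ZB \<omega>)) -` S \<inter> space M"
  proof -
    have 1: "sq (?ZA \<omega>) = (\<Sum>i\<in>{1..m}. (\<xi> i \<omega>)\<^sup>2) / real n" for \<omega>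
      by (simp add: sq_def IA_def)
    have 2: "block_energy P (v (?ZA \<omega>, ?ZB \<omega>)) = block_energy P (\<lambda>j. \<Sum>i\<in>{1..m}. \<xi> i \<omega> * X i j \<omega>)" for \<omega>
      by (intro block_energy_cong[OF P]) (auto simp: v_def IA_def IB_def intro!: sum.cong)
    have 3: "(?ZA \<omega>, ?ZB \<omega>) \<in> space (?MA \<Otimes>\<^sub>M ?MB)" if "\<omega> \<in> space M" for \<omega>
      using measurable_space[OF mA that] measurable_space[OF mB that] by (simp add: space_pair_measure)
    show ?thesis using 3 by (auto simp: S_def 1 2)
  qed
  then have "emeasure M ?Bad = emeasure (distr M (?MA \<Otimes>\<^sub>M ?MB) (\<lambda>\<omega>. (?ZA \<omega>, ?ZB \<omega>))) S"
    using S measurable_Pair[OF mA mB] by (simp add: emeasure_distr)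
  also have "\<dots> = emeasure (distr M ?MA ?ZA \<Otimes>\<^sub>M distr M ?MB ?ZB) S" by (simp only: joint)
  also have "\<dots> = (\<integral>\<^sup>+a. emeasure (distr M ?MB ?ZB) (Pair a -` S) \<partial>distr M ?MA ?ZA)"
    using S by (intro B.emeasure_pair_measure_alt) (simp cong: sets_pair_measure_cong)
  also have "\<dots> \<le> (\<integral>\<^sup>+a. ennreal ?p \<partial>distr M ?MA ?ZA)"
    by (intro nn_integral_mono slice) simp
  also have "\<dots> = ennreal ?p" using A.emeasure_space_1 by simp
  finally show ?thesis by (simp add: emeasure_eq_measure)
qed

end

section \<open>Restricted lower isometry\<close>

definition dotn :: "nat \<Rightarrow> (nat \<Rightarrow> real) \<Rightarrow> (nat \<Rightarrow> real) \<Rightarrow> real" where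
  "dotn n h t = (\<Sum>j\<in>{1..n}. h j * t j)"

definition nsq :: "nat \<Rightarrow> (nat \<Rightarrow> real) \<Rightarrow> real" where
  "nsq n t = (\<Sum>j\<in>{1..n}. (t j)\<^sup>2)"

lemma nsq_nonneg: "0 \<le> nsq n t"
  unfolding nsq_def by (intro sum_nonneg) auto

lemma nsq_L2: "nsq n t = (L2_set t {1..n})\<^sup>2"
  by (simp add: nsq_def L2_set_squared)

lemma sqrt_nsq: "sqrt (nsq n t) = L2_set t {1..n}"
  by (simp add: nsq_def L2_set_def)

lemma nsq_zero_imp: "nsq n t = 0 \<Longrightarrow> j \<in> {1..n} \<Longrightarrow> t j = 0"
  unfolding nsq_def by (subst (asm) sum_nonneg_eq_0_iff) auto

lemma dotn_measurable: "(\<lambda>h. dotn n h t) \<in> borel_measurable (gauss_on {1..n})"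
  unfolding dotn_def measurable_gauss_on
  by (intro borel_measurable_sum borel_measurable_times borel_measurable_const measurable_component_singleton)

text \<open>The linear form is normal with variance \<open>nsq n t\<close>. The fourth moment serves
  to control the loss caused by clipping.\<close>

lemma dotn_moments:
  shows "has_bochner_integral (gauss_on {1..n}) (\<lambda>h. (dotn n h t)\<^sup>2) (nsq n t)"
    and "has_bochner_integral (gauss_on {1..n}) (\<lambda>h. (dotn n h t) ^ 4) (3 * (nsq n t)\<^sup>2)"
proof -
  have "has_bochner_integral (gauss_on {1..n}) (\<lambda>h. (dotn n h t)\<^sup>2) (nsq n t) \<and>
     has_bochner_integral (gauss_on {1..n}) (\<lambda>h. (dotn n h t) ^ 4) (3 * (nsq n t)\<^sup>2)"
  proof (cases "\<exists>j\<in>{1..n}. t j \<noteq> 0")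
    case False
    then have "dotn n h t = 0" "nsq n t = 0" for h by (auto simp: dotn_def nsq_def)
    then show ?thesis by (simp add: has_bochner_integral_zero)
  next
    case True
    define r where "r = L2_set t {1..n}"
    have r: "0 < r" "nsq n t = r\<^sup>2"
    proof -
      have "r \<noteq> 0" using True by (auto simp: r_def L2_set_eq_0_iff)
      then show "0 < r" unfolding r_def using L2_set_nonneg[of t "{1..n}"] by linarith
    qed (simp add: r_def nsq_L2)
    have eq: "(\<lambda>h. dotn n h t) = (\<lambda>h. \<Sum>j\<in>{1..n}. t j * h j)" by (simp add: dotn_def mult.commute)
    have d: "distributed (gauss_on {1..n}) lborel (\<lambda>h. dotn n h t) (normal_density 0 r)"
      unfolding eq r_def by (rule distributed_gauss_on_linear[OF _ True]) simp
    have mom: "has_bochner_integral (gauss_on {1..n}) (\<lambda>h. g (dotn n h t)) c"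
      if "has_bochner_integral lborel (\<lambda>x. normal_density 0 r x * g x) c" "g \<in> borel_measurable borel" for g :: "real \<Rightarrow> real" and c
      using that distributed_integrable[OF d, of g] distributed_integral[OF d, of g]
      by (auto simp: has_bochner_integral_iff)
    have "has_bochner_integral lborel (\<lambda>x. normal_density 0 r x * x\<^sup>2) (r\<^sup>2)"
      using normal_moment_even[OF r(1), of 0 1] by simp
    moreover have "has_bochner_integral lborel (\<lambda>x. normal_density 0 r x * x ^ 4) (3 * (r\<^sup>2)\<^sup>2)"
    proof -
      have "fact (2 * 2) / ((2 / r\<^sup>2)\<^sup>2 * fact 2) = 3 * (r\<^sup>2)\<^sup>2"
        using r(1) by (simp add: fact_numeral power_divide field_simps)
      then show ?thesis using normal_moment_even[OF r(1), of 0 2] by simp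
    qed
    ultimately show ?thesis using mom[of "\<lambda>x. x\<^sup>2"] mom[of "\<lambda>x. x ^ 4"] r(2) by simp
  qed
  then show "has_bochner_integral (gauss_on {1..n}) (\<lambda>h. (dotn n h t)\<^sup>2) (nsq n t)"
    "has_bochner_integral (gauss_on {1..n}) (\<lambda>h. (dotn n h t) ^ 4) (3 * (nsq n t)\<^sup>2)" by auto
qed

definition clip_sq :: "real \<Rightarrow> real \<Rightarrow> real" where
  "clip_sq b x = min (x\<^sup>2) (b\<^sup>2)"

lemma clip_sq_bounds: "0 \<le> clip_sq b x" "clip_sq b x \<le> b\<^sup>2" "clip_sq b x \<le> x\<^sup>2" "clip_sq b 0 = 0"
  by (auto simp: clip_sq_def)

text \<open>Above the clipping level the polynomial is negative; below it, it is at most the square.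
  Its Gaussian moments are explicit, unlike those of the clipped square.\<close>

lemma clip_sq_ge:
  assumes "0 < b" shows "x\<^sup>2 - x ^ 4 / b\<^sup>2 \<le> clip_sq b x"
proof (cases "x\<^sup>2 \<le> b\<^sup>2")
  case True
  then show ?thesis by (simp add: clip_sq_def)
next
  case False
  then have "x\<^sup>2 * b\<^sup>2 \<le> x\<^sup>2 * x\<^sup>2" by (intro mult_left_mono) auto
  then have "x\<^sup>2 \<le> x ^ 4 / b\<^sup>2" using assms by (simp add: field_simps power4_eq_xxxx power2_eq_square)
  then show ?thesis using clip_sq_bounds(1)[of b x] by linarith
qed

lemma clip_sq_measurable: "clip_sq b \<in> borel_measurable borel"
  unfolding clip_sq_def[abs_def] by measurable

text \<open>The number 48 is \<open>3 * 4\<^sup>2\<close>: the factor of the Gaussian fourth moment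
  and the bound 4 for the squared length of a test vector.\<close>

lemma clip_sq_mean:
  assumes b: "0 < b" and t: "nsq n t \<le> 4"
  shows "nsq n t - 48 / b\<^sup>2 \<le> (\<integral>h. clip_sq b (dotn n h t) \<partial>gauss_on {1..n})"
proof -
  interpret prob_space "gauss_on {1..n}" by (rule prob_space_gauss_on)
  note m2 = dotn_moments(1)[of n t] and m4 = dotn_moments(2)[of n t]
  have hb: "has_bochner_integral (gauss_on {1..n}) (\<lambda>h. (dotn n h t)\<^sup>2 - (dotn n h t) ^ 4 / b\<^sup>2) (nsq n t - 3 * (nsq n t)\<^sup>2 / b\<^sup>2)"
    using has_bochner_integral_diff[OF m2 has_bochner_integral_divide_zero[OF m4, of "b\<^sup>2"]] by simp
  have "(nsq n t)\<^sup>2 \<le> 4\<^sup>2" by (intro power_mono t nsq_nonneg)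
  then have "3 * (nsq n t)\<^sup>2 / b\<^sup>2 \<le> 48 / b\<^sup>2" by (intro divide_right_mono) auto
  then have "nsq n t - 48 / b\<^sup>2 \<le> nsq n t - 3 * (nsq n t)\<^sup>2 / b\<^sup>2" by simp
  also have "\<dots> = (\<integral>h. (dotn n h t)\<^sup>2 - (dotn n h t) ^ 4 / b\<^sup>2 \<partial>gauss_on {1..n})"
    using hb by (simp add: has_bochner_integral_iff)
  also have "\<dots> \<le> (\<integral>h. clip_sq b (dotn n h t) \<partial>gauss_on {1..n})"
  proof (rule integral_mono)
    show "integrable (gauss_on {1..n}) (\<lambda>h. (dotn n h t)\<^sup>2 - (dotn n h t) ^ 4 / b\<^sup>2)"
      using hb by (simp add: has_bochner_integral_iff)
    show "integrable (gauss_on {1..n}) (\<lambda>h. clip_sq b (dotn n h t))"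
      using clip_sq_bounds
      by (intro integrable_const_bound[where B="b\<^sup>2"] measurable_compose[OF dotn_measurable clip_sq_measurable]) auto
  qed (rule clip_sq_ge[OF b])
  finally show ?thesis .
qed

text \<open>The unit ball of the blockwise monotone cone, thickened by a segment in direction
  \<open>e\<close>. When \<open>e\<close> is the normalised vector
  \<open>u = \<mu> - \<mu>0\<close>, it contains multiples both of \<open>w\<close> and of
  \<open>w + u\<close>.\<close>

definition test_class :: "nat \<Rightarrow> nat set set \<Rightarrow> (nat \<Rightarrow> real) \<Rightarrow> (nat \<Rightarrow> real) set" where
  "test_class n P e = {t. \<exists>w s. (\<forall>I\<in>P. mono_on I w) \<and> nsq n w \<le> 1 \<and> \<bar>s\<bar> \<le> 1 \<and> t = (\<lambda>j. w j + s * e j)}"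

lemma zero_in_test_class: "(\<lambda>_. 0) \<in> test_class n P e"
  unfolding test_class_def
  by (intro CollectI exI[of _ "\<lambda>_. 0"] exI[of _ 0]) (auto simp: mono_on_def nsq_def)

lemma test_class_dot_le:
  assumes P: "interval_partition n P" and t: "t \<in> test_class n P e"
  shows "dotn n h t \<le> sqrt (block_energy P h) + \<bar>dotn n h e\<bar>"
proof -
  obtain w s where w: "\<And>I. I \<in> P \<Longrightarrow> mono_on I w" "nsq n w \<le> 1" and s: "\<bar>s\<bar> \<le> 1" and t: "t = (\<lambda>j. w j + s * e j)"
    using t by (auto simp: test_class_def)
  have "dotn n h t = dotn n h w + s * dotn n h e"
    by (simp add: t dotn_def distrib_left sum.distrib sum_distrib_left mult.left_commute)
  also have "dotn n h w \<le> sqrt (block_energy P h) * sqrt (nsq n w)"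
    unfolding dotn_def nsq_def by (rule inner_le_block_energy[OF P w(1)])
  also have "\<dots> \<le> sqrt (block_energy P h) * 1"
    using w(2) block_energy_nonneg[of P h] by (intro mult_left_mono) auto
  also have "s * dotn n h e \<le> \<bar>s\<bar> * \<bar>dotn n h e\<bar>" by (metis abs_ge_self abs_mult)
  also have "\<dots> \<le> 1 * \<bar>dotn n h e\<bar>" using s by (intro mult_right_mono) auto
  finally show ?thesis by simp
qed

lemma test_class_nsq_le:
  assumes t: "t \<in> test_class n P e" and e: "nsq n e \<le> 1"
  shows "nsq n t \<le> 4"
proof -
  obtain w s where w: "nsq n w \<le> 1" and s: "\<bar>s\<bar> \<le> 1" and t: "t = (\<lambda>j. w j + s * e j)"
    using t by (auto simp: test_class_def)
  have "L2_set t {1..n} \<le> L2_set w {1..n} + L2_set (\<lambda>j. s * e j) {1..n}"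
    unfolding t by (rule L2_set_triangle_ineq)
  also have "L2_set (\<lambda>j. s * e j) {1..n} = \<bar>s\<bar> * L2_set e {1..n}"
    by (simp add: L2_set_def power_mult_distrib real_sqrt_mult flip: sum_distrib_left)
  also have "L2_set w {1..n} \<le> 1" using w by (simp add: sqrt_nsq[symmetric] del: One_nat_def)
  also have "\<bar>s\<bar> * L2_set e {1..n} \<le> 1 * 1" using s e by (intro mult_mono) (auto simp: sqrt_nsq[symmetric] nsq_nonneg simp del: One_nat_def)
  finally have "(L2_set t {1..n})\<^sup>2 \<le> 2\<^sup>2" by (intro power_mono) (auto simp: L2_set_nonneg)
  then show ?thesis by (simp add: nsq_L2)
qed

text \<open>The square root is linearised at \<open>D\<close>, and the modulus at 1, by the
  inequality between arithmetic and geometric means; what remains are the means of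
  \<open>block_energy\<close> and of the square of a linear form.\<close>

lemma nn_integral_width_le:
  assumes P: "interval_partition n P" and D: "harm_dim P \<le> D" "0 < D" and e: "nsq n e \<le> 1"
  shows "(\<integral>\<^sup>+h. sqrt (block_energy P h) + \<bar>dotn n h e\<bar> \<partial>gauss_on {1..n}) \<le> ennreal (sqrt D + 1)"
proof -
  interpret prob_space "gauss_on {1..n}" by (rule prob_space_gauss_on)
  note bi = integral_block_energy_le[OF P]
  have m2: "integrable (gauss_on {1..n}) (\<lambda>h. (dotn n h e)\<^sup>2)" "(\<integral>h. (dotn n h e)\<^sup>2 \<partial>gauss_on {1..n}) = nsq n e"
    using dotn_moments(1)[of n e] by (auto simp: has_bochner_integral_iff)
  let ?g = "\<lambda>h. (block_energy P h / sqrt D + sqrt D) / 2 + ((dotn n h e)\<^sup>2 + 1) / 2"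
  have "(\<integral>\<^sup>+h. sqrt (block_energy P h) + \<bar>dotn n h e\<bar> \<partial>gauss_on {1..n}) \<le> (\<integral>\<^sup>+h. ?g h \<partial>gauss_on {1..n})"
  proof (intro nn_integral_mono ennreal_leI add_mono)
    fix h
    have "0 \<le> (sqrt (block_energy P h) - sqrt D)\<^sup>2" by simp
    also have "\<dots> = block_energy P h + D - 2 * sqrt (block_energy P h) * sqrt D"
      using D block_energy_nonneg[of P h] by (simp add: power2_diff)
    finally have "2 * sqrt (block_energy P h) * sqrt D \<le> block_energy P h + sqrt D * sqrt D" using D by simp
    then show "sqrt (block_energy P h) \<le> (block_energy P h / sqrt D + sqrt D) / 2"
      using D by (simp add: field_simps)
    have "0 \<le> (\<bar>dotn n h e\<bar> - 1)\<^sup>2" by simp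
    then show "\<bar>dotn n h e\<bar> \<le> ((dotn n h e)\<^sup>2 + 1) / 2" by (simp add: power2_diff)
  qed
  also have "\<dots> = ennreal (\<integral>h. ?g h \<partial>gauss_on {1..n})"
    using bi(1) m2(1) D block_energy_nonneg[of P]
    by (intro nn_integral_eq_integral) (auto intro!: add_nonneg_nonneg divide_nonneg_nonneg simp del: One_nat_def)
  also have "(\<integral>h. ?g h \<partial>gauss_on {1..n}) = ((\<integral>h. block_energy P h \<partial>gauss_on {1..n}) / sqrt D + sqrt D) / 2 + (nsq n e + 1) / 2"
    using bi(1) m2 by (simp add: prob_space del: One_nat_def)
  also have "\<dots> \<le> (D / sqrt D + sqrt D) / 2 + (1 + 1) / 2"
    using bi(2) D e by (intro add_mono divide_right_mono) auto
  also have "\<dots> = sqrt D + 1" using D by (simp add: real_div_sqrt)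
  finally show ?thesis by (simp add: ennreal_leI)
qed

text \<open>The clipped square has Lipschitz constant \<open>2 * b\<close> and upper bound
  \<open>b\<^sup>2\<close>; the symmetry comes from the law of the negated vector.\<close>

lemma symmetric_process_gauss:
  assumes n: "1 \<le> n" and A: "finite A" "(\<lambda>_. 0) \<in> A" and b: "0 \<le> b"
  shows "symmetric_process (gauss_on {1..n}) A (\<lambda>t h. dotn n h t) (\<lambda>_. 0) (clip_sq b) (2 * b) (b\<^sup>2)"
proof -
  interpret prob_space "gauss_on {1..n}" by (rule prob_space_gauss_on)
  show ?thesis
  proof unfold_locales
    fix c :: "(nat \<Rightarrow> real) \<Rightarrow> real" and k :: real
    have K: "{1..n} \<noteq> {}" using n by simp
    let ?neg = "\<lambda>h::nat \<Rightarrow> real. \<lambda>i\<in>{1..n}. - h i"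
    have mneg: "?neg \<in> measurable (gauss_on {1..n}) (\<Pi>\<^sub>M i\<in>{1..n}. borel)"
      unfolding measurable_gauss_on by (intro measurable_restrict borel_measurable_uminus measurable_component_singleton)
    have m: "(\<lambda>x. ennreal (Max ((\<lambda>t. c t + k * dotn n x t) ` A))) \<in> borel_measurable (gauss_on {1..n})"
      by (intro measurable_compose[OF _ measurable_ennreal] borel_measurable_Max[OF A(1)] borel_measurable_add
          borel_measurable_times borel_measurable_const dotn_measurable)
    have "(\<integral>\<^sup>+x. Max ((\<lambda>t. c t + k * dotn n x t) ` A) \<partial>gauss_on {1..n})
        = (\<integral>\<^sup>+x. Max ((\<lambda>t. c t + k * dotn n x t) ` A) \<partial>distr (gauss_on {1..n}) (\<Pi>\<^sub>M i\<in>{1..n}. borel) ?neg)"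
      by (simp only: distr_gauss_on_uminus[OF K])
    also have "\<dots> = (\<integral>\<^sup>+x. Max ((\<lambda>t. c t + k * dotn n (?neg x) t) ` A) \<partial>gauss_on {1..n})"
      by (rule nn_integral_distr[OF mneg]) (use m in \<open>simp only: measurable_gauss_on measurable_distr_eq1\<close>)
    also have "\<dots> = (\<integral>\<^sup>+x. Max ((\<lambda>t. c t - k * dotn n x t) ` A) \<partial>gauss_on {1..n})"
    proof -
      have "dotn n (?neg x) t = - dotn n x t" for x t
        unfolding dotn_def sum_negf[symmetric] by (intro sum.cong) auto
      then show ?thesis by simp
    qed
    finally show "(\<integral>\<^sup>+x. Max ((\<lambda>t. c t - k * dotn n x t) ` A) \<partial>gauss_on {1..n})
        = (\<integral>\<^sup>+x. Max ((\<lambda>t. c t + k * dotn n x t) ` A) \<partial>gauss_on {1..n})" by (rule sym)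
  next
    show "\<bar>clip_sq b x - clip_sq b y\<bar> \<le> 2 * b * \<bar>x - y\<bar>" for x y
      unfolding clip_sq_def by (rule clipped_square_lipschitz[OF b])
  qed (use A clip_sq_bounds clip_sq_measurable dotn_measurable in \<open>auto simp: dotn_def[of _ _ "\<lambda>_. 0"] simp del: One_nat_def\<close>)
qed

declare One_nat_def [simp del]

section \<open>Empirical process over the rows of the design\<close>

context gaussian_design
begin

text \<open>The factor \<open>sqrt n\<close> turns a row of the design into a standard Gaussian
  vector.\<close>

definition scaled_row :: "'a \<Rightarrow> nat \<Rightarrow> nat \<Rightarrow> real" where
  "scaled_row \<omega> i = (\<lambda>j\<in>{1..n}. sqrt (real n) * X i j \<omega>)"

lemma scaled_row_measurable: "i \<in> {1..m} \<Longrightarrow> (\<lambda>\<omega>. scaled_row \<omega> i) \<in> measurable M (\<Pi>\<^sub>M j\<in>{1..n}. borel)"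
  unfolding scaled_row_def
  by (intro measurable_restrict borel_measurable_times borel_measurable_const X_measurable)

lemma dotn_row_measurable: "i \<in> {1..m} \<Longrightarrow> (\<lambda>\<omega>. dotn n (scaled_row \<omega> i) t) \<in> borel_measurable M"
  using measurable_compose[OF scaled_row_measurable dotn_measurable[unfolded measurable_gauss_on]] .

lemma nn_integral_rows:
  assumes F: "F \<in> borel_measurable (\<Pi>\<^sub>M i\<in>{1..m}. (\<Pi>\<^sub>M j\<in>{1..n}. borel))"
    and cong: "\<And>G G'. (\<And>i. i \<in> {1..m} \<Longrightarrow> G i = G' i) \<Longrightarrow> F G = F G'"
  shows "(\<integral>\<^sup>+G. F G \<partial>(\<Pi>\<^sub>M i\<in>{1..m}. gauss_on {1..n})) = (\<integral>\<^sup>+\<omega>. F (scaled_row \<omega>) \<partial>M)"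
proof -
  have m: "(\<lambda>\<omega>. \<lambda>i\<in>{1..m}. scaled_row \<omega> i) \<in> measurable M (\<Pi>\<^sub>M i\<in>{1..m}. (\<Pi>\<^sub>M j\<in>{1..n}. borel))"
    by (intro measurable_restrict scaled_row_measurable)
  have "(\<integral>\<^sup>+G. F G \<partial>(\<Pi>\<^sub>M i\<in>{1..m}. gauss_on {1..n})) = (\<integral>\<^sup>+\<omega>. F (\<lambda>i\<in>{1..m}. scaled_row \<omega> i) \<partial>M)"
    unfolding rows_law[folded scaled_row_def, symmetric]
    by (rule nn_integral_distr[OF m]) (use F in simp)
  also have "\<dots> = (\<integral>\<^sup>+\<omega>. F (scaled_row \<omega>) \<partial>M)"
    by (intro nn_integral_cong cong) simp
  finally show ?thesis .
qed

lemma measurable_row_Max: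
  assumes A: "finite A" and f: "f \<in> borel_measurable borel"
  shows "(\<lambda>G. ennreal (Max ((\<lambda>t. \<Sum>i\<in>{1..m}. c t + f (dotn n (G i) t)) ` A)))
    \<in> borel_measurable (\<Pi>\<^sub>M i\<in>{1..m}. (\<Pi>\<^sub>M j\<in>{1..n}. borel))"
proof -
  have "(\<lambda>G. f (dotn n (G i) t)) \<in> borel_measurable (\<Pi>\<^sub>M i\<in>{1..m}. (\<Pi>\<^sub>M j\<in>{1..n}. borel))" if "i \<in> {1..m}" for i t
    using measurable_compose[OF measurable_component_singleton[OF that] dotn_measurable[unfolded measurable_gauss_on]]
    by (rule measurable_compose[OF _ f])
  then show ?thesis
    by (intro measurable_compose[OF _ measurable_ennreal] borel_measurable_Max[OF A] borel_measurable_sum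
        borel_measurable_add borel_measurable_const)
qed

lemma row_sum_law:
  "distr M (\<Pi>\<^sub>M j\<in>{1..n}. borel) (\<lambda>\<omega>. \<lambda>j\<in>{1..n}. (sqrt (real n) / sqrt (real m)) * (\<Sum>i\<in>{1..m}. X i j \<omega>)) = gauss_on {1..n}"
proof -
  have "L2_set (\<lambda>_. 1) {1..m} = sqrt (real m)" by (simp add: L2_set_def)
  moreover have "\<exists>i\<in>{1..m}. (1::real) \<noteq> 0" using dims by (intro bexI[of _ 1]) auto
  ultimately show ?thesis using scaled_combination_law[of "\<lambda>_. 1"] by simp
qed

text \<open>After the comparison the process is linear in the rows, whose sum is distributed as
  \<open>sqrt m\<close> times one standard Gaussian vector; only the width of the test class is
  left. The factor \<open>4 * b\<close> is \<open>2 * \<Lambda>\<close> with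
  \<open>\<Lambda> = 2 * b\<close>.\<close>

lemma nn_integral_empirical_deviation_le:
  assumes P: "interval_partition n P" and D: "harm_dim P \<le> D" "0 < D" and e: "nsq n e \<le> 1"
    and A: "finite A" "(\<lambda>_. 0) \<in> A" "A \<subseteq> test_class n P e" and b: "0 < b"
  shows "(\<integral>\<^sup>+\<omega>. Max ((\<lambda>t. \<Sum>i\<in>{1..m}. (\<integral>h. clip_sq b (dotn n h t) \<partial>gauss_on {1..n})
            - clip_sq b (dotn n (scaled_row \<omega> i) t)) ` A) \<partial>M)
     \<le> ennreal (4 * b * sqrt (real m) * (sqrt D + 1))"
proof -
  interpret S: symmetric_process "gauss_on {1..n}" A "\<lambda>t h. dotn n h t" "\<lambda>_. 0" "clip_sq b" "2 * b" "b\<^sup>2"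
    using dims A b by (intro symmetric_process_gauss) auto
  have "(\<integral>\<^sup>+\<omega>. Max ((\<lambda>t. \<Sum>i\<in>{1..m}. S.mphi t - clip_sq b (dotn n (scaled_row \<omega> i) t)) ` A) \<partial>M)
     = (\<integral>\<^sup>+G. Max ((\<lambda>t. \<Sum>i\<in>{1..m}. S.mphi t - clip_sq b (dotn n (G i) t)) ` A) \<partial>(\<Pi>\<^sub>M i\<in>{1..m}. gauss_on {1..n}))"
  proof (rule nn_integral_rows[symmetric])
    show "(\<lambda>G. ennreal (Max ((\<lambda>t. \<Sum>i\<in>{1..m}. S.mphi t - clip_sq b (dotn n (G i) t)) ` A)))
      \<in> borel_measurable (\<Pi>\<^sub>M i\<in>{1..m}. (\<Pi>\<^sub>M j\<in>{1..n}. borel))"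
      using measurable_row_Max[OF A(1), of "\<lambda>x. - clip_sq b x" S.mphi] clip_sq_measurable by simp
    show "ennreal (Max ((\<lambda>t. \<Sum>i\<in>{1..m}. S.mphi t - clip_sq b (dotn n (G i) t)) ` A))
        = ennreal (Max ((\<lambda>t. \<Sum>i\<in>{1..m}. S.mphi t - clip_sq b (dotn n (G' i) t)) ` A))"
      if "\<And>i. i \<in> {1..m} \<Longrightarrow> G i = G' i" for G G'
      using that by (intro arg_cong[where f="\<lambda>S. ennreal (Max S)"] image_cong sum.cong refl) simp
  qed
  also have "\<dots> \<le> (\<integral>\<^sup>+G. Max ((\<lambda>t. \<Sum>i\<in>{1..m}. 2 * (2 * b) * dotn n (G i) t) ` A) \<partial>(\<Pi>\<^sub>M i\<in>{1..m}. gauss_on {1..n}))"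
    by (rule S.rows_comparison) auto
  also have "\<dots> = (\<integral>\<^sup>+\<omega>. Max ((\<lambda>t. \<Sum>i\<in>{1..m}. 2 * (2 * b) * dotn n (scaled_row \<omega> i) t) ` A) \<partial>M)"
  proof (rule nn_integral_rows)
    show "(\<lambda>G. ennreal (Max ((\<lambda>t. \<Sum>i\<in>{1..m}. 2 * (2 * b) * dotn n (G i) t) ` A)))
      \<in> borel_measurable (\<Pi>\<^sub>M i\<in>{1..m}. (\<Pi>\<^sub>M j\<in>{1..n}. borel))"
      using measurable_row_Max[OF A(1), of "\<lambda>x. 2 * (2 * b) * x" "\<lambda>_. 0"] by simp
    show "ennreal (Max ((\<lambda>t. \<Sum>i\<in>{1..m}. 2 * (2 * b) * dotn n (G i) t) ` A))
        = ennreal (Max ((\<lambda>t. \<Sum>i\<in>{1..m}. 2 * (2 * b) * dotn n (G' i) t) ` A))"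
      if "\<And>i. i \<in> {1..m} \<Longrightarrow> G i = G' i" for G G'
      using that by (intro arg_cong[where f="\<lambda>S. ennreal (Max S)"] image_cong sum.cong refl) simp
  qed
  also have "\<dots> = (\<integral>\<^sup>+\<omega>. Max ((\<lambda>t. 4 * b * sqrt (real m) *
      dotn n (\<lambda>j\<in>{1..n}. (sqrt (real n) / sqrt (real m)) * (\<Sum>i\<in>{1..m}. X i j \<omega>)) t) ` A) \<partial>M)"
  proof (intro nn_integral_cong arg_cong[where f="\<lambda>S. ennreal (Max S)"] image_cong refl)
    fix \<omega> t
    let ?r = "sqrt (real n) / sqrt (real m)"
    have "dotn n (\<lambda>j\<in>{1..n}. ?r * (\<Sum>i\<in>{1..m}. X i j \<omega>)) t
        = (\<Sum>j\<in>{1..n}. \<Sum>i\<in>{1..m}. ?r * X i j \<omega> * t j)"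
      unfolding dotn_def by (intro sum.cong) (auto simp: sum_distrib_left sum_distrib_right)
    also have "\<dots> = (\<Sum>i\<in>{1..m}. \<Sum>j\<in>{1..n}. ?r * X i j \<omega> * t j)" by (rule sum.swap)
    finally have "sqrt (real m) * dotn n (\<lambda>j\<in>{1..n}. ?r * (\<Sum>i\<in>{1..m}. X i j \<omega>)) t
        = (\<Sum>i\<in>{1..m}. \<Sum>j\<in>{1..n}. sqrt (real m) * (?r * X i j \<omega> * t j))"
      by (simp add: sum_distrib_left)
    also have "\<dots> = (\<Sum>i\<in>{1..m}. dotn n (scaled_row \<omega> i) t)"
      unfolding dotn_def using dims_pos by (intro sum.cong refl) (auto simp: scaled_row_def)
    finally show "(\<Sum>i\<in>{1..m}. 2 * (2 * b) * dotn n (scaled_row \<omega> i) t)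
      = 4 * b * sqrt (real m) * dotn n (\<lambda>j\<in>{1..n}. ?r * (\<Sum>i\<in>{1..m}. X i j \<omega>)) t"
      by (simp add: mult.assoc flip: sum_distrib_left)
  qed
  also have "\<dots> = (\<integral>\<^sup>+h. Max ((\<lambda>t. 4 * b * sqrt (real m) * dotn n h t) ` A) \<partial>gauss_on {1..n})"
    unfolding row_sum_law[symmetric]
  proof (rule nn_integral_distr[symmetric])
    show "(\<lambda>\<omega>. \<lambda>j\<in>{1..n}. (sqrt (real n) / sqrt (real m)) * (\<Sum>i\<in>{1..m}. X i j \<omega>)) \<in> measurable M (\<Pi>\<^sub>M j\<in>{1..n}. borel)"
      by (intro measurable_restrict borel_measurable_times borel_measurable_const borel_measurable_sum X_measurable)
    have "(\<lambda>h. ennreal (Max ((\<lambda>t. 4 * b * sqrt (real m) * dotn n h t) ` A))) \<in> borel_measurable (\<Pi>\<^sub>M j\<in>{1..n}. borel)"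
      using dotn_measurable unfolding measurable_gauss_on
      by (intro measurable_compose[OF _ measurable_ennreal] borel_measurable_Max[OF A(1)] borel_measurable_times borel_measurable_const)
    then show "(\<lambda>h. ennreal (Max ((\<lambda>t. 4 * b * sqrt (real m) * dotn n h t) ` A)))
      \<in> borel_measurable (distr M (\<Pi>\<^sub>M j\<in>{1..n}. borel) (\<lambda>\<omega>. \<lambda>j\<in>{1..n}. (sqrt (real n) / sqrt (real m)) * (\<Sum>i\<in>{1..m}. X i j \<omega>)))"
      by (simp only: measurable_distr_eq1)
  qed
  also have "\<dots> \<le> (\<integral>\<^sup>+h. ennreal (4 * b * sqrt (real m)) * ennreal (sqrt (block_energy P h) + \<bar>dotn n h e\<bar>) \<partial>gauss_on {1..n})"
  proof (intro nn_integral_mono)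
    fix h
    have "Max ((\<lambda>t. 4 * b * sqrt (real m) * dotn n h t) ` A) \<le> 4 * b * sqrt (real m) * (sqrt (block_energy P h) + \<bar>dotn n h e\<bar>)"
      using A b by (subst Max_image_le_iff) (auto intro!: mult_left_mono test_class_dot_le[OF P])
    then show "ennreal (Max ((\<lambda>t. 4 * b * sqrt (real m) * dotn n h t) ` A))
       \<le> ennreal (4 * b * sqrt (real m)) * ennreal (sqrt (block_energy P h) + \<bar>dotn n h e\<bar>)"
      using b block_energy_nonneg[of P h] by (subst ennreal_mult[symmetric]) (auto intro: ennreal_leI)
  qed
  also have "\<dots> = ennreal (4 * b * sqrt (real m)) * (\<integral>\<^sup>+h. sqrt (block_energy P h) + \<bar>dotn n h e\<bar> \<partial>gauss_on {1..n})"
  proof (intro nn_integral_cmult measurable_compose[OF _ measurable_ennreal] borel_measurable_add borel_measurable_abs dotn_measurable)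
    show "(\<lambda>h. sqrt (block_energy P h)) \<in> borel_measurable (gauss_on {1..n})"
      by (rule measurable_compose[OF borel_measurable_block_energy[OF P, folded measurable_gauss_on]]) measurable
  qed
  also have "\<dots> \<le> ennreal (4 * b * sqrt (real m)) * ennreal (sqrt D + 1)"
    by (intro mult_left_mono nn_integral_width_le[OF P D e]) simp
  also have "\<dots> = ennreal (4 * b * sqrt (real m) * (sqrt D + 1))"
    using b D by (intro ennreal_mult[symmetric]) auto
  finally show ?thesis unfolding S.mphi_def .
qed

text \<open>The strict inequality makes the defect an open condition on \<open>t\<close>. The slack
  \<open>2 * \<eta>\<close> leaves one \<open>\<eta>\<close> for clipping and one for the deviation
  from the mean.\<close>

definition isometry_defect :: "real \<Rightarrow> (nat \<Rightarrow> real) \<Rightarrow> 'a \<Rightarrow> bool" where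
  "isometry_defect \<eta> t \<omega> \<longleftrightarrow> (\<Sum>i\<in>{1..m}. (dotn n (scaled_row \<omega> i) t)\<^sup>2) < real m * (nsq n t - 2 * \<eta>)"

lemma isometry_defect_sets: "{\<omega>\<in>space M. isometry_defect \<eta> t \<omega>} \<in> sets M"
  unfolding isometry_defect_def
  by (intro borel_measurable_less borel_measurable_const borel_measurable_sum borel_measurable_power dotn_row_measurable)

text \<open>Markov's inequality for the largest deviation: the clipped mean is at least
  \<open>nsq n t - \<eta>\<close>, so a defect pushes the deviation to \<open>\<eta> * m\<close> or
  more.\<close>

lemma isometry_finite:
  assumes P: "interval_partition n P" and D: "harm_dim P \<le> D" "0 < D" and e: "nsq n e \<le> 1"
    and A: "finite A" "(\<lambda>_. 0) \<in> A" "A \<subseteq> test_class n P e" and \<eta>: "0 < \<eta>"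
  shows "measure M {\<omega>\<in>space M. \<exists>t\<in>A. isometry_defect \<eta> t \<omega>}
    \<le> 4 * sqrt (48 / \<eta>) / \<eta> * (sqrt (D / real m) + 1 / sqrt (real m))"
proof -
  \<comment> \<open>Chosen so that the clipping loss \<open>48 / b\<^sup>2\<close> equals
    \<open>\<eta>\<close>.\<close>
  define b where "b = sqrt (48 / \<eta>)"
  have b: "0 < b" "48 / b\<^sup>2 = \<eta>" using \<eta> by (auto simp: b_def)
  let ?mu = "\<lambda>t. \<integral>h. clip_sq b (dotn n h t) \<partial>gauss_on {1..n}"
  let ?V = "\<lambda>\<omega>. Max ((\<lambda>t. \<Sum>i\<in>{1..m}. ?mu t - clip_sq b (dotn n (scaled_row \<omega> i) t)) ` A)"
  let ?E = "{\<omega>\<in>space M. \<exists>t\<in>A. isometry_defect \<eta> t \<omega>}"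
  have E: "?E \<in> sets M"
  proof -
    have "?E = (\<Union>t\<in>A. {\<omega>\<in>space M. isometry_defect \<eta> t \<omega>})" by auto
    then show ?thesis using A(1) isometry_defect_sets by auto
  qed
  have V: "?V \<in> borel_measurable M"
    by (intro borel_measurable_Max[OF A(1)] borel_measurable_sum borel_measurable_diff borel_measurable_const
        measurable_compose[OF dotn_row_measurable clip_sq_measurable])
  have ge: "\<eta> * real m \<le> ?V \<omega>" if \<omega>: "\<omega> \<in> ?E" for \<omega>
  proof -
    obtain t where t: "t \<in> A" "(\<Sum>i\<in>{1..m}. (dotn n (scaled_row \<omega> i) t)\<^sup>2) < real m * (nsq n t - 2 * \<eta>)"
      using \<omega> by (auto simp: isometry_defect_def)
    have "nsq n t - \<eta> \<le> ?mu t"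
      using clip_sq_mean[OF b(1) test_class_nsq_le[of t n P e]] t A e b(2) by auto
    then have "real m * (nsq n t - \<eta>) \<le> real m * ?mu t" using dims_pos by (intro mult_left_mono) auto
    moreover have "(\<Sum>i\<in>{1..m}. clip_sq b (dotn n (scaled_row \<omega> i) t)) \<le> (\<Sum>i\<in>{1..m}. (dotn n (scaled_row \<omega> i) t)\<^sup>2)"
      by (intro sum_mono clip_sq_bounds)
    ultimately have "\<eta> * real m \<le> (\<Sum>i\<in>{1..m}. ?mu t - clip_sq b (dotn n (scaled_row \<omega> i) t))"
      using t(2) by (simp add: sum_subtractf algebra_simps)
    also have "\<dots> \<le> ?V \<omega>" by (rule Max_image_ge[OF A(1) t(1)])
    finally show ?thesis .
  qed
  let ?d = "\<eta> * real m"
  have d: "0 < ?d" using \<eta> dims_pos by simp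
  have "ennreal ?d * emeasure M ?E = (\<integral>\<^sup>+\<omega>. ennreal ?d * indicator ?E \<omega> \<partial>M)"
    using E by (simp add: nn_integral_cmult_indicator)
  also have "\<dots> \<le> (\<integral>\<^sup>+\<omega>. ?V \<omega> \<partial>M)"
    using ge by (intro nn_integral_mono) (auto split: split_indicator intro: ennreal_leI)
  also have "\<dots> \<le> ennreal (4 * b * sqrt (real m) * (sqrt D + 1))"
    by (rule nn_integral_empirical_deviation_le[OF P D e A b(1)])
  finally have "ennreal (?d * measure M ?E) \<le> ennreal (4 * b * sqrt (real m) * (sqrt D + 1))"
    using d by (simp add: emeasure_eq_measure ennreal_mult)
  then have "?d * measure M ?E \<le> 4 * b * sqrt (real m) * (sqrt D + 1)"
    using b D by (subst (asm) ennreal_le_iff) auto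
  then have "measure M ?E \<le> 4 * b * sqrt (real m) * (sqrt D + 1) / ?d"
    using d by (simp add: pos_le_divide_eq mult.commute)
  also have "\<dots> = 4 * b / \<eta> * ((sqrt (real m) / real m) * (sqrt D + 1))"
    by simp
  also have "(sqrt (real m) / real m) * (sqrt D + 1) = sqrt (D / real m) + 1 / sqrt (real m)"
  proof -
    have "sqrt (real m) / real m = 1 / sqrt (real m)"
      using dims_pos by (simp add: field_simps)
    then show ?thesis by (simp add: real_sqrt_divide add_divide_distrib)
  qed
  finally show ?thesis by (simp add: b_def)
qed

text \<open>The bound for finite sets does not depend on their size. A countable dense subset
  detects every defect by openness, and it is exhausted by an increasing sequence of finite
  sets.\<close>

lemma isometry_uniform:
  assumes P: "interval_partition n P" and D: "harm_dim P \<le> D" "0 < D" and e: "nsq n e \<le> 1" and \<eta>: "0 < \<eta>"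
  shows "{\<omega>\<in>space M. \<exists>t\<in>test_class n P e. isometry_defect \<eta> t \<omega>} \<in> sets M"
    and "measure M {\<omega>\<in>space M. \<exists>t\<in>test_class n P e. isometry_defect \<eta> t \<omega>}
    \<le> 4 * sqrt (48 / \<eta>) / \<eta> * (sqrt (D / real m) + 1 / sqrt (real m))"
proof -
  let ?T = "test_class n P e"
  obtain C where C: "countable C" "C \<subseteq> ?T" "?T \<subseteq> closure C"
    using separable[of ?T] by blast
  have "C \<noteq> {}" using C(3) zero_in_test_class[of n P e] by auto
  then have ran: "range (from_nat_into C) = C" using C(1) by (intro range_from_nat_into)
  define A where "A = (\<lambda>k. insert (\<lambda>_. 0) (from_nat_into C ` {..<k}))"
  define E where "E = (\<lambda>k. {\<omega>\<in>space M. \<exists>t\<in>A k. isometry_defect \<eta> t \<omega>})"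
  have A: "finite (A k)" "(\<lambda>_. 0) \<in> A k" "A k \<subseteq> ?T" for k
    using C(2) ran zero_in_test_class[of n P e] by (auto simp: A_def)
  have key: "(\<exists>t\<in>?T. isometry_defect \<eta> t \<omega>) \<longleftrightarrow> (\<exists>t\<in>C. isometry_defect \<eta> t \<omega>)" for \<omega>
  proof
    assume "\<exists>t\<in>?T. isometry_defect \<eta> t \<omega>"
    then obtain t where t: "t \<in> ?T" "isometry_defect \<eta> t \<omega>" by blast
    have "open {t. isometry_defect \<eta> t \<omega>}"
      unfolding isometry_defect_def dotn_def nsq_def
      by (intro open_Collect_less continuous_on_sum continuous_on_power continuous_on_mult continuous_on_diff
          continuous_on_const continuous_on_product_coordinates)
    moreover have "t \<in> {t. isometry_defect \<eta> t \<omega>} \<inter> closure C" using t C(3) by auto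
    ultimately have "{t. isometry_defect \<eta> t \<omega>} \<inter> C \<noteq> {}"
      using open_Int_closure_eq_empty[of "{t. isometry_defect \<eta> t \<omega>}" C] by blast
    then show "\<exists>t\<in>C. isometry_defect \<eta> t \<omega>" by blast
  qed (use C(2) in blast)
  have un: "{\<omega>\<in>space M. \<exists>t\<in>?T. isometry_defect \<eta> t \<omega>} = (\<Union>k. E k)"
  proof (intro set_eqI iffI)
    fix \<omega> assume "\<omega> \<in> {\<omega>\<in>space M. \<exists>t\<in>?T. isometry_defect \<eta> t \<omega>}"
    then obtain t where "\<omega> \<in> space M" "t \<in> C" "isometry_defect \<eta> t \<omega>" using key by auto
    moreover from this obtain i where "t = from_nat_into C i" using ran by (metis rangeE)
    ultimately have "\<omega> \<in> E (Suc i)" by (auto simp: E_def A_def)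
    then show "\<omega> \<in> (\<Union>k. E k)" by blast
  next
    fix \<omega> assume "\<omega> \<in> (\<Union>k. E k)"
    then show "\<omega> \<in> {\<omega>\<in>space M. \<exists>t\<in>?T. isometry_defect \<eta> t \<omega>}" using A(3) by (auto simp: E_def)
  qed
  have Es: "E k \<in> sets M" for k
  proof -
    have "E k = (\<Union>t\<in>A k. {\<omega>\<in>space M. isometry_defect \<eta> t \<omega>})" by (auto simp: E_def)
    then show ?thesis using A(1) isometry_defect_sets by auto
  qed
  show "{\<omega>\<in>space M. \<exists>t\<in>?T. isometry_defect \<eta> t \<omega>} \<in> sets M" unfolding un using Es by auto
  have "incseq E" by (auto simp: incseq_def E_def A_def)
  then have lim: "(\<lambda>k. measure M (E k)) \<longlonglongrightarrow> measure M (\<Union>k. E k)"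
    using Es by (intro finite_Lim_measure_incseq) auto
  have "measure M (E k) \<le> 4 * sqrt (48 / \<eta>) / \<eta> * (sqrt (D / real m) + 1 / sqrt (real m))" for k
    unfolding E_def by (rule isometry_finite[OF P D e A \<eta>])
  with lim show "measure M {\<omega>\<in>space M. \<exists>t\<in>?T. isometry_defect \<eta> t \<omega>}
    \<le> 4 * sqrt (48 / \<eta>) / \<eta> * (sqrt (D / real m) + 1 / sqrt (real m))"
    unfolding un by (intro LIMSEQ_le_const2) auto
qed

end

section \<open>Laws of large numbers for sums of squares\<close>

text \<open>With a second moment only, the squares are split at level \<open>b\<close>: Hoeffding's
  inequality handles the clipped part, Markov's inequality the excess.\<close>

lemma (in prob_space) sum_sq_tail:
  assumes nu: "real_distribution \<nu>" and int: "integrable \<nu> (\<lambda>x. x\<^sup>2)" and m: "1 \<le> m"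
    and Z: "indep_vars (\<lambda>_. borel) Z {1..m}" "\<And>i. i \<in> {1..m} \<Longrightarrow> distr M borel (Z i) = \<nu>"
    and b: "0 < b" and \<eta>: "0 < \<eta>"
  shows "measure M {\<omega>\<in>space M. ((\<integral>x. x\<^sup>2 \<partial>\<nu>) + \<eta>) * real m < (\<Sum>i\<in>{1..m}. (Z i \<omega>)\<^sup>2)}
    \<le> 2 * (\<integral>x. x\<^sup>2 - clip_sq b x \<partial>\<nu>) / \<eta> + exp (- (\<eta>\<^sup>2 / (2 * b ^ 4)) * real m)"
proof -
  interpret nu: real_distribution \<nu> by (rule nu)
  define s2 where "s2 = (\<integral>x. x\<^sup>2 \<partial>\<nu>)"
  define \<delta> where "\<delta> = (\<integral>x. x\<^sup>2 - clip_sq b x \<partial>\<nu>)"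
  have Zm: "random_variable borel (Z i)" if "i \<in> {1..m}" for i using Z(1) that by (auto simp: indep_vars_def)
  have clipm: "clip_sq b \<in> borel_measurable \<nu>" using clip_sq_measurable by simp
  have clipi: "integrable \<nu> (clip_sq b)"
    using clip_sq_bounds by (intro nu.integrable_const_bound[where B="b\<^sup>2"] clipm) auto
  have EZ: "(\<integral>\<omega>. g (Z i \<omega>) \<partial>M) = (\<integral>x. g x \<partial>\<nu>)" if "i \<in> {1..m}" "g \<in> borel_measurable borel" for g :: "real \<Rightarrow> real" and i
    unfolding Z(2)[OF that(1), symmetric] by (rule integral_distr[symmetric]) (use Zm that in auto)
  have IZ: "integrable M (\<lambda>\<omega>. g (Z i \<omega>))" if "i \<in> {1..m}" "g \<in> borel_measurable borel" "integrable \<nu> g" for g :: "real \<Rightarrow> real" and i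
    using that Zm integrable_distr_eq[of "Z i" M borel g] Z(2)[OF that(1)] by simp
  let ?R = "\<lambda>\<omega>. \<Sum>i\<in>{1..m}. (Z i \<omega>)\<^sup>2 - clip_sq b (Z i \<omega>)"
  let ?C = "\<lambda>\<omega>. \<Sum>i\<in>{1..m}. clip_sq b (Z i \<omega>)"
  let ?E1 = "{\<omega>\<in>space M. \<eta> / 2 * m \<le> ?R \<omega>}"
  let ?E2 = "{\<omega>\<in>space M. (\<Sum>i\<in>{1..m}. expectation (\<lambda>\<omega>. clip_sq b (Z i \<omega>))) + \<eta> / 2 * m \<le> ?C \<omega>}"
  have cm: "(\<lambda>\<omega>. clip_sq b (Z i \<omega>)) \<in> borel_measurable M" if "i \<in> {1..m}" for i
    by (rule measurable_compose[OF Zm[OF that] clip_sq_measurable])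
  have Rm: "?R \<in> borel_measurable M"
    by (intro borel_measurable_sum borel_measurable_diff borel_measurable_power cm Zm)
  have Cm: "?C \<in> borel_measurable M" by (intro borel_measurable_sum cm)
  have E1s: "?E1 \<in> sets M" by (rule borel_measurable_le[OF borel_measurable_const Rm])
  have E2s: "?E2 \<in> sets M" by (rule borel_measurable_le[OF borel_measurable_const Cm])
  have gm: "(\<lambda>x. x\<^sup>2 - clip_sq b x) \<in> borel_measurable borel"
    using clip_sq_measurable by (intro borel_measurable_diff borel_measurable_power) auto
  have gi: "integrable \<nu> (\<lambda>x. x\<^sup>2 - clip_sq b x)" using int clipi by simp
  have Ri: "integrable M ?R" by (intro Bochner_Integration.integrable_sum IZ[OF _ gm gi])
  have ER: "expectation ?R = m * \<delta>"
    using EZ[OF _ gm] IZ[OF _ gm gi] by (subst Bochner_Integration.integral_sum) (simp_all add: \<delta>_def)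
  have p1: "prob ?E1 \<le> 2 * \<delta> / \<eta>"
  proof -
    have "prob ?E1 \<le> expectation ?R / (\<eta> / 2 * m)"
      using Ri \<eta> m clip_sq_bounds(3)[of b] E1s
      by (intro integral_Markov_inequality_measure[where A="{}"]) (auto intro!: AE_I2 sum_nonneg)
    also have "\<dots> = 2 * \<delta> / \<eta>" using \<eta> m by (simp add: ER field_simps)
    finally show ?thesis .
  qed
  interpret H: Hoeffding_ineq M "{1..m}" "\<lambda>i \<omega>. clip_sq b (Z i \<omega>)" "\<lambda>_. 0" "\<lambda>_. b\<^sup>2"
     "\<Sum>i\<in>{1..m}. expectation (\<lambda>\<omega>. clip_sq b (Z i \<omega>))"
  proof unfold_locales
    show "indep_vars (\<lambda>_. borel) (\<lambda>i \<omega>. clip_sq b (Z i \<omega>)) {1..m}"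
      by (rule indep_vars_compose2[OF Z(1)]) (use clip_sq_measurable in auto)
  qed (auto simp: clip_sq_bounds)
  have p2: "prob ?E2 \<le> exp (- (\<eta>\<^sup>2 / (2 * b ^ 4)) * real m)"
  proof -
    have "prob ?E2 \<le> exp (-2 * (\<eta> / 2 * m)\<^sup>2 / (\<Sum>i\<in>{1..m}. (b\<^sup>2 - 0)\<^sup>2))"
      using \<eta> m b by (intro H.Hoeffding_ineq_ge) auto
    also have "-2 * (\<eta> / 2 * m)\<^sup>2 / (\<Sum>i\<in>{1..m}. (b\<^sup>2 - 0)\<^sup>2) = - (\<eta>\<^sup>2 / (2 * b ^ 4)) * real m"
      using m b by (simp add: power2_eq_square power4_eq_xxxx field_simps)
    finally show ?thesis .
  qed
  have mean: "(\<Sum>i\<in>{1..m}. expectation (\<lambda>\<omega>. clip_sq b (Z i \<omega>))) \<le> s2 * m"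
  proof -
    have "(\<integral>x. clip_sq b x \<partial>\<nu>) \<le> s2" unfolding s2_def by (intro integral_mono clipi int clip_sq_bounds)
    then have "(\<Sum>i\<in>{1..m}. expectation (\<lambda>\<omega>. clip_sq b (Z i \<omega>))) \<le> (\<Sum>i\<in>{1..m}. s2)"
      using EZ[OF _ clip_sq_measurable] by (intro sum_mono) auto
    then show ?thesis by (simp add: mult.commute)
  qed
  have "{\<omega>\<in>space M. (s2 + \<eta>) * real m < (\<Sum>i\<in>{1..m}. (Z i \<omega>)\<^sup>2)} \<subseteq> ?E1 \<union> ?E2"
  proof (rule subsetI, rule ccontr)
    fix \<omega> assume a: "\<omega> \<in> {\<omega>\<in>space M. (s2 + \<eta>) * real m < (\<Sum>i\<in>{1..m}. (Z i \<omega>)\<^sup>2)}" "\<omega> \<notin> ?E1 \<union> ?E2"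
    have "(\<Sum>i\<in>{1..m}. (Z i \<omega>)\<^sup>2) = ?R \<omega> + ?C \<omega>" by (simp add: sum_subtractf)
    then show False using a mean by (auto simp: algebra_simps)
  qed
  then have "prob {\<omega>\<in>space M. (s2 + \<eta>) * real m < (\<Sum>i\<in>{1..m}. (Z i \<omega>)\<^sup>2)} \<le> prob (?E1 \<union> ?E2)"
    using E1s E2s by (intro finite_measure_mono) auto
  also have "\<dots> \<le> prob ?E1 + prob ?E2" by (rule measure_Un_le[OF E1s E2s])
  finally show ?thesis using p1 p2 by (simp add: s2_def \<delta>_def)
qed

text \<open>Dominated convergence along integer clipping levels, with majorant
  \<open>x\<^sup>2\<close>.\<close>

lemma clip_sq_tail_small:
  assumes nu: "real_distribution \<nu>" and int: "integrable \<nu> (\<lambda>x. x\<^sup>2)" and p: "0 < p"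
  shows "\<exists>b>0. (\<integral>x. x\<^sup>2 - clip_sq b x \<partial>\<nu>) < p"
proof -
  interpret nu: real_distribution \<nu> by (rule nu)
  have "(\<lambda>k::nat. \<integral>x. x\<^sup>2 - clip_sq (real k) x \<partial>\<nu>) \<longlonglongrightarrow> (\<integral>x. 0 \<partial>\<nu>)"
  proof (rule integral_dominated_convergence[where w="\<lambda>x. x\<^sup>2"])
    show "(\<lambda>x. x\<^sup>2 - clip_sq (real k) x) \<in> borel_measurable \<nu>" for k
      using clip_sq_measurable by (intro borel_measurable_diff borel_measurable_power) auto
    show "AE x in \<nu>. (\<lambda>k. x\<^sup>2 - clip_sq (real k) x) \<longlonglongrightarrow> 0"
    proof (intro AE_I2 tendsto_eventually)
      fix x :: real
      obtain k0 :: nat where k0: "\<bar>x\<bar> \<le> real k0" using real_arch_simple by blast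
      have "x\<^sup>2 - clip_sq (real k) x = 0" if "k0 \<le> k" for k
      proof -
        have "\<bar>x\<bar> \<le> \<bar>real k\<bar>" using k0 that by simp
        then have "x\<^sup>2 \<le> (real k)\<^sup>2" by (simp only: abs_le_square_iff)
        then show ?thesis by (simp add: clip_sq_def)
      qed
      then show "\<forall>\<^sub>F k in sequentially. x\<^sup>2 - clip_sq (real k) x = 0"
        by (auto simp: eventually_sequentially)
    qed
    show "AE x in \<nu>. norm (x\<^sup>2 - clip_sq (real k) x) \<le> x\<^sup>2" for k
      using clip_sq_bounds(1,3)[of "real k"] by (auto simp: abs_of_nonneg)
  qed (use int in auto)
  then have "\<forall>\<^sub>F k in sequentially. (\<integral>x. x\<^sup>2 - clip_sq (real k) x \<partial>\<nu>) < p"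
    using p by (auto dest: order_tendstoD)
  then have "\<forall>\<^sub>F k::nat in sequentially. (\<integral>x. x\<^sup>2 - clip_sq (real k) x \<partial>\<nu>) < p \<and> 0 < k"
    using eventually_gt_at_top[of 0] by eventually_elim simp
  then obtain k :: nat where "(\<integral>x. x\<^sup>2 - clip_sq (real k) x \<partial>\<nu>) < p" "0 < k"
    by (auto simp: eventually_sequentially)
  then show ?thesis by (intro exI[of _ "real k"]) simp
qed

text \<open>The probability space changes with the sample size, so the law of large numbers takes
  the form of a threshold that depends on the law \<open>\<nu>\<close> and the tolerances but not on
  the space.\<close>

lemma sum_sq_tail_uniform:
  assumes nu: "real_distribution \<nu>" and int: "integrable \<nu> (\<lambda>x. x\<^sup>2)" and \<eta>: "0 < \<eta>" and p: "0 < p"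
  shows "\<exists>m0. \<forall>m\<ge>m0. \<forall>(M :: 'a measure) Z. prob_space M \<longrightarrow> prob_space.indep_vars M (\<lambda>_. borel) Z {1..m} \<longrightarrow>
    (\<forall>i\<in>{1..m}. distr M borel (Z i) = \<nu>) \<longrightarrow>
    measure M {\<omega>\<in>space M. ((\<integral>x. x\<^sup>2 \<partial>\<nu>) + \<eta>) * real m < (\<Sum>i\<in>{1..m}. (Z i \<omega>)\<^sup>2)} \<le> p"
proof -
  \<comment> \<open>The excess above the clipping level then contributes at most
    \<open>2 * (p * \<eta> / 4) / \<eta> = p / 2\<close>; the exponential term gets the other
    half.\<close>
  obtain b where b: "0 < b" "(\<integral>x. x\<^sup>2 - clip_sq b x \<partial>\<nu>) < p * \<eta> / 4"
    using clip_sq_tail_small[OF nu int, of "p * \<eta> / 4"] p \<eta> by auto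
  have c: "0 < \<eta>\<^sup>2 / (2 * b ^ 4)" using b \<eta> by simp
  have "((\<lambda>m. exp (- (\<eta>\<^sup>2 / (2 * b ^ 4)) * real m)) \<longlongrightarrow> 0) sequentially"
    using c by (intro filterlim_compose[OF exp_at_bot] filterlim_tendsto_neg_mult_at_bot[OF tendsto_const]
        filterlim_real_sequentially) auto
  then have "\<forall>\<^sub>F m in sequentially. exp (- (\<eta>\<^sup>2 / (2 * b ^ 4)) * real m) < p / 2"
    by (rule order_tendstoD(2)) (use p in simp)
  then obtain m0 where m0: "\<And>m. m0 \<le> m \<Longrightarrow> exp (- (\<eta>\<^sup>2 / (2 * b ^ 4)) * real m) < p / 2"
    by (auto simp: eventually_sequentially)
  show ?thesis
  proof (intro exI[of _ "max m0 1"] allI impI)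
    fix m and M :: "'a measure" and Z
    assume m: "max m0 1 \<le> m" and M: "prob_space M" and Z: "prob_space.indep_vars M (\<lambda>_. borel) Z {1..m}"
      "\<forall>i\<in>{1..m}. distr M borel (Z i) = \<nu>"
    have "measure M {\<omega>\<in>space M. ((\<integral>x. x\<^sup>2 \<partial>\<nu>) + \<eta>) * real m < (\<Sum>i\<in>{1..m}. (Z i \<omega>)\<^sup>2)}
      \<le> 2 * (\<integral>x. x\<^sup>2 - clip_sq b x \<partial>\<nu>) / \<eta> + exp (- (\<eta>\<^sup>2 / (2 * b ^ 4)) * real m)"
      using m Z by (intro prob_space.sum_sq_tail[OF M nu int _ _ _ b(1) \<eta>]) auto
    also have "\<dots> \<le> 2 * (p * \<eta> / 4) / \<eta> + p / 2"
      using b(2) \<eta> m0[of m] m by (intro add_mono divide_right_mono) (auto simp: mult.commute)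
    also have "\<dots> = p" using \<eta> by simp
    finally show "measure M {\<omega>\<in>space M. ((\<integral>x. x\<^sup>2 \<partial>\<nu>) + \<eta>) * real m < (\<Sum>i\<in>{1..m}. (Z i \<omega>)\<^sup>2)} \<le> p" .
  qed
qed

context gaussian_design
begin

text \<open>Prepares the upper bound for \<open>|X u|\<close> in one fixed direction: the squares of
  these variables obey the law of large numbers.\<close>

lemma indep_row_projections:
  assumes u: "0 < nsq n u"
  shows "indep_vars (\<lambda>_. borel) (\<lambda>i \<omega>. dotn n (scaled_row \<omega> i) u / sqrt (nsq n u)) {1..m}"
    and "i \<in> {1..m} \<Longrightarrow> distr M borel (\<lambda>\<omega>. dotn n (scaled_row \<omega> i) u / sqrt (nsq n u)) = std_normal"
proof -
  let ?B = "\<Pi>\<^sub>M j\<in>{1..n}. (borel :: real measure)"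
  have "distr M (\<Pi>\<^sub>M i\<in>{1..m}. ?B) (\<lambda>\<omega>. \<lambda>i\<in>{1..m}. scaled_row \<omega> i) = (\<Pi>\<^sub>M i\<in>{1..m}. gauss_on {1..n})"
    using rows_law by (simp add: scaled_row_def)
  also have "\<dots> = (\<Pi>\<^sub>M i\<in>{1..m}. distr M ?B (\<lambda>\<omega>. scaled_row \<omega> i))"
    unfolding scaled_row_def by (intro PiM_cong row_law[symmetric] refl) simp
  finally have rows: "indep_vars (\<lambda>_. ?B) (\<lambda>i \<omega>. scaled_row \<omega> i) {1..m}"
    using dims by (subst indep_vars_iff_distr_eq_PiM'[where M'="\<lambda>_. ?B"]) (auto intro: scaled_row_measurable)
  have pm: "(\<lambda>h. dotn n h u / sqrt (nsq n u)) \<in> borel_measurable ?B"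
    using dotn_measurable unfolding measurable_gauss_on by (intro borel_measurable_divide borel_measurable_const)
  show "indep_vars (\<lambda>_. borel) (\<lambda>i \<omega>. dotn n (scaled_row \<omega> i) u / sqrt (nsq n u)) {1..m}"
    using indep_vars_compose2[OF rows, of "\<lambda>_ h. dotn n h u / sqrt (nsq n u)" "\<lambda>_. borel"] pm by simp
  assume i: "i \<in> {1..m}"
  let ?a = "\<lambda>j. u j / sqrt (nsq n u)"
  have a: "\<exists>j\<in>{1..n}. ?a j \<noteq> 0"
  proof (rule ccontr)
    assume "\<not> ?thesis"
    then have "nsq n u = 0" using u by (auto simp: nsq_def)
    then show False using u by simp
  qed
  have "L2_set ?a {1..n} = 1"
    using u by (simp add: L2_set_def power_divide sum_divide_distrib[symmetric] nsq_def[symmetric])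
  then have d: "distributed (gauss_on {1..n}) lborel (\<lambda>h. \<Sum>j\<in>{1..n}. ?a j * h j) std_normal_density"
    using distributed_gauss_on_linear[OF _ a] by simp
  have eq: "(\<lambda>h. dotn n h u / sqrt (nsq n u)) = (\<lambda>h. \<Sum>j\<in>{1..n}. ?a j * h j)"
    by (simp add: dotn_def sum_divide_distrib mult.commute)
  have "distr M borel (\<lambda>\<omega>. dotn n (scaled_row \<omega> i) u / sqrt (nsq n u))
      = distr (distr M ?B (\<lambda>\<omega>. scaled_row \<omega> i)) borel (\<lambda>h. dotn n h u / sqrt (nsq n u))"
    using distr_distr[OF pm scaled_row_measurable[OF i]] by (simp add: comp_def)
  also have "\<dots> = distr (gauss_on {1..n}) borel (\<lambda>h. dotn n h u / sqrt (nsq n u))"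
    using row_law[OF i] by (simp add: scaled_row_def)
  also have "\<dots> = distr (gauss_on {1..n}) lborel (\<lambda>h. \<Sum>j\<in>{1..n}. ?a j * h j)"
    unfolding eq by (intro distr_cong) auto
  also have "\<dots> = std_normal" using d by (simp add: distributed_def)
  finally show "distr M borel (\<lambda>\<omega>. dotn n (scaled_row \<omega> i) u / sqrt (nsq n u)) = std_normal" .
qed

end

section \<open>The risk radius\<close>

lemma nsq_cong: "(\<And>j. j \<in> {1..n} \<Longrightarrow> t j = t' j) \<Longrightarrow> nsq n t = nsq n t'"
  unfolding nsq_def by (intro sum.cong) auto

lemma vdist_nsq: "(vdist n x y)\<^sup>2 = nsq n (\<lambda>i. x i - y i)"
  by (simp add: vdist_squared nsq_def)

lemma isoreg_self: "\<mu> \<in> monotone_cone n \<Longrightarrow> isoreg n \<mu> = \<mu>"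
  by (rule iso_eqI) auto

lemma vdist_sym: "vdist n x y = vdist n y x"
  unfolding vdist_def L2_set_def by (simp add: power2_commute)

lemma vdist_triangle: "vdist n x z \<le> vdist n x y + vdist n y z"
  using L2_set_triangle_ineq[of "\<lambda>i. x i - y i" "\<lambda>i. y i - z i" "{1..n}"] by (simp add: vdist_def)

definition blockwise_const :: "nat set set \<Rightarrow> (nat \<Rightarrow> real) \<Rightarrow> bool" where
  "blockwise_const P \<mu> \<longleftrightarrow> (\<forall>I\<in>P. \<mu> constant_on I)"

text \<open>Within a block \<open>\<mu>\<close> is constant, so the difference inherits the
  monotonicity of \<open>\<nu>\<close>. In this way differences to \<open>\<mu>\<close> enter the
  blockwise cone.\<close>

lemma mono_on_diff_const:
  assumes P: "interval_partition n P" and \<nu>: "\<nu> \<in> monotone_cone n" and \<mu>: "blockwise_const P \<mu>" and I: "I \<in> P"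
  shows "mono_on I (\<lambda>j. \<nu> j - \<mu> j)"
proof (rule mono_onI)
  fix r s assume rs: "r \<in> I" "s \<in> I" "r \<le> s"
  have "\<mu> r = \<mu> s" using \<mu> I rs by (auto simp: blockwise_const_def constant_on_def)
  moreover have "\<nu> r \<le> \<nu> s"
    using rs interval_partition_block(2)[OF P I] by (intro monotone_cone_le[OF \<nu>]) auto
  ultimately show "\<nu> r - \<mu> r \<le> \<nu> s - \<mu> s" by simp
qed

section \<open>Error of the projection of a perturbed signal\<close>

context
  fixes n :: nat and \<mu>0 :: "nat \<Rightarrow> real"
  assumes n: "1 \<le> n" and \<mu>0: "\<mu>0 \<in> monotone_cone n"
begin

definition perturbed_error :: "real \<Rightarrow> (nat \<Rightarrow> real) \<Rightarrow> real" where
  "perturbed_error w h = vdist n (isoreg n (\<lambda>i. \<mu>0 i + w * h i)) \<mu>0"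

lemma perturbed_error_nonneg: "0 \<le> perturbed_error w h"
  by (simp add: perturbed_error_def vdist_nonneg)

lemma perturbed_error_le: "perturbed_error w h \<le> \<bar>w\<bar> * sqrt (nsq n h)"
proof -
  have "perturbed_error w h = vdist n (isoreg n (\<lambda>i. \<mu>0 i + w * h i)) (isoreg n \<mu>0)"
    by (simp add: perturbed_error_def isoreg_self[OF \<mu>0])
  also have "\<dots> \<le> vdist n (\<lambda>i. \<mu>0 i + w * h i) \<mu>0" by (rule iso_nonexpansive)
  also have "\<dots> = \<bar>w\<bar> * sqrt (nsq n h)"
    by (simp add: vdist_def L2_set_def nsq_def power_mult_distrib real_sqrt_mult flip: sum_distrib_left)
  finally show ?thesis .
qed

lemma perturbed_error_lipschitz: "\<bar>perturbed_error w h - perturbed_error w' h\<bar> \<le> \<bar>w - w'\<bar> * sqrt (nsq n h)"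
proof -
  let ?p = "isoreg n (\<lambda>i. \<mu>0 i + w * h i)" and ?q = "isoreg n (\<lambda>i. \<mu>0 i + w' * h i)"
  have "\<bar>perturbed_error w h - perturbed_error w' h\<bar> \<le> vdist n ?p ?q"
    using vdist_triangle[of n ?p \<mu>0 ?q] vdist_triangle[of n ?q \<mu>0 ?p] vdist_sym[of n ?p ?q]
    by (simp add: perturbed_error_def)
  also have "\<dots> \<le> vdist n (\<lambda>i. \<mu>0 i + w * h i) (\<lambda>i. \<mu>0 i + w' * h i)" by (rule iso_nonexpansive)
  also have "\<dots> = \<bar>w - w'\<bar> * sqrt (nsq n h)"
    by (simp add: vdist_def L2_set_def nsq_def power_mult_distrib real_sqrt_mult flip: sum_distrib_left left_diff_distrib)
  finally show ?thesis .
qed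

text \<open>A difference of squares whose two factors are bounded by multiples of
  \<open>sqrt (nsq n h)\<close>. The bound is linear in the variance
  \<open>w\<^sup>2\<close>.\<close>

lemma perturbed_error_sq_diff:
  assumes "0 \<le> w" "w \<le> w'"
  shows "\<bar>(perturbed_error w' h)\<^sup>2 - (perturbed_error w h)\<^sup>2\<bar> \<le> (w'\<^sup>2 - w\<^sup>2) * nsq n h"
proof -
  have "\<bar>(perturbed_error w' h)\<^sup>2 - (perturbed_error w h)\<^sup>2\<bar>
      = \<bar>perturbed_error w' h - perturbed_error w h\<bar> * (perturbed_error w' h + perturbed_error w h)"
    using perturbed_error_nonneg[of w h] perturbed_error_nonneg[of w' h]
    by (simp add: power2_eq_square square_diff_square_factored abs_mult)
  also have "\<dots> \<le> (\<bar>w' - w\<bar> * sqrt (nsq n h)) * (\<bar>w'\<bar> * sqrt (nsq n h) + \<bar>w\<bar> * sqrt (nsq n h))"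
    using perturbed_error_nonneg nsq_nonneg
    by (intro mult_mono perturbed_error_lipschitz add_mono perturbed_error_le) (auto intro!: add_nonneg_nonneg)
  also have "\<dots> = (w'\<^sup>2 - w\<^sup>2) * (sqrt (nsq n h) * sqrt (nsq n h))"
    using assms by (simp add: power2_eq_square algebra_simps)
  also have "\<dots> = (w'\<^sup>2 - w\<^sup>2) * nsq n h" using nsq_nonneg[of n h] by simp
  finally show ?thesis .
qed

text \<open>The error relative to the noise level does not increase. With \<open>a = w / w'\<close>,
  the two variational inequalities, the second weighted by \<open>a\<close>, combine to
  \<open>(a * Q - P) * (Q - P) \<le> 0\<close>, which puts \<open>P\<close> between
  \<open>a * Q\<close> and \<open>Q\<close>.\<close>

lemma perturbed_error_ray:
  assumes w: "0 < w" "w < w'"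
  shows "w * perturbed_error w' h \<le> w' * perturbed_error w h"
proof -
  define p where "p = (\<lambda>i. isoreg n (\<lambda>i. \<mu>0 i + w * h i) i - \<mu>0 i)"
  define q where "q = (\<lambda>i. isoreg n (\<lambda>i. \<mu>0 i + w' * h i) i - \<mu>0 i)"
  define a where "a = w / w'"
  have a: "0 < a" "a < 1" "w = a * w'" using w by (auto simp: a_def)
  have "(\<Sum>i\<in>{1..n}. (\<mu>0 i + w * h i - isoreg n (\<lambda>i. \<mu>0 i + w * h i) i) *
     (isoreg n (\<lambda>i. \<mu>0 i + w' * h i) i - isoreg n (\<lambda>i. \<mu>0 i + w * h i) i)) \<le> 0"
    by (rule iso_variational[OF iso_in])
  then have 1: "(\<Sum>i\<in>{1..n}. (w * h i - p i) * (q i - p i)) \<le> 0" by (simp add: p_def q_def algebra_simps)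
  have "(\<Sum>i\<in>{1..n}. (\<mu>0 i + w' * h i - isoreg n (\<lambda>i. \<mu>0 i + w' * h i) i) *
     (isoreg n (\<lambda>i. \<mu>0 i + w * h i) i - isoreg n (\<lambda>i. \<mu>0 i + w' * h i) i)) \<le> 0"
    by (rule iso_variational[OF iso_in])
  then have 2: "(\<Sum>i\<in>{1..n}. (w' * h i - q i) * (p i - q i)) \<le> 0" by (simp add: p_def q_def algebra_simps)
  have "(\<Sum>i\<in>{1..n}. (w * h i - p i) * (q i - p i)) + a * (\<Sum>i\<in>{1..n}. (w' * h i - q i) * (p i - q i))
      = a * nsq n q + nsq n p - (1 + a) * dotn n p q"
    unfolding nsq_def dotn_def sum_distrib_left sum.distrib[symmetric] sum_subtractf[symmetric] a(3)
    by (intro sum.cong) (auto simp: power2_eq_square algebra_simps)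
  moreover have "a * (\<Sum>i\<in>{1..n}. (w' * h i - q i) * (p i - q i)) \<le> 0" using a 2 by (simp add: mult_nonneg_nonpos)
  ultimately have 3: "a * nsq n q + nsq n p \<le> (1 + a) * dotn n p q" using 1 by linarith
  define P Q where "P = sqrt (nsq n p)" and "Q = sqrt (nsq n q)"
  have PQ: "0 \<le> P" "0 \<le> Q" "P * P = nsq n p" "Q * Q = nsq n q" using nsq_nonneg by (auto simp: P_def Q_def)
  have "dotn n p q \<le> P * Q"
  proof -
    have "dotn n p q \<le> (\<Sum>i\<in>{1..n}. \<bar>p i\<bar> * \<bar>q i\<bar>)" unfolding dotn_def by (intro sum_mono) (metis abs_ge_self abs_mult)
    also have "\<dots> \<le> L2_set p {1..n} * L2_set q {1..n}" by (rule L2_set_mult_ineq)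
    finally show ?thesis by (simp add: P_def Q_def sqrt_nsq)
  qed
  then have "(1 + a) * dotn n p q \<le> (1 + a) * (P * Q)" using a by (intro mult_left_mono) auto
  with 3 have "(a * Q - P) * (Q - P) \<le> 0" unfolding PQ(3,4)[symmetric] by (simp add: algebra_simps)
  then have aQ: "a * Q \<le> P"
  proof (cases "P < Q")
    case True
    then show ?thesis using \<open>(a * Q - P) * (Q - P) \<le> 0\<close> by (simp add: mult_le_0_iff)
  next
    case False
    have "a * Q \<le> 1 * Q" using a PQ by (intro mult_right_mono) auto
    then show ?thesis using False by simp
  qed
  have e: "perturbed_error w h = P" "perturbed_error w' h = Q"
    by (simp_all add: perturbed_error_def vdist_def P_def Q_def sqrt_nsq p_def q_def)
  show ?thesis unfolding e using mult_left_mono[OF aQ, of w'] w by (simp add: a_def)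
qed

text \<open>Testing the variational inequality at \<open>\<mu>\<close> leaves a cross term between
  the noise and a blockwise monotone difference. It is bounded by the block energy plus the squared
  length of the difference, and the latter also occurs on the left and cancels.\<close>

lemma perturbed_error_oracle:
  assumes w: "0 \<le> w" and P: "interval_partition n P" and \<mu>: "\<mu> \<in> monotone_cone n" "blockwise_const P \<mu>"
  shows "(perturbed_error w h)\<^sup>2 \<le> (vdist n \<mu> \<mu>0)\<^sup>2 + w\<^sup>2 * block_energy P h"
proof -
  let ?p = "isoreg n (\<lambda>i. \<mu>0 i + w * h i)"
  let ?W = "\<lambda>j. ?p j - \<mu> j"
  have "(\<Sum>i\<in>{1..n}. (\<mu>0 i + w * h i - ?p i) * (\<mu> i - ?p i)) \<le> 0" by (rule iso_variational[OF \<mu>(1)])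
  moreover have "(\<Sum>i\<in>{1..n}. (?p i - \<mu>0 i)\<^sup>2) + (\<Sum>i\<in>{1..n}. (?p i - \<mu> i)\<^sup>2)
     = (\<Sum>i\<in>{1..n}. (\<mu> i - \<mu>0 i)\<^sup>2) + 2 * (\<Sum>i\<in>{1..n}. (w * h i) * ?W i)
       + 2 * (\<Sum>i\<in>{1..n}. (\<mu>0 i + w * h i - ?p i) * (\<mu> i - ?p i))"
    unfolding sum_distrib_left sum.distrib[symmetric] by (intro sum.cong) (auto simp: power2_eq_square algebra_simps)
  moreover have "2 * (\<Sum>i\<in>{1..n}. (w * h i) * ?W i) \<le> w\<^sup>2 * block_energy P h + nsq n ?W"
  proof -
    have "(\<Sum>i\<in>{1..n}. (w * h i) * ?W i) \<le> sqrt (block_energy P (\<lambda>i. w * h i)) * sqrt (nsq n ?W)"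
      unfolding nsq_def by (intro inner_le_block_energy[OF P] mono_on_diff_const[OF P iso_in \<mu>(2)])
    moreover have "2 * (sqrt (block_energy P (\<lambda>i. w * h i)) * sqrt (nsq n ?W)) \<le> block_energy P (\<lambda>i. w * h i) + nsq n ?W"
      using sum_squares_bound[of "sqrt (block_energy P (\<lambda>i. w * h i))" "sqrt (nsq n ?W)"]
      by (simp add: block_energy_nonneg nsq_nonneg mult.assoc)
    ultimately show ?thesis using block_energy_scale[OF w, of P h] by linarith
  qed
  ultimately show ?thesis unfolding perturbed_error_def vdist_squared nsq_def by linarith
qed

lemma perturbed_error_measurable: "perturbed_error w \<in> borel_measurable (gauss_on {1..n})"
proof -
  have "(\<lambda>h. \<lambda>i\<in>{1..n}. \<mu>0 i + w * h i) \<in> measurable (\<Pi>\<^sub>M i\<in>{1..n}. borel) (\<Pi>\<^sub>M i\<in>{1..n}. borel)"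
    by (intro measurable_restrict borel_measurable_add borel_measurable_times borel_measurable_const measurable_component_singleton)
  then have "(\<lambda>h. isoreg n (\<lambda>i\<in>{1..n}. \<mu>0 i + w * h i) j) \<in> borel_measurable (\<Pi>\<^sub>M i\<in>{1..n}. borel)" if "j \<in> {1..n}" for j
    by (rule measurable_compose[OF _ borel_measurable_iso[OF that]])
  moreover have "isoreg n (\<lambda>i\<in>{1..n}. \<mu>0 i + w * h i) = isoreg n (\<lambda>i. \<mu>0 i + w * h i)" for h
    by (rule iso_cong) simp
  ultimately have "(\<lambda>h. isoreg n (\<lambda>i. \<mu>0 i + w * h i) j) \<in> borel_measurable (gauss_on {1..n})" if "j \<in> {1..n}" for j
    using that by (simp add: measurable_gauss_on)
  then have "(\<lambda>h. \<Sum>j\<in>{1..n}. (isoreg n (\<lambda>i. \<mu>0 i + w * h i) j - \<mu>0 j)\<^sup>2) \<in> borel_measurable (gauss_on {1..n})"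
    by (intro borel_measurable_sum borel_measurable_power borel_measurable_diff borel_measurable_const)
  then show ?thesis unfolding perturbed_error_def[abs_def] vdist_def L2_set_def
    by (rule measurable_compose) measurable
qed

section \<open>Risk as a function of the noise variance\<close>

lemma integral_nsq: "has_bochner_integral (gauss_on {1..n}) (nsq n) (real n)"
proof -
  have "has_bochner_integral (gauss_on {1..n}) (\<lambda>h. (h j)\<^sup>2) 1" if j: "j \<in> {1..n}" for j
  proof -
    have "dotn n h (\<lambda>i. of_bool (i = j)) = h j" for h
      using j by (simp add: dotn_def of_bool_def if_distrib[where f="\<lambda>x. _ * x"] cong: if_cong)
    moreover have "nsq n (\<lambda>i. of_bool (i = j)) = 1"
      using j by (simp add: nsq_def of_bool_def if_distrib[where f="\<lambda>x. x ^ 2"] cong: if_cong)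
    ultimately show ?thesis using dotn_moments(1)[of n "\<lambda>i. of_bool (i = j)"] by simp
  qed
  then have "has_bochner_integral (gauss_on {1..n}) (\<lambda>h. \<Sum>j\<in>{1..n}. (h j)\<^sup>2) (\<Sum>j\<in>{1..n}. 1)"
    by (intro has_bochner_integral_sum) auto
  then show ?thesis by (simp add: nsq_def[abs_def])
qed

text \<open>The argument is the variance, not the standard deviation: in this variable the risk is
  Lipschitz, and its quotient by the variable is nonincreasing.\<close>

definition perturbed_risk :: "real \<Rightarrow> real" where
  "perturbed_risk s = (\<integral>h. (perturbed_error (sqrt s) h)\<^sup>2 \<partial>gauss_on {1..n})"

lemma perturbed_error_integrable: "integrable (gauss_on {1..n}) (\<lambda>h. (perturbed_error w h)\<^sup>2)"
proof (rule Bochner_Integration.integrable_bound)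
  show "integrable (gauss_on {1..n}) (\<lambda>h. w\<^sup>2 * nsq n h)"
    using integral_nsq by (simp add: has_bochner_integral_iff)
  show "(\<lambda>h. (perturbed_error w h)\<^sup>2) \<in> borel_measurable (gauss_on {1..n})"
    by (intro borel_measurable_power perturbed_error_measurable)
  have "(perturbed_error w h)\<^sup>2 \<le> w\<^sup>2 * nsq n h" for h
    using power_mono[OF perturbed_error_le[of w h] perturbed_error_nonneg, of 2]
    by (simp add: power_mult_distrib nsq_nonneg)
  then show "AE h in gauss_on {1..n}. norm ((perturbed_error w h)\<^sup>2) \<le> norm (w\<^sup>2 * nsq n h)"
    by (intro AE_I2) (simp add: nsq_nonneg)
qed

lemma perturbed_risk_lipschitz:
  assumes "0 \<le> s" "s \<le> s'"
  shows "\<bar>perturbed_risk s' - perturbed_risk s\<bar> \<le> (s' - s) * real n"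
proof -
  have "\<bar>perturbed_risk s' - perturbed_risk s\<bar>
     = \<bar>\<integral>h. (perturbed_error (sqrt s') h)\<^sup>2 - (perturbed_error (sqrt s) h)\<^sup>2 \<partial>gauss_on {1..n}\<bar>"
    unfolding perturbed_risk_def by (subst Bochner_Integration.integral_diff) (auto intro: perturbed_error_integrable)
  also have "\<dots> \<le> (\<integral>h. \<bar>(perturbed_error (sqrt s') h)\<^sup>2 - (perturbed_error (sqrt s) h)\<^sup>2\<bar> \<partial>gauss_on {1..n})"
    by (rule integral_abs_bound)
  also have "\<dots> \<le> (\<integral>h. (s' - s) * nsq n h \<partial>gauss_on {1..n})"
  proof (rule integral_mono)
    show "integrable (gauss_on {1..n}) (\<lambda>h. \<bar>(perturbed_error (sqrt s') h)\<^sup>2 - (perturbed_error (sqrt s) h)\<^sup>2\<bar>)"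
      by (intro integrable_abs Bochner_Integration.integrable_diff perturbed_error_integrable)
    show "integrable (gauss_on {1..n}) (\<lambda>h. (s' - s) * nsq n h)"
      using integral_nsq by (simp add: has_bochner_integral_iff)
    show "\<bar>(perturbed_error (sqrt s') h)\<^sup>2 - (perturbed_error (sqrt s) h)\<^sup>2\<bar> \<le> (s' - s) * nsq n h" for h
      using perturbed_error_sq_diff[of "sqrt s" "sqrt s'" h] assms by simp
  qed
  also have "\<dots> = (s' - s) * real n" using integral_nsq by (simp add: has_bochner_integral_iff)
  finally show ?thesis .
qed

lemma perturbed_risk_ray:
  assumes s: "0 < s" "s < s'"
  shows "s * perturbed_risk s' \<le> s' * perturbed_risk s"
proof -
  have "s * perturbed_risk s' = (\<integral>h. s * (perturbed_error (sqrt s') h)\<^sup>2 \<partial>gauss_on {1..n})"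
    by (simp add: perturbed_risk_def)
  also have "\<dots> \<le> (\<integral>h. s' * (perturbed_error (sqrt s) h)\<^sup>2 \<partial>gauss_on {1..n})"
  proof (intro integral_mono integrable_mult_right perturbed_error_integrable)
    fix h
    have "(sqrt s * perturbed_error (sqrt s') h)\<^sup>2 \<le> (sqrt s' * perturbed_error (sqrt s) h)\<^sup>2"
      using s by (intro power_mono perturbed_error_ray) (auto simp: perturbed_error_nonneg)
    then show "s * (perturbed_error (sqrt s') h)\<^sup>2 \<le> s' * (perturbed_error (sqrt s) h)\<^sup>2"
      using s by (simp add: power_mult_distrib)
  qed
  also have "\<dots> = s' * perturbed_risk s" by (simp add: perturbed_risk_def)
  finally show ?thesis .
qed

lemma perturbed_risk_nonneg: "0 \<le> perturbed_risk s"
  unfolding perturbed_risk_def by (intro Bochner_Integration.integral_nonneg) auto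

text \<open>With vanishing risk the projection would equal \<open>\<mu>0\<close> almost surely. The
  residual always sums to zero, so the sum of the Gaussian coordinates would vanish as well, which
  has probability zero.\<close>

lemma perturbed_risk_pos:
  assumes s: "0 < s" shows "0 < perturbed_risk s"
proof (rule ccontr)
  interpret prob_space "gauss_on {1..n}" by (rule prob_space_gauss_on)
  assume "\<not> ?thesis"
  then have "perturbed_risk s = 0" using perturbed_risk_nonneg[of s] by simp
  then have "AE h in gauss_on {1..n}. (perturbed_error (sqrt s) h)\<^sup>2 = 0"
    unfolding perturbed_risk_def
    by (subst (asm) integral_nonneg_eq_0_iff_AE) (auto intro: perturbed_error_integrable)
  moreover have "AE h in gauss_on {1..n}. (\<Sum>i\<in>{1..n}. 1 * h i) \<noteq> 0"
    using n by (intro gauss_on_linear_AE_nonzero) (auto intro: bexI[of _ 1])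
  ultimately have "AE h in gauss_on {1..n}. False"
  proof eventually_elim
    case (elim h)
    let ?x = "\<lambda>i. \<mu>0 i + sqrt s * h i"
    have "nsq n (\<lambda>i. isoreg n ?x i - \<mu>0 i) = 0"
      using elim(1) unfolding perturbed_error_def vdist_nsq .
    then have "isoreg n ?x i = \<mu>0 i" if "i \<in> {1..n}" for i using nsq_zero_imp[OF _ that, of "\<lambda>i. isoreg n ?x i - \<mu>0 i"] by simp
    then have "(\<Sum>i\<in>{1..n}. ?x i - isoreg n ?x i) = (\<Sum>i\<in>{1..n}. sqrt s * h i)"
      by (intro sum.cong) auto
    moreover have "(\<Sum>i\<in>{1..n}. ?x i - isoreg n ?x i) = 0"
      using iso_gap_total[of n ?x] by (simp add: iso_gap_def)
    ultimately have "sqrt s * (\<Sum>i\<in>{1..n}. 1 * h i) = 0" by (simp add: sum_distrib_left)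
    then show False using s elim(2) by simp
  qed
  then show False by simp
qed

lemma perturbed_risk_oracle:
  assumes s: "0 \<le> s" and P: "interval_partition n P" and \<mu>: "\<mu> \<in> monotone_cone n" "blockwise_const P \<mu>"
  shows "perturbed_risk s \<le> (vdist n \<mu> \<mu>0)\<^sup>2 + s * harm_dim P"
proof -
  interpret prob_space "gauss_on {1..n}" by (rule prob_space_gauss_on)
  have "perturbed_risk s \<le> (\<integral>h. (vdist n \<mu> \<mu>0)\<^sup>2 + s * block_energy P h \<partial>gauss_on {1..n})"
    unfolding perturbed_risk_def
  proof (rule integral_mono[OF perturbed_error_integrable])
    show "integrable (gauss_on {1..n}) (\<lambda>h. (vdist n \<mu> \<mu>0)\<^sup>2 + s * block_energy P h)"
      using integral_block_energy_le(1)[OF P] by auto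
    show "(perturbed_error (sqrt s) h)\<^sup>2 \<le> (vdist n \<mu> \<mu>0)\<^sup>2 + s * block_energy P h" for h
      using perturbed_error_oracle[OF _ P \<mu>, of "sqrt s" h] s by simp
  qed
  also have "\<dots> = (vdist n \<mu> \<mu>0)\<^sup>2 + s * (\<integral>h. block_energy P h \<partial>gauss_on {1..n})"
    using integral_block_energy_le(1)[OF P] by (simp add: prob_space)
  also have "\<dots> \<le> (vdist n \<mu> \<mu>0)\<^sup>2 + s * harm_dim P"
    using integral_block_energy_le(2)[OF P] s by (intro add_left_mono mult_left_mono)
  finally show ?thesis .
qed

lemma perturbed_risk_continuous: "continuous_on {0..} perturbed_risk"
proof (rule lipschitz_on_continuous_on)
  show "(real n)-lipschitz_on {0..} perturbed_risk"
  proof (rule lipschitz_onI)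
    fix s s' :: real assume "s \<in> {0..}" "s' \<in> {0..}"
    then show "dist (perturbed_risk s) (perturbed_risk s') \<le> real n * dist s s'"
      using perturbed_risk_lipschitz[of s s'] perturbed_risk_lipschitz[of s' s]
      by (cases "s \<le> s'") (auto simp: dist_real_def mult.commute abs_minus_commute)
  qed simp
qed

section \<open>The fixed point equation of the risk radius\<close>

lemma risk_equation_iff:
  assumes m: "1 \<le> m"
  shows "(\<integral>h. (vdist n (metric_proj n (monotone_cone n) (\<lambda>i\<in>{1..n}. \<mu>0 i + omega \<sigma> (real m / real n) r * h i)) \<mu>0)\<^sup>2
        \<partial>std_gaussian n) / real n = r\<^sup>2
     \<longleftrightarrow> perturbed_risk ((r\<^sup>2 + \<sigma>\<^sup>2) * n / m) = r\<^sup>2 * n"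
proof -
  have mp: "metric_proj n (monotone_cone n) (\<lambda>i\<in>{1..n}. \<mu>0 i + w * h i) = isoreg n (\<lambda>i. \<mu>0 i + w * h i)" for w h
    unfolding isoreg_def[symmetric] by (rule iso_cong) simp
  have om: "omega \<sigma> (real m / real n) r = sqrt ((r\<^sup>2 + \<sigma>\<^sup>2) * n / m)" by (simp add: omega_def)
  have "(\<integral>h. (vdist n (metric_proj n (monotone_cone n) (\<lambda>i\<in>{1..n}. \<mu>0 i + omega \<sigma> (real m / real n) r * h i)) \<mu>0)\<^sup>2
        \<partial>std_gaussian n) = perturbed_risk ((r\<^sup>2 + \<sigma>\<^sup>2) * n / m)"
    by (simp only: mp om perturbed_risk_def perturbed_error_def std_gaussian_eq)
  then show ?thesis using n by (simp add: divide_eq_eq)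
qed

text \<open>The radius is a definite description, so existence and uniqueness are shown. In the
  variable \<open>s = (r\<^sup>2 + \<sigma>\<^sup>2) * n / m\<close> the equation reads
  \<open>perturbed_risk s = s * m - n * \<sigma>\<^sup>2\<close>. The right side has slope
  \<open>m\<close>, the left side stays below a line of slope \<open>harm n < m\<close>, and the two
  meet by the intermediate value theorem. Uniqueness comes from
  \<open>perturbed_risk_ray\<close>.\<close>

lemma risk_radius_solution:
  assumes \<sigma>: "0 < \<sigma>" and m: "1 + ln (real n) < real m"
  shows "perturbed_risk (((risk_radius m n \<sigma> (monotone_cone n) \<mu>0)\<^sup>2 + \<sigma>\<^sup>2) * n / m)
     = (risk_radius m n \<sigma> (monotone_cone n) \<mu>0)\<^sup>2 * n"
proof -
  have m1: "1 \<le> m" using m n ln_ge_zero[of "real n"] by linarith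
  have pos: "0 < real m" "0 < real n" using m1 n by auto
  \<comment> \<open>One block and the zero vector give the crudest oracle bound, of slope at most
    \<open>1 + ln n\<close>.\<close>
  define P0 where "P0 = {{1..n}}"
  define \<mu>1 where "\<mu>1 = (\<lambda>i\<in>{1..n}. 0::real)"
  have P0: "interval_partition n P0" using n by (auto simp: interval_partition_def P0_def partition_on_def disjoint_def)
  have \<mu>1: "\<mu>1 \<in> monotone_cone n" "blockwise_const P0 \<mu>1"
    by (auto simp: \<mu>1_def P0_def blockwise_const_def constant_on_def mono_on_def intro!: restrict_monotone_cone)
  define C where "C = (vdist n \<mu>1 \<mu>0)\<^sup>2"
  define H where "H = harm_dim P0"
  have H: "H < real m" using harm_le_ln[OF n] m by (simp add: H_def harm_dim_def P0_def)
  have up: "perturbed_risk s \<le> C + s * H" if "0 \<le> s" for s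
    unfolding C_def H_def by (rule perturbed_risk_oracle[OF that P0 \<mu>1])
  define a where "a = \<sigma>\<^sup>2 * n / m"
  have a: "0 < a" using \<sigma> pos by (simp add: a_def)
  define f where "f = (\<lambda>s. s * real m - real n * \<sigma>\<^sup>2 - perturbed_risk s)"
  \<comment> \<open>At this point \<open>s * m - n * \<sigma>\<^sup>2\<close> has overtaken the line
    \<open>C + s * H\<close>.\<close>
  define b where "b = a + (n * \<sigma>\<^sup>2 + C + a * H) / (m - H)"
  have C0: "0 \<le> C" "0 \<le> H" by (auto simp: C_def H_def harm_dim_nonneg)
  have b: "a \<le> b" using a H C0 by (simp add: b_def)
  have fa: "f a \<le> 0" using perturbed_risk_nonneg[of a] pos by (simp add: f_def a_def)
  have "(b - a) * (m - H) = n * \<sigma>\<^sup>2 + C + a * H" using H by (simp add: b_def)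
  moreover have "0 \<le> a * m" using a by simp
  ultimately have "n * \<sigma>\<^sup>2 + C + b * H \<le> b * m" by (simp add: algebra_simps)
  then have fb: "0 \<le> f b" using up[of b] a b by (simp add: f_def)
  have "continuous_on {a..b} f" unfolding f_def
    using a by (intro continuous_intros continuous_on_subset[OF perturbed_risk_continuous]) auto
  from IVT'[OF fa fb b this] obtain s where s: "a \<le> s" "f s = 0" by auto
  \<comment> \<open>This excludes \<open>r = 0\<close>: at \<open>a\<close> the equation would say
    that the risk vanishes.\<close>
  have "s \<noteq> a"
  proof
    assume "s = a"
    then have "perturbed_risk a = 0" using s(2) pos by (simp add: f_def a_def)
    then show False using perturbed_risk_pos[OF a] by simp
  qed
  with s have s: "a < s" "f s = 0" by auto
  define r where "r = sqrt (s * m / n - \<sigma>\<^sup>2)"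
  have "0 < s * m / n - \<sigma>\<^sup>2" using s(1) pos by (simp add: a_def field_simps)
  then have r: "0 < r" "r\<^sup>2 = s * m / n - \<sigma>\<^sup>2" by (auto simp: r_def)
  have req: "perturbed_risk ((r\<^sup>2 + \<sigma>\<^sup>2) * n / m) = r\<^sup>2 * n"
  proof -
    have "(r\<^sup>2 + \<sigma>\<^sup>2) * n / m = s" "r\<^sup>2 * n = s * m - n * \<sigma>\<^sup>2" using pos by (simp_all add: r(2) field_simps)
    then show ?thesis using s(2) by (simp add: f_def)
  qed
  have uniq: False if rr: "0 < r1" "r1 < r2" "perturbed_risk ((r1\<^sup>2 + \<sigma>\<^sup>2) * n / m) = r1\<^sup>2 * n"
      "perturbed_risk ((r2\<^sup>2 + \<sigma>\<^sup>2) * n / m) = r2\<^sup>2 * n" for r1 r2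
  proof -
    have sq: "r1\<^sup>2 < r2\<^sup>2" using rr by (intro power_strict_mono) auto
    \<comment> \<open>In the ray inequality for two solutions the terms with
      \<open>r1\<^sup>2 * r2\<^sup>2\<close> cancel, and positivity of \<open>\<sigma>\<close>
      decides.\<close>
    have "(r1\<^sup>2 + \<sigma>\<^sup>2) * n / m * (r2\<^sup>2 * n) \<le> (r2\<^sup>2 + \<sigma>\<^sup>2) * n / m * (r1\<^sup>2 * n)"
      unfolding rr(3,4)[symmetric] using sq pos \<sigma>
      by (intro perturbed_risk_ray divide_strict_right_mono mult_strict_right_mono)
         (auto intro!: divide_pos_pos mult_pos_pos add_nonneg_pos)
    then have "(n * n / m) * (\<sigma>\<^sup>2 * r2\<^sup>2) \<le> (n * n / m) * (\<sigma>\<^sup>2 * r1\<^sup>2)" by (simp add: algebra_simps add_divide_distrib)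
    then have "\<sigma>\<^sup>2 * r2\<^sup>2 \<le> \<sigma>\<^sup>2 * r1\<^sup>2" using pos by (subst (asm) mult_le_cancel_left_pos) auto
    then show False using sq \<sigma> by simp
  qed
  let ?Q = "\<lambda>r. 0 < r \<and> perturbed_risk ((r\<^sup>2 + \<sigma>\<^sup>2) * n / m) = r\<^sup>2 * n"
  have "\<exists>!r. ?Q r"
  proof (rule ex1I[of _ r])
    show "?Q r" using r req by simp
    show "r' = r" if "?Q r'" for r' using uniq[of r r'] uniq[of r' r] that r req by (cases r r' rule: linorder_cases) auto
  qed
  from theI'[OF this] show ?thesis unfolding risk_radius_def risk_equation_iff[OF m1] by simp
qed

text \<open>The oracle bound is inserted into the fixed point equation. The part proportional to
  \<open>r\<^sup>2\<close> has the factor \<open>D / m \<le> 1/2\<close> and is absorbed, which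
  doubles the rest.\<close>

lemma risk_radius_le:
  assumes \<sigma>: "0 < \<sigma>" and m: "1 + ln (real n) < real m"
    and P: "interval_partition n P" and \<mu>: "\<mu> \<in> monotone_cone n" "blockwise_const P \<mu>"
    and D: "harm_dim P \<le> D" "D \<le> real m / 2"
  shows "(risk_radius m n \<sigma> (monotone_cone n) \<mu>0)\<^sup>2 \<le> 2 * ((vdist n \<mu> \<mu>0)\<^sup>2 / n + \<sigma>\<^sup>2 * D / m)"
proof -
  define r where "r = risk_radius m n \<sigma> (monotone_cone n) \<mu>0"
  have "0 \<le> ln (real n)" using n by simp
  with m n have pos: "0 < real m" "0 < real n" by linarith+
  have "r\<^sup>2 * n = perturbed_risk ((r\<^sup>2 + \<sigma>\<^sup>2) * n / m)" unfolding r_def by (rule risk_radius_solution[OF \<sigma> m, symmetric])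
  also have "\<dots> \<le> (vdist n \<mu> \<mu>0)\<^sup>2 + (r\<^sup>2 + \<sigma>\<^sup>2) * n / m * harm_dim P"
    using pos by (intro perturbed_risk_oracle P \<mu>) auto
  also have "\<dots> \<le> (vdist n \<mu> \<mu>0)\<^sup>2 + (r\<^sup>2 + \<sigma>\<^sup>2) * n / m * D"
    using pos D(1) by (intro add_left_mono mult_left_mono) auto
  finally have "r\<^sup>2 \<le> (vdist n \<mu> \<mu>0)\<^sup>2 / n + (r\<^sup>2 + \<sigma>\<^sup>2) * D / m" using pos by (simp add: field_simps)
  also have "\<dots> = (vdist n \<mu> \<mu>0)\<^sup>2 / n + \<sigma>\<^sup>2 * D / m + r\<^sup>2 * (D / m)" by (simp add: field_simps add_divide_distrib)
  also have "r\<^sup>2 * (D / m) \<le> r\<^sup>2 * (1 / 2)" using D(2) pos by (intro mult_left_mono) (auto simp: field_simps)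
  finally show ?thesis by (simp add: r_def)
qed

end

section \<open>The basic inequality\<close>

lemma dotn_cong_right: "(\<And>j. j \<in> {1..n} \<Longrightarrow> t j = t' j) \<Longrightarrow> dotn n h t = dotn n h t'"
  unfolding dotn_def by (intro sum.cong) auto

lemma sq_loss_eq:
  "sq_loss m n X (response n X \<xi> \<mu>0) \<mu> \<omega>
    = (\<Sum>i\<in>{1..m}. (\<xi> i \<omega> - dotn n (\<lambda>j. X i j \<omega>) (\<lambda>j. \<mu> j - \<mu>0 j))\<^sup>2) / real m"
proof -
  have "response n X \<xi> \<mu>0 \<omega> i - (\<Sum>j\<in>{1..n}. X i j \<omega> * \<mu> j) = \<xi> i \<omega> - dotn n (\<lambda>j. X i j \<omega>) (\<lambda>j. \<mu> j - \<mu>0 j)" for i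
    by (simp add: response_def dotn_def right_diff_distrib sum_subtractf)
  then show ?thesis by (simp add: sq_loss_def L2_set_squared)
qed

text \<open>The estimator is compared with the point at fraction \<open>\<theta>\<close> on the way
  to \<open>\<mu>\<close>, and the result is divided by \<open>\<theta>\<close>. Comparison with
  \<open>\<mu>\<close> itself (\<open>\<theta> = 1\<close>) would lose the quadratic term in
  \<open>\<mu>h - \<mu>\<close>; a small \<open>\<theta>\<close> keeps nearly all of it at the price
  \<open>z / \<theta>\<close>.\<close>

lemma near_minimizer_basic_inequality:
  fixes z :: real
  assumes m: "1 \<le> m" and \<mu>h: "\<mu>h \<in> monotone_cone n" and \<mu>: "\<mu> \<in> monotone_cone n" and \<theta>: "0 < \<theta>" "\<theta> \<le> 1"
    and near: "sq_loss m n X (response n X \<xi> \<mu>0) \<mu>h \<omega> \<le> (INF \<nu>\<in>monotone_cone n. sq_loss m n X (response n X \<xi> \<mu>0) \<nu> \<omega>) + z"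
  defines "Q \<equiv> \<lambda>t. (\<Sum>i\<in>{1..m}. (dotn n (\<lambda>j. X i j \<omega>) t)\<^sup>2) / real m"
  shows "Q (\<lambda>j. \<mu>h j - \<mu>0 j) + (1 - \<theta>) * Q (\<lambda>j. \<mu>h j - \<mu> j)
    \<le> Q (\<lambda>j. \<mu> j - \<mu>0 j) + 2 * (\<Sum>i\<in>{1..m}. \<xi> i \<omega> * dotn n (\<lambda>j. X i j \<omega>) (\<lambda>j. \<mu>h j - \<mu> j)) / real m + z / \<theta>"
proof -
  let ?L = "\<lambda>\<nu>. sq_loss m n X (response n X \<xi> \<mu>0) \<nu> \<omega>"
  define \<mu>t where "\<mu>t = (\<lambda>j\<in>{1..n}. (1 - \<theta>) * \<mu>h j + \<theta> * \<mu> j)"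
  have "\<mu>t \<in> monotone_cone n"
  proof (rule monotone_coneI)
    fix i j :: nat assume ij: "1 \<le> i" "i \<le> j" "j \<le> n"
    have "(1-\<theta>) * \<mu>h i + \<theta> * \<mu> i \<le> (1-\<theta>) * \<mu>h j + \<theta> * \<mu> j"
      using \<theta> monotone_cone_le[OF \<mu>h ij] monotone_cone_le[OF \<mu> ij] by (intro add_mono mult_left_mono) auto
    then show "\<mu>t i \<le> \<mu>t j" using ij by (simp add: \<mu>t_def)
  qed (auto simp: \<mu>t_def)
  moreover have "bdd_below (?L ` monotone_cone n)"
    by (intro bdd_belowI2[where m=0]) (simp add: sq_loss_def)
  ultimately have "(INF \<nu>\<in>monotone_cone n. ?L \<nu>) \<le> ?L \<mu>t" by (intro cINF_lower)
  with near have le: "?L \<mu>h \<le> ?L \<mu>t + z" by simp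
  define x where "x = (\<lambda>i t. dotn n (\<lambda>j. X i j \<omega>) t)"
  define v u w where "v = (\<lambda>j. \<mu>h j - \<mu>0 j)" and "u = (\<lambda>j. \<mu> j - \<mu>0 j)" and "w = (\<lambda>j. \<mu>h j - \<mu> j)"
  have xt: "x i (\<lambda>j. \<mu>t j - \<mu>0 j) = (1 - \<theta>) * x i v + \<theta> * x i u" for i
  proof -
    have "x i (\<lambda>j. \<mu>t j - \<mu>0 j) = x i (\<lambda>j. (1 - \<theta>) * v j + \<theta> * u j)"
      unfolding x_def by (intro dotn_cong_right) (simp add: \<mu>t_def v_def u_def algebra_simps)
    then show ?thesis by (simp add: x_def dotn_def algebra_simps sum.distrib sum_distrib_left sum_subtractf)
  qed
  have xw: "x i w = x i v - x i u" for i
    by (simp add: x_def dotn_def v_def u_def w_def algebra_simps sum_subtractf)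
  have Lh: "?L \<mu>h * m = (\<Sum>i\<in>{1..m}. (\<xi> i \<omega> - x i v)\<^sup>2)"
    using m unfolding sq_loss_eq x_def v_def by simp
  have Lt: "?L \<mu>t * m = (\<Sum>i\<in>{1..m}. (\<xi> i \<omega> - ((1 - \<theta>) * x i v + \<theta> * x i u))\<^sup>2)"
    using m unfolding sq_loss_eq by (simp add: xt[unfolded x_def] x_def)
  have "(\<Sum>i\<in>{1..m}. (\<xi> i \<omega> - x i v)\<^sup>2) \<le> (\<Sum>i\<in>{1..m}. (\<xi> i \<omega> - ((1 - \<theta>) * x i v + \<theta> * x i u))\<^sup>2) + z * m"
    using mult_right_mono[OF le, of "real m"] Lh Lt by (simp add: distrib_right)
  \<comment> \<open>Expansion of the quadratic loss along the segment; the last term carries the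
    curvature.\<close>
  also have "(\<Sum>i\<in>{1..m}. (\<xi> i \<omega> - ((1 - \<theta>) * x i v + \<theta> * x i u))\<^sup>2)
     = (\<Sum>i\<in>{1..m}. (\<xi> i \<omega> - x i v)\<^sup>2)
       + \<theta> * ((\<Sum>i\<in>{1..m}. (x i u)\<^sup>2) + 2 * (\<Sum>i\<in>{1..m}. \<xi> i \<omega> * x i w) - (\<Sum>i\<in>{1..m}. (x i v)\<^sup>2) - (1 - \<theta>) * (\<Sum>i\<in>{1..m}. (x i w)\<^sup>2))"
    unfolding sum_distrib_left sum.distrib[symmetric] sum_subtractf[symmetric] xw
    by (intro sum.cong refl) (simp add: power2_eq_square algebra_simps)
  finally have "0 \<le> \<theta> * ((\<Sum>i\<in>{1..m}. (x i u)\<^sup>2) + 2 * (\<Sum>i\<in>{1..m}. \<xi> i \<omega> * x i w) - (\<Sum>i\<in>{1..m}. (x i v)\<^sup>2) - (1 - \<theta>) * (\<Sum>i\<in>{1..m}. (x i w)\<^sup>2) + z / \<theta> * m)"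
    using \<theta> by (simp add: algebra_simps)
  then have "0 \<le> (\<Sum>i\<in>{1..m}. (x i u)\<^sup>2) + 2 * (\<Sum>i\<in>{1..m}. \<xi> i \<omega> * x i w) - (\<Sum>i\<in>{1..m}. (x i v)\<^sup>2) - (1 - \<theta>) * (\<Sum>i\<in>{1..m}. (x i w)\<^sup>2) + z / \<theta> * m"
    using \<theta> by (simp add: zero_le_mult_iff)
  then have "0 \<le> ((\<Sum>i\<in>{1..m}. (x i u)\<^sup>2) + 2 * (\<Sum>i\<in>{1..m}. \<xi> i \<omega> * x i w) - (\<Sum>i\<in>{1..m}. (x i v)\<^sup>2) - (1 - \<theta>) * (\<Sum>i\<in>{1..m}. (x i w)\<^sup>2) + z / \<theta> * m) / m"
    by simp
  then have "0 \<le> (\<Sum>i\<in>{1..m}. (x i u)\<^sup>2) / m + 2 * (\<Sum>i\<in>{1..m}. \<xi> i \<omega> * x i w) / m - (\<Sum>i\<in>{1..m}. (x i v)\<^sup>2) / m - (1 - \<theta>) * ((\<Sum>i\<in>{1..m}. (x i w)\<^sup>2) / m) + z / \<theta>"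
    using m by (simp add: add_divide_distrib diff_divide_distrib)
  then show ?thesis unfolding Q_def v_def[symmetric] u_def[symmetric] w_def[symmetric] x_def by linarith
qed

text \<open>\<open>Nv\<close>, \<open>Nw\<close>, \<open>Nu\<close> stand for the squared lengths of
  the three differences divided by \<open>n\<close>, \<open>qv\<close>, \<open>qw\<close>,
  \<open>qu\<close> for the quadratic form of the design, and \<open>V\<close> for the variance term
  of the oracle. The cross term is split so that its share in \<open>Nw\<close> is what the left
  side can pay for; the rest is \<open>V\<close> with a factor close to one.\<close>

lemma combine_bounds:
  fixes Nv Nw Nu :: real
  assumes \<eta>: "0 < \<eta>" "\<eta> \<le> 1/16"
    and qv: "Nv - 2 * \<eta> * (Nw + Nu) \<le> qv" and qw: "(1 - \<eta>) * Nw \<le> qw" and qu: "qu \<le> (1 + \<eta>) * Nu"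
    and basic: "qv + (1 - \<eta>) * qw \<le> qu + 2 * c + z / \<eta>"
    and c: "c\<^sup>2 \<le> (1 + \<eta>)\<^sup>2 * V * Nw"
    and nn: "0 \<le> Nw" "0 \<le> Nu" "0 \<le> V"
    and z: "z \<le> \<eta>\<^sup>2 * ob" and ob: "Nu + V \<le> (1 + \<eta>) * ob"
  shows "Nv \<le> (1 + 12 * \<eta>) * ob"
proof -
  \<comment> \<open>The coefficient of \<open>Nw\<close> available on the left is
    \<open>(1 - \<eta>)\<^sup>2 - 2 * \<eta>\<close>, which is at least
    \<open>1 - 4 * \<eta>\<close>.\<close>
  define a where "a = 1 - 4 * \<eta>"
  have a: "0 < a" "3/4 \<le> a" using \<eta> by (auto simp: a_def)
  have ob0: "0 \<le> ob"
  proof -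
    have "0 \<le> (1 + \<eta>) * ob" using ob nn by linarith
    then show ?thesis using \<eta> by (simp add: zero_le_mult_iff)
  qed
  have c2: "2 * c \<le> a * Nw + (1 + \<eta>)\<^sup>2 * V / a"
  proof -
    define g where "g = (1 + \<eta>)\<^sup>2 * V / a"
    have g: "0 \<le> g" "(1 + \<eta>)\<^sup>2 * V = a * g" using a nn by (auto simp: g_def)
    have "c\<^sup>2 \<le> (a * Nw) * g" using c unfolding g(2) by (simp add: algebra_simps)
    also have "4 * ((a * Nw) * g) \<le> (a * Nw + g)\<^sup>2"
      using zero_le_power2[of "a * Nw - g"] by (simp add: power2_eq_square algebra_simps)
    finally have "(2 * c)\<^sup>2 \<le> (a * Nw + g)\<^sup>2" by (simp add: power_mult_distrib)
    then have "2 * c \<le> a * Nw + g" using a nn g by (intro power2_le_imp_le[of "2 * c"]) auto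
    then show ?thesis by (simp add: g_def)
  qed
  have "(1 - \<eta>) * ((1 - \<eta>) * Nw) \<le> (1 - \<eta>) * qw" using qw \<eta> by (intro mult_left_mono) auto
  moreover have "a * Nw + 2 * \<eta> * Nw \<le> (1 - \<eta>) * ((1 - \<eta>) * Nw)"
    using nn by (simp add: a_def algebra_simps)
  moreover have "z / \<eta> \<le> \<eta> * ob" using z \<eta> by (simp add: divide_le_eq power2_eq_square mult.commute mult.left_commute)
  ultimately have "Nv \<le> (1 + 3 * \<eta>) * Nu + (1 + \<eta>)\<^sup>2 * V / a + \<eta> * ob"
    using qv qu basic c2 by (simp add: algebra_simps)
  also have "(1 + 3 * \<eta>) * Nu \<le> ((1 + \<eta>)\<^sup>2 / a) * Nu"
  proof (intro mult_right_mono nn)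
    have "(1 + 3 * \<eta>) * a \<le> (1 + \<eta>)\<^sup>2" using \<eta> by (simp add: a_def power2_eq_square algebra_simps)
    then show "1 + 3 * \<eta> \<le> (1 + \<eta>)\<^sup>2 / a" using a by (simp add: pos_le_divide_eq)
  qed
  also have "((1 + \<eta>)\<^sup>2 / a) * Nu + (1 + \<eta>)\<^sup>2 * V / a = ((1 + \<eta>)\<^sup>2 / a) * (Nu + V)"
    by (simp add: algebra_simps add_divide_distrib)
  also have "\<dots> \<le> ((1 + \<eta>)\<^sup>2 / a) * ((1 + \<eta>) * ob)" using ob a by (intro mult_left_mono) auto
  also have "\<dots> = ((1 + \<eta>) ^ 3 / a) * ob" by (simp add: power2_eq_square power3_eq_cube)
  \<comment> \<open>With \<open>\<eta> \<le> 1/16\<close> the cube is at most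
    \<open>1 + 4 * \<eta>\<close>, and dividing by \<open>a\<close> raises this to at most
    \<open>1 + 11 * \<eta>\<close>. The twelfth \<open>\<eta>\<close> pays for the slack of the near
    minimizer.\<close>
  also have "\<dots> \<le> (1 + 11 * \<eta>) * ob"
  proof (intro mult_right_mono ob0)
    have e2: "\<eta> * \<eta> \<le> \<eta> / 16" using \<eta> by (simp add: field_simps mult_left_le)
    have e3: "\<eta> * \<eta> * \<eta> \<le> \<eta> / 16 * (1/16)" using \<eta> e2 by (intro mult_mono) auto
    have "(1 + \<eta>) ^ 3 = 1 + 3 * \<eta> + 3 * (\<eta> * \<eta>) + \<eta> * \<eta> * \<eta>" by (simp add: power3_eq_cube algebra_simps)
    also have "\<dots> \<le> 1 + 4 * \<eta>" using e2 e3 \<eta> by linarith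
    also have "\<dots> \<le> (1 + 11 * \<eta>) * a"
    proof -
      have "(1 + 11 * \<eta>) * a = 1 + 7 * \<eta> - 44 * (\<eta> * \<eta>)" by (simp add: a_def algebra_simps)
      then show ?thesis using e2 \<eta> by linarith
    qed
    finally show "(1 + \<eta>) ^ 3 / a \<le> 1 + 11 * \<eta>" using a by (simp add: pos_divide_le_eq)
  qed
  finally show ?thesis by (simp add: algebra_simps)
qed

context gaussian_design
begin

lemma dotn_scaled_row: "dotn n (scaled_row \<omega> i) t = sqrt (real n) * dotn n (\<lambda>j. X i j \<omega>) t"
  unfolding dotn_def sum_distrib_left by (intro sum.cong) (auto simp: scaled_row_def)

text \<open>Division by \<open>\<rho> = |w| + s |u|\<close> puts \<open>w + s u\<close> into the
  test class, so the error term of the isometry becomes proportional to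
  \<open>\<rho>\<^sup>2\<close>. For \<open>\<rho> = 0\<close> the vector vanishes on
  \<open>{1..n}\<close>.\<close>

lemma isometry_homogeneous:
  assumes good: "\<And>t. t \<in> test_class n P (\<lambda>j. u j / sqrt (nsq n u)) \<Longrightarrow> \<not> isometry_defect (\<eta> / 2) t \<omega>"
    and w: "\<And>I. I \<in> P \<Longrightarrow> mono_on I w" and s: "0 \<le> s"
  shows "(nsq n (\<lambda>j. w j + s * u j) - \<eta> * (sqrt (nsq n w) + s * sqrt (nsq n u))\<^sup>2) / real n
     \<le> (\<Sum>i\<in>{1..m}. (dotn n (\<lambda>j. X i j \<omega>) (\<lambda>j. w j + s * u j))\<^sup>2) / real m"
proof -
  let ?t = "\<lambda>j. w j + s * u j"
  define \<rho> where "\<rho> = sqrt (nsq n w) + s * sqrt (nsq n u)"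
  define Q where "Q = (\<Sum>i\<in>{1..m}. (dotn n (\<lambda>j. X i j \<omega>) ?t)\<^sup>2)"
  have Q0: "0 \<le> Q" unfolding Q_def by (intro sum_nonneg) auto
  have \<rho>0: "0 \<le> \<rho>" using s nsq_nonneg by (auto simp: \<rho>_def intro!: add_nonneg_nonneg)
  have "real m * (nsq n ?t - \<eta> * \<rho>\<^sup>2) \<le> real n * Q"
  proof (cases "\<rho> = 0")
    case True
    then have z: "sqrt (nsq n w) = 0" "s * sqrt (nsq n u) = 0"
      using s nsq_nonneg[of n w] nsq_nonneg[of n u] unfolding \<rho>_def by (smt (verit) mult_nonneg_nonneg real_sqrt_ge_zero)+
    have "?t j = 0" if j: "j \<in> {1..n}" for j
    proof -
      have "w j = 0" using z(1) nsq_zero_imp[OF _ j, of w] by simp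
      moreover have "s * u j = 0"
        using z(2) nsq_zero_imp[OF _ j, of u] by auto
      ultimately show ?thesis by simp
    qed
    then have "nsq n ?t = 0" by (simp add: nsq_def)
    then show ?thesis using True Q0 dims_pos by simp
  next
    case False
    with \<rho>0 have \<rho>: "0 < \<rho>" by simp
    let ?e = "\<lambda>j. u j / sqrt (nsq n u)"
    define t' where "t' = (\<lambda>j. w j / \<rho> + (s * sqrt (nsq n u) / \<rho>) * ?e j)"
    have t'_eq: "t' j = ?t j / \<rho>" if "j \<in> {1..n}" for j
      using nsq_zero_imp[OF _ that, of u] \<rho> by (cases "nsq n u = 0") (auto simp: t'_def add_divide_distrib)
    have "t' \<in> test_class n P ?e"
      unfolding test_class_def
    proof (intro CollectI exI conjI)
      show "\<forall>I\<in>P. mono_on I (\<lambda>j. w j / \<rho>)" using w \<rho> by (auto simp: mono_on_def divide_right_mono)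
      have "nsq n (\<lambda>j. w j / \<rho>) = (sqrt (nsq n w) / \<rho>)\<^sup>2"
        using nsq_nonneg[of n w] by (simp add: nsq_def power_divide sum_divide_distrib)
      also have "\<dots> \<le> 1\<^sup>2"
        using \<rho> s nsq_nonneg by (intro power_mono) (auto simp: \<rho>_def divide_le_eq)
      finally show "nsq n (\<lambda>j. w j / \<rho>) \<le> 1" by simp
      show "\<bar>s * sqrt (nsq n u) / \<rho>\<bar> \<le> 1" using \<rho> s nsq_nonneg by (auto simp: \<rho>_def abs_mult)
    qed (rule t'_def)
    from good[OF this] have "real m * (nsq n t' - 2 * (\<eta> / 2)) \<le> (\<Sum>i\<in>{1..m}. (dotn n (scaled_row \<omega> i) t')\<^sup>2)"
      unfolding isometry_defect_def by linarith
    also have "\<dots> = (\<Sum>i\<in>{1..m}. real n * (dotn n (\<lambda>j. X i j \<omega>) ?t)\<^sup>2 / \<rho>\<^sup>2)"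
    proof (intro sum.cong refl)
      fix i
      have "dotn n (\<lambda>j. X i j \<omega>) t' = dotn n (\<lambda>j. X i j \<omega>) (\<lambda>j. ?t j / \<rho>)"
        by (intro dotn_cong_right t'_eq)
      also have "\<dots> = dotn n (\<lambda>j. X i j \<omega>) ?t / \<rho>" by (simp add: dotn_def sum_divide_distrib)
      finally show "(dotn n (scaled_row \<omega> i) t')\<^sup>2 = real n * (dotn n (\<lambda>j. X i j \<omega>) ?t)\<^sup>2 / \<rho>\<^sup>2"
        by (simp add: dotn_scaled_row power_mult_distrib power_divide)
    qed
    also have "\<dots> = real n * Q / \<rho>\<^sup>2" by (simp add: Q_def sum_distrib_left sum_divide_distrib)
    also have "nsq n t' = nsq n (\<lambda>j. ?t j / \<rho>)" by (intro nsq_cong t'_eq)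
    also have "\<dots> = nsq n ?t / \<rho>\<^sup>2" by (simp add: nsq_def power_divide sum_divide_distrib)
    finally have "real m * (nsq n ?t / \<rho>\<^sup>2 - \<eta>) * \<rho>\<^sup>2 \<le> real n * Q" using \<rho> by (simp add: pos_le_divide_eq)
    then show ?thesis using \<rho> by (simp add: algebra_simps)
  qed
  then show ?thesis unfolding Q_def[symmetric] \<rho>_def[symmetric] using dims_pos by (simp add: field_simps)
qed

text \<open>The deterministic core: the outcome \<open>\<omega>\<close> is fixed and enters only
  through the listed inequalities. The isometry is used with \<open>s = 1\<close> for
  \<open>v = w + u\<close> and with \<open>s = 0\<close> for \<open>w\<close>.\<close>

lemma error_bound_on_good_event:
  assumes \<eta>: "0 < \<eta>" "\<eta> \<le> 1/16" and P: "interval_partition n P"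
    and \<mu>0: "\<mu>0 \<in> monotone_cone n" and \<mu>: "\<mu> \<in> monotone_cone n" "blockwise_const P \<mu>" and D: "0 \<le> D"
    and iso: "\<And>t. t \<in> test_class n P (\<lambda>j. (\<mu> j - \<mu>0 j) / sqrt (nsq n (\<lambda>j. \<mu> j - \<mu>0 j))) \<Longrightarrow> \<not> isometry_defect (\<eta> / 2) t \<omega>"
    and sig: "(\<Sum>i\<in>{1..m}. (dotn n (scaled_row \<omega> i) (\<lambda>j. \<mu> j - \<mu>0 j))\<^sup>2) \<le> (1 + \<eta>) * nsq n (\<lambda>j. \<mu> j - \<mu>0 j) * real m"
    and noise: "(\<Sum>i\<in>{1..m}. (\<xi> i \<omega>)\<^sup>2) \<le> (1 + \<eta>) * \<sigma>\<^sup>2 * real m"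
    and be: "block_energy P (\<lambda>j. \<Sum>i\<in>{1..m}. \<xi> i \<omega> * X i j \<omega>) \<le> (1 + \<eta>) * D * ((\<Sum>i\<in>{1..m}. (\<xi> i \<omega>)\<^sup>2) / real n)"
    and \<mu>h: "\<mu>h \<in> monotone_cone n"
    and near: "sq_loss m n X (response n X \<xi> \<mu>0) \<mu>h \<omega> \<le> (INF \<nu>\<in>monotone_cone n. sq_loss m n X (response n X \<xi> \<mu>0) \<nu> \<omega>) + z"
    and z: "z \<le> \<eta>\<^sup>2 * ob" and ob: "(vdist n \<mu> \<mu>0)\<^sup>2 / n + \<sigma>\<^sup>2 * D / m \<le> (1 + \<eta>) * ob"
  shows "(vdist n \<mu>h \<mu>0)\<^sup>2 / n \<le> (1 + 12 * \<eta>) * ob"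
proof -
  define v u w where "v = (\<lambda>j. \<mu>h j - \<mu>0 j)" and "u = (\<lambda>j. \<mu> j - \<mu>0 j)" and "w = (\<lambda>j. \<mu>h j - \<mu> j)"
  let ?Q = "\<lambda>t. (\<Sum>i\<in>{1..m}. (dotn n (\<lambda>j. X i j \<omega>) t)\<^sup>2) / real m"
  have vwu: "(\<lambda>j. w j + 1 * u j) = v" "(\<lambda>j. w j + 0 * u j) = w" by (auto simp: v_def w_def u_def)
  have mono: "mono_on I w" if "I \<in> P" for I unfolding w_def by (rule mono_on_diff_const[OF P \<mu>h \<mu>(2) that])
  have good: "\<not> isometry_defect (\<eta> / 2) t \<omega>" if "t \<in> test_class n P (\<lambda>j. u j / sqrt (nsq n u))" for t
    using iso that by (simp add: u_def)
  note iso' = isometry_homogeneous[of P u \<eta> \<omega> w, OF good mono]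
  have qw: "(1 - \<eta>) * (nsq n w / n) \<le> ?Q w"
    using iso'[of 0] unfolding vwu by (simp add: nsq_nonneg algebra_simps diff_divide_distrib)
  have qv: "nsq n v / n - 2 * \<eta> * (nsq n w / n + nsq n u / n) \<le> ?Q v"
  proof -
    have "(sqrt (nsq n w) + 1 * sqrt (nsq n u))\<^sup>2 \<le> 2 * (nsq n w + nsq n u)"
      using zero_le_power2[of "sqrt (nsq n w) - sqrt (nsq n u)"] nsq_nonneg[of n w] nsq_nonneg[of n u]
      by (simp add: power2_sum power2_diff)
    then have "\<eta> * (sqrt (nsq n w) + 1 * sqrt (nsq n u))\<^sup>2 \<le> \<eta> * (2 * (nsq n w + nsq n u))"
      using \<eta> by (intro mult_left_mono) auto
    then have "(nsq n v - \<eta> * (2 * (nsq n w + nsq n u))) / n \<le> (nsq n v - \<eta> * (sqrt (nsq n w) + 1 * sqrt (nsq n u))\<^sup>2) / n"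
      by (intro divide_right_mono) auto
    also have "\<dots> \<le> ?Q v" using iso'[of 1] unfolding vwu by simp
    finally show ?thesis by (simp add: diff_divide_distrib add_divide_distrib algebra_simps)
  qed
  have qu: "?Q u \<le> (1 + \<eta>) * (nsq n u / n)"
  proof -
    have "real n * (\<Sum>i\<in>{1..m}. (dotn n (\<lambda>j. X i j \<omega>) u)\<^sup>2) \<le> (1 + \<eta>) * nsq n u * real m"
      using sig[folded u_def] dims_pos unfolding dotn_scaled_row
      by (simp add: power_mult_distrib sum_distrib_left)
    then show ?thesis using dims_pos by (simp add: field_simps)
  qed
  define c where "c = (\<Sum>i\<in>{1..m}. \<xi> i \<omega> * dotn n (\<lambda>j. X i j \<omega>) w) / m"
  have basic: "?Q v + (1 - \<eta>) * ?Q w \<le> ?Q u + 2 * c + z / \<eta>"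
    using near_minimizer_basic_inequality[OF dims(1) \<mu>h \<mu>(1) \<eta>(1) _ near] \<eta>
    by (simp add: v_def u_def w_def c_def)
  have c_le: "c \<le> sqrt ((1 + \<eta>)\<^sup>2 * (\<sigma>\<^sup>2 * D / m) * (nsq n w / n))"
  proof -
    let ?g = "\<lambda>j. \<Sum>i\<in>{1..m}. \<xi> i \<omega> * X i j \<omega>"
    have "(\<Sum>i\<in>{1..m}. \<xi> i \<omega> * dotn n (\<lambda>j. X i j \<omega>) w) = (\<Sum>i\<in>{1..m}. \<Sum>j\<in>{1..n}. \<xi> i \<omega> * X i j \<omega> * w j)"
      by (simp add: dotn_def sum_distrib_left mult.assoc)
    also have "\<dots> = (\<Sum>j\<in>{1..n}. \<Sum>i\<in>{1..m}. \<xi> i \<omega> * X i j \<omega> * w j)" by (rule sum.swap)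
    also have "\<dots> = (\<Sum>j\<in>{1..n}. ?g j * w j)" by (simp add: sum_distrib_right)
    also have "\<dots> \<le> sqrt (block_energy P ?g) * sqrt (nsq n w)"
      unfolding nsq_def by (rule inner_le_block_energy[OF P mono])
    also have "\<dots> \<le> sqrt ((1 + \<eta>) * D * ((1 + \<eta>) * \<sigma>\<^sup>2 * real m / real n)) * sqrt (nsq n w)"
    proof (intro mult_right_mono real_sqrt_le_mono)
      have "(1 + \<eta>) * D * ((\<Sum>i\<in>{1..m}. (\<xi> i \<omega>)\<^sup>2) / real n) \<le> (1 + \<eta>) * D * ((1 + \<eta>) * \<sigma>\<^sup>2 * real m / real n)"
        using noise \<eta> D by (intro mult_left_mono divide_right_mono) auto
      with be show "block_energy P ?g \<le> (1 + \<eta>) * D * ((1 + \<eta>) * \<sigma>\<^sup>2 * real m / real n)" by (rule order_trans)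
    qed (simp add: nsq_nonneg)
    finally have "c \<le> sqrt ((1 + \<eta>) * D * ((1 + \<eta>) * \<sigma>\<^sup>2 * real m / real n)) * sqrt (nsq n w) / m"
      unfolding c_def using dims_pos by (intro divide_right_mono) auto
    also have "\<dots> = sqrt (((1 + \<eta>) * D * ((1 + \<eta>) * \<sigma>\<^sup>2 * real m / real n)) * nsq n w / (real m)\<^sup>2)"
      by (simp add: real_sqrt_mult real_sqrt_divide)
    also have "((1 + \<eta>) * D * ((1 + \<eta>) * \<sigma>\<^sup>2 * real m / real n)) * nsq n w / (real m)\<^sup>2
      = (1 + \<eta>)\<^sup>2 * (\<sigma>\<^sup>2 * D / m) * (nsq n w / n)"
      using dims_pos by (simp add: power2_eq_square field_simps)
    finally show ?thesis .
  qed
  define c' where "c' = sqrt ((1 + \<eta>)\<^sup>2 * (\<sigma>\<^sup>2 * D / m) * (nsq n w / n))"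
  have "nsq n v / n \<le> (1 + 12 * \<eta>) * ob"
  proof (rule combine_bounds[OF \<eta> qv qw qu])
    show "?Q v + (1 - \<eta>) * ?Q w \<le> ?Q u + 2 * c' + z / \<eta>" using basic c_le by (simp add: c'_def)
    show "c'\<^sup>2 \<le> (1 + \<eta>)\<^sup>2 * (\<sigma>\<^sup>2 * D / m) * (nsq n w / n)"
      using D nsq_nonneg[of n w] by (simp add: c'_def)
    show "nsq n u / n + \<sigma>\<^sup>2 * D / m \<le> (1 + \<eta>) * ob" using ob by (simp add: vdist_nsq u_def)
  qed (use D z nsq_nonneg in auto)
  then show ?thesis by (simp add: vdist_nsq v_def)
qed

end

section \<open>The oracle bound\<close>

lemma pw_const_partition:
  assumes "\<mu> \<in> pw_const n k"
  obtains P where "interval_partition n P" "blockwise_const P \<mu>" "card P \<le> k" "\<mu> \<in> monotone_cone n"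
  using assms unfolding pw_const_def interval_partition_def blockwise_const_def by blast

text \<open>The values of \<open>\<mu>0\<close> are rounded down to a grid of mesh
  \<open>C / k\<close>; by monotonicity, points with the same grid value form an interval. The
  strict bound by \<open>C\<close> keeps the top of the range from opening another cell.\<close>

lemma pw_const_approx:
  assumes n: "1 \<le> n" and k: "1 \<le> k" and \<mu>0: "\<mu>0 \<in> monotone_cone n" and C: "\<mu>0 n - \<mu>0 1 < C"
  shows "\<exists>\<mu>\<in>pw_const n k. (vdist n \<mu> \<mu>0)\<^sup>2 / real n \<le> (C / real k)\<^sup>2"
proof -
  have rng: "0 \<le> \<mu>0 i - \<mu>0 1" "\<mu>0 i - \<mu>0 1 < C" if "i \<in> {1..n}" for i
  proof -
    show "0 \<le> \<mu>0 i - \<mu>0 1" using monotone_cone_le[OF \<mu>0, of 1 i] that by simp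
    show "\<mu>0 i - \<mu>0 1 < C" using monotone_cone_le[OF \<mu>0, of i n] that C by simp
  qed
  have C0: "0 < C" using rng[of 1] n by auto
  define y where "y = (\<lambda>i. real k * (\<mu>0 i - \<mu>0 1) / C)"
  define q where "q = (\<lambda>i. nat \<lfloor>y i\<rfloor>)"
  have y: "0 \<le> y i" "y i < real k" if "i \<in> {1..n}" for i
    using rng[OF that] C0 k by (auto simp: y_def divide_less_eq)
  have ymono: "y i \<le> y j" if "i \<in> {1..n}" "j \<in> {1..n}" "i \<le> j" for i j
    using monotone_cone_le[OF \<mu>0, of i j] that C0 by (auto simp: y_def intro!: divide_right_mono mult_left_mono)
  have qy: "real (q i) \<le> y i" "y i < real (q i) + 1" if "i \<in> {1..n}" for i
  proof -
    have "0 \<le> \<lfloor>y i\<rfloor>" using y[OF that] by simp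
    then have "real (q i) = of_int \<lfloor>y i\<rfloor>" by (simp add: q_def)
    then show "real (q i) \<le> y i" "y i < real (q i) + 1" by linarith+
  qed
  have qk: "q i < k" if "i \<in> {1..n}" for i using qy(1)[OF that] y(2)[OF that] by linarith
  have qmono: "q i \<le> q j" if "i \<in> {1..n}" "j \<in> {1..n}" "i \<le> j" for i j
    unfolding q_def by (intro nat_mono floor_mono ymono that)
  define \<mu> where "\<mu> = (\<lambda>i\<in>{1..n}. \<mu>0 1 + C * real (q i) / real k)"
  define S where "S = (\<lambda>v. {i\<in>{1..n}. q i = v})"
  define P where "P = S ` (q ` {1..n})"
  have "\<mu> \<in> monotone_cone n"
    unfolding \<mu>_def using qmono C0 k
    by (intro restrict_monotone_cone) (auto simp: mono_on_def intro!: divide_right_mono mult_left_mono)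
  moreover have "partition_on {1..n} P"
    by (intro partition_onI) (auto simp: P_def S_def disjnt_def)
  moreover have "card P \<le> k"
  proof -
    have "card P \<le> card (q ` {1..n})" unfolding P_def by (intro card_image_le) auto
    also have "\<dots> \<le> card {..<k}" using qk by (intro card_mono) auto
    finally show ?thesis by simp
  qed
  moreover have "\<exists>a b. I = {a..b}" and "\<mu> constant_on I" if I: "I \<in> P" for I
  proof -
    obtain v where v: "v \<in> q ` {1..n}" "I = S v" using I by (auto simp: P_def)
    have fin: "finite I" "I \<noteq> {}" using v by (auto simp: S_def)
    have ab: "Min I \<in> I" "Max I \<in> I" using fin by (auto intro: Min_in Max_in)
    have "I = {Min I..Max I}"
    proof
      show "I \<subseteq> {Min I..Max I}" using fin by auto
      show "{Min I..Max I} \<subseteq> I"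
      proof
        fix i assume i: "i \<in> {Min I..Max I}"
        then have i': "i \<in> {1..n}" using ab v by (auto simp: S_def)
        have "Min I \<in> {1..n}" "Max I \<in> {1..n}" "q (Min I) = v" "q (Max I) = v" using ab v(2) by (auto simp: S_def)
        then have "v \<le> q i" "q i \<le> v" using qmono[of "Min I" i] qmono[of i "Max I"] i i' by auto
        then show "i \<in> I" using v(2) i' by (auto simp: S_def)
      qed
    qed
    then show "\<exists>a b. I = {a..b}" by blast
    have "\<mu> i = \<mu>0 1 + C * real v / real k" if "i \<in> I" for i using that v by (auto simp: \<mu>_def S_def)
    then show "\<mu> constant_on I" unfolding constant_on_def by blast
  qed
  ultimately have "\<mu> \<in> pw_const n k" unfolding pw_const_def by blast
  moreover have "(vdist n \<mu> \<mu>0)\<^sup>2 \<le> (\<Sum>i\<in>{1..n}. (C / real k)\<^sup>2)"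
    unfolding vdist_squared
  proof (rule sum_mono)
    fix i assume i: "i \<in> {1..n}"
    have "\<mu>0 i - \<mu>0 1 = C / k * y i" using C0 k by (simp add: y_def)
    then have e: "\<mu>0 i - \<mu> i = C / k * (y i - q i)" using i by (simp add: \<mu>_def algebra_simps)
    have "(C / k * (y i - q i))\<^sup>2 \<le> (C / k * 1)\<^sup>2"
      using qy[OF i] C0 by (intro power_mono mult_left_mono) auto
    then show "(\<mu> i - \<mu>0 i)\<^sup>2 \<le> (C / real k)\<^sup>2" using e by (metis mult.right_neutral power2_commute)
  qed
  then have "(vdist n \<mu> \<mu>0)\<^sup>2 / real n \<le> (C / real k)\<^sup>2" using n by (simp add: divide_le_eq mult.commute)
  ultimately show ?thesis by blast
qed

lemma pw_const_nonempty:
  assumes n: "1 \<le> n" and k: "1 \<le> k" and \<mu>0: "\<mu>0 \<in> monotone_cone n"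
  shows "pw_const n k \<noteq> {}"
  using pw_const_approx[OF n k \<mu>0, of "\<mu>0 n - \<mu>0 1 + 1"] by auto

text \<open>The penalty is smallest at \<open>k = 1\<close>, by \<open>ln k \<le> k - 1\<close> and
  \<open>(k - 1) * ln (n / k) \<ge> 0\<close>. Exponents proportional to \<open>D\<close> are
  therefore at least of order \<open>log n\<close>.\<close>

lemma klog_ge:
  assumes "1 \<le> k" "k \<le> n"
  shows "1 + ln (real n) \<le> real k * ln (exp 1 * real n / real k)"
proof -
  have e: "ln (exp 1 * real n / real k) = 1 + ln (real n / real k)"
    using assms by (simp add: ln_div ln_mult)
  have "ln (real k) \<le> real k - 1" using assms by (intro ln_le_minus_one) auto
  moreover have l: "ln (real n / real k) = ln n - ln k" using assms by (simp add: ln_div)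
  moreover have "0 \<le> (real k - 1) * ln (real n / real k)" using assms by (intro mult_nonneg_nonneg) auto
  ultimately show ?thesis unfolding e l by (simp add: algebra_simps)
qed

lemma klog_le:
  assumes "1 \<le> k" "k \<le> n"
  shows "real k * ln (exp 1 * real n / real k) \<le> real k * (1 + ln (real n))"
  using assms by (intro mult_left_mono) (simp_all add: ln_div ln_mult)

context
  fixes m n :: nat and \<sigma> :: real and \<mu>0 :: "nat \<Rightarrow> real"
  assumes n: "1 \<le> n" and m: "1 \<le> m" and \<sigma>: "0 < \<sigma>" and \<mu>0: "\<mu>0 \<in> monotone_cone n"
begin

lemma bias_bdd: "bdd_below ((\<lambda>\<mu>. (vdist n \<mu> \<mu>0)\<^sup>2 / real n) ` S)"
  by (intro bdd_belowI2[where m=0]) simp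

lemma bias_nonneg: "1 \<le> k \<Longrightarrow> 0 \<le> (INF \<mu>\<in>pw_const n k. (vdist n \<mu> \<mu>0)\<^sup>2 / real n)"
  by (intro cINF_greatest pw_const_nonempty[OF n _ \<mu>0]) auto

lemma oracle_le:
  assumes k: "1 \<le> k" "k \<le> n" and \<mu>: "\<mu> \<in> pw_const n k"
  shows "oracle_bound m n \<sigma> \<mu>0 \<le> (vdist n \<mu> \<mu>0)\<^sup>2 / real n + \<sigma>\<^sup>2 * real k * ln (exp 1 * real n / real k) / real m"
proof -
  have "oracle_bound m n \<sigma> \<mu>0 \<le> (INF \<mu>\<in>pw_const n k. (vdist n \<mu> \<mu>0)\<^sup>2 / real n)
     + \<sigma>\<^sup>2 * real k * ln (exp 1 * real n / real k) / real m"
    unfolding oracle_bound_def using k by (intro cINF_lower) auto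
  also have "(INF \<mu>\<in>pw_const n k. (vdist n \<mu> \<mu>0)\<^sup>2 / real n) \<le> (vdist n \<mu> \<mu>0)\<^sup>2 / real n"
    by (rule cINF_lower[OF bias_bdd \<mu>])
  finally show ?thesis by simp
qed

lemma oracle_ge: "\<sigma>\<^sup>2 * (1 + ln (real n)) / real m \<le> oracle_bound m n \<sigma> \<mu>0"
  unfolding oracle_bound_def
proof (rule cINF_greatest)
  fix k assume k: "k \<in> {1..n}"
  have "\<sigma>\<^sup>2 * (1 + ln (real n)) / real m \<le> \<sigma>\<^sup>2 * (real k * ln (exp 1 * real n / real k)) / real m"
    using k klog_ge[of k n] by (intro divide_right_mono mult_left_mono) auto
  also have "\<dots> \<le> (INF \<mu>\<in>pw_const n k. (vdist n \<mu> \<mu>0)\<^sup>2 / real n) + \<sigma>\<^sup>2 * real k * ln (exp 1 * real n / real k) / real m"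
    using bias_nonneg[of k] k by (simp add: mult.assoc)
  finally show "\<sigma>\<^sup>2 * (1 + ln (real n)) / real m \<le> (INF \<mu>\<in>pw_const n k. (vdist n \<mu> \<mu>0)\<^sup>2 / real n) + \<sigma>\<^sup>2 * real k * ln (exp 1 * real n / real k) / real m" .
qed (use n in auto)

lemma oracle_pos: "0 < oracle_bound m n \<sigma> \<mu>0"
proof -
  have "0 \<le> ln (real n)" using n by simp
  then have "0 < \<sigma>\<^sup>2 * (1 + ln (real n)) / real m" using \<sigma> m by (intro divide_pos_pos mult_pos_pos) auto
  then show ?thesis using oracle_ge by linarith
qed

text \<open>The bound is an infimum of infima. Being positive, it is strictly below its multiple by
  \<open>1 + \<eta>\<close>, so a suitable \<open>k\<close> and then a suitable \<open>\<mu>\<close>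
  exist.\<close>

lemma oracle_attained_approx:
  assumes \<eta>: "0 < \<eta>"
  obtains k P \<mu> where "1 \<le> k" "k \<le> n" "interval_partition n P" "blockwise_const P \<mu>" "card P \<le> k" "\<mu> \<in> monotone_cone n"
    "(vdist n \<mu> \<mu>0)\<^sup>2 / real n + \<sigma>\<^sup>2 * (real k * ln (exp 1 * real n / real k)) / real m \<le> (1 + \<eta>) * oracle_bound m n \<sigma> \<mu>0"
proof -
  let ?ob = "oracle_bound m n \<sigma> \<mu>0"
  let ?v = "\<lambda>k. \<sigma>\<^sup>2 * real k * ln (exp 1 * real n / real k) / real m"
  let ?b = "\<lambda>k. INF \<mu>\<in>pw_const n k. (vdist n \<mu> \<mu>0)\<^sup>2 / real n"
  have "?ob < (1 + \<eta>) * ?ob" using oracle_pos \<eta> by simp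
  then have "\<exists>k\<in>{1..n}. ?b k + ?v k < (1 + \<eta>) * ?ob"
    unfolding oracle_bound_def using n by (subst (asm) (1) cINF_less_iff) auto
  then obtain k where k: "1 \<le> k" "k \<le> n" "?b k + ?v k < (1 + \<eta>) * ?ob" by auto
  then have "?b k < (1 + \<eta>) * ?ob - ?v k" by simp
  then obtain \<mu> where \<mu>: "\<mu> \<in> pw_const n k" "(vdist n \<mu> \<mu>0)\<^sup>2 / real n < (1 + \<eta>) * ?ob - ?v k"
    using cINF_less_iff[OF pw_const_nonempty[OF n k(1) \<mu>0] bias_bdd] by blast
  obtain P where P: "interval_partition n P" "blockwise_const P \<mu>" "card P \<le> k" "\<mu> \<in> monotone_cone n"
    using pw_const_partition[OF \<mu>(1)] by blast
  show ?thesis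
    by (rule that[OF k(1,2) P(1,2,3,4)]) (use \<mu>(2) in \<open>simp add: mult.assoc\<close>)
qed

end

text \<open>Continuity at zero, where the constant is one. It determines how small the Chernoff
  parameter is taken.\<close>

lemma chisq_const_near_one:
  assumes "0 < \<eta>"
  shows "\<exists>lam>0. lam < 1/2 \<and> chisq_const lam < 1 + \<eta>"
proof -
  have "((\<lambda>s. (1 / sqrt (1 - 2 * s)) ^ 3) \<longlongrightarrow> (1 / sqrt (1 - 2 * 0)) ^ 3) (at_right 0)"
    by (intro tendsto_intros) auto
  then have "((\<lambda>s. chisq_const s) \<longlongrightarrow> 1) (at_right 0)" by (simp add: chisq_const_def)
  then have "\<forall>\<^sub>F s in at_right 0. chisq_const s < 1 + \<eta>" by (rule order_tendstoD(2)) (use assms in simp)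
  moreover have "\<forall>\<^sub>F s in at_right (0::real). s < 1/2"
    by (rule eventually_at_right_real[of 0 "1/2", THEN eventually_mono]) auto
  moreover have "\<forall>\<^sub>F s in at_right (0::real). 0 < s" by (rule eventually_at_right_less)
  ultimately have "\<forall>\<^sub>F s in at_right 0. 0 < s \<and> s < 1/2 \<and> chisq_const s < 1 + \<eta>" by eventually_elim simp
  then show ?thesis using eventually_happens trivial_limit_at_right_real by blast
qed

section \<open>Probability of a large error\<close>

context gaussian_design
begin

text \<open>Division by the length of \<open>u\<close> turns the projections into independent
  standard normals; if that length is zero the event is empty.\<close>

lemma projection_sq_tail:
  assumes lln: "\<And>Z. indep_vars (\<lambda>_. borel) Z {1..m} \<Longrightarrow> (\<forall>i\<in>{1..m}. distr M borel (Z i) = std_normal) \<Longrightarrow>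
      measure M {\<omega>\<in>space M. (1 + \<eta>) * real m < (\<Sum>i\<in>{1..m}. (Z i \<omega>)\<^sup>2)} \<le> p" and p: "0 \<le> p"
  shows "measure M {\<omega>\<in>space M. (1 + \<eta>) * nsq n u * real m < (\<Sum>i\<in>{1..m}. (dotn n (scaled_row \<omega> i) u)\<^sup>2)} \<le> p"
proof (cases "nsq n u = 0")
  case True
  then have "dotn n h u = 0" for h using nsq_zero_imp[OF True] by (simp add: dotn_def)
  then show ?thesis using True p by simp
next
  case False
  then have u: "0 < nsq n u" using nsq_nonneg[of n u] by simp
  have "(1 + \<eta>) * nsq n u * real m < (\<Sum>i\<in>{1..m}. (dotn n (scaled_row \<omega> i) u)\<^sup>2)
    \<longleftrightarrow> (1 + \<eta>) * real m < (\<Sum>i\<in>{1..m}. (dotn n (scaled_row \<omega> i) u / sqrt (nsq n u))\<^sup>2)" for \<omega>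
    using u by (simp add: power_divide sum_divide_distrib[symmetric] pos_less_divide_eq mult_ac)
  then show ?thesis using lln[OF indep_row_projections(1)[OF u]] indep_row_projections(2)[OF u] by simp
qed

text \<open>A union bound over the failures of isometry, projected noise, signal, noise and slack in
  \<open>error_bound_on_good_event\<close>. The first two have explicit bounds; the other three
  receive a budget \<open>p\<close> each.\<close>

lemma error_probability_le:
  fixes \<mu>h :: "'a \<Rightarrow> nat \<Rightarrow> real" and Z :: "'a \<Rightarrow> real"
  assumes \<eta>: "0 < \<eta>" "\<eta> \<le> 1/16" and P: "interval_partition n P" "card P \<le> k" and k: "1 \<le> k" "k \<le> n"
    and \<mu>0: "\<mu>0 \<in> monotone_cone n" and \<mu>: "\<mu> \<in> monotone_cone n" "blockwise_const P \<mu>"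
    and D_def: "D = real k * ln (exp 1 * real n / real k)"
    and lam: "0 < lam" "lam < 1/2" "chisq_const lam \<le> 1 + \<eta> / 2"
    and lln: "\<And>Z. indep_vars (\<lambda>_. borel) Z {1..m} \<Longrightarrow> (\<forall>i\<in>{1..m}. distr M borel (Z i) = std_normal) \<Longrightarrow>
      measure M {\<omega>\<in>space M. (1 + \<eta>) * real m < (\<Sum>i\<in>{1..m}. (Z i \<omega>)\<^sup>2)} \<le> p"
      "measure M {\<omega>\<in>space M. (1 + \<eta>) * \<sigma>\<^sup>2 * real m < (\<Sum>i\<in>{1..m}. (\<xi> i \<omega>)\<^sup>2)} \<le> p" "0 \<le> p"
    and Z: "Z \<in> borel_measurable M" "measure M {\<omega>\<in>space M. \<eta>\<^sup>2 * ob < \<bar>Z \<omega>\<bar>} \<le> p"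
    and near: "AE \<omega> in M. \<mu>h \<omega> \<in> monotone_cone n \<and> sq_loss m n X (response n X \<xi> \<mu>0) (\<mu>h \<omega>) \<omega>
        \<le> (INF \<nu>\<in>monotone_cone n. sq_loss m n X (response n X \<xi> \<mu>0) \<nu> \<omega>) + Z \<omega>"
    and ob: "(vdist n \<mu> \<mu>0)\<^sup>2 / n + \<sigma>\<^sup>2 * D / m \<le> (1 + \<eta>) * ob"
  shows "measure M {\<omega>\<in>space M. (1 + 12 * \<eta>) * ob < (vdist n (\<mu>h \<omega>) \<mu>0)\<^sup>2 / n}
    \<le> 4 * sqrt (48 / (\<eta> / 2)) / (\<eta> / 2) * (sqrt (D / real m) + 1 / sqrt (real m))
      + exp (- (lam * (\<eta> / 2) * (1 + ln (real n)))) + 3 * p"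
proof -
  define u where "u = (\<lambda>j. \<mu> j - \<mu>0 j)"
  define e where "e = (\<lambda>j. u j / sqrt (nsq n u))"
  have D1: "1 + ln (real n) \<le> D" unfolding D_def by (rule klog_ge[OF k])
  have ln0: "0 \<le> ln (real n)" using dims by simp
  with D1 have D0: "0 < D" by linarith
  have hd: "harm_dim P \<le> D" unfolding D_def by (rule harm_dim_le[OF P k])
  have e1: "nsq n e \<le> 1"
    using nsq_nonneg[of n u]
    by (simp add: e_def nsq_def power_divide sum_divide_distrib[symmetric] sum_nonneg)
  define B1 where "B1 = {\<omega>\<in>space M. \<exists>t\<in>test_class n P e. isometry_defect (\<eta> / 2) t \<omega>}"
  define B2 where "B2 = {\<omega>\<in>space M. (1 + \<eta>) * nsq n u * real m < (\<Sum>i\<in>{1..m}. (dotn n (scaled_row \<omega> i) u)\<^sup>2)}"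
  define B3 where "B3 = {\<omega>\<in>space M. (1 + \<eta>) * \<sigma>\<^sup>2 * real m < (\<Sum>i\<in>{1..m}. (\<xi> i \<omega>)\<^sup>2)}"
  define B4 where "B4 = {\<omega>\<in>space M. (1 + \<eta>) * D * ((\<Sum>i\<in>{1..m}. (\<xi> i \<omega>)\<^sup>2) / real n)
      < block_energy P (\<lambda>j. \<Sum>i\<in>{1..m}. \<xi> i \<omega> * X i j \<omega>)}"
  define B5 where "B5 = {\<omega>\<in>space M. \<eta>\<^sup>2 * ob < \<bar>Z \<omega>\<bar>}"
  have s1: "B1 \<in> sets M" unfolding B1_def using \<eta> by (intro isometry_uniform(1)[OF P(1) hd D0 e1]) auto
  have s2: "B2 \<in> sets M" unfolding B2_def
    by (intro borel_measurable_less borel_measurable_const borel_measurable_sum borel_measurable_power dotn_row_measurable)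
  have xs: "(\<lambda>\<omega>. \<Sum>i\<in>{1..m}. (\<xi> i \<omega>)\<^sup>2) \<in> borel_measurable M"
    by (intro borel_measurable_sum borel_measurable_power xi_measurable)
  have s3: "B3 \<in> sets M" unfolding B3_def by (intro borel_measurable_less borel_measurable_const xs)
  have bem: "(\<lambda>\<omega>. block_energy P (\<lambda>j. \<Sum>i\<in>{1..m}. \<xi> i \<omega> * X i j \<omega>)) \<in> borel_measurable M"
  proof -
    have "(\<lambda>\<omega>. \<lambda>j\<in>{1..n}. \<Sum>i\<in>{1..m}. \<xi> i \<omega> * X i j \<omega>) \<in> measurable M (\<Pi>\<^sub>M j\<in>{1..n}. borel)"
      by (intro measurable_restrict borel_measurable_sum borel_measurable_times xi_measurable X_measurable)
    then have "(\<lambda>\<omega>. block_energy P (\<lambda>j\<in>{1..n}. \<Sum>i\<in>{1..m}. \<xi> i \<omega> * X i j \<omega>)) \<in> borel_measurable M"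
      by (rule measurable_compose[OF _ borel_measurable_block_energy[OF P(1)]])
    moreover have "block_energy P (\<lambda>j\<in>{1..n}. \<Sum>i\<in>{1..m}. \<xi> i \<omega> * X i j \<omega>) = block_energy P (\<lambda>j. \<Sum>i\<in>{1..m}. \<xi> i \<omega> * X i j \<omega>)" for \<omega>
      by (rule block_energy_cong[OF P(1)]) simp
    ultimately show ?thesis by simp
  qed
  have s4: "B4 \<in> sets M" unfolding B4_def
    by (intro borel_measurable_less borel_measurable_times borel_measurable_divide borel_measurable_const xs bem)
  have s5: "B5 \<in> sets M" unfolding B5_def by (intro borel_measurable_less borel_measurable_const borel_measurable_abs Z)
  let ?U = "B1 \<union> (B4 \<union> (B2 \<union> (B3 \<union> B5)))"
  have "measure M {\<omega>\<in>space M. (1 + 12 * \<eta>) * ob < (vdist n (\<mu>h \<omega>) \<mu>0)\<^sup>2 / n} \<le> measure M ?U"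
  proof (rule finite_measure_mono_AE)
    show "AE \<omega> in M. \<omega> \<in> {\<omega>\<in>space M. (1 + 12 * \<eta>) * ob < (vdist n (\<mu>h \<omega>) \<mu>0)\<^sup>2 / n} \<longrightarrow> \<omega> \<in> ?U"
      using near
    proof eventually_elim
      case (elim \<omega>)
      have "(vdist n (\<mu>h \<omega>) \<mu>0)\<^sup>2 / n \<le> (1 + 12 * \<eta>) * ob" if \<omega>: "\<omega> \<in> space M" and nb: "\<omega> \<notin> ?U"
      proof (rule error_bound_on_good_event[OF \<eta> P(1) \<mu>0 \<mu>])
        show "\<not> isometry_defect (\<eta> / 2) t \<omega>" if "t \<in> test_class n P (\<lambda>j. (\<mu> j - \<mu>0 j) / sqrt (nsq n (\<lambda>j. \<mu> j - \<mu>0 j)))" for t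
          using that nb \<omega> by (auto simp: B1_def e_def u_def)
        show "(\<Sum>i\<in>{1..m}. (dotn n (scaled_row \<omega> i) (\<lambda>j. \<mu> j - \<mu>0 j))\<^sup>2) \<le> (1 + \<eta>) * nsq n (\<lambda>j. \<mu> j - \<mu>0 j) * real m"
          using nb \<omega> by (auto simp: B2_def u_def)
        show "(\<Sum>i\<in>{1..m}. (\<xi> i \<omega>)\<^sup>2) \<le> (1 + \<eta>) * \<sigma>\<^sup>2 * real m" using nb \<omega> by (auto simp: B3_def)
        show "block_energy P (\<lambda>j. \<Sum>i\<in>{1..m}. \<xi> i \<omega> * X i j \<omega>) \<le> (1 + \<eta>) * D * ((\<Sum>i\<in>{1..m}. (\<xi> i \<omega>)\<^sup>2) / real n)"
          using nb \<omega> by (auto simp: B4_def)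
        show "Z \<omega> \<le> \<eta>\<^sup>2 * ob" using nb \<omega> by (auto simp: B5_def)
      qed (use elim D0 ob in auto)
      then show ?case by fastforce
    qed
    show "?U \<in> sets M" using s1 s2 s3 s4 s5 by auto
  qed
  also have "\<dots> \<le> measure M B1 + (measure M B4 + (measure M B2 + (measure M B3 + measure M B5)))"
    using s1 s2 s3 s4 s5
    by (intro order_trans[OF measure_Un_le] add_left_mono measure_Un_le) auto
  also have "\<dots> \<le> 4 * sqrt (48 / (\<eta> / 2)) / (\<eta> / 2) * (sqrt (D / real m) + 1 / sqrt (real m))
      + (exp (- (lam * (\<eta> / 2) * (1 + ln (real n)))) + (p + (p + p)))"
  proof (intro add_mono)
    show "measure M B1 \<le> 4 * sqrt (48 / (\<eta> / 2)) / (\<eta> / 2) * (sqrt (D / real m) + 1 / sqrt (real m))"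
      unfolding B1_def using \<eta> by (intro isometry_uniform(2)[OF P(1) hd D0 e1]) auto
    have "measure M B4 \<le> exp (- (lam * D * (1 + \<eta> - chisq_const lam)))"
      unfolding B4_def by (rule noise_block_energy_tail[OF P(1) lam(1,2) hd])
    also have "\<dots> \<le> exp (- (lam * (\<eta> / 2) * (1 + ln (real n))))"
    proof -
      \<comment> \<open>The bound on \<open>chisq_const lam\<close> leaves half of
        \<open>\<eta>\<close> in the exponent, and \<open>D\<close> is at least
        \<open>1 + ln n\<close>.\<close>
      have "lam * (1 + ln (real n)) * (\<eta> / 2) \<le> lam * D * (1 + \<eta> - chisq_const lam)"
        using lam D0 D1 \<eta> ln0 by (intro mult_mono) auto
      then show ?thesis by (simp add: mult_ac)
    qed
    finally show "measure M B4 \<le> exp (- (lam * (\<eta> / 2) * (1 + ln (real n))))" .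
    show "measure M B2 \<le> p" unfolding B2_def by (rule projection_sq_tail[OF lln(1,3)])
    show "measure M B3 \<le> p" unfolding B3_def by (rule lln(2))
    show "measure M B5 \<le> p" unfolding B5_def by (rule Z(2))
  qed
  finally show ?thesis by simp
qed

end

section \<open>Asymptotics\<close>

context
  fixes M :: "nat \<Rightarrow> 'a measure"
    and m :: "nat \<Rightarrow> nat"
    and \<sigma> :: real
    and noise :: "real measure"
    and X :: "nat \<Rightarrow> nat \<Rightarrow> nat \<Rightarrow> 'a \<Rightarrow> real"
    and \<xi> :: "nat \<Rightarrow> nat \<Rightarrow> 'a \<Rightarrow> real"
    and \<mu>0 :: "nat \<Rightarrow> nat \<Rightarrow> real"
    and \<mu>hat :: "nat \<Rightarrow> 'a \<Rightarrow> nat \<Rightarrow> real"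
  assumes \<sigma>: "0 < \<sigma>"
    and noise_prob: "real_distribution noise"
    and noise_sq: "integrable noise (\<lambda>x. x\<^sup>2)"
    and noise_mean: "(\<integral>x. x \<partial>noise) = 0"
    and noise_var: "prob_space.variance noise (\<lambda>x. x) = \<sigma>\<^sup>2"
    and model: "\<And>n. 1 \<le> n \<Longrightarrow> gaussian_design (M n) (m n) n (X n) (\<xi> n) noise"
    and \<mu>0: "\<And>n. 1 \<le> n \<Longrightarrow> \<mu>0 n \<in> monotone_cone n"
    and m_growth: "filterlim (\<lambda>n. real (m n) / ln (real n)) at_top sequentially"
    and \<mu>0_range: "(\<lambda>n. \<mu>0 n n - \<mu>0 n 1) \<in> O(\<lambda>_. 1)"
    and \<mu>hat: "near_minimizers M monotone_cone
           (\<lambda>n. sq_loss (m n) n (X n) (response n (X n) (\<xi> n) (\<mu>0 n)))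
           (\<lambda>n. (risk_radius (m n) n \<sigma> (monotone_cone n) (\<mu>0 n))\<^sup>2) \<mu>hat"
begin

section \<open>Limits of the sample size and of the oracle bound\<close>

abbreviation "ob n \<equiv> oracle_bound (m n) n \<sigma> (\<mu>0 n)"

lemma m_ge_1: "1 \<le> n \<Longrightarrow> 1 \<le> m n"
  using gaussian_design.dims(1)[OF model] .

lemma ob_pos: "1 \<le> n \<Longrightarrow> 0 < ob n"
  by (rule oracle_pos[OF _ m_ge_1 \<sigma> \<mu>0])

lemma ln_at_top_nat: "filterlim (\<lambda>n. ln (real n)) at_top sequentially"
  by (rule filterlim_compose[OF ln_at_top filterlim_real_sequentially])

lemma log_over_m: "(\<lambda>n. (1 + ln (real n)) / real (m n)) \<longlonglongrightarrow> 0"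
proof -
  have a: "(\<lambda>n. inverse (real (m n) / ln (real n))) \<longlonglongrightarrow> 0"
    by (rule tendsto_inverse_0_at_top[OF m_growth])
  have b: "(\<lambda>n. inverse (ln (real n))) \<longlonglongrightarrow> 0"
    by (rule tendsto_inverse_0_at_top[OF ln_at_top_nat])
  have "(\<lambda>n. (1 + inverse (ln (real n))) * inverse (real (m n) / ln (real n))) \<longlonglongrightarrow> (1 + 0) * 0"
    by (intro tendsto_intros a b)
  moreover have "\<forall>\<^sub>F n in sequentially. (1 + inverse (ln (real n))) * inverse (real (m n) / ln (real n)) = (1 + ln (real n)) / real (m n)"
    using eventually_ge_at_top[of 2]
  proof eventually_elim
    case (elim n)
    then have "0 < ln (real n)" by simp
    then have "(1 + inverse (ln (real n))) * ln (real n) = 1 + ln (real n)" by (simp add: distrib_right add.commute)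
    moreover have "(1 + inverse (ln (real n))) * inverse (real (m n) / ln (real n))
        = (1 + inverse (ln (real n))) * ln (real n) / real (m n)" by simp
    ultimately show ?case by simp
  qed
  ultimately have "(\<lambda>n. (1 + ln (real n)) / real (m n)) \<longlonglongrightarrow> (1 + 0) * 0"
    by (rule Lim_transform_eventually)
  then show ?thesis by simp
qed

lemma m_at_top: "filterlim m at_top sequentially"
proof -
  have "filterlim (\<lambda>n. real (m n)) at_top sequentially"
  proof (rule filterlim_at_top_mono[OF ln_at_top_nat])
    have "\<forall>\<^sub>F n in sequentially. 1 \<le> real (m n) / ln (real n)"
      using m_growth by (simp add: filterlim_at_top)
    then show "\<forall>\<^sub>F n in sequentially. ln (real n) \<le> real (m n)"
      using eventually_ge_at_top[of 2]
    proof eventually_elim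
      case (elim n)
      then have "0 < ln (real n)" by simp
      then show ?case using elim by (simp add: pos_le_divide_eq)
    qed
  qed
  then have "\<forall>\<^sub>F n in sequentially. real z \<le> real (m n)" for z unfolding filterlim_at_top by blast
  then show ?thesis by (simp add: filterlim_at_top)
qed

text \<open>The number of pieces is fixed first, to make the bias \<open>(C / k)\<^sup>2\<close>
  small; for this fixed \<open>k\<close> the variance term is of order \<open>log n / m\<close> and
  vanishes.\<close>

lemma oracle_tendsto_0: "(\<lambda>n. ob n) \<longlonglongrightarrow> 0"
proof (rule tendstoI)
  fix e :: real assume e: "0 < e"
  obtain c where c: "\<forall>\<^sub>F n in sequentially. norm (\<mu>0 n n - \<mu>0 n 1) \<le> c * norm (1::real)"
    using \<mu>0_range by (auto elim: landau_o.bigE)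
  define C where "C = \<bar>c\<bar> + 1"
  have "((\<lambda>k::nat. (C / real k)\<^sup>2) \<longlongrightarrow> 0\<^sup>2) sequentially"
    by (intro tendsto_power tendsto_divide_0[OF tendsto_const] filterlim_at_top_imp_at_infinity filterlim_real_sequentially)
  then have "\<forall>\<^sub>F k::nat in sequentially. (C / real k)\<^sup>2 < e / 2"
    by (rule order_tendstoD(2)) (use e in simp)
  then have "\<forall>\<^sub>F k::nat in sequentially. (C / real k)\<^sup>2 < e / 2 \<and> 1 \<le> k"
    using eventually_ge_at_top[of 1] by eventually_elim simp
  then obtain k :: nat where k: "(C / real k)\<^sup>2 < e / 2" "1 \<le> k" by (auto simp: eventually_sequentially)
  have "(\<lambda>n. (\<sigma>\<^sup>2 * real k) * ((1 + ln (real n)) / real (m n))) \<longlonglongrightarrow> (\<sigma>\<^sup>2 * real k) * 0"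
    by (intro tendsto_mult tendsto_const log_over_m)
  then have "\<forall>\<^sub>F n in sequentially. (\<sigma>\<^sup>2 * real k) * ((1 + ln (real n)) / real (m n)) < e / 2"
    by (rule order_tendstoD(2)) (use e in simp)
  then show "\<forall>\<^sub>F n in sequentially. dist (ob n) 0 < e"
    using c eventually_ge_at_top[of k]
  proof eventually_elim
    case (elim n)
    have n: "1 \<le> n" using elim k by simp
    have "\<mu>0 n n - \<mu>0 n 1 < C" using elim(2) by (simp add: C_def)
    from pw_const_approx[OF n k(2) \<mu>0[OF n] this] obtain \<mu> where
      \<mu>: "\<mu> \<in> pw_const n k" "(vdist n \<mu> (\<mu>0 n))\<^sup>2 / real n \<le> (C / real k)\<^sup>2" by blast
    have "ob n \<le> (vdist n \<mu> (\<mu>0 n))\<^sup>2 / real n + \<sigma>\<^sup>2 * real k * ln (exp 1 * real n / real k) / real (m n)"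
      by (rule oracle_le[OF n m_ge_1[OF n] \<sigma> \<mu>0[OF n] k(2) elim(3) \<mu>(1)])
    also have "\<sigma>\<^sup>2 * real k * ln (exp 1 * real n / real k) / real (m n) \<le> \<sigma>\<^sup>2 * (real k * (1 + ln (real n))) / real (m n)"
      unfolding mult.assoc by (intro divide_right_mono mult_left_mono[OF klog_le[OF k(2) elim(3)]]) auto
    also have "\<dots> = (\<sigma>\<^sup>2 * real k) * ((1 + ln (real n)) / real (m n))" by simp
    finally have "ob n < e" using elim(1) \<mu>(2) k(1) by linarith
    then show ?case using ob_pos[OF n] by simp
  qed
qed

lemma noise_second_moment: "(\<integral>x. x\<^sup>2 \<partial>noise) = \<sigma>\<^sup>2"
proof -
  interpret N: real_distribution noise by (rule noise_prob)
  show ?thesis using noise_var by (simp add: noise_mean)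
qed

text \<open>\<open>D / m\<close> is at most a multiple of the oracle bound, which tends to zero, so
  the isometry fails with vanishing probability. The slack, negligible against the squared radius,
  is transferred to the scale of the oracle bound by \<open>risk_radius_le\<close>.\<close>

lemma error_exceeds_oracle:
  assumes e: "0 < e"
  shows "(\<lambda>n. measure (M n) {\<omega>\<in>space (M n). (1 + e) * ob n < (vdist n (\<mu>hat n \<omega>) (\<mu>0 n))\<^sup>2 / real n}) \<longlonglongrightarrow> 0"
proof -
  \<comment> \<open>\<open>12 * \<eta> \<le> e\<close> matches the factor lost in
    \<open>combine_bounds\<close>.\<close>
  define \<eta> where "\<eta> = min (1/16) (e / 12)"
  have \<eta>: "0 < \<eta>" "\<eta> \<le> 1/16" "12 * \<eta> \<le> e" using e by (auto simp: \<eta>_def)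
  obtain lam where lam: "0 < lam" "lam < 1/2" "chisq_const lam < 1 + \<eta> / 2"
    using chisq_const_near_one[of "\<eta> / 2"] \<eta> by auto
  obtain Z where Zo: "small_oP M Z (\<lambda>n. (risk_radius (m n) n \<sigma> (monotone_cone n) (\<mu>0 n))\<^sup>2)"
    and near: "\<And>n. 1 \<le> n \<Longrightarrow> AE \<omega> in M n. \<mu>hat n \<omega> \<in> monotone_cone n \<and>
       sq_loss (m n) n (X n) (response n (X n) (\<xi> n) (\<mu>0 n)) (\<mu>hat n \<omega>) \<omega>
         \<le> (INF \<mu>\<in>monotone_cone n. sq_loss (m n) n (X n) (response n (X n) (\<xi> n) (\<mu>0 n)) \<mu> \<omega>) + Z n \<omega>"
    using \<mu>hat unfolding near_minimizers_def by blast
  define A where "A = 4 * sqrt (48 / (\<eta> / 2)) / (\<eta> / 2)"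
  have A: "0 \<le> A" using \<eta> by (simp add: A_def)
  define g where "g = (\<lambda>n. A * (sqrt ((1 + \<eta>) * ob n / \<sigma>\<^sup>2) + 1 / sqrt (real (m n))) + exp (- (lam * (\<eta> / 2) * (1 + ln (real n)))))"
  have g: "g \<longlonglongrightarrow> 0"
  proof -
    have "(\<lambda>n. sqrt ((1 + \<eta>) * ob n / \<sigma>\<^sup>2)) \<longlonglongrightarrow> sqrt ((1 + \<eta>) * 0 / \<sigma>\<^sup>2)"
      using \<sigma> by (intro tendsto_intros oracle_tendsto_0) auto
    moreover have "(\<lambda>n. 1 / sqrt (real (m n))) \<longlonglongrightarrow> 0"
      by (intro tendsto_divide_0[OF tendsto_const] filterlim_at_top_imp_at_infinity filterlim_compose[OF sqrt_at_top]
          filterlim_compose[OF filterlim_real_sequentially m_at_top])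
    moreover have "(\<lambda>n. exp (- (lam * (\<eta> / 2) * (1 + ln (real n))))) \<longlonglongrightarrow> 0"
    proof -
      have "filterlim (\<lambda>n. 1 + ln (real n)) at_top sequentially"
        by (rule filterlim_tendsto_add_at_top[OF tendsto_const ln_at_top_nat])
      then have "filterlim (\<lambda>n. (- (lam * (\<eta> / 2))) * (1 + ln (real n))) at_bot sequentially"
        using lam \<eta> by (intro filterlim_tendsto_neg_mult_at_bot[OF tendsto_const]) auto
      from filterlim_compose[OF exp_at_bot this] show ?thesis by simp
    qed
    ultimately have "g \<longlonglongrightarrow> A * (sqrt ((1 + \<eta>) * 0 / \<sigma>\<^sup>2) + 0) + 0"
      unfolding g_def by (intro tendsto_add tendsto_mult tendsto_const)
    then show ?thesis by simp
  qed
  show ?thesis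
  proof (rule tendstoI)
    fix q :: real assume q: "0 < q"
    \<comment> \<open>Four shares \<open>p\<close> are spent, one on \<open>g\<close> and three on
      the events with budget \<open>p\<close>; together they make \<open>q / 2\<close>.\<close>
    define p where "p = q / 8"
    have p: "0 < p" using q by (simp add: p_def)
    have N: "real_distribution std_normal" by (rule real_dist_normal_dist)
    have N2: "integrable std_normal (\<lambda>x. x\<^sup>2)" "(\<integral>x. x\<^sup>2 \<partial>std_normal) = 1"
    proof -
      have "has_bochner_integral lborel (\<lambda>x. std_normal_density x * x\<^sup>2) 1"
        using normal_moment_even[of 1 0 1] by simp
      then show "integrable std_normal (\<lambda>x. x\<^sup>2)" "(\<integral>x. x\<^sup>2 \<partial>std_normal) = 1"
        by (auto simp: has_bochner_integral_iff integrable_density integral_density)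
    qed
    obtain m1 where m1: "\<forall>m\<ge>m1. \<forall>(M :: 'a measure) Z. prob_space M \<longrightarrow> prob_space.indep_vars M (\<lambda>_. borel) Z {1..m} \<longrightarrow>
      (\<forall>i\<in>{1..m}. distr M borel (Z i) = std_normal) \<longrightarrow>
      measure M {\<omega>\<in>space M. (1 + \<eta>) * real m < (\<Sum>i\<in>{1..m}. (Z i \<omega>)\<^sup>2)} \<le> p"
      using sum_sq_tail_uniform[where 'a='a, OF N N2(1) \<eta>(1) p] unfolding N2(2) by blast
    have "0 < \<eta> * \<sigma>\<^sup>2" using \<eta> \<sigma> by simp
    from sum_sq_tail_uniform[where 'a='a, OF noise_prob noise_sq this p]
    obtain m2 where m2: "\<forall>m\<ge>m2. \<forall>(M :: 'a measure) Z. prob_space M \<longrightarrow> prob_space.indep_vars M (\<lambda>_. borel) Z {1..m} \<longrightarrow>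
      (\<forall>i\<in>{1..m}. distr M borel (Z i) = noise) \<longrightarrow>
      measure M {\<omega>\<in>space M. (\<sigma>\<^sup>2 + \<eta> * \<sigma>\<^sup>2) * real m < (\<Sum>i\<in>{1..m}. (Z i \<omega>)\<^sup>2)} \<le> p"
      unfolding noise_second_moment by blast
    have ev_m: "\<forall>\<^sub>F n in sequentially. max m1 m2 \<le> m n"
      using m_at_top unfolding filterlim_at_top by blast
    have ev_g: "\<forall>\<^sub>F n in sequentially. g n < p" using g p by (rule order_tendstoD(2))
    \<comment> \<open>This level guarantees \<open>D \<le> m / 2\<close>, as required for the bound
      on the radius.\<close>
    have ev_ob: "\<forall>\<^sub>F n in sequentially. ob n < \<sigma>\<^sup>2 / 4"
      using oracle_tendsto_0 by (rule order_tendstoD(2)) (use \<sigma> in simp)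
    have ev_ln: "\<forall>\<^sub>F n in sequentially. (1 + ln (real n)) / real (m n) < 1"
      using log_over_m by (rule order_tendstoD(2)) simp
    \<comment> \<open>The squared radius will be at most four times the oracle bound, so the level
      \<open>\<eta>\<^sup>2 / 4\<close> for the radius stays below \<open>\<eta>\<^sup>2\<close> for
      the oracle bound.\<close>
    have "(\<lambda>n. measure (M n) {\<omega>\<in>space (M n). \<bar>Z n \<omega>\<bar> > \<eta>\<^sup>2 / 4 * (risk_radius (m n) n \<sigma> (monotone_cone n) (\<mu>0 n))\<^sup>2}) \<longlonglongrightarrow> 0"
    proof -
      have "0 < \<eta>\<^sup>2 / 4" using \<eta> by simp
      then show ?thesis using Zo unfolding small_oP_def by blast
    qed
    then have ev_Z: "\<forall>\<^sub>F n in sequentially. measure (M n) {\<omega>\<in>space (M n). \<bar>Z n \<omega>\<bar> > \<eta>\<^sup>2 / 4 * (risk_radius (m n) n \<sigma> (monotone_cone n) (\<mu>0 n))\<^sup>2} < p"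
      using p by (rule order_tendstoD(2))
    show "\<forall>\<^sub>F n in sequentially. dist (measure (M n) {\<omega>\<in>space (M n). (1 + e) * ob n < (vdist n (\<mu>hat n \<omega>) (\<mu>0 n))\<^sup>2 / real n}) 0 < q"
      using ev_m ev_g ev_ob ev_ln ev_Z eventually_ge_at_top[of 1]
    proof eventually_elim
      case (elim n)
      then have n: "1 \<le> n" by simp
      interpret G: gaussian_design "M n" "m n" n "X n" "\<xi> n" noise by (rule model[OF n])
      note ob0 = ob_pos[OF n]
      obtain k P \<mu> where k: "1 \<le> k" "k \<le> n" and P: "interval_partition n P" "blockwise_const P \<mu>" "card P \<le> k"
        and \<mu>: "\<mu> \<in> monotone_cone n"
        and ob: "(vdist n \<mu> (\<mu>0 n))\<^sup>2 / real n + \<sigma>\<^sup>2 * (real k * ln (exp 1 * real n / real k)) / real (m n) \<le> (1 + \<eta>) * ob n"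
        by (rule oracle_attained_approx[OF n G.dims(1) \<sigma> \<mu>0[OF n] \<eta>(1)])
      define D where "D = real k * ln (exp 1 * real n / real k)"
      have Dm: "D / real (m n) \<le> (1 + \<eta>) * ob n / \<sigma>\<^sup>2"
      proof -
        have "0 \<le> (vdist n \<mu> (\<mu>0 n))\<^sup>2 / real n" by simp
        with ob have "\<sigma>\<^sup>2 * D / real (m n) \<le> (1 + \<eta>) * ob n" unfolding D_def by linarith
        then show ?thesis using \<sigma> by (simp add: pos_le_divide_eq mult.commute)
      qed
      have Dm2: "D \<le> real (m n) / 2"
      proof -
        have "(1 + \<eta>) * ob n \<le> 2 * (\<sigma>\<^sup>2 / 4)" using elim(3) \<eta> ob0 by (intro mult_mono) auto
        then have "(1 + \<eta>) * ob n / \<sigma>\<^sup>2 \<le> 1 / 2" using \<sigma> by (simp add: divide_le_eq)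
        with Dm have "D / real (m n) \<le> 1 / 2" by linarith
        then show ?thesis using G.dims_pos by (simp add: divide_le_eq)
      qed
      have hd: "harm_dim P \<le> D" unfolding D_def by (rule harm_dim_le[OF P(1,3) k])
      have "1 + ln (real n) < real (m n)" using elim(4) G.dims_pos by (simp add: divide_less_eq)
      then have "(risk_radius (m n) n \<sigma> (monotone_cone n) (\<mu>0 n))\<^sup>2 \<le> 2 * ((vdist n \<mu> (\<mu>0 n))\<^sup>2 / n + \<sigma>\<^sup>2 * D / m n)"
        by (rule risk_radius_le[OF n \<mu>0[OF n] \<sigma> _ P(1) \<mu> P(2) hd Dm2])
      also have "\<dots> \<le> 2 * ((1 + \<eta>) * ob n)" unfolding D_def by (rule mult_left_mono[OF ob]) simp
      also have "\<dots> \<le> 2 * (2 * ob n)" using \<eta> ob0 by (intro mult_left_mono mult_right_mono) auto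
      finally have rr: "\<eta>\<^sup>2 / 4 * (risk_radius (m n) n \<sigma> (monotone_cone n) (\<mu>0 n))\<^sup>2 \<le> \<eta>\<^sup>2 / 4 * (2 * (2 * ob n))"
        by (intro mult_left_mono) auto
      have Zm: "Z n \<in> borel_measurable (M n)" using Zo by (simp add: small_oP_def)
      have Zp: "measure (M n) {\<omega>\<in>space (M n). \<eta>\<^sup>2 * ob n < \<bar>Z n \<omega>\<bar>} \<le> p"
      proof -
        have "measure (M n) {\<omega>\<in>space (M n). \<eta>\<^sup>2 * ob n < \<bar>Z n \<omega>\<bar>}
          \<le> measure (M n) {\<omega>\<in>space (M n). \<bar>Z n \<omega>\<bar> > \<eta>\<^sup>2 / 4 * (risk_radius (m n) n \<sigma> (monotone_cone n) (\<mu>0 n))\<^sup>2}"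
        proof (rule G.finite_measure_mono)
          show "{\<omega>\<in>space (M n). \<bar>Z n \<omega>\<bar> > \<eta>\<^sup>2 / 4 * (risk_radius (m n) n \<sigma> (monotone_cone n) (\<mu>0 n))\<^sup>2} \<in> sets (M n)"
            by (intro borel_measurable_less borel_measurable_const borel_measurable_abs Zm)
        qed (use rr in auto)
        then show ?thesis using elim(5) by linarith
      qed
      have "measure (M n) {\<omega>\<in>space (M n). (1 + 12 * \<eta>) * ob n < (vdist n (\<mu>hat n \<omega>) (\<mu>0 n))\<^sup>2 / n}
        \<le> 4 * sqrt (48 / (\<eta> / 2)) / (\<eta> / 2) * (sqrt (D / real (m n)) + 1 / sqrt (real (m n)))
          + exp (- (lam * (\<eta> / 2) * (1 + ln (real n)))) + 3 * p"
      proof (rule G.error_probability_le[OF \<eta>(1,2) P(1,3) k \<mu>0[OF n] \<mu> P(2) D_def lam(1,2)])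
        show "chisq_const lam \<le> 1 + \<eta> / 2" using lam by simp
        show "measure (M n) {\<omega>\<in>space (M n). (1 + \<eta>) * real (m n) < (\<Sum>i\<in>{1..m n}. (Z' i \<omega>)\<^sup>2)} \<le> p"
          if "G.indep_vars (\<lambda>_. borel) Z' {1..m n}" "\<forall>i\<in>{1..m n}. distr (M n) borel (Z' i) = std_normal" for Z'
          using m1 elim(1) that G.prob_space_axioms by auto
        have "measure (M n) {\<omega>\<in>space (M n). (\<sigma>\<^sup>2 + \<eta> * \<sigma>\<^sup>2) * real (m n) < (\<Sum>i\<in>{1..m n}. (\<xi> n i \<omega>)\<^sup>2)} \<le> p"
          using m2 elim(1) G.indep_xi G.\<xi>_law G.prob_space_axioms by auto
        then show "measure (M n) {\<omega>\<in>space (M n). (1 + \<eta>) * \<sigma>\<^sup>2 * real (m n) < (\<Sum>i\<in>{1..m n}. (\<xi> n i \<omega>)\<^sup>2)} \<le> p"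
          by (simp add: distrib_right)
        show "(vdist n \<mu> (\<mu>0 n))\<^sup>2 / real n + \<sigma>\<^sup>2 * D / real (m n) \<le> (1 + \<eta>) * ob n" using ob by (simp add: D_def)
      qed (use p near[OF n] Zm Zp in auto)
      also have "\<dots> \<le> g n + 3 * p"
        unfolding g_def A_def[symmetric] using A Dm by (intro add_mono mult_left_mono real_sqrt_le_mono) auto
      also have "\<dots> < p + 3 * p" using elim(2) by simp
      finally have small: "measure (M n) {\<omega>\<in>space (M n). (1 + 12 * \<eta>) * ob n < (vdist n (\<mu>hat n \<omega>) (\<mu>0 n))\<^sup>2 / n} < 4 * p" by simp
      have "measure (M n) {\<omega>\<in>space (M n). (1 + e) * ob n < (vdist n (\<mu>hat n \<omega>) (\<mu>0 n))\<^sup>2 / real n}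
        \<le> measure (M n) {\<omega>\<in>space (M n). (1 + 12 * \<eta>) * ob n < (vdist n (\<mu>hat n \<omega>) (\<mu>0 n))\<^sup>2 / n}"
      proof (rule G.finite_measure_mono)
        have mh: "\<mu>hat n \<in> measurable (M n) (\<Pi>\<^sub>M i\<in>{1..n}. borel)" using \<mu>hat n by (simp add: near_minimizers_def)
        have "(\<lambda>\<omega>. (vdist n (\<mu>hat n \<omega>) (\<mu>0 n))\<^sup>2 / real n) \<in> borel_measurable (M n)"
          unfolding vdist_squared
          by (intro borel_measurable_divide borel_measurable_sum borel_measurable_power borel_measurable_diff
              borel_measurable_const measurable_compose[OF mh measurable_component_singleton])
        then show "{\<omega>\<in>space (M n). (1 + 12 * \<eta>) * ob n < (vdist n (\<mu>hat n \<omega>) (\<mu>0 n))\<^sup>2 / n} \<in> sets (M n)"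
          by (rule borel_measurable_less[OF borel_measurable_const])
        have "(1 + 12 * \<eta>) * ob n \<le> (1 + e) * ob n" using \<eta> ob0 by (intro mult_right_mono) auto
        then show "{\<omega>\<in>space (M n). (1 + e) * ob n < (vdist n (\<mu>hat n \<omega>) (\<mu>0 n))\<^sup>2 / real n}
          \<subseteq> {\<omega>\<in>space (M n). (1 + 12 * \<eta>) * ob n < (vdist n (\<mu>hat n \<omega>) (\<mu>0 n))\<^sup>2 / n}" by auto
      qed
      with small show ?case using p by (simp add: p_def)
    qed
  qed
qed

text \<open>Defined from the exact ratio, so that the inequality holds at every outcome and only
  smallness in probability is left to prove. The positive part keeps the final bound nonnegative for
  \<open>n \<ge> 1\<close>; at \<open>n = 0\<close>, outside the model, the constant zero gives
  measurability.\<close>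

definition excess_ratio :: "nat \<Rightarrow> 'a \<Rightarrow> real" where
  "excess_ratio n \<omega> = (if n = 0 then 0 else max 0 ((vdist n (\<mu>hat n \<omega>) (\<mu>0 n))\<^sup>2 / real n / ob n - 1))"

lemma excess_ratio_measurable: "excess_ratio n \<in> borel_measurable (M n)"
proof (cases "n = 0")
  case True
  then show ?thesis by (simp add: excess_ratio_def[abs_def])
next
  case False
  then have mh: "\<mu>hat n \<in> measurable (M n) (\<Pi>\<^sub>M i\<in>{1..n}. borel)" using \<mu>hat by (simp add: near_minimizers_def)
  have "(\<lambda>\<omega>. max 0 ((vdist n (\<mu>hat n \<omega>) (\<mu>0 n))\<^sup>2 / real n / ob n - 1)) \<in> borel_measurable (M n)"
    unfolding vdist_squared
    by (intro borel_measurable_max borel_measurable_divide borel_measurable_sum borel_measurable_power borel_measurable_diff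
        borel_measurable_const measurable_compose[OF mh measurable_component_singleton])
  then show ?thesis using False by (simp add: excess_ratio_def[abs_def])
qed

lemma excess_ratio_bound:
  assumes "1 \<le> n"
  shows "(vdist n (\<mu>hat n \<omega>) (\<mu>0 n))\<^sup>2 / real n \<le> (1 + excess_ratio n \<omega>) * ob n"
proof -
  have "(vdist n (\<mu>hat n \<omega>) (\<mu>0 n))\<^sup>2 / real n / ob n \<le> 1 + excess_ratio n \<omega>"
    using assms by (simp add: excess_ratio_def)
  then show ?thesis by (rule iffD1[OF pos_divide_le_eq[OF ob_pos[OF assms]]])
qed

text \<open>After multiplication by the positive oracle bound, a ratio above \<open>e\<close> is
  exactly the event of \<open>error_exceeds_oracle\<close>.\<close>

lemma excess_ratio_small: "small_oP M excess_ratio (\<lambda>_. 1)"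
  unfolding small_oP_def
proof (intro conjI allI impI excess_ratio_measurable)
  fix e :: real assume e: "0 < e"
  show "(\<lambda>n. measure (M n) {\<omega>\<in>space (M n). \<bar>excess_ratio n \<omega>\<bar> > e * 1}) \<longlonglongrightarrow> 0"
  proof (rule Lim_transform_eventually[OF error_exceeds_oracle[OF e]])
    show "\<forall>\<^sub>F n in sequentially. measure (M n) {\<omega>\<in>space (M n). (1 + e) * ob n < (vdist n (\<mu>hat n \<omega>) (\<mu>0 n))\<^sup>2 / real n}
       = measure (M n) {\<omega>\<in>space (M n). \<bar>excess_ratio n \<omega>\<bar> > e * 1}"
      using eventually_ge_at_top[of 1]
    proof eventually_elim
      case (elim n)
      have "(1 + e) * ob n < (vdist n (\<mu>hat n \<omega>) (\<mu>0 n))\<^sup>2 / real n \<longleftrightarrow> \<bar>excess_ratio n \<omega>\<bar> > e * 1" for \<omega>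
      proof -
        have "(1 + e) * ob n < (vdist n (\<mu>hat n \<omega>) (\<mu>0 n))\<^sup>2 / real n
           \<longleftrightarrow> 1 + e < (vdist n (\<mu>hat n \<omega>) (\<mu>0 n))\<^sup>2 / real n / ob n"
          using ob_pos[OF elim] by (rule pos_less_divide_eq[symmetric])
        then show ?thesis using e elim by (auto simp: excess_ratio_def)
      qed
      then show ?case by simp
    qed
  qed
qed

text \<open>Off an event of vanishing probability the ratio is at most one, and the bound is then at
  most twice the oracle bound, which tends to zero.\<close>

lemma bound_small: "small_oP M (\<lambda>n \<omega>. (1 + excess_ratio n \<omega>) * ob n) (\<lambda>_. 1)"
  unfolding small_oP_def
proof (intro conjI allI impI)
  show "(\<lambda>\<omega>. (1 + excess_ratio n \<omega>) * ob n) \<in> borel_measurable (M n)" for n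
    by (intro borel_measurable_times borel_measurable_add borel_measurable_const excess_ratio_measurable)
  fix e :: real assume e: "0 < e"
  have lim: "(\<lambda>n. measure (M n) {\<omega>\<in>space (M n). \<bar>excess_ratio n \<omega>\<bar> > 1 * 1}) \<longlonglongrightarrow> 0"
    using excess_ratio_small unfolding small_oP_def by (meson zero_less_one)
  have "\<forall>\<^sub>F n in sequentially. ob n < e / 2"
    using oracle_tendsto_0 by (rule order_tendstoD(2)) (use e in simp)
  then have "\<forall>\<^sub>F n in sequentially. measure (M n) {\<omega>\<in>space (M n). \<bar>(1 + excess_ratio n \<omega>) * ob n\<bar> > e * 1}
     \<le> measure (M n) {\<omega>\<in>space (M n). \<bar>excess_ratio n \<omega>\<bar> > 1 * 1}"
    using eventually_ge_at_top[of 1]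
  proof eventually_elim
    case (elim n)
    interpret G: gaussian_design "M n" "m n" n "X n" "\<xi> n" noise by (rule model[OF elim(2)])
    show ?case
    proof (rule G.finite_measure_mono)
      show "{\<omega>\<in>space (M n). \<bar>excess_ratio n \<omega>\<bar> > 1 * 1} \<in> sets (M n)"
        by (intro borel_measurable_less borel_measurable_const borel_measurable_abs excess_ratio_measurable)
      have "1 < excess_ratio n \<omega>" if "\<bar>(1 + excess_ratio n \<omega>) * ob n\<bar> > e" for \<omega>
      proof (rule ccontr)
        assume a: "\<not> 1 < excess_ratio n \<omega>"
        have r: "0 \<le> excess_ratio n \<omega>" by (simp add: excess_ratio_def)
        have "(1 + excess_ratio n \<omega>) * ob n \<le> 2 * ob n" using a ob_pos[OF elim(2)] by (intro mult_right_mono) auto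
        moreover have "0 \<le> (1 + excess_ratio n \<omega>) * ob n" using r ob_pos[OF elim(2)] by (intro mult_nonneg_nonneg) auto
        ultimately show False using that elim(1) by linarith
      qed
      then show "{\<omega>\<in>space (M n). \<bar>(1 + excess_ratio n \<omega>) * ob n\<bar> > e * 1} \<subseteq> {\<omega>\<in>space (M n). \<bar>excess_ratio n \<omega>\<bar> > 1 * 1}"
        by force
    qed
  qed
  then show "(\<lambda>n. measure (M n) {\<omega>\<in>space (M n). \<bar>(1 + excess_ratio n \<omega>) * ob n\<bar> > e * 1}) \<longlonglongrightarrow> 0"
    by (intro tendsto_sandwich[OF _ _ tendsto_const lim]) auto
qed

end

theorem corollary3p4:
  fixes M :: "nat \<Rightarrow> 'a measure"
    and m :: "nat \<Rightarrow> nat"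
    and \<sigma> :: real
    and noise :: "real measure"
    and X :: "nat \<Rightarrow> nat \<Rightarrow> nat \<Rightarrow> 'a \<Rightarrow> real"
    and \<xi> :: "nat \<Rightarrow> nat \<Rightarrow> 'a \<Rightarrow> real"
    and \<mu>0 :: "nat \<Rightarrow> nat \<Rightarrow> real"
    and \<mu>hat :: "nat \<Rightarrow> 'a \<Rightarrow> nat \<Rightarrow> real"
  assumes \<sigma>: "0 < \<sigma>"
    and noise_prob: "real_distribution noise"
    and noise_sq: "integrable noise (\<lambda>x. x\<^sup>2)"
    and noise_mean: "(\<integral>x. x \<partial>noise) = 0"
    and noise_var: "prob_space.variance noise (\<lambda>x. x) = \<sigma>\<^sup>2"
    and model: "\<And>n. 1 \<le> n \<Longrightarrow> gaussian_design (M n) (m n) n (X n) (\<xi> n) noise"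
    and \<mu>0: "\<And>n. 1 \<le> n \<Longrightarrow> \<mu>0 n \<in> monotone_cone n"
    and m_growth: "filterlim (\<lambda>n. real (m n) / ln (real n)) at_top sequentially"
    and \<mu>0_range: "(\<lambda>n. \<mu>0 n n - \<mu>0 n 1) \<in> O(\<lambda>_. 1)"
    and \<mu>hat: "near_minimizers M monotone_cone
           (\<lambda>n. sq_loss (m n) n (X n) (response n (X n) (\<xi> n) (\<mu>0 n)))
           (\<lambda>n. (risk_radius (m n) n \<sigma> (monotone_cone n) (\<mu>0 n))\<^sup>2) \<mu>hat"
  shows "(\<exists>\<epsilon> B. small_oP M \<epsilon> (\<lambda>_. 1) \<and>
            big_OP M B (\<lambda>n. log_term n (monotone_cone n) (\<mu>0 n) / real (m n)) \<and>
            (\<forall>n\<ge>1. AE \<omega> in M n. (vdist n (\<mu>hat n \<omega>) (\<mu>0 n))\<^sup>2 / real n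
               \<le> (1 + \<epsilon> n \<omega>) * oracle_bound (m n) n \<sigma> (\<mu>0 n) + B n \<omega>) \<and>
            small_oP M (\<lambda>n \<omega>. (1 + \<epsilon> n \<omega>) * oracle_bound (m n) n \<sigma> (\<mu>0 n) + B n \<omega>) (\<lambda>_. 1))
       \<and> (\<forall>k\<ge>1. (\<forall>\<^sub>F n in sequentially. \<mu>0 n \<in> pw_const n k) \<longrightarrow>
            (\<exists>\<epsilon>. small_oP M \<epsilon> (\<lambda>_. 1) \<and>
               (\<forall>n\<ge>1. AE \<omega> in M n. (vdist n (\<mu>hat n \<omega>) (\<mu>0 n))\<^sup>2 / real n
                  \<le> (1 + \<epsilon> n \<omega>) * oracle_bound (m n) n \<sigma> (\<mu>0 n)) \<and>
               small_oP M (\<lambda>n \<omega>. (1 + \<epsilon> n \<omega>) * oracle_bound (m n) n \<sigma> (\<mu>0 n)) (\<lambda>_. 1)))"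
proof -
  note asm = assms
  let ?\<epsilon> = "excess_ratio m \<sigma> \<mu>0 \<mu>hat"
  have small: "small_oP M ?\<epsilon> (\<lambda>_. 1)" by (rule excess_ratio_small[OF asm])
  have bound: "(vdist n (\<mu>hat n \<omega>) (\<mu>0 n))\<^sup>2 / real n \<le> (1 + ?\<epsilon> n \<omega>) * oracle_bound (m n) n \<sigma> (\<mu>0 n)"
    if "1 \<le> n" for n \<omega>
    by (rule excess_ratio_bound[OF asm that])
  have total: "small_oP M (\<lambda>n \<omega>. (1 + ?\<epsilon> n \<omega>) * oracle_bound (m n) n \<sigma> (\<mu>0 n)) (\<lambda>_. 1)"
    by (rule bound_small[OF asm])
  \<comment> \<open>With \<open>C = 0\<close> the event reads \<open>0 > 0\<close> and is
    empty.\<close>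
  have B0: "big_OP M (\<lambda>_ _. 0) (\<lambda>n. log_term n (monotone_cone n) (\<mu>0 n) / real (m n))"
    unfolding big_OP_def by (auto intro!: exI[of _ 0])
  show ?thesis
  proof (intro conjI allI impI)
    show "\<exists>\<epsilon> B. small_oP M \<epsilon> (\<lambda>_. 1) \<and>
            big_OP M B (\<lambda>n. log_term n (monotone_cone n) (\<mu>0 n) / real (m n)) \<and>
            (\<forall>n\<ge>1. AE \<omega> in M n. (vdist n (\<mu>hat n \<omega>) (\<mu>0 n))\<^sup>2 / real n
               \<le> (1 + \<epsilon> n \<omega>) * oracle_bound (m n) n \<sigma> (\<mu>0 n) + B n \<omega>) \<and>
            small_oP M (\<lambda>n \<omega>. (1 + \<epsilon> n \<omega>) * oracle_bound (m n) n \<sigma> (\<mu>0 n) + B n \<omega>) (\<lambda>_. 1)"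
      using small B0 total bound by (intro exI[of _ ?\<epsilon>] exI[of _ "\<lambda>_ _. 0"] conjI allI impI AE_I2) auto
    show "\<exists>\<epsilon>. small_oP M \<epsilon> (\<lambda>_. 1) \<and>
               (\<forall>n\<ge>1. AE \<omega> in M n. (vdist n (\<mu>hat n \<omega>) (\<mu>0 n))\<^sup>2 / real n
                  \<le> (1 + \<epsilon> n \<omega>) * oracle_bound (m n) n \<sigma> (\<mu>0 n)) \<and>
               small_oP M (\<lambda>n \<omega>. (1 + \<epsilon> n \<omega>) * oracle_bound (m n) n \<sigma> (\<mu>0 n)) (\<lambda>_. 1)" for k
      using small total bound by (intro exI[of _ ?\<epsilon>] conjI allI impI AE_I2) auto
  qed
qed

end
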